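(* Let $1\le k\le n$ be integers. For every $\epsilon>0$ there exists $\delta=\delta(n,\epsilon)>0$ such that the following holds. Let $S\subseteq B_2(0^n)\subseteq\mathbb{R}^n$ be a $\lambda^k$-measurable subset, and assume that for each ball $B_r(x)\subseteq B_2(0^n)$ with $\lambda^k(S\cap B_r(x))\ge\epsilon_nr^k$ one has $$\int_{S\cap B_r(x)}\Big(\int_0^rD^k_S(y,s)\,\frac{ds}{s}\Big)\,d\lambda^k(y)<\delta^2r^k.$$ Then: 1. For each ball $B_r(x)\subseteq B_1(0^n)$ with $x\in S$, $\lambda^k(S\cap B_r(x))\le(1+\epsilon)\omega_kr^k$. 2. $S\cap B_1(0^n)$ is $k$-rectifiable.
   Context: $\lambda^k$ is $k$-dimensional Hausdorff measure, $\omega_k$ the volume of the unit ball in $\mathbb{R}^k$, and $\epsilon_n=(1000n)^{-7n^2}$. For a measure $\mu$ on $B_2(0^n)$, define $$D^k_\mu(x,r)=\inf_{L^k}r^{-(k+2)}\int_{B_r(x)}d^2(y,L^k)\,d\mu(y)\quad\text{if }\mu(B_r(x))\ge\epsilon_nr^k,$$ and $D^k_\mu(x,r)=0$ otherwise, the infimum being over all $k$-dimensional affine subspaces of $\mathbb{R}^n$. For a set $S$, $D^k_S=D^k_\mu$ with $\mu=\lambda^k|_S$. A set is $k$-rectifiable if, up to a set of $\lambda^k$-measure zero, it is contained in a countable union of Lipschitz images of $\mathbb{R}^k$. *)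

theory Defs
  imports "HOL-Analysis.Analysis"
begin

section \<open>Hausdorff measure\<close>

text \<open>The normalisation is such that \<open>k\<close>-dimensional Hausdorff measure agrees with Lebesgue
  measure on \<open>k\<close>-planes, i.e. a \<open>k\<close>-dimensional unit disc has measure \<open>unit_ball_vol k\<close>.
  The case distinction only matters for \<open>k = 0\<close>, where \<open>0 ^ 0 = 1\<close> must not be charged to \<open>{}\<close>.\<close>

definition hausdorff_weight :: "nat \<Rightarrow> 'a::metric_space set \<Rightarrow> ennreal" where
  "hausdorff_weight k C =
     (if C = {} then 0 else ennreal (unit_ball_vol (real k) * (diameter C / 2) ^ k))"

text \<open>Boundedness is required because \<open>diameter\<close> is unspecified on unbounded sets.\<close>

definition hausdorff_covers :: "real \<Rightarrow> 'a::metric_space set \<Rightarrow> (nat \<Rightarrow> 'a set) set" where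
  "hausdorff_covers d A =
     {C. A \<subseteq> (\<Union>i. C i) \<and> (\<forall>i. bounded (C i) \<and> diameter (C i) \<le> d)}"

definition hausdorff_content :: "nat \<Rightarrow> real \<Rightarrow> 'a::metric_space set \<Rightarrow> ennreal" where
  "hausdorff_content k d A = (INF C\<in>hausdorff_covers d A. \<Sum>i. hausdorff_weight k (C i))"

definition hausdorff_outer :: "nat \<Rightarrow> 'a::metric_space set \<Rightarrow> ennreal" where
  "hausdorff_outer k A = (SUP d\<in>{0<..}. hausdorff_content k d A)"

text \<open>The measurable sets are those in the sense of Caratheodory. The facts
  \<open>sets_hausdorff_measure\<close>, \<open>emeasure_hausdorff_measure\<close> and \<open>borel_hausdorff_measure\<close>
  below show that this is the intended complete measure and that Borel sets are measurable.\<close>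

definition hausdorff_measure :: "nat \<Rightarrow> 'a::metric_space measure" where
  "hausdorff_measure k =
     measure_of UNIV (lambda_system UNIV UNIV (hausdorff_outer k)) (hausdorff_outer k)"

lemma hausdorff_content_mono:
  "A \<subseteq> B \<Longrightarrow> hausdorff_content k d A \<le> hausdorff_content k d B"
  unfolding hausdorff_content_def hausdorff_covers_def by (rule INF_superset_mono) auto

lemma hausdorff_content_antimono:
  "d \<le> e \<Longrightarrow> hausdorff_content k e A \<le> hausdorff_content k d A"
  unfolding hausdorff_content_def hausdorff_covers_def
  by (rule INF_superset_mono) (auto intro: order_trans)

lemma hausdorff_content_le_outer: "0 < d \<Longrightarrow> hausdorff_content k d A \<le> hausdorff_outer k A"
  unfolding hausdorff_outer_def by (rule SUP_upper) auto

lemma hausdorff_outer_mono: "A \<subseteq> B \<Longrightarrow> hausdorff_outer k A \<le> hausdorff_outer k B"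
  unfolding hausdorff_outer_def by (rule SUP_mono) (auto intro: hausdorff_content_mono)

lemma hausdorff_outer_empty [simp]: "hausdorff_outer k {} = 0"
proof -
  have "hausdorff_content k d {} \<le> 0" if "0 < d" for d
    unfolding hausdorff_content_def
    by (rule INF_lower2[of "\<lambda>_. {}"])
      (use that in \<open>auto simp: hausdorff_covers_def hausdorff_weight_def\<close>)
  then show ?thesis
    unfolding hausdorff_outer_def by (intro antisym SUP_least) auto
qed

lemma hausdorff_content_countably_subadditive:
  "hausdorff_content k d (\<Union>i. A i) \<le> (\<Sum>i. hausdorff_content k d (A i))"
proof (rule ennreal_le_epsilon)
  fix e :: real
  assume e: "0 < e" and fin: "(\<Sum>i. hausdorff_content k d (A i)) < top"
  have *: "hausdorff_content k d (A n) < hausdorff_content k d (A n) + e * (1/2)^Suc n" for n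
    using fin e by (auto simp add: less_top dest!: ennreal_suminf_lessD)
  have "\<exists>C. C \<in> hausdorff_covers d (A n) \<and>
      (\<Sum>i. hausdorff_weight k (C i)) \<le> hausdorff_content k d (A n) + e * (1/2)^Suc n" for n
  proof -
    have "(INF C\<in>hausdorff_covers d (A n). \<Sum>i. hausdorff_weight k (C i))
        < hausdorff_content k d (A n) + e * (1/2)^Suc n"
      using *[of n] by (simp add: hausdorff_content_def)
    then show ?thesis
      unfolding INF_less_iff by (auto intro: less_imp_le)
  qed
  then obtain C where C: "\<And>n. C n \<in> hausdorff_covers d (A n)"
    and Cle: "\<And>n. (\<Sum>i. hausdorff_weight k (C n i))
      \<le> hausdorff_content k d (A n) + e * (1/2)^Suc n"
    by metis
  define D where "D = case_prod C \<circ> prod_decode"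
  have D: "D \<in> hausdorff_covers d (\<Union>i. A i)"
  proof -
    have "x \<in> (\<Union>j. D j)" if x: "x \<in> A i" for x i
    proof -
      obtain j where "x \<in> C i j"
        using C[of i] x unfolding hausdorff_covers_def by blast
      then have "x \<in> D (prod_encode (i, j))"
        by (simp add: D_def)
      then show ?thesis by blast
    qed
    then show ?thesis
      using C by (auto simp: hausdorff_covers_def D_def split: prod.split)
  qed
  have "hausdorff_content k d (\<Union>i. A i) \<le> (\<Sum>i. hausdorff_weight k (D i))"
    unfolding hausdorff_content_def by (rule INF_lower[OF D])
  also have "\<dots> = (\<Sum>i. case_prod (\<lambda>m n. hausdorff_weight k (C m n)) (prod_decode i))"
    by (simp add: D_def split_beta)
  also have "\<dots> = (\<Sum>n. \<Sum>i. hausdorff_weight k (C n i))"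
    by (intro suminf_ennreal_2dimen) auto
  also have "\<dots> \<le> (\<Sum>n. hausdorff_content k d (A n) + e * (1/2) ^ Suc n)"
    by (intro suminf_le allI Cle) auto
  also have "\<dots> = (\<Sum>n. hausdorff_content k d (A n)) + (\<Sum>n. ennreal e * ennreal ((1/2) ^ Suc n))"
    using e by (subst suminf_add[symmetric])
      (auto simp del: ennreal_suminf_cmult simp add: ennreal_mult[symmetric])
  also have "\<dots> = (\<Sum>n. hausdorff_content k d (A n)) + e"
    unfolding ennreal_suminf_cmult
    by (subst suminf_ennreal_eq[OF zero_le_power power_half_series]) auto
  finally show "hausdorff_content k d (\<Union>i. A i) \<le> (\<Sum>n. hausdorff_content k d (A n)) + e" .
qed

lemma hausdorff_outer_countably_subadditive:
  "hausdorff_outer k (\<Union>i. A i) \<le> (\<Sum>i. hausdorff_outer k (A i))"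
  unfolding hausdorff_outer_def[of k "\<Union>i. A i"]
proof (rule SUP_least)
  fix d :: real assume "d \<in> {0<..}"
  then have "(\<Sum>i. hausdorff_content k d (A i)) \<le> (\<Sum>i. hausdorff_outer k (A i))"
    by (intro suminf_le hausdorff_content_le_outer) auto
  with hausdorff_content_countably_subadditive
  show "hausdorff_content k d (\<Union>i. A i) \<le> (\<Sum>i. hausdorff_outer k (A i))"
    by (rule order_trans)
qed

lemma outer_measure_space_hausdorff: "outer_measure_space UNIV (hausdorff_outer k)"
  by (auto simp: outer_measure_space_def positive_def increasing_def countably_subadditive_def
      intro: hausdorff_outer_mono hausdorff_outer_countably_subadditive)

lemma measure_space_hausdorff:
  "measure_space UNIV (lambda_system UNIV UNIV (hausdorff_outer k)) (hausdorff_outer k)"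
  using sigma_algebra.caratheodory_lemma[OF sigma_algebra_Pow, of UNIV "hausdorff_outer k"]
    outer_measure_space_hausdorff[of k] by simp

lemma space_hausdorff_measure [simp]: "space (hausdorff_measure k) = UNIV"
  by (simp add: hausdorff_measure_def space_measure_of_conv)

lemma sets_hausdorff_measure:
  "sets (hausdorff_measure k :: 'a::metric_space measure)
     = lambda_system UNIV UNIV (hausdorff_outer k)"
proof -
  interpret sigma_algebra UNIV "lambda_system UNIV UNIV (hausdorff_outer k :: 'a set \<Rightarrow> _)"
    by (rule measure_space_hausdorff[unfolded measure_space_def, THEN conjunct1])
  show ?thesis
    unfolding hausdorff_measure_def by (simp add: sets_measure_of_eq)
qed

lemma emeasure_hausdorff_measure:
  fixes A :: "'a::metric_space set"
  assumes "A \<in> sets (hausdorff_measure k)"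
  shows "emeasure (hausdorff_measure k) A = hausdorff_outer k A"
proof -
  have ms: "measure_space UNIV (lambda_system UNIV UNIV (hausdorff_outer k))
      (hausdorff_outer k :: 'a set \<Rightarrow> _)"
    by (rule measure_space_hausdorff)
  have A: "A \<in> lambda_system UNIV UNIV (hausdorff_outer k)"
    using assms by (simp only: sets_hausdorff_measure)
  show ?thesis
    unfolding hausdorff_measure_def
    using ms by (intro emeasure_measure_of_sigma A) (simp_all add: measure_space_def)
qed

lemma hausdorff_outer_subadditive:
  "hausdorff_outer k (A \<union> B) \<le> hausdorff_outer k A + hausdorff_outer k B"
proof -
  define C where "C = (\<lambda>i::nat. if i = 0 then A else if i = 1 then B else {})"
  have "A \<union> B = (\<Union>i. C i)"
    by (auto simp: C_def split: if_splits)
  then have "hausdorff_outer k (A \<union> B) \<le> (\<Sum>i. hausdorff_outer k (C i))"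
    using hausdorff_outer_countably_subadditive[of k C] by simp
  also have "\<dots> = (\<Sum>i\<in>{0,1}. hausdorff_outer k (C i))"
    by (rule suminf_finite) (auto simp: C_def)
  finally show ?thesis
    by (simp add: C_def)
qed

lemma hausdorff_content_separated:
  assumes sep: "\<And>a b. a \<in> A \<Longrightarrow> b \<in> B \<Longrightarrow> d < dist a b"
  shows "hausdorff_content k d A + hausdorff_content k d B \<le> hausdorff_content k d (A \<union> B)"
  unfolding hausdorff_content_def[of k d "A \<union> B"]
proof (rule INF_greatest)
  fix C assume C: "C \<in> hausdorff_covers d (A \<union> B)"
  define P where "P = (\<lambda>Z i. if C i \<inter> Z = {} then {} else C i)"
  have "0 \<le> d"
    using C diameter_ge_0[of "C 0"] by (auto simp: hausdorff_covers_def intro: order_trans)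
  then have P: "P Z \<in> hausdorff_covers d Z" if "Z \<subseteq> A \<union> B" for Z
    using C that unfolding hausdorff_covers_def P_def mem_Collect_eq
    by (intro conjI subsetI allI) (auto 0 3 simp: subset_iff)
  have PA: "P A \<in> hausdorff_covers d A" and PB: "P B \<in> hausdorff_covers d B"
    by (rule P; simp)+
  have disj: "C i \<inter> A = {} \<or> C i \<inter> B = {}" for i
  proof (rule ccontr)
    assume "\<not> ?thesis"
    then obtain a b where ab: "a \<in> A" "b \<in> B" "a \<in> C i" "b \<in> C i" by auto
    have "dist a b \<le> diameter (C i)"
      using C ab by (intro diameter_bounded_bound) (auto simp: hausdorff_covers_def)
    also have "\<dots> \<le> d"
      using C by (auto simp: hausdorff_covers_def)
    finally show False
      using sep[OF ab(1,2)] by simp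
  qed
  have "hausdorff_content k d A + hausdorff_content k d B
      \<le> (\<Sum>i. hausdorff_weight k (P A i)) + (\<Sum>i. hausdorff_weight k (P B i))"
    unfolding hausdorff_content_def by (intro add_mono INF_lower PA PB)
  also have "\<dots> = (\<Sum>i. hausdorff_weight k (P A i) + hausdorff_weight k (P B i))"
    by (rule suminf_add) auto
  also have "\<dots> \<le> (\<Sum>i. hausdorff_weight k (C i))"
  proof (rule suminf_le)
    show "hausdorff_weight k (P A i) + hausdorff_weight k (P B i) \<le> hausdorff_weight k (C i)" for i
      using disj[of i] by (auto simp: P_def hausdorff_weight_def)
  qed auto
  finally show "hausdorff_content k d A + hausdorff_content k d B
      \<le> (\<Sum>i. hausdorff_weight k (C i))" .
qed

lemma hausdorff_outer_separated:
  assumes e: "0 < e" and sep: "\<And>a b. a \<in> A \<Longrightarrow> b \<in> B \<Longrightarrow> e \<le> dist a b"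
  shows "hausdorff_outer k A + hausdorff_outer k B \<le> hausdorff_outer k (A \<union> B)"
proof -
  have *: "hausdorff_content k d1 A + hausdorff_content k d2 B \<le> hausdorff_outer k (A \<union> B)"
    if d: "0 < d1" "0 < d2" for d1 d2
  proof -
    define d where "d = min (min d1 d2) (e / 2)"
    have "0 < d" "d \<le> d1" "d \<le> d2" "d < e"
      using d e by (auto simp: d_def)
    have "hausdorff_content k d1 A + hausdorff_content k d2 B
        \<le> hausdorff_content k d A + hausdorff_content k d B"
      by (intro add_mono hausdorff_content_antimono) fact+
    also have "\<dots> \<le> hausdorff_content k d (A \<union> B)"
      by (rule hausdorff_content_separated) (use sep \<open>d < e\<close> in force)
    also have "\<dots> \<le> hausdorff_outer k (A \<union> B)"
      by (rule hausdorff_content_le_outer) fact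
    finally show ?thesis .
  qed
  have "hausdorff_outer k A + hausdorff_content k d2 B \<le> hausdorff_outer k (A \<union> B)"
    if "0 < d2" for d2
    unfolding hausdorff_outer_def[of k A]
    by (subst ennreal_SUP_add_left[symmetric]) (use * that in \<open>auto intro: SUP_least exI[of _ 1]\<close>)
  then show ?thesis
    unfolding hausdorff_outer_def[of k B]
    by (subst ennreal_SUP_add_right) (auto intro: SUP_least exI[of _ 1])
qed

lemma hausdorff_outer_closed:
  fixes F :: "'a::metric_space set"
  assumes F: "closed F"
  shows "hausdorff_outer k (F \<inter> X) + hausdorff_outer k (X - F) \<le> hausdorff_outer k X"
proof (cases "F = {} \<or> hausdorff_outer k X = \<infinity>")
  case True
  then show ?thesis by auto
next
  case False
  then have ne: "F \<noteq> {}" and fin: "hausdorff_outer k X < \<infinity>"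
    by (auto simp: less_top)
  let ?H = "hausdorff_outer k"
  define E where "E n = {x \<in> X. 1 / real (Suc n) \<le> infdist x F}" for n
  define R where "R n = E (Suc n) - E n" for n
  have lip: "infdist a F \<le> infdist b F + dist a b" for a b
    by (rule infdist_triangle)
  have mono: "E m \<subseteq> E n" if "m \<le> n" for m n
  proof -
    have "1 / real (Suc n) \<le> 1 / real (Suc m)"
      using that by (intro divide_left_mono) auto
    then show ?thesis by (auto simp: E_def)
  qed
  have EX: "E n \<subseteq> X" for n by (auto simp: E_def)
  have step: "?H (E n) + ?H (R (Suc n)) \<le> ?H (E (Suc (Suc n)))" for n
  proof -
    have "?H (E n) + ?H (R (Suc n)) \<le> ?H (E n \<union> R (Suc n))"
    proof (rule hausdorff_outer_separated)
      show "0 < 1 / real (Suc n) - 1 / real (Suc (Suc n))"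
        by (simp add: field_simps add_pos_nonneg)
      fix a b assume "a \<in> E n" "b \<in> R (Suc n)"
      then show "1 / real (Suc n) - 1 / real (Suc (Suc n)) \<le> dist a b"
        using lip[of a b] by (auto simp: E_def R_def)
    qed
    also have "\<dots> \<le> ?H (E (Suc (Suc n)))"
      using mono[of n "Suc (Suc n)"] by (intro hausdorff_outer_mono) (auto simp: R_def)
    finally show ?thesis .
  qed
  have "(\<Sum>j<N. ?H (R (Suc j))) \<le> ?H (E (Suc N)) + ?H (E N)" for N
  proof (induction N)
    case (Suc N)
    have "(\<Sum>j<Suc N. ?H (R (Suc j))) \<le> ?H (E (Suc N)) + ?H (E N) + ?H (R (Suc N))"
      using Suc by (simp add: add_right_mono)
    also have "\<dots> = ?H (E (Suc N)) + (?H (E N) + ?H (R (Suc N)))"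
      by (simp add: add.assoc)
    also have "\<dots> \<le> ?H (E (Suc N)) + ?H (E (Suc (Suc N)))"
      by (intro add_left_mono step)
    finally show ?case by (simp add: add.commute)
  qed simp
  moreover have "?H (E (Suc N)) + ?H (E N) \<le> ?H X + ?H X" for N
    by (intro add_mono hausdorff_outer_mono EX)
  ultimately have "(\<Sum>j<N. ?H (R (Suc j))) \<le> ?H X + ?H X" for N
    by (rule order_trans)
  then have "(\<Sum>j. ?H (R (Suc j))) \<le> ?H X + ?H X"
    by (intro suminf_le_const) auto
  also have "\<dots> < \<infinity>"
    using fin by (simp add: ennreal_add_less_top)
  finally have sumfin: "(\<Sum>j. ?H (R (Suc j))) \<noteq> top" by auto
  have Rfin: "?H (R j) = ennreal (enn2real (?H (R j)))" for j
  proof -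
    have "?H (R j) \<le> ?H X" by (intro hausdorff_outer_mono) (auto simp: R_def E_def)
    then show ?thesis using fin by (simp add: less_top)
  qed
  have summ: "summable (\<lambda>j. enn2real (?H (R (Suc j))))"
    by (rule summable_suminf_not_top) (use sumfin in \<open>simp_all flip: Rfin\<close>)
  have "?H (F \<inter> X) + ?H (X - F) \<le> ?H X + ennreal e" if e: "0 < e" for e
  proof -
    obtain n where n: "norm (\<Sum>j. enn2real (?H (R (Suc (j + n))))) < e"
      using suminf_exist_split[OF e summ] by (meson order_refl)
    have "(\<Sum>j. ?H (R (Suc (j + n)))) = (\<Sum>j. ennreal (enn2real (?H (R (Suc (j + n))))))"
      by (simp flip: Rfin)
    also have "\<dots> = ennreal (\<Sum>j. enn2real (?H (R (Suc (j + n)))))"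
      by (rule suminf_ennreal2) (use summable_ignore_initial_segment[OF summ] in auto)
    also have "\<dots> \<le> ennreal e"
      using n by (intro ennreal_leI) auto
    finally have tail: "(\<Sum>j. ?H (R (Suc (j + n)))) \<le> ennreal e" .
    have "X - F \<subseteq> E (Suc n) \<union> (\<Union>j. R (Suc (j + n)))"
    proof
      fix x assume x: "x \<in> X - F"
      then have "0 < infdist x F"
        using F ne by (metis Diff_iff infdist_pos_not_in_closed)
      then obtain m where "1 / real (Suc m) < infdist x F"
        using nat_approx_posE by blast
      then have ex: "x \<in> E m" using x by (auto simp: E_def)
      define l where "l = (LEAST m. x \<in> E m)"
      have l: "x \<in> E l" unfolding l_def using ex by (rule LeastI)
      show "x \<in> E (Suc n) \<union> (\<Union>j. R (Suc (j + n)))"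
      proof (cases "l \<le> Suc n")
        case True
        then show ?thesis using mono l by blast
      next
        case False
        then obtain j where j: "l = Suc (Suc (j + n))"
          using less_imp_Suc_add[of "Suc n" l] by (auto simp: add.commute)
        have "x \<notin> E (Suc (j + n))"
          using not_less_Least[of "Suc (j + n)" "\<lambda>m. x \<in> E m"] j by (auto simp: l_def)
        then show ?thesis using l j by (auto simp: R_def)
      qed
    qed
    then have "?H (X - F) \<le> ?H (E (Suc n) \<union> (\<Union>j. R (Suc (j + n))))"
      by (rule hausdorff_outer_mono)
    also have "\<dots> \<le> ?H (E (Suc n)) + ?H (\<Union>j. R (Suc (j + n)))"
      by (rule hausdorff_outer_subadditive)
    also have "\<dots> \<le> ?H (E (Suc n)) + (\<Sum>j. ?H (R (Suc (j + n))))"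
      by (intro add_left_mono hausdorff_outer_countably_subadditive)
    also have "\<dots> \<le> ?H (E (Suc n)) + ennreal e"
      by (intro add_left_mono tail)
    finally have "?H (F \<inter> X) + ?H (X - F) \<le> ?H (F \<inter> X) + (?H (E (Suc n)) + ennreal e)"
      by (rule add_left_mono)
    also have "\<dots> = ?H (F \<inter> X) + ?H (E (Suc n)) + ennreal e"
      by (simp add: add.assoc)
    also have "?H (F \<inter> X) + ?H (E (Suc n)) \<le> ?H ((F \<inter> X) \<union> E (Suc n))"
    proof (rule hausdorff_outer_separated)
      show "0 < 1 / real (Suc (Suc n))" by simp
      fix a b assume "a \<in> F \<inter> X" "b \<in> E (Suc n)"
      then show "1 / real (Suc (Suc n)) \<le> dist a b"
        using lip[of b a] by (auto simp: E_def dist_commute)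
    qed
    also have "\<dots> \<le> ?H X"
      by (intro hausdorff_outer_mono) (auto simp: E_def)
    finally show ?thesis by (simp add: add_right_mono)
  qed
  then show ?thesis
    by (rule ennreal_le_epsilon)
qed

lemma borel_hausdorff_measure: "sets borel \<subseteq> sets (hausdorff_measure k :: 'a::metric_space measure)"
proof -
  have "{A. closed A} \<subseteq> sets (hausdorff_measure k :: 'a measure)"
  proof (intro subsetI)
    fix F :: "'a set" assume "F \<in> {A. closed A}"
    then have F: "closed F" by simp
    have "hausdorff_outer k (F \<inter> X) + hausdorff_outer k ((UNIV - F) \<inter> X)
        = hausdorff_outer k X" for X
    proof (rule antisym)
      show "hausdorff_outer k (F \<inter> X) + hausdorff_outer k ((UNIV - F) \<inter> X) \<le> hausdorff_outer k X"
        using hausdorff_outer_closed[OF F, of k X] by (simp add: Diff_eq Int_commute)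
      have "X = (F \<inter> X) \<union> ((UNIV - F) \<inter> X)" by auto
      then show "hausdorff_outer k X
          \<le> hausdorff_outer k (F \<inter> X) + hausdorff_outer k ((UNIV - F) \<inter> X)"
        by (metis hausdorff_outer_subadditive)
    qed
    then show "F \<in> sets (hausdorff_measure k)"
      by (simp add: sets_hausdorff_measure lambda_system_def)
  qed
  then have "sigma_sets UNIV {A. closed A} \<subseteq> sets (hausdorff_measure k :: 'a measure)"
    using sets.sigma_sets_subset[of "{A. closed A}" "hausdorff_measure k :: 'a measure"] by simp
  then show ?thesis
    by (simp add: borel_eq_closed)
qed

section \<open>Mean flatness, rectifiability\<close>

definition eps_const :: "nat \<Rightarrow> real" where
  "eps_const n = (1000 * real n) powi (- int (7 * n\<^sup>2))"

text \<open>The quantity \<open>D\<^sup>k\<^sub>\<mu>(x,r)\<close>. Balls are open, and \<open>infdist y L\<close> is \<open>d(y,L)\<close>.\<close>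

definition mean_flatness ::
    "nat \<Rightarrow> 'a::euclidean_space measure \<Rightarrow> 'a \<Rightarrow> real \<Rightarrow> ennreal" where
  "mean_flatness k \<mu> x r =
     (if emeasure \<mu> (ball x r) \<ge> ennreal (eps_const DIM('a) * r ^ k)
      then (INF L\<in>{L. affine L \<and> aff_dim L = int k}.
              ennreal (1 / r ^ (k + 2)) *
              (\<integral>\<^sup>+y\<in>ball x r. ennreal ((infdist y L)\<^sup>2) \<partial>\<mu>))
      else 0)"

text \<open>The measure \<open>\<lambda>\<^sup>k|\<^sub>S\<close>, as a measure on the whole space concentrated on \<open>S\<close>
  (so not \<open>restrict_space\<close>, whose space is \<open>S\<close> and for which balls are not measurable sets).\<close>

definition hausdorff_on :: "nat \<Rightarrow> 'a::metric_space set \<Rightarrow> 'a measure" where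
  "hausdorff_on k S = density (hausdorff_measure k) (indicator S)"

lemma emeasure_hausdorff_on:
  assumes "S \<in> sets (hausdorff_measure k)" "A \<in> sets (hausdorff_measure k)"
  shows "emeasure (hausdorff_on k S) A = emeasure (hausdorff_measure k) (S \<inter> A)"
  using assms unfolding hausdorff_on_def by (rule emeasure_restricted)

text \<open>\<open>\<real>\<^sup>k\<close> for a \<open>k\<close> that is quantified inside the statement is the library's
  \<open>Euclidean_space k\<close>: the points are the sequences vanishing from index \<open>k\<close> on. Its Euclidean
  distance is \<open>L2_set\<close> of the first \<open>k\<close> coordinate differences.\<close>

definition lipschitz_from_Rk :: "nat \<Rightarrow> ((nat \<Rightarrow> real) \<Rightarrow> 'a::metric_space) \<Rightarrow> bool" where
  "lipschitz_from_Rk k f \<longleftrightarrow>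
     (\<exists>C\<ge>0. \<forall>u\<in>topspace (Euclidean_space k). \<forall>v\<in>topspace (Euclidean_space k).
        dist (f u) (f v) \<le> C * L2_set (\<lambda>i. u i - v i) {..<k})"

definition rectifiable :: "nat \<Rightarrow> 'a::metric_space set \<Rightarrow> bool" where
  "rectifiable k A \<longleftrightarrow>
     (\<exists>f :: nat \<Rightarrow> (nat \<Rightarrow> real) \<Rightarrow> 'a.
        (\<forall>i. lipschitz_from_Rk k (f i)) \<and>
        A - (\<Union>i. f i ` topspace (Euclidean_space k)) \<in> null_sets (hausdorff_measure k))"

end

theory Submission
 imports Defs
begin

text \<open>If the density were too large somewhere, a nearly maximal choice of ball, together with the flatness
hypothesis, would put almost all the mass of the ball close to a plane; rescaling gives a measure all
of whose balls have density at most 1 while the unit mass is nearly attained. Dyadic cells of the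
plane are refined and fitted by affine maps until a cell has too little mass, is not flat, or its fit
is too steep. Non-flat cells are few by Chebyshev. Steep cells are few because the
fits interpolate to lattice functions whose Dirichlet energy is controlled by the flatness.
Sparse cells are few because the density bound makes missing mass irreplaceable. So most of the
mass lies on a Lipschitz graph. Comparing the initial mass with the mass on fine cells, where the
density is at most 1 by Vitali's covering lemma, contradicts the excess density. The same graph is a
Lipschitz piece of positive measure, and exhaustion gives rectifiability.\<close>

subsection \<open>Dyadic cells and affine maps over a plane\<close>

text \<open>The hypothesis bounds a sum over scales of squared tilts, not of tilts, so slopes cannot
  be controlled by adding up the changes of the fits along a chain of cells. Orthogonality replaces
  absolute convergence: interpolation to the next level does not increase the scaled Dirichlet
  energy, and after summation by parts an update costs only a product of two factors, each of the
  size of the square root of the flatness. A steep cell uses up energy in proportion to its area.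
  Neither a lower nor an upper density bound is given, and the set may have infinite measure. The
  flatness hypothesis itself yields sigma-finiteness. On a piece of finite positive measure the
  largest density ratio is at least \<open>1 / 4 ^ k\<close> by an elementary covering argument;
  this lifts all balls that matter above the threshold \<open>eps_const\<close>, and dividing by
  that ratio gives the upper bound 1. The hypothesis passes to subsets, so points of large
  small-scale density can be cut away beforehand. The constants of the normalised situation depend
  only on \<open>k\<close> and the admissible error, so \<open>\<delta>\<close> can be fixed before
  the set.\<close>

type_synonym zv = "nat \<Rightarrow> int"

abbreviation sqdist :: "'a::metric_space measure \<Rightarrow> 'a \<Rightarrow> real \<Rightarrow> 'a set \<Rightarrow> ennreal" where
 "sqdist \<mu> y s L \<equiv> (\<integral>\<^sup>+x\<in>ball y s. ennreal ((infdist x L)\<^sup>2) \<partial>\<mu>)"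

definition half :: "zv \<Rightarrow> nat \<Rightarrow> int" where
 "half z = (\<lambda>i. z i div 2)"

locale frame =
 fixes e :: "nat \<Rightarrow> 'a::euclidean_space" and k :: nat
 assumes k_pos: "1 \<le> k"
  and orth: "\<And>i j. i < k \<Longrightarrow> j < k \<Longrightarrow> e i \<bullet> e j = (if i = j then 1 else 0)"
begin

definition co :: "'a \<Rightarrow> nat \<Rightarrow> real" where "co x = (\<lambda>i. x \<bullet> e i)"

definition emb :: "(nat \<Rightarrow> real) \<Rightarrow> 'a" where "emb u = (\<Sum>i<k. u i *\<^sub>R e i)"

definition hor :: "'a \<Rightarrow> 'a" where "hor x = emb (co x)"

definition ver :: "'a \<Rightarrow> 'a" where "ver x = x - hor x"

text \<open>A pair \<open>(a, s)\<close> encodes the affine map with value \<open>a\<close> at \<open>0\<close> and slopes \<open>s 0, ..., s (k - 1)\<close>.\<close>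

definition af :: "'a \<times> (nat \<Rightarrow> 'a) \<Rightarrow> (nat \<Rightarrow> real) \<Rightarrow> 'a" where
 "af A u = fst A + (\<Sum>i<k. u i *\<^sub>R snd A i)"

definition res :: "'a \<times> (nat \<Rightarrow> 'a) \<Rightarrow> 'a \<Rightarrow> 'a" where
 "res A x = ver x - af A (co x)"

definition adiff :: "'a \<times> (nat \<Rightarrow> 'a) \<Rightarrow> 'a \<times> (nat \<Rightarrow> 'a) \<Rightarrow> 'a \<times> (nat \<Rightarrow> 'a)" where
 "adiff A B = (fst A - fst B, \<lambda>i. snd A i - snd B i)"

definition Z :: "zv set" where "Z = {z. \<forall>i\<ge>k. z i = 0}"

text \<open>The lattice point \<open>z\<close> at level \<open>j\<close> stands for the dyadic cell of side \<open>2 ^ -j\<close> with corner \<open>z / 2 ^ j\<close>;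
lattice points vanish from index \<open>k\<close> on.\<close>

definition idx :: "nat \<Rightarrow> (nat \<Rightarrow> real) \<Rightarrow> nat \<Rightarrow> int" where
 "idx j u = (\<lambda>i. if i < k then \<lfloor>2 ^ j * u i\<rfloor> else 0)"

definition adj :: "zv \<Rightarrow> zv \<Rightarrow> bool" where
 "adj z w \<longleftrightarrow> (\<forall>i<k. \<bar>z i - w i\<bar> \<le> 1)"

definition subs :: "nat \<Rightarrow> zv \<Rightarrow> zv set" where
 "subs q z = {z' \<in> Z. \<forall>i<k. z' i div 2 ^ q = z i}"

lemma emb_inner: "i < k \<Longrightarrow> emb u \<bullet> e i = u i"
proof -
 assume i: "i < k"
 have "emb u \<bullet> e i = (\<Sum>j<k. u j * (e j \<bullet> e i))"
  by (simp add: emb_def inner_sum_left)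
 also have "\<dots> = (\<Sum>j<k. if j = i then u i else 0)"
  by (intro sum.cong) (auto simp: orth i)
 finally show ?thesis using i by simp
qed

lemma emb_diff: "emb u - emb v = emb (\<lambda>i. u i - v i)"
 by (simp add: emb_def scaleR_diff_left sum_subtractf)

lemma emb_cong: "(\<And>i. i < k \<Longrightarrow> u i = v i) \<Longrightarrow> emb u = emb v"
 by (simp add: emb_def)

lemma norm_emb: "norm (emb u) = L2_set u {..<k}"
proof -
 have "(norm (emb u))\<^sup>2 = (\<Sum>i<k. u i * (emb u \<bullet> e i))"
  unfolding power2_norm_eq_inner
  by (subst (2) emb_def) (simp add: inner_sum_right)
 also have "\<dots> = (\<Sum>i<k. (u i)\<^sup>2)"
  by (intro sum.cong) (auto simp: emb_inner power2_eq_square)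
 finally show ?thesis
  by (simp add: L2_set_def real_sqrt_unique)
qed

lemma emb_coord_le: "i < k \<Longrightarrow> \<bar>u i\<bar> \<le> norm (emb u)"
proof -
 assume i: "i < k"
 have "\<bar>u i\<bar>\<^sup>2 \<le> (\<Sum>i<k. (u i)\<^sup>2)"
  using i member_le_sum[of i "{..<k}" "\<lambda>i. (u i)\<^sup>2"] by simp
 then show ?thesis
  unfolding norm_emb L2_set_def by (intro real_le_rsqrt) simp
qed

lemma norm_emb_le: "(\<And>i. i < k \<Longrightarrow> \<bar>u i\<bar> \<le> d) \<Longrightarrow> norm (emb u) \<le> real k * d"
 unfolding norm_emb
 by (rule order_trans[OF L2_set_le_sum_abs], rule order_trans[OF sum_bounded_above[where K=d]]) auto

lemma hor_inner: "i < k \<Longrightarrow> hor x \<bullet> e i = x \<bullet> e i"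
 by (simp add: hor_def emb_inner co_def)

lemma ver_inner: "i < k \<Longrightarrow> ver x \<bullet> e i = 0"
 by (simp add: ver_def inner_diff_left hor_inner)

lemma inner_emb_zero: "(\<And>i. i < k \<Longrightarrow> x \<bullet> e i = 0) \<Longrightarrow> x \<bullet> emb u = 0"
 by (simp add: emb_def inner_sum_right)

lemma ver_emb_orth: "ver x \<bullet> emb u = 0"
 by (rule inner_emb_zero) (rule ver_inner)

lemma co_diff: "co (x - y) = (\<lambda>i. co x i - co y i)"
 by (auto simp: co_def inner_diff_left)

lemma hor_diff: "hor (x - y) = hor x - hor y"
 by (simp add: hor_def emb_diff co_diff)

lemma ver_diff: "ver (x - y) = ver x - ver y"
 by (simp add: ver_def hor_diff)

lemma linear_hor: "linear hor"
 unfolding hor_def emb_def co_def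
 by (intro linearI) (auto simp: inner_add_left scaleR_add_left sum.distrib scaleR_sum_right)

lemma linear_ver: "linear ver"
 unfolding ver_def using linear_hor by (intro linear_compose_sub linear_id[unfolded id_def])

lemma hor_ver: "hor x + ver x = x"
 by (simp add: ver_def)

lemma norm_hor_ver: "(norm x)\<^sup>2 = (norm (hor x))\<^sup>2 + (norm (ver x))\<^sup>2"
proof -
 have "hor x \<bullet> ver x = 0"
  using ver_emb_orth[of x "co x"] by (simp add: hor_def inner_commute)
 then have "(norm (hor x + ver x))\<^sup>2 = (norm (hor x))\<^sup>2 + (norm (ver x))\<^sup>2"
  by (simp add: power2_norm_eq_inner inner_add_left inner_add_right inner_commute)
 then show ?thesis by (simp add: hor_ver)
qed

lemma norm_hor_le: "norm (hor x) \<le> norm x"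
 by (rule power2_le_imp_le) (simp_all add: norm_hor_ver[of x])

lemma norm_ver_le: "norm (ver x) \<le> norm x"
 by (rule power2_le_imp_le) (simp_all add: norm_hor_ver[of x])

lemma co_le_norm: "i < k \<Longrightarrow> \<bar>co x i\<bar> \<le> norm (hor x)"
 unfolding hor_def by (rule emb_coord_le)

lemma measurable_co [measurable]: "(\<lambda>x. co x i) \<in> borel_measurable borel"
 unfolding co_def by simp

lemma measurable_hor [measurable]: "hor \<in> borel_measurable borel"
 unfolding hor_def emb_def[abs_def] co_def by simp

lemma measurable_ver [measurable]: "ver \<in> borel_measurable borel"
 unfolding ver_def[abs_def] by simp

lemma measurable_res [measurable]: "res A \<in> borel_measurable borel"
 unfolding res_def[abs_def] af_def co_def by simp

lemma af_adiff: "af (adiff A B) u = af A u - af B u"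
 by (simp add: af_def adiff_def scaleR_diff_right sum_subtractf)

lemma res_adiff: "res B x - res A x = af (adiff A B) (co x)"
 by (simp add: res_def af_adiff)

lemma af_diff: "af A u - af A v = (\<Sum>i<k. (u i - v i) *\<^sub>R snd A i)"
 by (simp add: af_def scaleR_diff_left sum_subtractf)

lemma af_lip:
 assumes "\<And>i. i < k \<Longrightarrow> norm (snd A i) \<le> \<theta>" "\<And>i. i < k \<Longrightarrow> \<bar>u i - v i\<bar> \<le> d"
 shows "norm (af A u - af A v) \<le> real k * \<theta> * d"
proof -
 have "norm (af A u - af A v) \<le> (\<Sum>i<k. norm ((u i - v i) *\<^sub>R snd A i))"
  unfolding af_diff by (rule norm_sum)
 also have "\<dots> \<le> (\<Sum>i<k. \<theta> * d)"
 proof (rule sum_mono)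
  fix i assume "i \<in> {..<k}"
  then have i: "i < k" by simp
  have "0 \<le> d" using assms(2)[OF i] by linarith
  then show "norm ((u i - v i) *\<^sub>R snd A i) \<le> \<theta> * d"
   using mult_mono[OF assms(2)[OF i] assms(1)[OF i]] by (simp add: mult.commute)
 qed
 finally show ?thesis by simp
qed

lemma af_lip_norm:
 assumes "\<And>i. i < k \<Longrightarrow> norm (snd A i) \<le> \<theta>"
 shows "norm (af A u - af A v) \<le> real k * \<theta> * norm (emb u - emb v)"
 by (rule af_lip[OF assms]) (auto simp: emb_diff intro: emb_coord_le)

lemma idx_Z [simp]: "idx j u \<in> Z"
 by (simp add: idx_def Z_def)

lemma half_Z: "z \<in> Z \<Longrightarrow> half z \<in> Z"
 by (simp add: half_def Z_def)

lemma idx_div: "i < k \<Longrightarrow> idx (j + m) u i div 2 ^ m = idx j u i"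
proof -
 assume i: "i < k"
 have "\<lfloor>2 ^ j * u i\<rfloor> = \<lfloor>(2 ^ (j + m) * u i) / real_of_int (2 ^ m)\<rfloor>"
  by (simp add: power_add)
 also have "\<dots> = \<lfloor>2 ^ (j + m) * u i\<rfloor> div 2 ^ m"
  by (rule floor_divide_real_eq_div) simp
 finally show ?thesis using i by (simp add: idx_def)
qed

lemma half_idx: "half (idx (Suc j) u) = idx j u"
proof
 fix i show "half (idx (Suc j) u) i = idx j u i"
 proof (cases "i < k")
  case True
  show ?thesis
   using idx_div[OF True, of j 1 u] by (simp add: half_def)
 qed (simp add: half_def idx_def)
qed

lemma idx_eq_iff:
 "idx j u = z \<longleftrightarrow> z \<in> Z \<and> (\<forall>i<k. real_of_int (z i) / 2 ^ j \<le> u i \<and> u i < (real_of_int (z i) + 1) / 2 ^ j)"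
proof -
 have "idx j u = z \<longleftrightarrow> z \<in> Z \<and> (\<forall>i<k. \<lfloor>2 ^ j * u i\<rfloor> = z i)"
 proof
  assume "idx j u = z"
  then show "z \<in> Z \<and> (\<forall>i<k. \<lfloor>2 ^ j * u i\<rfloor> = z i)"
   using idx_Z[of j u] by (auto simp only: idx_def if_True)
 next
  assume *: "z \<in> Z \<and> (\<forall>i<k. \<lfloor>2 ^ j * u i\<rfloor> = z i)"
  show "idx j u = z"
  proof
   fix i show "idx j u i = z i"
    using * by (cases "i < k") (simp_all add: idx_def Z_def)
  qed
 qed
 also have "\<dots> \<longleftrightarrow> z \<in> Z \<and> (\<forall>i<k. real_of_int (z i) / 2 ^ j \<le> u i \<and> u i < (real_of_int (z i) + 1) / 2 ^ j)"
 proof -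
  have "\<lfloor>2 ^ j * a\<rfloor> = c \<longleftrightarrow> real_of_int c / 2 ^ j \<le> a \<and> a < (real_of_int c + 1) / 2 ^ j" for a c
   unfolding floor_eq_iff by (simp only: pos_divide_le_eq pos_less_divide_eq zero_less_numeral zero_less_power mult.commute)
  then show ?thesis by simp
 qed
 finally show ?thesis .
qed

lemma idx_bounds:
 "i < k \<Longrightarrow> real_of_int (idx j u i) / 2 ^ j \<le> u i \<and> u i < (real_of_int (idx j u i) + 1) / 2 ^ j"
 using idx_eq_iff[of j u "idx j u"] by auto

lemma adj_refl [simp]: "adj z z" by (simp add: adj_def)

lemma adj_half: "adj z w \<Longrightarrow> adj (half z) (half w)"
 unfolding adj_def half_def
proof (intro allI impI)
 fix i assume "\<forall>i<k. \<bar>z i - w i\<bar> \<le> 1" "i < k"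
 then have "\<bar>z i - w i\<bar> \<le> 1" by blast
 then show "\<bar>z i div 2 - w i div 2\<bar> \<le> 1" by linarith
qed

lemma idx_adj_dist:
 assumes "adj (idx j u) (idx j v)" "i < k"
 shows "\<bar>u i - v i\<bar> \<le> 2 / 2 ^ j"
proof -
 have "real_of_int \<bar>idx j u i - idx j v i\<bar> \<le> 1"
  using assms by (auto simp: adj_def)
 then have "\<bar>real_of_int (idx j u i) - real_of_int (idx j v i)\<bar> \<le> 1" by simp
 then have "\<bar>real_of_int (idx j u i) - real_of_int (idx j v i)\<bar> / 2 ^ j \<le> 1 / 2 ^ j"
  by (intro divide_right_mono) auto
 then have *: "\<bar>real_of_int (idx j u i) / 2 ^ j - real_of_int (idx j v i) / 2 ^ j\<bar> \<le> 1 / 2 ^ j"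
  by (simp add: diff_divide_distrib[symmetric])
 have **: "real_of_int (idx j w i) / 2 ^ j \<le> w i" "w i < real_of_int (idx j w i) / 2 ^ j + 1 / 2 ^ j" for w
  using idx_bounds[OF assms(2), of j w] by (simp_all add: add_divide_distrib)
 show ?thesis
  using * **[of u] **[of v] by linarith
qed

lemma dist_imp_adj:
 assumes "\<And>i. i < k \<Longrightarrow> \<bar>u i - v i\<bar> \<le> 1 / 2 ^ j"
 shows "adj (idx j u) (idx j v)"
 unfolding adj_def
proof (intro allI impI)
 fix i assume i: "i < k"
 have "\<bar>2 ^ j * u i - 2 ^ j * v i\<bar> = 2 ^ j * \<bar>u i - v i\<bar>"
  by (simp add: abs_mult flip: right_diff_distrib)
 also have "\<dots> \<le> 1" using assms[OF i] by (simp add: field_simps)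
 finally have "\<bar>2 ^ j * u i - 2 ^ j * v i\<bar> \<le> 1" .
 then show "\<bar>idx j u i - idx j v i\<bar> \<le> 1"
  using i by (simp add: idx_def) linarith
qed

lemma Z_ext: "z \<in> Z \<Longrightarrow> w \<in> Z \<Longrightarrow> (\<And>i. i < k \<Longrightarrow> z i = w i) \<Longrightarrow> z = w"
proof
 fix i assume "z \<in> Z" "w \<in> Z" and *: "\<And>i. i < k \<Longrightarrow> z i = w i"
 then show "z i = w i"
  by (cases "i < k") (simp_all add: Z_def)
qed

lemma card_Z_Pi:
 assumes "\<And>i. i < k \<Longrightarrow> finite (S i)"
 shows "finite {z \<in> Z. \<forall>i<k. z i \<in> S i}" "card {z \<in> Z. \<forall>i<k. z i \<in> S i} = (\<Prod>i<k. card (S i))"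
proof -
 have bij: "bij_betw (\<lambda>z. restrict z {..<k}) {z \<in> Z. \<forall>i<k. z i \<in> S i} (PiE {..<k} S)"
 proof (rule bij_betw_byWitness[where f'="\<lambda>z i. if i < k then z i else 0"])
  show "\<forall>z\<in>{z \<in> Z. \<forall>i<k. z i \<in> S i}. (\<lambda>i. if i < k then restrict z {..<k} i else 0) = z"
   by (intro ballI ext) (simp add: Z_def)
  show "\<forall>z\<in>PiE {..<k} S. restrict (\<lambda>i. if i < k then z i else 0) {..<k} = z"
   by (intro ballI ext) (simp add: PiE_def extensional_def restrict_def)
  show "(\<lambda>z. restrict z {..<k}) ` {z \<in> Z. \<forall>i<k. z i \<in> S i} \<subseteq> PiE {..<k} S"
   by (intro image_subsetI) simp
  show "(\<lambda>z i. if i < k then z i else 0) ` PiE {..<k} S \<subseteq> {z \<in> Z. \<forall>i<k. z i \<in> S i}"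
   by (intro image_subsetI) (simp add: Z_def PiE_def Pi_def)
 qed
 moreover have "finite (PiE {..<k} S)"
  by (rule finite_PiE) (simp_all add: assms)
 moreover have "card (PiE {..<k} S) = (\<Prod>i<k. card (S i))"
  by (rule card_PiE) simp
 ultimately show "finite {z \<in> Z. \<forall>i<k. z i \<in> S i}" "card {z \<in> Z. \<forall>i<k. z i \<in> S i} = (\<Prod>i<k. card (S i))"
  by (simp_all only: bij_betw_finite[OF bij] bij_betw_same_card[OF bij])
qed

lemma subs_alt: "subs q z = {z' \<in> Z. \<forall>i<k. z' i \<in> {z i * 2 ^ q ..< z i * 2 ^ q + 2 ^ q}}"
proof -
 have *: "a div 2 ^ q = b \<longleftrightarrow> a \<in> {b * 2 ^ q ..< b * 2 ^ q + 2 ^ q}" for a b :: int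
 proof
  assume "a div 2 ^ q = b"
  then have "a = b * 2 ^ q + a mod 2 ^ q" by (metis div_mult_mod_eq)
  moreover have "0 \<le> a mod 2 ^ q" "a mod 2 ^ q < 2 ^ q" by auto
  ultimately show "a \<in> {b * 2 ^ q ..< b * 2 ^ q + 2 ^ q}"
   unfolding atLeastLessThan_iff by linarith
 next
  assume "a \<in> {b * 2 ^ q ..< b * 2 ^ q + 2 ^ q}"
  then have "a = 2 ^ q * b + (a - b * 2 ^ q)" "0 \<le> a - b * 2 ^ q" "a - b * 2 ^ q < 2 ^ q" by auto
  then show "a div 2 ^ q = b"
   by (rule int_div_pos_eq)
 qed
 show ?thesis by (simp only: subs_def *)
qed

lemma finite_subs: "finite (subs q z)"
 unfolding subs_alt by (rule card_Z_Pi(1)) (rule finite_atLeastLessThan_int)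

lemma card_subs: "card (subs q z) = 2 ^ (q * k)"
proof -
 have "card (subs q z) = (\<Prod>i<k. card {z i * 2 ^ q ..< z i * 2 ^ q + 2 ^ q})"
  unfolding subs_alt by (rule card_Z_Pi(2)) (rule finite_atLeastLessThan_int)
 also have "\<dots> = (\<Prod>i<k. 2 ^ q)"
 proof (intro prod.cong refl)
  fix i
  have "(2::int) ^ q = int (2 ^ q)" by simp
  then show "card {z i * 2 ^ q ..< z i * 2 ^ q + 2 ^ q} = 2 ^ q"
   by (simp only: card_atLeastLessThan_int add_diff_cancel_left' nat_int)
 qed
 finally show ?thesis
  by (simp only: prod_constant card_lessThan power_mult)
qed

lemma idx_subs:
 assumes z: "z \<in> Z"
 shows "idx (j + q) u \<in> subs q z \<longleftrightarrow> idx j u = z"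
proof -
 have "idx (j + q) u \<in> subs q z \<longleftrightarrow> (\<forall>i<k. idx j u i = z i)"
  by (simp add: subs_def idx_div)
 also have "\<dots> \<longleftrightarrow> idx j u = z"
  using Z_ext[OF idx_Z z, of j u] by blast
 finally show ?thesis .
qed

end

section \<open>Lebesgue measure on the parameter space, and the mass over a cell\<close>

context frame
begin

abbreviation \<omega> :: real where "\<omega> \<equiv> unit_ball_vol (real k)"

text \<open>As \<open>k\<close> is a term, Euclidean \<open>k\<close>-space appears as a product
  measure over \<open>{..<k}\<close>, whose points are extensional functions. \<open>emb\<close>,
  \<open>af\<close> and \<open>idx\<close> read only coordinates below \<open>k\<close>, so they
  treat these points and the sequences \<open>co x\<close> alike.\<close>

definition LK :: "(nat \<Rightarrow> real) measure" where "LK = Pi\<^sub>M {..<k} (\<lambda>_. lborel)"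

lemma space_LK: "space LK = extensional {..<k}"
 by (simp add: LK_def space_PiM PiE_def)

lemma sets_LK [measurable_cong]: "sets LK = sets (Pi\<^sub>M {..<k} (\<lambda>_. borel))"
 unfolding LK_def by (intro sets_PiM_cong) auto

lemma sigma_finite_LK: "sigma_finite_measure LK"
proof -
 interpret product_sigma_finite "\<lambda>_. lborel :: real measure" ..
 show ?thesis unfolding LK_def by (rule sigma_finite) simp
qed

lemma measurable_LK_component [measurable]: "i < k \<Longrightarrow> (\<lambda>u. u i) \<in> borel_measurable LK"
 unfolding LK_def by measurable

lemma measurable_emb [measurable]: "emb \<in> borel_measurable LK"
 unfolding emb_def[abs_def]
 by (intro borel_measurable_sum borel_measurable_scaleR measurable_LK_component) auto

lemma measurable_af [measurable]: "af A \<in> borel_measurable LK"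
 unfolding af_def[abs_def]
 by (intro borel_measurable_add borel_measurable_sum borel_measurable_scaleR measurable_LK_component) auto

lemma emeasure_box:
 assumes "\<And>i. i < k \<Longrightarrow> a i \<le> b i"
 shows "emeasure LK {u \<in> space LK. \<forall>i<k. a i \<le> u i \<and> u i < b i} = ennreal (\<Prod>i<k. b i - a i)"
proof -
 interpret product_sigma_finite "\<lambda>_. lborel :: real measure" ..
 have "{u \<in> space LK. \<forall>i<k. a i \<le> u i \<and> u i < b i} = PiE {..<k} (\<lambda>i. {a i ..< b i})"
  by (simp add: space_LK PiE_def Pi_def) blast
 then have "emeasure LK {u \<in> space LK. \<forall>i<k. a i \<le> u i \<and> u i < b i} = (\<Prod>i<k. emeasure lborel {a i ..< b i})"
  unfolding LK_def by (simp add: emeasure_PiM)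
 also have "\<dots> = (\<Prod>i<k. ennreal (b i - a i))"
  using assms by (intro prod.cong) auto
 also have "\<dots> = ennreal (\<Prod>i<k. b i - a i)"
  using assms by (intro prod_ennreal) auto
 finally show ?thesis .
qed

text \<open>Boxes determine the product measure, so translation invariance in each factor suffices.
  It moves the disc in \<open>emeasure_disc\<close> to the origin.\<close>

lemma LK_translation:
 "distr LK LK (\<lambda>u. \<lambda>i\<in>{..<k}. u i + v i) = LK"
proof -
 interpret product_sigma_finite "\<lambda>_. lborel :: real measure" ..
 have m: "(\<lambda>u. \<lambda>i\<in>{..<k}. u i + v i) \<in> LK \<rightarrow>\<^sub>M LK"
  unfolding LK_def by measurable
 show ?thesis
  unfolding LK_def
 proof (rule PiM_eqI)
  fix A :: "nat \<Rightarrow> real set" assume A: "\<And>i. i \<in> {..<k} \<Longrightarrow> A i \<in> sets lborel"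
  have PA: "PiE {..<k} A \<in> sets (Pi\<^sub>M {..<k} (\<lambda>_. lborel))"
   using A by (intro sets_PiM_I_finite) auto
  have "emeasure (distr (Pi\<^sub>M {..<k} (\<lambda>_. lborel)) (Pi\<^sub>M {..<k} (\<lambda>_. lborel)) (\<lambda>u. \<lambda>i\<in>{..<k}. u i + v i)) (PiE {..<k} A)
    = emeasure (Pi\<^sub>M {..<k} (\<lambda>_. lborel)) ((\<lambda>u. \<lambda>i\<in>{..<k}. u i + v i) -` (PiE {..<k} A) \<inter> space (Pi\<^sub>M {..<k} (\<lambda>_. lborel)))"
   using m PA unfolding LK_def by (rule emeasure_distr)
  also have "(\<lambda>u. \<lambda>i\<in>{..<k}. u i + v i) -` (PiE {..<k} A) \<inter> space (Pi\<^sub>M {..<k} (\<lambda>_. lborel))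
    = PiE {..<k} (\<lambda>i. (\<lambda>x. x + v i) -` A i)"
   by (auto simp: space_PiM PiE_def Pi_def extensional_def)
  also have "emeasure (Pi\<^sub>M {..<k} (\<lambda>_. lborel)) \<dots> = (\<Prod>i<k. emeasure lborel ((\<lambda>x. x + v i) -` A i))"
  proof (rule emeasure_PiM)
   fix i assume "i \<in> {..<k}"
   then show "(\<lambda>x. x + v i) -` A i \<in> sets lborel"
    using A by (simp add: borel_measurable_add measurable_sets_borel[of _ borel])
  qed simp
  also have "\<dots> = (\<Prod>i<k. emeasure lborel (A i))"
  proof (intro prod.cong refl)
   fix i assume i: "i \<in> {..<k}"
   have "emeasure lborel (A i) = emeasure (distr lborel borel ((+) (v i))) (A i)"
    by (simp add: lborel_distr_plus)
   also have "(+) (v i) = (\<lambda>x. x + v i)"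
    by (simp add: fun_eq_iff)
   also have "emeasure (distr lborel borel (\<lambda>x. x + v i)) (A i) = emeasure lborel ((\<lambda>x. x + v i) -` A i)"
    using A[OF i] by (subst emeasure_distr) (auto simp: add.commute[of "v i"])
   finally show "emeasure lborel ((\<lambda>x. x + v i) -` A i) = emeasure lborel (A i)" ..
  qed
  finally show "emeasure (distr (Pi\<^sub>M {..<k} (\<lambda>_. lborel)) (Pi\<^sub>M {..<k} (\<lambda>_. lborel)) (\<lambda>u. \<lambda>i\<in>{..<k}. u i + v i)) (PiE {..<k} A)
   = (\<Prod>i\<in>{..<k}. emeasure lborel (A i))" .
 qed auto
qed

lemma emeasure_disc:
 assumes r: "0 < r"
 shows "emeasure LK {u \<in> space LK. norm (emb u - emb v) \<le> r} = ennreal (\<omega> * r ^ k)"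
proof -
 let ?T = "\<lambda>u. \<lambda>i\<in>{..<k}. u i + v i"
 have m: "?T \<in> LK \<rightarrow>\<^sub>M LK"
  unfolding LK_def by measurable
 have "emeasure LK {u \<in> space LK. norm (emb u - emb v) \<le> r} = emeasure (distr LK LK ?T) {u \<in> space LK. norm (emb u - emb v) \<le> r}"
  by (simp only: LK_translation)
 also have "\<dots> = emeasure LK (?T -` {u \<in> space LK. norm (emb u - emb v) \<le> r} \<inter> space LK)"
  by (rule emeasure_distr[OF m]) measurable
 also have "?T -` {u \<in> space LK. norm (emb u - emb v) \<le> r} \<inter> space LK = {f. sqrt (\<Sum>i\<in>{..<k}. (f i)\<^sup>2) \<le> r} \<inter> space LK"
 proof -
  have "emb (?T u) - emb v = emb u" for u
   unfolding emb_diff by (rule emb_cong) simp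
  then show ?thesis
   using measurable_space[OF m] by (auto simp: norm_emb L2_set_def)
 qed
 also have "emeasure LK \<dots> = ennreal (\<omega> * r ^ k)"
  unfolding LK_def using emeasure_cball_aux[of "{..<k}" r] r by simp
 finally show ?thesis .
qed

end

locale fmeas = frame e k + finite_measure M
 for e :: "nat \<Rightarrow> 'a::euclidean_space" and k and M :: "'a measure" +
 assumes sets_M [measurable_cong]: "sets M = sets borel"
begin

abbreviation resint :: "'a \<times> (nat \<Rightarrow> 'a) \<Rightarrow> 'a set \<Rightarrow> ennreal" where
 "resint A X \<equiv> (\<integral>\<^sup>+x\<in>X. ennreal ((norm (res A x))\<^sup>2) \<partial>M)"

lemma space_M [simp]: "space M = UNIV"
 using sets_eq_imp_space_eq[OF sets_M] by simp

lemma measurable_M_eq: "borel_measurable M = borel_measurable borel"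
 by (rule measurable_cong_sets) (simp_all add: sets_M)

text \<open>Double counting of the pairs \<open>(u, x)\<close> with
  \<open>norm (emb u - hor x) \<le> r\<close>. Each \<open>x\<close> in \<open>X\<close> has a full
  disc of such \<open>u\<close>; for each \<open>u\<close> the matching \<open>x\<close> lie in one
  ball about the graph point over \<open>u\<close>, where the density bound applies, and
  \<open>u\<close> stays within \<open>r\<close> of the cell. Averaging over balls keeps the sharp
  constant for a cube, which a covering by balls would lose.\<close>

lemma measure_slab_le:
 assumes X: "X \<in> sets borel" and r: "0 < r" and u: "0 \<le> c" and r': "0 \<le> r'"
  and idx: "\<And>x. x \<in> X \<Longrightarrow> idx j (co x) = z" and res: "\<And>x. x \<in> X \<Longrightarrow> norm (res A x) \<le> \<rho>"
  and slope: "\<And>i. i < k \<Longrightarrow> norm (snd A i) \<le> \<theta>"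
  and rr: "(1 + real k * \<theta>) * r + \<rho> < r'"
  and U: "\<And>y. measure M (ball y r') \<le> c * \<omega> * r' ^ k"
 shows "measure M X * r ^ k \<le> c * (1 / 2 ^ j + 2 * r) ^ k * r' ^ k"
proof -
 interpret L: sigma_finite_measure LK by (rule sigma_finite_LK)
 interpret pair_sigma_finite LK M ..
 let ?f = "\<lambda>u x. indicator {x \<in> X. norm (emb u - hor x) \<le> r} x :: ennreal"
 let ?B = "{u \<in> space LK. \<forall>i<k. real_of_int (z i) / 2 ^ j - r \<le> u i \<and> u i < (real_of_int (z i) + 1) / 2 ^ j + r}"
 have XM [measurable]: "X \<in> sets M" using X by (simp add: sets_M)
 have hM [measurable]: "hor \<in> borel_measurable M"
  using measurable_hor by (simp add: measurable_M_eq)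
 have meas: "case_prod ?f \<in> borel_measurable (LK \<Otimes>\<^sub>M M)"
  by measurable
 have "ennreal (measure M X * (\<omega> * r ^ k)) = (\<integral>\<^sup>+x. ennreal (\<omega> * r ^ k) * indicator X x \<partial>M)"
  using r by (subst nn_integral_cmult_indicator) (auto simp: emeasure_eq_measure ennreal_mult[symmetric] mult.commute)
 also have "\<dots> = (\<integral>\<^sup>+x. (\<integral>\<^sup>+u. ?f u x \<partial>LK) \<partial>M)"
 proof (rule nn_integral_cong)
  fix x
  have "(\<integral>\<^sup>+u. ?f u x \<partial>LK) = (\<integral>\<^sup>+u. indicator X x * indicator {u \<in> space LK. norm (emb u - emb (co x)) \<le> r} u \<partial>LK)"
   by (intro nn_integral_cong) (auto simp: indicator_def hor_def)
  also have "\<dots> = indicator X x * ennreal (\<omega> * r ^ k)"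
   by (subst nn_integral_cmult_indicator) (auto simp: emeasure_disc[OF r])
  finally show "ennreal (\<omega> * r ^ k) * indicator X x = (\<integral>\<^sup>+u. ?f u x \<partial>LK)"
   by (simp add: mult.commute)
 qed
 also have "\<dots> = (\<integral>\<^sup>+u. (\<integral>\<^sup>+x. ?f u x \<partial>M) \<partial>LK)"
  using meas by (rule Fubini')
 also have "\<dots> \<le> (\<integral>\<^sup>+u. ennreal (c * \<omega> * r' ^ k) * indicator ?B u \<partial>LK)"
 proof (rule nn_integral_mono)
  fix u assume u: "u \<in> space LK"
  \<comment> \<open>From the graph point over \<open>u\<close> to \<open>x\<close> there are three
    contributions: the horizontal gap, the rise of the affine map over that gap, and the residual.
    \<open>rr\<close> adds them up.\<close>
  have sub: "{x \<in> X. norm (emb u - hor x) \<le> r} \<subseteq> ball (emb u + af A u) r'"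
  proof clarify
   fix x assume x: "x \<in> X" "norm (emb u - hor x) \<le> r"
   have "x = hor x + (af A (co x) + res A x)"
    by (simp add: res_def ver_def)
   then have "emb u + af A u - x = (emb u - hor x) + (af A u - af A (co x)) - res A x"
    by (metis (no_types, lifting) add_diff_add diff_diff_add)
   then have "norm (emb u + af A u - x) \<le> norm (emb u - hor x) + norm (af A u - af A (co x)) + norm (res A x)"
    by (metis norm_triangle_ineq4 norm_triangle_ineq add_right_mono order_trans)
   also have "norm (af A u - af A (co x)) \<le> real k * \<theta> * norm (emb u - hor x)"
    using af_lip_norm[OF slope, of u "co x"] by (simp add: hor_def)
   also have "\<dots> \<le> real k * \<theta> * r"
   proof -
    have "0 \<le> \<theta>" using slope[of 0] k_pos norm_ge_zero[of "snd A 0"] by linarith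
    then show ?thesis using x(2) by (intro mult_left_mono) auto
   qed
   finally show "x \<in> ball (emb u + af A u) r'"
    using x res[OF x(1)] rr by (simp add: dist_norm algebra_simps)
  qed
  show "(\<integral>\<^sup>+x. ?f u x \<partial>M) \<le> ennreal (c * \<omega> * r' ^ k) * indicator ?B u"
  proof (cases "u \<in> ?B")
   case True
   have "(\<integral>\<^sup>+x. ?f u x \<partial>M) = emeasure M {x \<in> X. norm (emb u - hor x) \<le> r}"
    by simp
   also have "\<dots> \<le> emeasure M (ball (emb u + af A u) r')"
    using sub by (rule emeasure_mono) (simp add: sets_M)
   also have "\<dots> \<le> ennreal (c * \<omega> * r' ^ k)"
    unfolding emeasure_eq_measure by (rule ennreal_leI) (rule U)
   finally show ?thesis using True by simp
  next
   case False
   have "{x \<in> X. norm (emb u - hor x) \<le> r} = {}"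
   proof (rule ccontr)
    assume "{x \<in> X. norm (emb u - hor x) \<le> r} \<noteq> {}"
    then obtain x where x: "x \<in> X" "norm (emb u - hor x) \<le> r" by blast
    have "real_of_int (z i) / 2 ^ j - r \<le> u i \<and> u i < (real_of_int (z i) + 1) / 2 ^ j + r" if i: "i < k" for i
    proof -
     have "\<bar>u i - co x i\<bar> \<le> r"
      using emb_coord_le[OF i, of "\<lambda>i. u i - co x i"] x(2) by (simp add: hor_def emb_diff)
     then show ?thesis
      using idx_bounds[OF i, of j "co x"] idx[OF x(1)] by auto
    qed
    then show False using False u by auto
   qed
   then show ?thesis by (simp only: indicator_simps) simp
  qed
 qed
 also have "\<dots> = ennreal (c * \<omega> * r' ^ k) * emeasure LK ?B"
  by (rule nn_integral_cmult_indicator) measurable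
 also have "emeasure LK ?B = ennreal (\<Prod>i<k. (1 / 2 ^ j + 2 * r))"
 proof (subst emeasure_box)
  fix i
  have "real_of_int (z i) / 2 ^ j \<le> (real_of_int (z i) + 1) / 2 ^ j"
   by (intro divide_right_mono) auto
  then show "real_of_int (z i) / 2 ^ j - r \<le> (real_of_int (z i) + 1) / 2 ^ j + r"
   using r by linarith
 qed (simp add: add_divide_distrib)
 also have "ennreal (c * \<omega> * r' ^ k) * \<dots> = ennreal (\<omega> * (c * (1 / 2 ^ j + 2 * r) ^ k * r' ^ k))"
  using u r r' by (subst ennreal_mult[symmetric]) (auto simp: mult_ac)
 finally have "measure M X * (\<omega> * r ^ k) \<le> \<omega> * (c * (1 / 2 ^ j + 2 * r) ^ k * r' ^ k)"
  using u r r' by (subst (asm) ennreal_le_iff) auto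
 then have "\<omega> * (measure M X * r ^ k) \<le> \<omega> * (c * (1 / 2 ^ j + 2 * r) ^ k * r' ^ k)"
  by (simp only: mult_ac)
 then show ?thesis
  by (rule mult_left_le_imp_le) simp
qed

end

section \<open>Comparison of two affine fits to the same mass\<close>

lemma norm_diff_diff_le: "norm (a - b - c) \<le> norm a + norm b + norm c"
 for a b c :: "'a::real_normed_vector"
 by (rule order_trans[OF norm_triangle_ineq4]) (simp add: norm_triangle_ineq4)

context frame
begin

text \<open>This depth gives \<open>4 * k \<le> 2 ^ qd\<close>: uncertainties of one subcell side in
  up to \<open>k\<close> coordinates amount to at most a quarter of the side of the cell.\<close>

definition qd :: nat where "qd = k + 2"

text \<open>Take the direction \<open>i0\<close> of largest slope and the two extreme subcells along
  it. Their sample points differ by at least half a cell side in coordinate \<open>i0\<close> and by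
  at most one subcell side in the others, whose slopes are no larger, so no cancellation can hide
  the slope along \<open>i0\<close>.\<close>

lemma coef_bound:
 assumes z: "z \<in> Z"
  and D: "\<And>z'. z' \<in> subs qd z \<Longrightarrow> \<exists>u. idx (j + qd) u = z' \<and> norm (af D u) \<le> \<epsilon>"
  and i: "i < k"
 shows "norm (snd D i) \<le> 8 * \<epsilon> * 2 ^ j"
proof -
 let ?q = qd
 obtain i0 where i0: "i0 < k" and max: "\<And>l. l < k \<Longrightarrow> norm (snd D l) \<le> norm (snd D i0)"
 proof -
  have fin: "finite ((\<lambda>l. norm (snd D l)) ` {..<k})" "(\<lambda>l. norm (snd D l)) ` {..<k} \<noteq> {}"
   using i by auto
  obtain i0 where "i0 < k" "Max ((\<lambda>l. norm (snd D l)) ` {..<k}) = norm (snd D i0)"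
   using Max_in[OF fin] by auto
  with that[of i0] Max_ge[OF fin(1)] show ?thesis by auto
 qed
 define m where "m = norm (snd D i0)"
 define z1 where "z1 = (\<lambda>l. if l < k then z l * 2 ^ ?q else 0)"
 define z2 where "z2 = z1(i0 := z1 i0 + (2 ^ ?q - 1))"
 have q1: "(1::int) \<le> 2 ^ ?q" by (rule one_le_power) simp
 have z1: "z1 \<in> subs ?q z"
  unfolding subs_alt by (auto simp: z1_def Z_def)
 have z2: "z2 \<in> subs ?q z"
  using i0 q1 unfolding subs_alt by (auto simp: z2_def z1_def Z_def)
 obtain u1 where u1: "idx (j + ?q) u1 = z1" "norm (af D u1) \<le> \<epsilon>" using D[OF z1] by blast
 obtain u2 where u2: "idx (j + ?q) u2 = z2" "norm (af D u2) \<le> \<epsilon>" using D[OF z2] by blast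
 define h where "h = (1::real) / 2 ^ (j + ?q)"
 have b: "real_of_int (idx (j + ?q) u l) * h \<le> u l" "u l < real_of_int (idx (j + ?q) u l) * h + h" if "l < k" for u l
  using idx_bounds[OF that, of "j + ?q" u] by (simp_all add: h_def add_divide_distrib)
 have small: "\<bar>u2 l - u1 l\<bar> \<le> h" if "l < k" "l \<noteq> i0" for l
  using b[OF that(1), of u1] b[OF that(1), of u2] that by (simp add: u1 u2 z2_def)
 have big: "(2 ^ ?q - 2) * h \<le> u2 i0 - u1 i0"
  using b[OF i0, of u1] b[OF i0, of u2] by (simp add: u1 u2 z2_def algebra_simps)
 have h: "2 ^ ?q * h = 1 / 2 ^ j" "0 < h"
  by (simp_all add: h_def power_add)
 have k4: "4 * real k \<le> 2 ^ ?q"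
 proof -
  have "real k \<le> 2 ^ k" by simp
  then show ?thesis by (simp add: qd_def)
 qed
 have big2: "1 / 2 ^ j / 2 \<le> u2 i0 - u1 i0"
 proof -
  have "1 / 2 ^ j / 2 = (2 ^ ?q / 2) * h" using h(1) by simp
  also have "\<dots> \<le> (2 ^ ?q - 2) * h"
  proof (rule mult_right_mono)
   have "(1::real) \<le> 2 ^ k" by simp
   then show "(2::real) ^ ?q / 2 \<le> 2 ^ ?q - 2" by (simp add: qd_def)
  qed (use h in simp)
  finally show ?thesis using big by linarith
 qed
 have "af D u2 - af D u1 = (u2 i0 - u1 i0) *\<^sub>R snd D i0 + (\<Sum>l\<in>{..<k} - {i0}. (u2 l - u1 l) *\<^sub>R snd D l)"
  unfolding af_diff using i0 by (subst sum.remove[of _ i0]) auto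
 then have "(u2 i0 - u1 i0) *\<^sub>R snd D i0 = af D u2 - af D u1 - (\<Sum>l\<in>{..<k} - {i0}. (u2 l - u1 l) *\<^sub>R snd D l)"
  by simp
 then have "norm ((u2 i0 - u1 i0) *\<^sub>R snd D i0) \<le> norm (af D u2) + norm (af D u1) + norm (\<Sum>l\<in>{..<k} - {i0}. (u2 l - u1 l) *\<^sub>R snd D l)"
  by (simp only: norm_diff_diff_le)
 also have "norm (\<Sum>l\<in>{..<k} - {i0}. (u2 l - u1 l) *\<^sub>R snd D l) \<le> (\<Sum>l\<in>{..<k} - {i0}. norm ((u2 l - u1 l) *\<^sub>R snd D l))"
  by (rule norm_sum)
 also have "\<dots> \<le> (\<Sum>l\<in>{..<k} - {i0}. h * m)"
 proof (rule sum_mono)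
  fix l assume "l \<in> {..<k} - {i0}"
  then show "norm ((u2 l - u1 l) *\<^sub>R snd D l) \<le> h * m"
   using small[of l] max[of l] h(2) by (simp add: m_def mult_mono)
 qed
 also have "\<dots> \<le> real k * (h * m)"
 proof -
  have "card ({..<k} - {i0}) \<le> k" by (metis card_Diff1_le card_lessThan finite_lessThan)
  then show ?thesis using h(2) by (simp add: m_def mult_right_mono)
 qed
 also have "real k * (h * m) \<le> (2 ^ ?q * h) * m / 4"
 proof -
  have "(4 * real k) * (h * m) \<le> 2 ^ ?q * (h * m)"
   by (rule mult_right_mono[OF k4]) (use h in \<open>simp add: m_def\<close>)
  then show ?thesis by (simp add: mult_ac)
 qed
 also have "\<dots> = 1 / 2 ^ j * m / 4" by (simp only: h(1))
 also have "norm ((u2 i0 - u1 i0) *\<^sub>R snd D i0) = (u2 i0 - u1 i0) * m"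
 proof -
  have "0 \<le> 1 / (2::real) ^ j / 2" by simp
  then have "0 \<le> u2 i0 - u1 i0" using big2 by linarith
  then show ?thesis by (simp add: m_def)
 qed
 finally have "(u2 i0 - u1 i0) * m \<le> \<epsilon> + \<epsilon> + 1 / 2 ^ j * m / 4"
  using u1(2) u2(2) by linarith
 moreover have "1 / 2 ^ j / 2 * m \<le> (u2 i0 - u1 i0) * m"
  using big2 by (rule mult_right_mono) (simp add: m_def)
 ultimately have "m * (1 / 2 ^ j) \<le> 8 * \<epsilon>" by simp
 then have "m \<le> 8 * \<epsilon> * 2 ^ j" by (simp add: field_simps)
 then show ?thesis using max[OF i] by (simp add: m_def)
qed

end

context fmeas
begin

lemma exists_le_average:
 assumes Y: "Y \<in> sets borel" and m: "0 < m" "m \<le> measure M Y" and f[measurable]: "f \<in> borel_measurable borel"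
  and nn: "\<And>x. 0 \<le> f x" and I: "(\<integral>\<^sup>+x\<in>Y. ennreal (f x) \<partial>M) \<le> ennreal C" and C: "0 \<le> C"
 shows "\<exists>x\<in>Y. f x \<le> C / m"
proof (rule ccontr)
 assume "\<not> ?thesis"
 then have gt: "C / m < f x" if "x \<in> Y" for x using that by force
 have [measurable]: "Y \<in> sets M" "f \<in> borel_measurable M"
  using Y f by (simp_all add: sets_M measurable_M_eq)
 have "ennreal C \<le> ennreal (C / m) * emeasure M Y"
  using m C by (simp add: emeasure_eq_measure ennreal_mult[symmetric] field_simps mult_left_mono)
 also have "\<dots> = (\<integral>\<^sup>+x. ennreal (C / m) * indicator Y x \<partial>M)"
  by (simp add: nn_integral_cmult_indicator)
 also have "\<dots> < (\<integral>\<^sup>+x. ennreal (f x) * indicator Y x \<partial>M)"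
 proof (rule nn_integral_less)
  show "(\<integral>\<^sup>+x. ennreal (C / m) * indicator Y x \<partial>M) \<noteq> \<infinity>"
   by (simp add: nn_integral_cmult_indicator emeasure_eq_measure ennreal_mult_eq_top_iff)
  show "AE x in M. ennreal (C / m) * indicator Y x \<le> ennreal (f x) * indicator Y x"
   using gt by (intro AE_I2) (simp add: indicator_def ennreal_leI less_imp_le)
  show "\<not> (AE x in M. ennreal (f x) * indicator Y x \<le> ennreal (C / m) * indicator Y x)"
  proof
   assume "AE x in M. ennreal (f x) * indicator Y x \<le> ennreal (C / m) * indicator Y x"
   then have "AE x in M. x \<notin> Y"
   proof eventually_elim
    case (elim x)
    show ?case
    proof
     assume x: "x \<in> Y"
     then have "f x \<le> C / m" using elim m C by (simp add: ennreal_le_iff)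
     then show False using gt[OF x] by simp
    qed
   qed
   then have "emeasure M Y = 0"
    by (subst (asm) AE_iff_measurable[of Y]) auto
   then show False using m by (simp add: measure_def)
  qed
 qed measurable
 finally show False using I by simp
qed

text \<open>Averaging the sum of both squared residuals yields one point that is good for
  \<open>A\<close> and \<open>B\<close> at once. At a common point the vertical parts cancel and the
  residuals differ exactly by the difference of the affine maps.\<close>

lemma affine_compare_aux:
 assumes z: "z \<in> Z" and X: "X \<in> sets borel"
  and sub: "\<And>z'. z' \<in> subs qd z \<Longrightarrow> (1 / 2 ^ (j + qd)) ^ k / 2 \<le> measure M {x \<in> X. idx (j + qd) (co x) = z'}"
  and A: "resint A X \<le> ennreal (a * (1 / 2 ^ j) ^ (k + 2))"
  and B: "resint B X \<le> ennreal (b * (1 / 2 ^ j) ^ (k + 2))"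
  and ab: "0 \<le> a" "0 \<le> b"
  and z': "z' \<in> subs qd z"
 shows "\<exists>x\<in>X. idx (j + qd) (co x) = z' \<and> norm (af (adiff A B) (co x)) \<le> 2 * 2 ^ (qd * k) * sqrt (a + b) / 2 ^ j"
proof -
 let ?q = qd let ?t = "1 / (2::real) ^ j"
 let ?Y = "{x \<in> X. idx (j + ?q) (co x) = z'}"
 let ?f = "\<lambda>x. (norm (res A x))\<^sup>2 + (norm (res B x))\<^sup>2"
 have Ymeas: "?Y \<in> sets borel"
 proof -
  have "?Y = X \<inter> (\<Inter>i\<in>{..<k}. {x. real_of_int (z' i) / 2 ^ (j + ?q) \<le> co x i \<and> co x i < (real_of_int (z' i) + 1) / 2 ^ (j + ?q)})"
   using z' by (auto simp: idx_eq_iff subs_def)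
  also have "\<dots> \<in> sets borel"
  proof (intro sets.Int X sets.finite_INT)
   show "{..<k} \<noteq> {}" using k_pos by (auto simp: lessThan_empty_iff)
  qed (auto intro!: sets.sets_Collect simp: co_def)
  finally show ?thesis .
 qed
 have m: "0 < (1 / (2::real) ^ (j + ?q)) ^ k / 2" by simp
 have "(\<integral>\<^sup>+x\<in>?Y. ennreal (?f x) \<partial>M) \<le> (\<integral>\<^sup>+x\<in>X. ennreal (?f x) \<partial>M)"
  by (intro nn_integral_mono) (auto simp: indicator_def)
 also have "\<dots> = (\<integral>\<^sup>+x. ennreal ((norm (res A x))\<^sup>2) * indicator X x + ennreal ((norm (res B x))\<^sup>2) * indicator X x \<partial>M)"
  by (intro nn_integral_cong) (simp add: distrib_right)
 also have "\<dots> = resint A X + resint B X"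
  using X by (intro nn_integral_add) (auto simp: measurable_M_eq)
 also have "\<dots> \<le> ennreal (a * ?t ^ (k + 2)) + ennreal (b * ?t ^ (k + 2))"
  using A B by (rule add_mono)
 also have "\<dots> = ennreal ((a + b) * ?t ^ (k + 2))"
 proof -
  have "0 \<le> ?t ^ (k + 2)" by simp
  then show ?thesis using ab by (simp only: distrib_right ennreal_plus mult_nonneg_nonneg)
 qed
 finally obtain x where x: "x \<in> ?Y" "?f x \<le> (a + b) * ?t ^ (k + 2) / ((1 / 2 ^ (j + ?q)) ^ k / 2)"
  using exists_le_average[OF Ymeas m sub[OF z'], of ?f] ab by fastforce
 have "(a + b) * ?t ^ (k + 2) / ((1 / 2 ^ (j + ?q)) ^ k / 2) = 2 * 2 ^ (?q * k) * (a + b) * ?t\<^sup>2"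
 proof -
  have "(1 / (2::real) ^ (j + ?q)) ^ k = ?t ^ k * (1 / 2 ^ (?q * k))"
   by (simp add: power_add power_mult power_divide power_mult_distrib)
  moreover have "a' * (P * s) / (P * (1 / Q) / 2) = 2 * Q * a' * s" if "0 < P" "0 < Q" for a' s P Q :: real
   using that by (simp add: field_simps)
  ultimately show ?thesis by (simp only: power_add) simp
 qed
 then have fx: "?f x \<le> 2 * 2 ^ (?q * k) * (a + b) * ?t\<^sup>2" using x by simp
 have "(norm (af (adiff A B) (co x)))\<^sup>2 \<le> (norm (res A x) + norm (res B x))\<^sup>2"
  unfolding res_adiff[symmetric]
  by (intro power_mono order_trans[OF norm_triangle_ineq4]) auto
 also have "\<dots> \<le> 2 * ?f x"
  using sum_squares_bound[of "norm (res A x)" "norm (res B x)"] by (simp add: power2_sum)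
 also have "\<dots> \<le> 4 * 2 ^ (?q * k) * (a + b) * ?t\<^sup>2" using fx by simp
 \<comment> \<open>The factor is enlarged to its square so that the final root leaves a plain power
   of two.\<close>
 also have "\<dots> \<le> 4 * (2 ^ (?q * k))\<^sup>2 * (a + b) * ?t\<^sup>2"
 proof -
  have "(1::real) \<le> 2 ^ (?q * k)" by simp
  then have "(2::real) ^ (?q * k) \<le> (2 ^ (?q * k))\<^sup>2" by (rule power_increasing[of 1 2 "2 ^ (?q * k)", simplified power_one_right, rotated]) simp
  then show ?thesis using ab by (intro mult_right_mono mult_left_mono) auto
 qed
 also have "\<dots> = (2 * 2 ^ (?q * k) * sqrt (a + b) / 2 ^ j)\<^sup>2"
  using ab by (simp add: power_mult_distrib power_divide)
 finally have "norm (af (adiff A B) (co x)) \<le> 2 * 2 ^ (?q * k) * sqrt (a + b) / 2 ^ j"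
  by (rule power2_le_imp_le) (use ab in simp)
 then show ?thesis using x by blast
qed

text \<open>Covers both parts of \<open>affine_compare\<close>: slopes need
  \<open>16 * 2 ^ (qd * k)\<close>. Values at points up to 10 sides from the corner lie within 11
  sides of a sample point, which needs \<open>(176 * k + 2) * 2 ^ (qd * k)\<close>.\<close>

definition CS :: real where "CS = 200 * real k * 2 ^ (qd * k)"

lemma affine_compare:
 assumes z: "z \<in> Z" and X: "X \<in> sets borel"
  and sub: "\<And>z'. z' \<in> subs qd z \<Longrightarrow> (1 / 2 ^ (j + qd)) ^ k / 2 \<le> measure M {x \<in> X. idx (j + qd) (co x) = z'}"
  and A: "resint A X \<le> ennreal (a * (1 / 2 ^ j) ^ (k + 2))"
  and B: "resint B X \<le> ennreal (b * (1 / 2 ^ j) ^ (k + 2))"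
  and ab: "0 \<le> a" "0 \<le> b"
 shows "i < k \<Longrightarrow> norm (snd A i - snd B i) \<le> CS * sqrt (a + b)"
  and "(\<And>i. i < k \<Longrightarrow> \<bar>u i - real_of_int (z i) / 2 ^ j\<bar> \<le> 10 / 2 ^ j) \<Longrightarrow> norm (af A u - af B u) \<le> CS * sqrt (a + b) / 2 ^ j"
proof -
 let ?q = qd let ?e = "2 * 2 ^ (qd * k) * sqrt (a + b) / 2 ^ j"
 have ex: "\<exists>x\<in>X. idx (j + ?q) (co x) = z' \<and> norm (af (adiff A B) (co x)) \<le> ?e" if "z' \<in> subs ?q z" for z'
  by (rule affine_compare_aux[OF z X sub A B ab that])
 have co: "norm (snd (adiff A B) i) \<le> 8 * ?e * 2 ^ j" if "i < k" for i
  by (rule coef_bound[OF z _ that]) (use ex in blast)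
 have co2: "norm (snd (adiff A B) i) \<le> 16 * 2 ^ (qd * k) * sqrt (a + b)" if "i < k" for i
  using co[OF that] by simp
 show "norm (snd A i - snd B i) \<le> CS * sqrt (a + b)" if "i < k"
 proof -
  have "16 * 2 ^ (qd * k) \<le> CS" using k_pos by (simp add: CS_def)
  then have "16 * 2 ^ (qd * k) * sqrt (a + b) \<le> CS * sqrt (a + b)"
   using ab by (intro mult_right_mono) auto
  then show ?thesis using co2[OF that] by (simp add: adiff_def)
 qed
 show "norm (af A u - af B u) \<le> CS * sqrt (a + b) / 2 ^ j"
  if u: "\<And>i. i < k \<Longrightarrow> \<bar>u i - real_of_int (z i) / 2 ^ j\<bar> \<le> 10 / 2 ^ j"
 proof -
  have "card (subs ?q z) \<noteq> 0" by (simp add: card_subs)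
  then obtain z' where z': "z' \<in> subs ?q z" by (metis card.empty ex_in_conv)
  then obtain x where x: "x \<in> X" "idx (j + ?q) (co x) = z'" "norm (af (adiff A B) (co x)) \<le> ?e" using ex by blast
  have "idx j (co x) = z" using x z' idx_subs[OF z, of j ?q "co x"] by simp
  then have xz: "real_of_int (z i) / 2 ^ j \<le> co x i \<and> co x i < (real_of_int (z i) + 1) / 2 ^ j" if "i < k" for i
   using idx_bounds[OF that, of j "co x"] by simp
  have d: "\<bar>u i - co x i\<bar> \<le> 11 / 2 ^ j" if "i < k" for i
   using xz[OF that] u[OF that] by (simp add: add_divide_distrib abs_le_iff)
  have "norm (af (adiff A B) u - af (adiff A B) (co x)) \<le> real k * (16 * 2 ^ (qd * k) * sqrt (a + b)) * (11 / 2 ^ j)"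
   by (rule af_lip[OF co2 d])
  then have "norm (af (adiff A B) u) \<le> real k * (16 * 2 ^ (qd * k) * sqrt (a + b)) * (11 / 2 ^ j) + ?e"
   using x(3) norm_triangle_sub[of "af (adiff A B) u" "af (adiff A B) (co x)"] by linarith
  also have "\<dots> = (176 * real k + 2) * 2 ^ (qd * k) * sqrt (a + b) / 2 ^ j"
   by (simp add: field_simps)
  also have "\<dots> \<le> (200 * real k) * 2 ^ (qd * k) * sqrt (a + b) / 2 ^ j"
   using k_pos ab by (intro divide_right_mono mult_right_mono) auto
  finally show ?thesis by (simp add: CS_def af_adiff)
 qed
qed

end

section \<open>Planes as graphs over the frame\<close>

lemma subspace_projection:
 fixes D :: "'a::euclidean_space set"
 assumes "subspace D"
 obtains T where "linear T" "\<And>d. d \<in> D \<Longrightarrow> T d = 0" "\<And>x d. d \<in> D \<Longrightarrow> T x \<bullet> d = 0"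
  "\<And>x. x - T x \<in> D" "\<And>x. norm (T x) \<le> norm x"
proof -
 obtain B where B: "B \<subseteq> D" "pairwise orthogonal B" "\<And>x. x \<in> B \<Longrightarrow> norm x = 1" "independent B" "span B = D"
  using orthonormal_basis_subspace[OF assms] by metis
 have fin: "finite B" using B(4) by (rule independent_imp_finite)
 \<comment> \<open>\<open>p\<close> is the orthogonal projection onto \<open>D\<close>; the map
   delivered in the end is the complementary projection \<open>x - p x\<close>.\<close>
 define p where "p x = (\<Sum>b\<in>B. (x \<bullet> b) *\<^sub>R b)" for x :: 'a
 have pD: "p x \<in> D" for x
  unfolding p_def using B(1) by (intro subspace_sum[OF assms] subspace_scale[OF assms]) auto
 have lin: "linear (\<lambda>x. x - p x)"
  unfolding p_def
  by (intro linearI) (auto simp: inner_add_left scaleR_add_left sum.distrib scaleR_sum_right scaleR_diff_right)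
 have pb: "p x \<bullet> b = x \<bullet> b" if b: "b \<in> B" for x b
 proof -
  have "p x \<bullet> b = (\<Sum>c\<in>B. (x \<bullet> c) * (c \<bullet> b))"
   by (simp add: p_def inner_sum_left)
  also have "\<dots> = (\<Sum>c\<in>B. if c = b then x \<bullet> b else 0)"
  proof (rule sum.cong)
   fix c assume c: "c \<in> B"
   show "(x \<bullet> c) * (c \<bullet> b) = (if c = b then x \<bullet> b else 0)"
    using pairwiseD[OF B(2) c b] B(3)[OF b] by (auto simp: orthogonal_def norm_eq_1)
  qed simp
  finally show ?thesis using fin b by simp
 qed
 have orth: "orthogonal (x - p x) d" if "d \<in> D" for x d
  using that unfolding B(5)[symmetric]
  by (rule orthogonal_to_span) (simp add: orthogonal_def inner_diff_left pb)
 have z: "d - p d = 0" if "d \<in> D" for d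
 proof -
  have "d - p d \<in> D" using that pD by (rule subspace_diff[OF assms])
  from orth[OF this, of d] show ?thesis by (simp add: orthogonal_def)
 qed
 have n: "norm (x - p x) \<le> norm x" for x
 proof -
  have "orthogonal (x - p x) (p x)" using orth[OF pD] .
  then have "(norm ((x - p x) + p x))\<^sup>2 = (norm (x - p x))\<^sup>2 + (norm (p x))\<^sup>2"
   by (rule norm_add_Pythagorean)
  then have "(norm (x - p x))\<^sup>2 \<le> (norm x)\<^sup>2" by simp
  then show ?thesis by (rule power2_le_imp_le) simp
 qed
 show ?thesis
 proof (rule that[of "\<lambda>x. x - p x"])
  show "x - (x - p x) \<in> D" for x using pD[of x] by simp
  show "(x - p x) \<bullet> d = 0" if "d \<in> D" for x d
   using orth[OF that] by (simp add: orthogonal_def)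
 qed (fact lin z n)+
qed

context frame
begin

lemma linear_af: "T (af A u) = T (fst A) + (\<Sum>i<k. u i *\<^sub>R T (snd A i))" if "linear T"
 by (simp add: af_def linear_add[OF that] linear_sum[OF that] linear_scale[OF that])

lemma emb_in_span: "emb u \<in> span (e ` {..<k})"
 unfolding emb_def by (intro span_sum span_scale span_base) auto

lemma hor_of_span: "x \<in> span (e ` {..<k}) \<Longrightarrow> hor x = x"
proof -
 assume x: "x \<in> span (e ` {..<k})"
 have "ver x \<bullet> y = 0" if "y \<in> span (e ` {..<k})" for y
 proof -
  have "orthogonal (ver x) y"
   by (rule orthogonal_to_span[OF that]) (auto simp: orthogonal_def ver_inner)
  then show ?thesis by (simp add: orthogonal_def)
 qed
 moreover have "ver x \<in> span (e ` {..<k})"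
  unfolding ver_def hor_def using x emb_in_span by (rule span_diff)
 ultimately have "ver x \<bullet> ver x = 0" by blast
 then show ?thesis by (simp add: ver_def)
qed

lemma inj_e: "inj_on e {..<k}"
proof (rule inj_onI)
 fix i j assume "i \<in> {..<k}" "j \<in> {..<k}" "e i = e j"
 then show "i = j" using orth[of i j] orth[of i i] by (auto split: if_splits)
qed

lemma dim_V: "dim (span (e ` {..<k})) = k"
proof -
 have "independent (e ` {..<k})"
 proof (rule pairwise_orthogonal_independent)
  show "pairwise orthogonal (e ` {..<k})"
   using orth by (auto simp: pairwise_def orthogonal_def split: if_splits)
  show "0 \<notin> e ` {..<k}"
   using orth by fastforce
 qed
 then have "dim (e ` {..<k}) = card (e ` {..<k})" by (rule dim_eq_card_independent)
 then show ?thesis by (simp add: dim_span card_image[OF inj_e])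
qed

text \<open>If some vertical unit vector were nearly contained in the direction space of \<open>L\<close>, then the
 horizontal shadow of \<open>L\<close> would be nearly of dimension \<open>k - 1\<close>, contradicting \<open>spread\<close>.\<close>

lemma plane_vertical_bound:
 assumes D: "subspace D" "dim D = k" and T: "linear T" "\<And>x d. d \<in> D \<Longrightarrow> T x \<bullet> d = 0"
  "\<And>x. x - T x \<in> D" and L: "closed L" "L \<noteq> {}" "\<And>l l'. l \<in> L \<Longrightarrow> l' \<in> L \<Longrightarrow> l - l' \<in> D"
  and spread: "\<And>u. norm (emb u) = 1 \<Longrightarrow>
   \<exists>x x'. infdist x L \<le> \<sigma> \<and> infdist x' L \<le> \<sigma> \<and> norm (x - x') \<le> d \<and> h \<le> emb u \<bullet> (x - x')"
  and h: "2 * \<sigma> + 2 * c * (d + 2 * \<sigma>) < h" and c: "0 < c" "c \<le> 1 / 2"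
  and n: "\<And>i. i < k \<Longrightarrow> n \<bullet> e i = 0" "norm n = 1"
 shows "c \<le> norm (T n)"
proof (rule ccontr)
 assume "\<not> ?thesis"
 then have Tn: "norm (T n) < c" by simp
 define u where "u = n - T n"
 have uD: "u \<in> D" using T(3) by (simp add: u_def)
 have "norm n \<le> norm u + norm (T n)" unfolding u_def by (metis add.commute norm_triangle_sub)
 then have nu: "1 / 2 \<le> norm u" using Tn c n by simp
 define D' where "D' = {y \<in> D. \<forall>x\<in>span {u}. orthogonal x y}"
 have "dim D' + dim (span {u}) = dim D"
  unfolding D'_def using uD D(1) by (intro dim_subspace_orthogonal_to_vectors) (auto simp: span_minimal)
 moreover have "dim (span {u}) = 1"
  using nu by (subst dim_span, subst dim_eq_card_independent) auto
 ultimately have dD': "dim D' = k - 1" "dim D' < k" using D k_pos by auto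
 have "dim (hor ` D') \<le> dim D'" by (rule dim_image_le[OF linear_hor])
 then have "dim (span (hor ` D')) < dim (span (e ` {..<k}))"
  unfolding dim_V using dD' by (simp add: dim_span)
 moreover have "span (hor ` D') \<subseteq> span (e ` {..<k})"
  by (rule span_minimal) (auto simp: hor_def emb_in_span)
 ultimately have "span (hor ` D') \<subset> span (e ` {..<k})" by (auto simp del: dim_span)
 \<comment> \<open>The shadow of \<open>D'\<close> has dimension below \<open>k\<close>, so a
   horizontal direction orthogonal to it exists. Along it \<open>D\<close> moves only through
   \<open>u\<close>, which is almost vertical, while \<open>spread\<close> provides two points near
   \<open>L\<close> that are far apart in this direction.\<close>
 then obtain w0 where w0: "w0 \<noteq> 0" "w0 \<in> span (e ` {..<k})" "\<And>y. y \<in> span (hor ` D') \<Longrightarrow> orthogonal w0 y"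
  using orthogonal_to_subspace_exists_gen by blast
 define w where "w = (1 / norm w0) *\<^sub>R w0"
 have w: "norm w = 1" "w \<in> span (e ` {..<k})" "\<And>y. y \<in> D' \<Longrightarrow> w \<bullet> hor y = 0"
  using w0 by (auto simp: w_def span_scale orthogonal_def span_base)
 have wemb: "emb (co w) = w" using hor_of_span[OF w(2)] by (simp add: hor_def)
 obtain x x' where x: "infdist x L \<le> \<sigma>" "infdist x' L \<le> \<sigma>" "norm (x - x') \<le> d" "h \<le> w \<bullet> (x - x')"
  using spread[of "co w"] w(1) by (auto simp: wemb)
 obtain l where l: "l \<in> L" "infdist x L = dist x l" using infdist_attains_inf[OF L(1,2)] by metis
 obtain l' where l': "l' \<in> L" "infdist x' L = dist x' l'" using infdist_attains_inf[OF L(1,2)] by metis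
 have lD: "l - l' \<in> D" using L(3) l l' by blast
 define a where "a = ((l - l') \<bullet> u) / (u \<bullet> u)"
 define y where "y = (l - l') - a *\<^sub>R u"
 have uu: "u \<bullet> u \<noteq> 0" using nu by auto
 have yD: "y \<in> D'"
 proof -
  have "y \<in> D" unfolding y_def by (rule subspace_diff[OF D(1) lD subspace_scale[OF D(1) uD]])
  moreover have "y \<bullet> u = 0" using uu by (simp add: y_def a_def inner_diff_left)
  moreover have "orthogonal x y" if "x \<in> span {u}" "y \<bullet> u = 0" for x
   using that by (auto simp: span_singleton orthogonal_def inner_commute)
  ultimately show ?thesis by (simp add: D'_def)
 qed
 have wy: "w \<bullet> y = 0"
 proof -
  have "w \<bullet> y = w \<bullet> hor y + w \<bullet> ver y" by (simp add: hor_ver flip: inner_add_right)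
  also have "w \<bullet> ver y = 0" using ver_emb_orth[of y "co w"] by (simp add: wemb inner_commute)
  finally show ?thesis using w(3)[OF yD] by simp
 qed
 have wn: "w \<bullet> n = 0"
  using inner_emb_zero[of n "co w"] n(1) by (simp add: wemb inner_commute)
 have wu: "\<bar>w \<bullet> u\<bar> \<le> c"
 proof -
  have "\<bar>w \<bullet> u\<bar> = \<bar>w \<bullet> T n\<bar>" by (simp add: u_def inner_diff_right wn)
  also have "\<dots> \<le> norm w * norm (T n)" by (rule Cauchy_Schwarz_ineq2)
  finally show ?thesis using Tn w(1) by simp
 qed
 have al: "\<bar>a\<bar> \<le> 2 * norm (l - l')"
 proof -
  have "\<bar>a\<bar> = \<bar>(l - l') \<bullet> u\<bar> / (norm u)\<^sup>2" by (simp add: a_def power2_norm_eq_inner)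
  also have "\<dots> \<le> norm (l - l') * norm u / (norm u)\<^sup>2"
   by (intro divide_right_mono Cauchy_Schwarz_ineq2) simp
  also have "\<dots> = norm (l - l') / norm u" using uu by (simp add: power2_eq_square)
  also have "\<dots> \<le> norm (l - l') / (1 / 2)" using nu by (intro divide_left_mono) auto
  finally show ?thesis by simp
 qed
 have nll: "norm (l - l') \<le> d + 2 * \<sigma>"
 proof -
  have "l - l' = (x - x') - (x - l) - (l' - x')" by simp
  then have "norm (l - l') \<le> norm (x - x') + norm (x - l) + norm (l' - x')"
   using norm_diff_diff_le by metis
  then show ?thesis using x l l' by (simp add: dist_norm norm_minus_commute)
 qed
 have "l - l' = a *\<^sub>R u + y" by (simp add: y_def)
 then have "w \<bullet> (l - l') = a * (w \<bullet> u)" by (simp add: inner_add_right wy)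
 also have "\<dots> \<le> \<bar>a\<bar> * \<bar>w \<bullet> u\<bar>" by (metis abs_ge_self abs_mult)
 also have "\<dots> \<le> (2 * (d + 2 * \<sigma>)) * c"
  using al nll wu by (intro mult_mono) (auto intro: order_trans)
 finally have 1: "w \<bullet> (l - l') \<le> 2 * c * (d + 2 * \<sigma>)" by (simp add: mult_ac)
 have 2: "w \<bullet> (x - l) \<le> \<sigma>" "w \<bullet> (l' - x') \<le> \<sigma>"
  using norm_cauchy_schwarz[of w "x - l"] norm_cauchy_schwarz[of w "l' - x'"] x l l' w(1)
  by (auto simp: dist_norm norm_minus_commute)
 have "w \<bullet> (x - x') = w \<bullet> (l - l') + w \<bullet> (x - l) + w \<bullet> (l' - x')"
  by (simp add: inner_diff_right)
 then show False using 1 2 x(4) h by linarith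
qed

text \<open>\<open>T\<close> is the projection along the directions of \<open>L\<close>. By
  \<open>plane_vertical_bound\<close> it is injective on the vertical space \<open>VP\<close>, which
  has the same dimension as the complement \<open>DP\<close> of \<open>D\<close>, hence maps it onto
  \<open>DP\<close>. So a vertical affine map can be solved for with
  \<open>T (res A x) = T (x - q)\<close>, whose norm is at most the distance to
  \<open>L\<close>.\<close>

lemma plane_is_graph:
 assumes L: "affine L" "aff_dim L = int k"
  and spread: "\<And>u. norm (emb u) = 1 \<Longrightarrow>
   \<exists>x x'. infdist x L \<le> \<sigma> \<and> infdist x' L \<le> \<sigma> \<and> norm (x - x') \<le> d \<and> h \<le> emb u \<bullet> (x - x')"
  and h: "2 * \<sigma> + 2 * c * (d + 2 * \<sigma>) < h" and c: "0 < c" "c \<le> 1 / 2"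
 shows "\<exists>A. \<forall>x. c * norm (res A x) \<le> infdist x L"
proof -
 have Lne: "L \<noteq> {}" using L(2) by auto
 then obtain q where q: "q \<in> L" by blast
 define D where "D = (\<lambda>x. x - q) ` L"
 have D: "subspace D" unfolding D_def using L(1) q by (rule affine_diffs_subspace_subtract)
 have dD: "dim D = k"
  using aff_dim_eq_dim_subtract[of q L] L q by (simp add: D_def hull_inc)
 have LD: "l - l' \<in> D" if "l \<in> L" "l' \<in> L" for l l'
 proof -
  have "l - q \<in> D" "l' - q \<in> D" using that by (auto simp: D_def)
  from subspace_diff[OF D this] show ?thesis by simp
 qed
 obtain T where T: "linear T" "\<And>d. d \<in> D \<Longrightarrow> T d = 0" "\<And>x d. d \<in> D \<Longrightarrow> T x \<bullet> d = 0"
  "\<And>x. x - T x \<in> D" "\<And>x. norm (T x) \<le> norm x"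
  using subspace_projection[OF D] by metis
 define VP where "VP = {y. \<forall>x\<in>span (e ` {..<k}). orthogonal x y}"
 have VPi: "n \<in> VP \<longleftrightarrow> (\<forall>i<k. n \<bullet> e i = 0)" for n
 proof
  assume "n \<in> VP"
  then show "\<forall>i<k. n \<bullet> e i = 0"
   by (auto simp: VP_def orthogonal_def inner_commute span_base)
 next
  assume *: "\<forall>i<k. n \<bullet> e i = 0"
  have "orthogonal n x" if "x \<in> span (e ` {..<k})" for x
   by (rule orthogonal_to_span[OF that]) (use * in \<open>auto simp: orthogonal_def\<close>)
  then show "n \<in> VP" by (auto simp: VP_def orthogonal_commute)
 qed
 have lower: "c * norm n \<le> norm (T n)" if "n \<in> VP" for n
 proof (cases "n = 0")
  case False
  define n' where "n' = (1 / norm n) *\<^sub>R n"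
  have "c \<le> norm (T n')"
  proof (rule plane_vertical_bound[OF D dD T(1,3,4) affine_closed[OF L(1)] Lne LD spread h c])
   show "\<And>i. i < k \<Longrightarrow> n' \<bullet> e i = 0" using that by (simp add: n'_def VPi)
   show "norm n' = 1" using False by (simp add: n'_def)
  qed
  then show ?thesis using False by (simp add: n'_def linear_scale[OF T(1)] field_simps)
 qed simp
 have sVP: "subspace VP" unfolding VP_def by (rule subspace_orthogonal_to_vectors)
 define DP where "DP = {y. \<forall>x\<in>D. orthogonal x y}"
 have sDP: "subspace DP" unfolding DP_def by (rule subspace_orthogonal_to_vectors)
 have "dim VP + dim (span (e ` {..<k})) = dim (UNIV :: 'a set)"
  using dim_subspace_orthogonal_to_vectors[of "span (e ` {..<k})" UNIV] by (simp add: VP_def)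
 moreover have "dim DP + dim D = dim (UNIV :: 'a set)"
  using dim_subspace_orthogonal_to_vectors[of D UNIV] D by (simp add: DP_def)
 ultimately have dims: "dim VP = dim DP" by (simp only: dim_V dD)
 have inj: "inj_on T (span VP)"
 proof (rule inj_onI)
  fix x y assume "x \<in> span VP" "y \<in> span VP" "T x = T y"
  then have "x - y \<in> VP" "T (x - y) = 0"
   using sVP by (auto simp: span_eq_iff[THEN iffD2, OF sVP] subspace_diff linear_diff[OF T(1)])
  then show "x = y" using lower[of "x - y"] c by (auto simp: mult_le_0_iff)
 qed
 have "T ` VP = DP"
 proof (rule subspace_dim_equal)
  show "subspace (T ` VP)" using T(1) sVP by (rule linear_subspace_image)
  show "T ` VP \<subseteq> DP" using T(3) by (auto simp: DP_def orthogonal_def inner_commute)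
  have "dim (T ` VP) = dim VP" using T(1) inj by (rule dim_image_eq)
  then show "dim DP \<le> dim (T ` VP)" using dims by simp
 qed (rule sDP)
 moreover have "T x \<in> DP" for x using T(3) by (auto simp: DP_def orthogonal_def inner_commute)
 ultimately have surj: "\<exists>n\<in>VP. T n = T x" for x by (metis imageE)
 \<comment> \<open>The map sought satisfies \<open>T (af A u) = T (q - emb u)\<close>; this fixes
   the images of its constant term and of its slopes.\<close>
 obtain a where a: "a \<in> VP" "T a = T q" using surj by blast
 have "\<exists>b\<in>VP. T b = T (- e i)" for i using surj by blast
 then obtain b where b: "\<And>i. b i \<in> VP" "\<And>i. T (b i) = T (- e i)" by metis
 have "c * norm (res (a, b) x) \<le> infdist x L" for x
 proof -
  have "af (a, b) (co x) \<in> VP"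
   unfolding af_def using a b sVP by (auto intro!: subspace_add subspace_sum subspace_scale)
  moreover have "ver x \<in> VP" by (simp add: VPi ver_inner)
  ultimately have "res (a, b) x \<in> VP" unfolding res_def using sVP by (intro subspace_diff)
  then have "c * norm (res (a, b) x) \<le> norm (T (res (a, b) x))" by (rule lower)
  also have "T (res (a, b) x) = T (x - q)"
  proof -
   have "T (hor x) = (\<Sum>i<k. co x i *\<^sub>R T (e i))"
    by (simp add: hor_def emb_def linear_sum[OF T(1)] linear_scale[OF T(1)])
   moreover have "T (af (a, b) (co x)) = T q - (\<Sum>i<k. co x i *\<^sub>R T (e i))"
    by (simp add: linear_af[OF T(1)] a b linear_neg[OF T(1)] sum_negf)
   ultimately show ?thesis
    by (simp add: res_def ver_def linear_diff[OF T(1)])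
  qed
  also have "norm (T (x - q)) \<le> infdist x L"
  proof -
   have "norm (T (x - q)) \<le> dist x l" if l: "l \<in> L" for l
   proof -
    have "T (x - q) = T ((x - l) + (l - q))" by simp
    also have "\<dots> = T (x - l) + T (l - q)" by (rule linear_add[OF T(1)])
    also have "T (l - q) = 0" using T(2)[OF LD[OF l q]] .
    finally show ?thesis using T(5)[of "x - l"] by (simp add: dist_norm)
   qed
   then show ?thesis
    unfolding infdist_def using Lne by (auto intro!: cINF_greatest)
  qed
  finally show ?thesis .
 qed
 then show ?thesis by blast
qed

end

section \<open>Measurability of cells, and the flatness of a measure\<close>

context frame
begin

lemma countable_Z: "countable Z"
proof -
 have "Z \<subseteq> (\<Union>n::nat. {z \<in> Z. \<forall>i<k. z i \<in> {- int n..int n}})"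
 proof
  fix z assume z: "z \<in> Z"
  define n where "n = nat (\<Sum>i<k. \<bar>z i\<bar>)"
  have "z i \<in> {- int n..int n}" if i: "i < k" for i
  proof -
   have "\<bar>z i\<bar> \<le> (\<Sum>i<k. \<bar>z i\<bar>)" using i by (intro member_le_sum) auto
   then show ?thesis by (simp add: n_def abs_le_iff sum_nonneg)
  qed
  then show "z \<in> (\<Union>n::nat. {z \<in> Z. \<forall>i<k. z i \<in> {- int n..int n}})" using z by auto
 qed
 moreover have "countable (\<Union>n::nat. {z \<in> Z. \<forall>i<k. z i \<in> {- int n..int n}})"
  by (intro countable_UN countableI_type countable_finite card_Z_Pi(1)[of "\<lambda>_. {- int _..int _}"]) (rule finite_atLeastAtMost_int)
 ultimately show ?thesis by (rule countable_subset)
qed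

lemma sets_idx1: "{x. idx j (co x) = z} \<in> sets borel"
proof -
 have "{x. idx j (co x) = z} = {x. z \<in> Z \<and> (\<forall>i\<in>{..<k}. real_of_int (z i) / 2 ^ j \<le> co x i \<and> co x i < (real_of_int (z i) + 1) / 2 ^ j)}"
  by (simp add: idx_eq_iff Ball_def)
 also have "\<dots> = {x \<in> space borel. z \<in> Z \<and> (\<forall>i\<in>{..<k}. real_of_int (z i) / 2 ^ j \<le> co x i \<and> co x i < (real_of_int (z i) + 1) / 2 ^ j)}"
  by simp
 also have "\<dots> \<in> sets borel" by measurable
 finally show ?thesis .
qed

lemma sets_idx:
 assumes "\<And>z. {x. P z x} \<in> sets borel"
 shows "{x. P (idx j (co x)) x} \<in> sets borel"
proof -
 have "{x. P (idx j (co x)) x} = (\<Union>z\<in>Z. {x. idx j (co x) = z} \<inter> {x. P z x})"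
  by auto
 also have "\<dots> \<in> sets borel"
  using countable_Z assms sets_idx1 by (intro sets.countable_UN' sets.Int) auto
 finally show ?thesis .
qed

end

context fmeas
begin

text \<open>The mean flatness without its mass threshold. The threshold is accounted for by the mass
  condition inside \<open>carleson\<close>.\<close>

definition fl :: "'a \<Rightarrow> real \<Rightarrow> ennreal" where
 "fl y s = (INF L\<in>{L. affine L \<and> aff_dim L = int k}.
   ennreal (1 / s ^ (k + 2)) * (sqdist M y s L))"

text \<open>In units of the cell side, a radius for which a ball about any retained point of a cell
  contains the retained mass of all adjacent cells; \<open>WW_dist\<close> needs
  \<open>3 * k + 2\<close>.\<close>

definition KK :: real where "KK = 4 * real k + 4"

text \<open>With \<open>c0 * KK = 1 / 16\<close> the hypothesis \<open>h\<close> of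
  \<open>plane_is_graph\<close> holds for points within diameter \<open>2 * KK\<close> and spread
  \<open>1 / 2\<close>, in units of the cell side.\<close>

definition c0 :: real where "c0 = 1 / (16 * KK)"

text \<open>Converts flatness at a radius up to \<open>2 * KK\<close> cell sides into a bound for
  squared residuals at the cell scale: the power rescales the radius, and \<open>1 / c0\<close>
  turns distance from the plane into the residual of the graph.\<close>

definition CG :: real where "CG = (2 * KK) ^ (k + 2) / c0\<^sup>2"

text \<open>A quarter of the relative volume of a subcell. A deficit \<open>\<kappa>\<close> of the
  cell and an excess \<open>\<kappa>\<close> of the other subcells then still leave each subcell
  half of its volume, see \<open>dense_sub\<close>.\<close>

definition \<kappa> :: real where "\<kappa> = 1 / (4 * 2 ^ (qd * k))"

text \<open>The flatness integral, discretised: only cells of one level that are disjoint compete for mass.\<close>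

definition carleson :: "real \<Rightarrow> bool" where
 "carleson \<delta> \<longleftrightarrow> (\<forall>(F :: (nat \<times> zv) set) X c lev. finite F \<longrightarrow>
   (\<forall>q\<in>F. X q \<in> sets borel \<and> 0 \<le> c q \<and> 1 \<le> lev q \<and>
    (\<forall>y\<in>X q. (1 / 2 ^ lev q) ^ k / 2 \<le> measure M (ball y (KK / 2 ^ lev q)) \<and>
      (\<forall>s. KK / 2 ^ lev q \<le> s \<longrightarrow> s < 2 * KK / 2 ^ lev q \<longrightarrow> ennreal (c q) \<le> fl y s))) \<longrightarrow>
   (\<forall>q\<in>F. \<forall>q'\<in>F. q \<noteq> q' \<longrightarrow> lev q \<noteq> lev q' \<or> X q \<inter> X q' = {}) \<longrightarrow>
   (\<Sum>q\<in>F. c q * measure M (X q)) \<le> \<delta>)"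

end

subsection \<open>The stopping-time construction\<close>

locale key = fmeas e k M
 for e :: "nat \<Rightarrow> 'a::euclidean_space" and k and M :: "'a measure" +
 fixes R \<tau> \<delta> \<iota> \<rho> \<theta> \<alpha> \<phi> :: real
 assumes U: "\<And>y r. 0 < r \<Longrightarrow> measure M (ball y r) \<le> unit_ball_vol (real k) * r ^ k"
  and supp: "emeasure M {x. R \<le> norm (hor x)} = 0"
  and vertical: "(\<integral>\<^sup>+x. ennreal ((norm (ver x))\<^sup>2) \<partial>M) \<le> ennreal \<tau>"
  and car: "carleson \<delta>"
  and pos: "1 \<le> R" "0 \<le> \<tau>" "0 \<le> \<delta>" "0 < \<iota>" "0 < \<rho>" "\<rho> \<le> 1 / 4" "0 < \<theta>" "\<theta> \<le> 1 / 2" "0 < \<alpha>" "0 < \<phi>"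
  and tau_phi: "\<tau> \<le> \<phi>"
  and Lam: "((1 + 2 * \<alpha>) * (1 + real k * \<theta> + 2 ^ (qd + 2) * \<rho> / \<alpha>)) ^ k \<le> 1 + \<kappa>"
  and phi: "CS * sqrt (2 * \<phi>) \<le> 1 / 2"
begin

definition \<Lambda> :: real where "\<Lambda> = ((1 + 2 * \<alpha>) * (1 + real k * \<theta> + 2 ^ (qd + 2) * \<rho> / \<alpha>)) ^ k"

definition X' :: "'a set \<Rightarrow> nat \<Rightarrow> zv \<Rightarrow> 'a set" where
 "X' G j z = {x \<in> G. idx (Suc j) (co x) = z}"

text \<open>A fit is demanded over the whole block of adjacent cells, so that the fits of two
  neighbours are tested on common mass and can be compared.\<close>

definition W' :: "'a set \<Rightarrow> nat \<Rightarrow> zv \<Rightarrow> 'a set" where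
 "W' G j z = {x \<in> G. adj (idx (Suc j) (co x)) z}"

definition cost :: "'a set \<Rightarrow> nat \<Rightarrow> zv \<Rightarrow> ennreal" where
 "cost G j z = (INF y\<in>X' G j z. INF s\<in>{KK / 2 ^ Suc j..<2 * KK / 2 ^ Suc j}. fl y s)"

text \<open>The strict slack turns the infimum in \<open>cost\<close> into an actual point, radius
  and plane even when \<open>cost\<close> vanishes; its factor \<open>1 / 2 ^ Suc j\<close> keeps
  the total over all levels bounded.\<close>

definition bbv :: "'a set \<Rightarrow> nat \<Rightarrow> zv \<Rightarrow> real" where
 "bbv G j z = CG * (2 * enn2real (cost G j z) + \<iota> / 2 ^ Suc j)"

definition fitA :: "'a set \<Rightarrow> nat \<Rightarrow> zv \<Rightarrow> 'a \<times> (nat \<Rightarrow> 'a) \<Rightarrow> bool" where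
 "fitA G j z A \<longleftrightarrow>
   resint A (W' G j z) \<le> ennreal (bbv G j z * (1 / 2 ^ Suc j) ^ (k + 2))"

definition goodA :: "'a set \<Rightarrow> nat \<Rightarrow> zv \<Rightarrow> 'a \<times> (nat \<Rightarrow> 'a) \<Rightarrow> bool" where
 "goodA G j z A \<longleftrightarrow> fitA G j z A \<and> (\<forall>i<k. norm (snd A i) \<le> \<theta>)"

text \<open>All neighbours of the parent must be active, because the interpolated lattice function
  near the cell, including the lattice points entering its second differences, depends on their
  fits.\<close>

definition consid' :: "zv set \<Rightarrow> zv \<Rightarrow> bool" where
 "consid' Ac z \<longleftrightarrow> z \<in> Z \<and> (\<forall>w\<in>Z. adj w (half z) \<longrightarrow> w \<in> Ac)"

definition dense' :: "'a set \<Rightarrow> nat \<Rightarrow> zv \<Rightarrow> bool" where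
 "dense' G j z \<longleftrightarrow> (1 - \<kappa>) * (1 / 2 ^ Suc j) ^ k \<le> measure M (X' G j z)"

definition act' :: "zv set \<Rightarrow> 'a set \<Rightarrow> nat \<Rightarrow> zv set" where
 "act' Ac G j = {z. consid' Ac z \<and> dense' G j z \<and> bbv G j z \<le> \<phi> \<and> (\<exists>A. goodA G j z A)}"

definition af' :: "'a set \<Rightarrow> nat \<Rightarrow> zv \<Rightarrow> 'a \<times> (nat \<Rightarrow> 'a)" where
 "af' G j z = (SOME A. goodA G j z A)"

definition gd' :: "zv set \<Rightarrow> 'a set \<Rightarrow> nat \<Rightarrow> 'a set" where
 "gd' Ac G j = {x \<in> G. idx (Suc j) (co x) \<in> act' Ac G j \<and>
   norm (res (af' G j (idx (Suc j) (co x))) x) \<le> \<rho> / 2 ^ Suc j}"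

text \<open>The first component consists of the cells still active at level \<open>j\<close>, the second of the points that
stayed within \<open>\<rho> / 2 ^ i\<close> of the fit of their cell at each level \<open>i \<le> j\<close>.\<close>

primrec st :: "nat \<Rightarrow> zv set \<times> 'a set" where
 "st 0 = (Z, {x. norm (ver x) \<le> \<rho>})"
| "st (Suc j) = (act' (fst (st j)) (snd (st j)) j, gd' (fst (st j)) (snd (st j)) j)"

definition Act :: "nat \<Rightarrow> zv set" where "Act j = fst (st j)"
definition Gd :: "nat \<Rightarrow> 'a set" where "Gd j = snd (st j)"

definition XX :: "nat \<Rightarrow> zv \<Rightarrow> 'a set" where "XX j = X' (Gd j) j"
definition WW :: "nat \<Rightarrow> zv \<Rightarrow> 'a set" where "WW j = W' (Gd j) j"

text \<open>Level \<open>0\<close> passes no tests: every cell is active with the zero map as its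
  fit, and \<open>\<tau>\<close> plays the part of its flatness. Tests made at stage
  \<open>i\<close> concern cells of level \<open>Suc i\<close>.\<close>

definition bb :: "nat \<Rightarrow> zv \<Rightarrow> real" where
 "bb j z = (case j of 0 \<Rightarrow> \<tau> | Suc i \<Rightarrow> bbv (Gd i) i z)"

definition Af :: "nat \<Rightarrow> zv \<Rightarrow> 'a \<times> (nat \<Rightarrow> 'a)" where
 "Af j z = (case j of 0 \<Rightarrow> (0, \<lambda>_. 0) | Suc i \<Rightarrow> af' (Gd i) i z)"

definition consid :: "nat \<Rightarrow> zv \<Rightarrow> bool" where "consid j = consid' (Act j)"
definition dense :: "nat \<Rightarrow> zv \<Rightarrow> bool" where "dense j = dense' (Gd j) j"

lemma Act_0: "Act 0 = Z" by (simp add: Act_def)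
lemma Gd_0: "Gd 0 = {x. norm (ver x) \<le> \<rho>}" by (simp add: Gd_def)

lemma Act_Suc: "z \<in> Act (Suc j) \<longleftrightarrow> consid j z \<and> dense j z \<and> bb (Suc j) z \<le> \<phi> \<and> (\<exists>A. goodA (Gd j) j z A)"
 by (simp add: Act_def Gd_def consid_def dense_def bb_def act'_def)

lemma Gd_Suc: "x \<in> Gd (Suc j) \<longleftrightarrow> x \<in> Gd j \<and> idx (Suc j) (co x) \<in> Act (Suc j) \<and>
   norm (res (Af (Suc j) (idx (Suc j) (co x))) x) \<le> \<rho> / 2 ^ Suc j"
 by (simp add: Gd_def Act_def Af_def gd'_def)

lemma XX_iff: "x \<in> XX j z \<longleftrightarrow> x \<in> Gd j \<and> idx (Suc j) (co x) = z"
 by (simp add: XX_def X'_def)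

lemma WW_iff: "x \<in> WW j z \<longleftrightarrow> x \<in> Gd j \<and> adj (idx (Suc j) (co x)) z"
 by (simp add: WW_def W'_def)

lemma res_0: "res (Af 0 z) x = ver x"
 by (simp add: Af_def res_def af_def)

lemma Gd_res:
 assumes "x \<in> Gd j"
 shows "idx j (co x) \<in> Act j \<and> norm (res (Af j (idx j (co x))) x) \<le> \<rho> / 2 ^ j"
proof (cases j)
 case 0
 then show ?thesis using assms res_0[of "idx j (co x)" x] by (simp add: Act_0 Gd_0)
qed (use assms in \<open>simp add: Gd_Suc\<close>)

lemma Gd_mono: "i \<le> j \<Longrightarrow> Gd j \<subseteq> Gd i"
 by (induction j rule: dec_induct) (auto simp: Gd_Suc)

lemma Act_Z: "z \<in> Act j \<Longrightarrow> z \<in> Z"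
 by (cases j) (auto simp: Act_0 Act_Suc consid_def consid'_def)

lemma Act_half: "z \<in> Act (Suc j) \<Longrightarrow> w \<in> Z \<Longrightarrow> adj w (half z) \<Longrightarrow> w \<in> Act j"
 by (auto simp: Act_Suc consid_def consid'_def)

lemma Act_half_self: "z \<in> Act (Suc j) \<Longrightarrow> half z \<in> Act j"
 by (rule Act_half[OF _ half_Z[OF Act_Z]]) auto

lemma good_Af: "z \<in> Act (Suc j) \<Longrightarrow> goodA (Gd j) j z (Af (Suc j) z)"
 unfolding Act_Suc Af_def nat.case af'_def by (auto intro: someI_ex)

lemma slope:
 assumes "z \<in> Act j" "i < k"
 shows "norm (snd (Af j z) i) \<le> \<theta>"
proof (cases j)
 case 0
 then show ?thesis using pos by (simp add: Af_def)
next
 case (Suc n)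
 then show ?thesis using assms good_Af[of z n] by (simp add: goodA_def)
qed

lemma fit:
 assumes "z \<in> Act j" "\<And>i. j = Suc i \<Longrightarrow> Y \<subseteq> WW i z"
 shows "resint (Af j z) Y \<le> ennreal (bb j z * (1 / 2 ^ j) ^ (k + 2))"
proof (cases j)
 case 0
 have "resint (Af j z) Y \<le> (\<integral>\<^sup>+x. ennreal ((norm (ver x))\<^sup>2) \<partial>M)"
  using 0 by (intro nn_integral_mono) (auto simp: indicator_def res_0)
 then show ?thesis using vertical 0 by (simp add: bb_def)
next
 case (Suc i)
 have "resint (Af j z) Y \<le> resint (Af j z) (WW i z)"
  using assms(2)[OF Suc] by (intro nn_integral_mono) (auto simp: indicator_def)
 also have "\<dots> \<le> ennreal (bb j z * (1 / 2 ^ j) ^ (k + 2))"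
  using good_Af[of z i] assms(1) Suc by (simp add: goodA_def fitA_def WW_def bb_def)
 finally show ?thesis .
qed

lemma Gd_sets [measurable]: "Gd j \<in> sets borel"
proof (induction j)
 case 0
 then show ?case by (simp add: Gd_0)
next
 case (Suc j)
 have "Gd (Suc j) = Gd j \<inter> {x. idx (Suc j) (co x) \<in> Act (Suc j) \<and>
   norm (res (Af (Suc j) (idx (Suc j) (co x))) x) \<le> \<rho> / 2 ^ Suc j}"
  by (auto simp: Gd_Suc)
 also have "\<dots> \<in> sets borel"
  by (intro sets.Int Suc.IH sets_idx[where P="\<lambda>z x. z \<in> Act (Suc j) \<and> norm (res (Af (Suc j) z) x) \<le> \<rho> / 2 ^ Suc j"]) simp
 finally show ?case .
qed

lemma XX_sets [measurable]: "XX j z \<in> sets borel"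
proof -
 have "XX j z = Gd j \<inter> {x. idx (Suc j) (co x) = z}" by (auto simp: XX_iff)
 then show ?thesis using sets_idx1[of "Suc j" z] by auto
qed

lemma WW_sets [measurable]: "WW j z \<in> sets borel"
proof -
 have "WW j z = Gd j \<inter> {x. adj (idx (Suc j) (co x)) z}" by (auto simp: WW_iff)
 then show ?thesis using sets_idx[of "\<lambda>w x. adj w z" "Suc j"] by auto
qed

lemma Gd_idx_sets [measurable]: "{x \<in> Gd j. idx i (co x) = z} \<in> sets borel"
proof -
 have "{x \<in> Gd j. idx i (co x) = z} = Gd j \<inter> {x. idx i (co x) = z}" by auto
 then show ?thesis using sets_idx1[of i z] by auto
qed

lemma kappa: "0 < \<kappa>" "\<kappa> \<le> 1 / 4" "4 * \<kappa> * 2 ^ (qd * k) = 1"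
proof -
 have "(1::real) \<le> 2 ^ (qd * k)" by simp
 then show "0 < \<kappa>" "\<kappa> \<le> 1 / 4" "4 * \<kappa> * 2 ^ (qd * k) = 1" by (simp_all add: \<kappa>_def field_simps)
qed

lemma Lam_bounds: "1 \<le> \<Lambda>" "\<Lambda> \<le> 1 + \<kappa>"
proof -
 have "1 * 1 \<le> (1 + 2 * \<alpha>) * (1 + real k * \<theta> + 2 ^ (qd + 2) * \<rho> / \<alpha>)"
  using pos by (intro mult_mono) auto
 then show "1 \<le> \<Lambda>" unfolding \<Lambda>_def by (intro one_le_power) simp
 show "\<Lambda> \<le> 1 + \<kappa>" using Lam by (simp add: \<Lambda>_def)
qed

text \<open>Here \<open>c\<close> is a density bound valid at the single radius that is used; it is \<open>1\<close> except at
 the bottom scale.\<close>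

lemma cell_mass_le:
 assumes m: "m \<le> Suc qd" and c: "0 \<le> c"
  and Uc: "\<And>y r. 0 < r \<Longrightarrow> r \<le> 2 * \<Lambda> * (1 / 2 ^ (j + m)) * (1 + \<alpha>) \<Longrightarrow> measure M (ball y r) \<le> c * \<omega> * r ^ k"
 shows "measure M {x \<in> Gd j. idx (j + m) (co x) = z} \<le> c * \<Lambda> * (1 / 2 ^ (j + m)) ^ k"
proof (cases "{x \<in> Gd j. idx (j + m) (co x) = z} = {}")
 case True
 then have "measure M {x \<in> Gd j. idx (j + m) (co x) = z} = 0" by (simp only: measure_empty)
 also have "0 \<le> c * \<Lambda> * (1 / 2 ^ (j + m)) ^ k" using c Lam_bounds by simp
 finally show ?thesis .
next
 case False
 let ?X = "{x \<in> Gd j. idx (j + m) (co x) = z}"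
 define w where "w = (\<lambda>i. if i < k then z i div 2 ^ m else 0)"
 have w: "idx j (co x) = w" if "x \<in> ?X" for x
 proof (rule Z_ext[OF idx_Z])
  show "w \<in> Z" by (simp add: w_def Z_def)
  show "idx j (co x) i = w i" if "i < k" for i
   using idx_div[OF that, of j m "co x"] that \<open>x \<in> ?X\<close> by (simp add: w_def)
 qed
 have wA: "w \<in> Act j" using False w Gd_res by force
 define t where "t = (1::real) / 2 ^ (j + m)"
 define r where "r = \<alpha> * t"
 define B where "B = 1 + real k * \<theta> + 2 ^ (qd + 2) * \<rho> / \<alpha>"
 define r' where "r' = B * r"
 have t: "0 < t" by (simp add: t_def)
 have r: "0 < r" using pos t by (simp add: r_def)
 have B1: "1 \<le> B" using pos by (simp add: B_def)
 \<comment> \<open>Points of \<open>Gd j\<close> are only known to be within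
   \<open>\<rho> / 2 ^ j\<close> of the fit, while the cell counted is up to \<open>Suc qd\<close>
   generations finer. This conversion is the origin of the power of two in \<open>Lam\<close>, with
   one further factor 2 for strictness.\<close>
 have jm: "1 / 2 ^ j \<le> 2 ^ Suc qd * t"
 proof -
  have "(2::real) ^ m \<le> 2 ^ Suc qd" using m by (intro power_increasing) auto
  then show ?thesis by (simp add: t_def power_add field_simps)
 qed
 have BL: "(1 + 2 * \<alpha>) * B \<le> \<Lambda>"
 proof -
  have "1 * 1 \<le> (1 + 2 * \<alpha>) * B" using pos B1 by (intro mult_mono) auto
  then have "((1 + 2 * \<alpha>) * B) ^ 1 \<le> ((1 + 2 * \<alpha>) * B) ^ k" using k_pos by (intro power_increasing) auto
  then show ?thesis by (simp add: \<Lambda>_def B_def)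
 qed
 have "measure M ?X * r ^ k \<le> c * (1 / 2 ^ (j + m) + 2 * r) ^ k * r' ^ k"
 proof (rule measure_slab_le[where A="Af j w" and \<theta>=\<theta> and z=z])
  show "?X \<in> sets borel" by measurable
  show "idx (j + m) (co x) = z" if "x \<in> ?X" for x using that by simp
  show "norm (res (Af j w) x) \<le> \<rho> / 2 ^ j" if "x \<in> ?X" for x
   using Gd_res[of x j] w[OF that] that by simp
  show "norm (snd (Af j w) i) \<le> \<theta>" if "i < k" for i using slope[OF wA that] .
  show "(1 + real k * \<theta>) * r + \<rho> / 2 ^ j < r'"
  proof -
   have "\<rho> * (1 / 2 ^ j) \<le> \<rho> * (2 ^ Suc qd * t)" by (rule mult_left_mono[OF jm]) (use pos in simp)
   then have "\<rho> / 2 ^ j \<le> \<rho> * (2 ^ Suc qd * t)" by (simp only: times_divide_eq_right mult_1_right)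
   also have "\<dots> < \<rho> * (2 ^ (qd + 2) * t)" using pos t by simp
   also have "\<dots> = 2 ^ (qd + 2) * \<rho> / \<alpha> * r" using pos by (simp add: r_def)
   finally show ?thesis by (simp add: r'_def B_def distrib_right)
  qed
  show "measure M (ball y r') \<le> c * \<omega> * r' ^ k" for y
  proof (rule Uc)
   show "0 < r'" using r B1 by (simp add: r'_def)
   have "r' = B * \<alpha> * t" by (simp add: r'_def r_def)
   also have "\<dots> \<le> \<Lambda> * (2 * (1 + \<alpha>)) * t"
   proof -
    have "1 * B \<le> (1 + 2 * \<alpha>) * B" using pos B1 by (intro mult_right_mono) auto
    then have "B \<le> \<Lambda>" using BL by simp
    then show ?thesis using t pos B1 Lam_bounds(1) by (intro mult_right_mono mult_mono) auto
   qed
   also have "\<dots> = 2 * \<Lambda> * t * (1 + \<alpha>)" by (simp only: mult_ac)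
   finally show "r' \<le> 2 * \<Lambda> * (1 / 2 ^ (j + m)) * (1 + \<alpha>)" by (simp only: t_def)
  qed
 qed (use r c B1 in \<open>auto simp: r'_def\<close>)
 also have "\<dots> = (c * \<Lambda> * t ^ k) * r ^ k"
 proof -
  have "1 / 2 ^ (j + m) + 2 * r = t + 2 * (\<alpha> * t)" by (simp only: r_def t_def)
  then have "1 / 2 ^ (j + m) + 2 * r = (1 + 2 * \<alpha>) * t" by (simp only: distrib_right mult_1 mult.assoc)
  then show ?thesis by (simp add: r'_def \<Lambda>_def B_def power_mult_distrib mult_ac)
 qed
 finally show ?thesis using r by (simp add: t_def)
qed

lemma cell_mass_le1:
 "m \<le> Suc qd \<Longrightarrow> measure M {x \<in> Gd j. idx (j + m) (co x) = z} \<le> \<Lambda> * (1 / 2 ^ (j + m)) ^ k"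
 using cell_mass_le[of m 1 j z] U by simp

lemma XX_mass_le: "measure M (XX j z) \<le> \<Lambda> * (1 / 2 ^ Suc j) ^ k"
 using cell_mass_le1[of 1 j z] by (simp add: XX_def X'_def)

text \<open>Pigeonhole with the upper bound: all other subcells together hold at most
  \<open>1 + \<kappa>\<close> times their volume, the cell at least \<open>1 - \<kappa>\<close>
  times its own, and the choice of \<open>\<kappa>\<close> leaves half the volume for the remaining
  subcell.\<close>

lemma dense_sub:
 assumes d: "dense j z" and z: "z \<in> Z" and z': "z' \<in> subs qd z"
 shows "(1 / 2 ^ (Suc j + qd)) ^ k / 2 \<le> measure M {x \<in> XX j z. idx (Suc j + qd) (co x) = z'}"
proof -
 let ?Y = "\<lambda>z'. {x \<in> XX j z. idx (Suc j + qd) (co x) = z'}"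
 define T where "T = (1 / (2::real) ^ Suc j) ^ k"
 define Q where "Q = (2::real) ^ (qd * k)"
 have Q: "1 \<le> Q" by (simp add: Q_def)
 have T: "0 < T" by (simp add: T_def)
 have tq: "(1 / (2::real) ^ (Suc j + qd)) ^ k = T / Q"
  unfolding T_def Q_def power_add power_divide power_mult power_mult_distrib by simp
 have Yeq: "?Y z'' = {x \<in> Gd j. idx (Suc j + qd) (co x) = z''}" if "z'' \<in> subs qd z" for z''
  using idx_subs[OF z, of "Suc j" qd] that by (auto simp: XX_iff)
 have sub: "measure M (?Y z'') \<le> \<Lambda> * (T / Q)" if "z'' \<in> subs qd z" for z''
  using cell_mass_le1[of "Suc qd" j z''] unfolding Yeq[OF that] tq[symmetric] by simp
 have XU: "XX j z = (\<Union>z''\<in>subs qd z. ?Y z'')"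
  using idx_subs[OF z, of "Suc j" qd] by (auto simp: XX_iff)
 have Ys: "?Y z'' \<in> sets M" for z''
 proof -
  have "?Y z'' = XX j z \<inter> {x. idx (Suc j + qd) (co x) = z''}" by auto
  then show ?thesis using sets_idx1[of "Suc j + qd" z''] by (auto simp: sets_M)
 qed
 have "measure M (XX j z) = (\<Sum>z''\<in>subs qd z. measure M (?Y z''))"
  by (subst XU, rule finite_measure_finite_Union) (use Ys finite_subs in \<open>auto simp: disjoint_family_on_def\<close>)
 also have "\<dots> = measure M (?Y z') + (\<Sum>z''\<in>subs qd z - {z'}. measure M (?Y z''))"
  using z' finite_subs by (intro sum.remove) auto
 also have "(\<Sum>z''\<in>subs qd z - {z'}. measure M (?Y z'')) \<le> (\<Sum>z''\<in>subs qd z - {z'}. \<Lambda> * (T / Q))"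
  using sub by (intro sum_mono) auto
 also have "\<dots> = (Q - 1) * (\<Lambda> * (T / Q))"
  using z' finite_subs by (simp add: card_Diff_singleton card_subs Q_def of_nat_diff)
 also have "\<dots> \<le> (Q - 1) * ((1 + \<kappa>) * (T / Q))"
  using Q T Lam_bounds by (intro mult_left_mono mult_right_mono) auto
 finally have "(1 - \<kappa>) * T \<le> measure M (?Y z') + (Q - 1) * ((1 + \<kappa>) * (T / Q))"
  using d by (simp add: dense_def dense'_def XX_def T_def)
 moreover have "(1 - \<kappa>) * T - (Q - 1) * ((1 + \<kappa>) * (T / Q)) \<ge> T / Q / 2"
 proof -
  have "(Q - 1) * ((1 + \<kappa>) * (T / Q)) = (1 + \<kappa>) * T - (1 + \<kappa>) * (T / Q)"
   using Q by (simp add: field_simps)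
  moreover have "2 * \<kappa> * T = T / Q / 2"
   using kappa(3) Q by (simp add: Q_def field_simps)
  moreover have "0 \<le> \<kappa> * (T / Q)" using kappa T Q by simp
  ultimately show ?thesis by (simp add: algebra_simps)
 qed
 ultimately show ?thesis unfolding tq by linarith
qed

end

section \<open>Fits of neighbouring cells, existence of fits, and the sum of the flatness\<close>

context key
begin

lemma KK_ge: "8 \<le> KK" "0 < c0" "c0 * KK = 1 / 16" "0 < CG"
proof -
 show K: "8 \<le> KK" using k_pos by (simp add: KK_def)
 then show "0 < c0" "c0 * KK = 1 / 16" by (simp_all add: c0_def)
 then show "0 < CG" using K by (simp add: CG_def)
qed

lemma bb_nonneg: "0 \<le> bb j z"
 using pos KK_ge by (cases j) (auto simp: bb_def bbv_def)

lemma CS_pos: "0 < CS" "2 ^ (qd * k) * sqrt \<phi> \<le> 1 / 400"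
proof -
 show "0 < CS" using k_pos by (simp add: CS_def)
 have "200 * 2 ^ (qd * k) * sqrt \<phi> \<le> CS * sqrt (2 * \<phi>)"
  using k_pos pos by (intro mult_mono) (auto simp: CS_def)
 then show "2 ^ (qd * k) * sqrt \<phi> \<le> 1 / 400" using phi by simp
qed

lemma bb_le_phi: "z \<in> Act j \<Longrightarrow> bb j z \<le> \<phi>"
 using tau_phi by (cases j) (auto simp: Act_Suc bb_def)

text \<open>Both fits are good on the mass of the single cell \<open>z\<close>, which belongs to the
  blocks of \<open>z\<close> and of \<open>z'\<close>, and \<open>dense_sub\<close> spreads this
  mass over all subcells. At level \<open>0\<close> both fits vanish.\<close>

lemma compare_adj:
 assumes z: "z \<in> Act j" and z': "z' \<in> Act j" and adj: "adj z z'"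
 shows "i < k \<Longrightarrow> norm (snd (Af j z) i - snd (Af j z') i) \<le> CS * sqrt (bb j z + bb j z')"
  and "(\<And>i. i < k \<Longrightarrow> \<bar>u i - real_of_int (z i) / 2 ^ j\<bar> \<le> 10 / 2 ^ j) \<Longrightarrow>
   norm (af (Af j z) u - af (Af j z') u) \<le> CS * sqrt (bb j z + bb j z') / 2 ^ j"
proof -
 have "(\<forall>i<k. norm (snd (Af j z) i - snd (Af j z') i) \<le> CS * sqrt (bb j z + bb j z')) \<and>
  ((\<forall>i<k. \<bar>u i - real_of_int (z i) / 2 ^ j\<bar> \<le> 10 / 2 ^ j) \<longrightarrow>
   norm (af (Af j z) u - af (Af j z') u) \<le> CS * sqrt (bb j z + bb j z') / 2 ^ j)"
 proof (cases j)
  case 0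
  then show ?thesis using CS_pos bb_nonneg by (simp add: Af_def af_def)
 next
  case (Suc n)
  have d: "dense n z" "z \<in> Z" using z Act_Z[OF z] by (auto simp: Suc Act_Suc)
  have 1: "XX n z \<subseteq> WW n z" "XX n z \<subseteq> WW n z'" using adj by (auto simp: XX_iff WW_iff)
  have f1: "resint (Af (Suc n) z) (XX n z) \<le> ennreal (bb (Suc n) z * (1 / 2 ^ Suc n) ^ (k + 2))"
   by (rule fit) (use z 1 Suc in auto)
  have f2: "resint (Af (Suc n) z') (XX n z) \<le> ennreal (bb (Suc n) z' * (1 / 2 ^ Suc n) ^ (k + 2))"
   by (rule fit) (use z' 1 Suc in auto)
  note ac = affine_compare[OF d(2) XX_sets dense_sub[OF d] f1 f2 bb_nonneg bb_nonneg]
  show ?thesis unfolding Suc using ac by blast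
 qed
 then show "i < k \<Longrightarrow> norm (snd (Af j z) i - snd (Af j z') i) \<le> CS * sqrt (bb j z + bb j z')"
  and "(\<And>i. i < k \<Longrightarrow> \<bar>u i - real_of_int (z i) / 2 ^ j\<bar> \<le> 10 / 2 ^ j) \<Longrightarrow>
   norm (af (Af j z) u - af (Af j z') u) \<le> CS * sqrt (bb j z + bb j z') / 2 ^ j"
  by blast+
qed

text \<open>The factor \<open>2 ^ (k + 2)\<close> renormalises the bound of the parent to half its
  side. \<open>B\<close> is left arbitrary because the comparison is also applied to fits that are
  rejected as too steep.\<close>

lemma compare_parent:
 assumes d: "dense j z" and z: "z \<in> Z" and w: "half z \<in> Act j" and b: "0 \<le> b"
  and B: "resint B (XX j z) \<le> ennreal (b * (1 / 2 ^ Suc j) ^ (k + 2))"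
 shows "i < k \<Longrightarrow> norm (snd B i - snd (Af j (half z)) i) \<le> CS * sqrt (b + 2 ^ (k + 2) * bb j (half z))"
  and "(\<And>i. i < k \<Longrightarrow> \<bar>u i - real_of_int (z i) / 2 ^ Suc j\<bar> \<le> 10 / 2 ^ Suc j) \<Longrightarrow>
   norm (af B u - af (Af j (half z)) u) \<le> CS * sqrt (b + 2 ^ (k + 2) * bb j (half z)) / 2 ^ Suc j"
proof -
 have sub: "XX j z \<subseteq> WW n (half z)" if "j = Suc n" for n
  using Gd_mono[of n j] that half_idx by (auto simp: XX_iff WW_iff)
 have "resint (Af j (half z)) (XX j z) \<le> ennreal (bb j (half z) * (1 / 2 ^ j) ^ (k + 2))"
  by (rule fit[OF w sub])
 also have "bb j (half z) * (1 / 2 ^ j) ^ (k + 2) = 2 ^ (k + 2) * bb j (half z) * (1 / 2 ^ Suc j) ^ (k + 2)"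
  unfolding power_Suc power_divide power_mult_distrib by simp
 finally have f2: "resint (Af j (half z)) (XX j z) \<le> ennreal (2 ^ (k + 2) * bb j (half z) * (1 / 2 ^ Suc j) ^ (k + 2))" .
 have "0 \<le> 2 ^ (k + 2) * bb j (half z)" using bb_nonneg by simp
 note ac = affine_compare[OF z XX_sets dense_sub[OF d z] B f2 b this]
 show "i < k \<Longrightarrow> norm (snd B i - snd (Af j (half z)) i) \<le> CS * sqrt (b + 2 ^ (k + 2) * bb j (half z))"
  and "(\<And>i. i < k \<Longrightarrow> \<bar>u i - real_of_int (z i) / 2 ^ Suc j\<bar> \<le> 10 / 2 ^ Suc j) \<Longrightarrow>
   norm (af B u - af (Af j (half z)) u) \<le> CS * sqrt (b + 2 ^ (k + 2) * bb j (half z)) / 2 ^ Suc j"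
  using ac by blast+
qed

text \<open>A Lipschitz estimate at the scale of the cells: \<open>phi\<close> contributes half a
  side for the change of fit, the two residuals contribute \<open>2 * \<rho> \<le> 1 / 2\<close>
  sides, and the rest is the slope of a single fit.\<close>

lemma Gd_dist:
 assumes x: "x \<in> Gd j" and y: "y \<in> Gd j" and adj: "adj (idx j (co x)) (idx j (co y))"
  and d: "\<And>i. i < k \<Longrightarrow> \<bar>co x i - co y i\<bar> \<le> d"
 shows "norm (ver x - ver y) \<le> 1 / 2 ^ j + real k * \<theta> * d"
proof -
 let ?w = "idx j (co x)" let ?v = "idx j (co y)"
 have w: "?w \<in> Act j" "norm (res (Af j ?w) x) \<le> \<rho> / 2 ^ j" using Gd_res[OF x] by auto
 have v: "?v \<in> Act j" "norm (res (Af j ?v) y) \<le> \<rho> / 2 ^ j" using Gd_res[OF y] by auto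
 have "norm (af (Af j ?w) (co x) - af (Af j ?v) (co x)) \<le> CS * sqrt (bb j ?w + bb j ?v) / 2 ^ j"
 proof (rule compare_adj(2)[OF w(1) v(1) adj])
  fix i assume i: "i < k"
  show "\<bar>co x i - real_of_int (?w i) / 2 ^ j\<bar> \<le> 10 / 2 ^ j"
   using idx_bounds[OF i, of j "co x"] by (simp add: add_divide_distrib abs_le_iff)
 qed
 also have "\<dots> \<le> 1 / 2 / 2 ^ j"
 proof (rule divide_right_mono)
  have "CS * sqrt (bb j ?w + bb j ?v) \<le> CS * sqrt (2 * \<phi>)"
   using CS_pos bb_le_phi[OF w(1)] bb_le_phi[OF v(1)] by simp
  then show "CS * sqrt (bb j ?w + bb j ?v) \<le> 1 / 2" using phi by simp
 qed simp
 finally have 1: "norm (af (Af j ?w) (co x) - af (Af j ?v) (co x)) \<le> 1 / 2 / 2 ^ j" .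
 have 2: "norm (af (Af j ?v) (co x) - af (Af j ?v) (co y)) \<le> real k * \<theta> * d"
  by (rule af_lip[OF slope[OF v(1)] d])
 have "ver x - ver y = (af (Af j ?w) (co x) - af (Af j ?v) (co x)) + (af (Af j ?v) (co x) - af (Af j ?v) (co y))
   + (res (Af j ?w) x - res (Af j ?v) y)"
  by (simp add: res_def)
 then have "norm (ver x - ver y) \<le> norm (af (Af j ?w) (co x) - af (Af j ?v) (co x)) + norm (af (Af j ?v) (co x) - af (Af j ?v) (co y))
   + (norm (res (Af j ?w) x) + norm (res (Af j ?v) y))"
  by (simp only:) (intro order_trans[OF norm_triangle_ineq] add_mono norm_triangle_ineq norm_triangle_ineq4)
 also have "\<dots> \<le> 1 / 2 / 2 ^ j + real k * \<theta> * d + (\<rho> / 2 ^ j + \<rho> / 2 ^ j)"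
  using 1 2 w v by (intro add_mono)
 also have "\<rho> / 2 ^ j + \<rho> / 2 ^ j \<le> 1 / 2 / 2 ^ j"
 proof -
  have "(2 * \<rho>) / 2 ^ j \<le> (1 / 2) / 2 ^ j" using pos by (intro divide_right_mono) auto
  then show ?thesis by simp
 qed
 finally show ?thesis by simp
qed

lemma WW_dist:
 assumes x: "x \<in> WW j z" and y: "y \<in> XX j z"
 shows "dist y x < KK / 2 ^ Suc j"
proof -
 let ?t = "1 / (2::real) ^ Suc j"
 have adj: "adj (idx (Suc j) (co x)) (idx (Suc j) (co y))" and G: "x \<in> Gd j" "y \<in> Gd j"
  using x y by (auto simp: WW_iff XX_iff)
 have co: "\<bar>co x i - co y i\<bar> \<le> 2 * ?t" if "i < k" for i
  using idx_adj_dist[OF adj that] by simp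
 have "adj (idx j (co x)) (idx j (co y))"
  using adj_half[OF adj] by (simp add: half_idx)
 then have v: "norm (ver x - ver y) \<le> 1 / 2 ^ j + real k * \<theta> * (2 * ?t)"
  using G co by (intro Gd_dist)
 have h: "norm (hor x - hor y) \<le> real k * (2 * ?t)"
  unfolding hor_def emb_diff by (rule norm_emb_le[OF co])
 have "norm (x - y) \<le> norm (hor x - hor y) + norm (ver x - ver y)"
 proof -
  have "x - y = (hor x - hor y) + (ver x - ver y)" by (simp add: ver_def)
  then show ?thesis by (metis norm_triangle_ineq)
 qed
 also have "\<dots> \<le> real k * (2 * ?t) + (2 * ?t + real k * (1 / 2) * (2 * ?t))"
 proof -
  have "real k * \<theta> * (2 * ?t) \<le> real k * (1 / 2) * (2 * ?t)"
   using pos by (intro mult_right_mono mult_left_mono) auto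
  then show ?thesis using v h by simp
 qed
 also have "\<dots> = (3 * real k + 2) * ?t" by (simp add: field_simps)
 also have "\<dots> < KK * ?t" by (rule mult_strict_right_mono) (auto simp: KK_def)
 finally show ?thesis by (simp add: dist_norm norm_minus_commute)
qed

lemma XX_subset_WW: "XX j z \<subseteq> WW j z" by (auto simp: XX_iff WW_iff)

lemma dense_mass:
 assumes d: "dense j z"
 shows "(1 / 2 ^ Suc j) ^ k / 2 \<le> measure M (XX j z)"
proof -
 have "(1 - \<kappa>) * (1 / 2 ^ Suc j) ^ k \<le> measure M (XX j z)"
  using d by (simp only: dense_def dense'_def XX_def)
 moreover have "(1 / 2) * (1 / (2::real) ^ Suc j) ^ k \<le> (1 - \<kappa>) * (1 / 2 ^ Suc j) ^ k"
  using kappa by (intro mult_right_mono) auto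
 ultimately show ?thesis by linarith
qed

lemma dense_nonempty: "dense j z \<Longrightarrow> XX j z \<noteq> {}"
proof
 assume d: "dense j z" and e: "XX j z = {}"
 have "0 < (1 / (2::real) ^ Suc j) ^ k / 2" by simp
 moreover have "measure M (XX j z) = 0" unfolding e by simp
 ultimately show False using dense_mass[OF d] by linarith
qed

lemma measurable_infdist [measurable]: "(\<lambda>x. infdist x L) \<in> borel_measurable borel" for L :: "'a set"
 by (intro borel_measurable_continuous_onI continuous_intros)

text \<open>Finiteness allows \<open>cost\<close> to be recovered from its
  \<open>enn2real\<close>.\<close>

lemma fl_finite: "fl y s < \<infinity>"
proof -
 let ?L = "span (e ` {..<k})"
 have L: "?L \<in> {L. affine L \<and> aff_dim L = int k}"
  using dim_V by (simp add: aff_dim_subspace subspace_imp_affine)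
 have "(\<integral>\<^sup>+x\<in>ball y s. ennreal ((infdist x ?L)\<^sup>2) \<partial>M) \<le> (\<integral>\<^sup>+x. ennreal ((norm y + \<bar>s\<bar>)\<^sup>2) \<partial>M)"
 proof (rule nn_integral_mono)
  fix x
  show "ennreal ((infdist x ?L)\<^sup>2) * indicator (ball y s) x \<le> ennreal ((norm y + \<bar>s\<bar>)\<^sup>2)"
  proof (cases "x \<in> ball y s")
   case True
   have "infdist x ?L \<le> dist x 0" by (rule infdist_le) (simp add: span_zero)
   also have "\<dots> \<le> norm y + \<bar>s\<bar>" using True norm_triangle_sub[of x y] by (simp add: dist_norm norm_minus_commute)
   finally show ?thesis using True by (simp add: ennreal_leI power_mono infdist_nonneg)
  qed simp
 qed
 also have "\<dots> < \<infinity>" by (simp add: emeasure_eq_measure ennreal_mult_less_top)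
 finally have "ennreal (1 / s ^ (k + 2)) * (\<integral>\<^sup>+x\<in>ball y s. ennreal ((infdist x ?L)\<^sup>2) \<partial>M) < \<infinity>"
  by (simp add: ennreal_mult_less_top)
 then show ?thesis unfolding fl_def using L by (rule INF_lower[THEN order_le_less_trans, rotated])
qed

lemma exists_plane:
 assumes d: "dense j z"
 obtains y s L where "y \<in> XX j z" "KK / 2 ^ Suc j \<le> s" "affine L" "aff_dim L = int k"
  "sqdist M y s L \<le> ennreal (c0\<^sup>2 * bb (Suc j) z * (1 / 2 ^ Suc j) ^ (k + 2))"
proof -
 let ?t = "1 / (2::real) ^ Suc j"
 define b2 where "b2 = 2 * enn2real (cost (Gd j) j z) + \<iota> / 2 ^ Suc j"
 have bb: "bb (Suc j) z = CG * b2" by (simp add: bb_def bbv_def b2_def)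
 obtain y0 where y0: "y0 \<in> XX j z" using dense_nonempty[OF d] by blast
 have K: "KK / 2 ^ Suc j < 2 * KK / 2 ^ Suc j" using KK_ge by (intro divide_strict_right_mono) auto
 have "cost (Gd j) j z \<le> fl y0 (KK / 2 ^ Suc j)"
  unfolding cost_def using y0 K by (intro INF_lower2[of y0] INF_lower) (auto simp: XX_def)
 also have "\<dots> < \<infinity>" by (rule fl_finite)
 finally have c: "cost (Gd j) j z = ennreal (enn2real (cost (Gd j) j z))" by simp
 have "0 < \<iota> / 2 ^ Suc j" using pos by simp
 then have b2: "enn2real (cost (Gd j) j z) < b2" "0 < b2"
  using enn2real_nonneg[of "cost (Gd j) j z"] by (simp_all add: b2_def del: enn2real_nonneg)
 then have "cost (Gd j) j z < ennreal b2" by (subst c) (simp add: ennreal_lessI)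
 then obtain y s where ys: "y \<in> XX j z" "s \<in> {KK / 2 ^ Suc j..<2 * KK / 2 ^ Suc j}" "fl y s < ennreal b2"
  unfolding cost_def INF_less_iff by (auto simp: XX_def)
 then obtain L where L: "affine L" "aff_dim L = int k"
  "ennreal (1 / s ^ (k + 2)) * (sqdist M y s L) < ennreal b2"
  unfolding fl_def INF_less_iff by auto
 have s: "0 < s" using ys(2) KK_ge by (auto intro: less_le_trans[rotated])
 let ?I = "\<integral>\<^sup>+x\<in>ball y s. ennreal ((infdist x L)\<^sup>2) \<partial>M"
 have "?I = ennreal (s ^ (k + 2)) * (ennreal (1 / s ^ (k + 2)) * ?I)"
  using s by (simp add: mult.assoc[symmetric] ennreal_mult[symmetric])
 also have "\<dots> \<le> ennreal (s ^ (k + 2)) * ennreal b2"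
  using L(3) by (intro mult_left_mono) auto
 also have "\<dots> = ennreal (s ^ (k + 2) * b2)" using s b2 by (simp add: ennreal_mult)
 also have "\<dots> \<le> ennreal ((2 * KK * ?t) ^ (k + 2) * b2)"
  using ys(2) s b2 by (intro ennreal_leI mult_right_mono power_mono) auto
 also have "(2 * KK * ?t) ^ (k + 2) * b2 = c0\<^sup>2 * bb (Suc j) z * ?t ^ (k + 2)"
 proof -
  have "c0\<^sup>2 * CG = (2 * KK) ^ (k + 2)" using KK_ge by (simp add: CG_def)
  then have "c0\<^sup>2 * bb (Suc j) z * ?t ^ (k + 2) = (2 * KK) ^ (k + 2) * b2 * ?t ^ (k + 2)"
   unfolding bb by (simp only: mult.assoc[symmetric])
  then show ?thesis by (simp only: power_mult_distrib mult_ac)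
 qed
 finally show ?thesis using that ys L by auto
qed

text \<open>Hence an examined cell that is dense and flat can fail only by steepness. Chebyshev's
  inequality finds a point near the plane in every subcell, and opposite corner subcells supply the
  spread that makes the plane a graph.\<close>

lemma exists_fit:
 assumes d: "dense j z" and z: "z \<in> Z" and b: "bb (Suc j) z \<le> \<phi>"
 shows "\<exists>A. fitA (Gd j) j z A"
proof -
 define t where "t = 1 / (2::real) ^ Suc j"
 have t: "0 < t" by (simp add: t_def)
 obtain y s L where y: "y \<in> XX j z" and s: "KK / 2 ^ Suc j \<le> s" and L: "affine L" "aff_dim L = int k"
  and I: "sqdist M y s L \<le> ennreal (c0\<^sup>2 * bb (Suc j) z * t ^ (k + 2))"
  by (rule exists_plane[OF d, folded t_def])
 have Wb: "WW j z \<subseteq> ball y s" using WW_dist[OF _ y] s by force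
 \<comment> \<open>The distance from the plane that averaging over one subcell guarantees. By the
   choice of \<open>\<phi>\<close> it is tiny against \<open>c0 * t\<close>.\<close>
 define \<sigma> where "\<sigma> = 2 * 2 ^ (qd * k) * c0 * sqrt \<phi> * t"
 have sig: "0 \<le> \<sigma>" "\<sigma> \<le> c0 * t / 200"
 proof -
  show "0 \<le> \<sigma>" using t pos KK_ge by (simp add: \<sigma>_def)
  have "\<sigma> = 2 * (c0 * t) * (2 ^ (qd * k) * sqrt \<phi>)" by (simp add: \<sigma>_def mult_ac)
  also have "\<dots> \<le> 2 * (c0 * t) * (1 / 400)" using CS_pos t KK_ge by (intro mult_left_mono) auto
  finally show "\<sigma> \<le> c0 * t / 200" by (simp add: mult.commute)
 qed
 have pt: "\<exists>x\<in>XX j z. idx (Suc j + qd) (co x) = z' \<and> infdist x L \<le> \<sigma>" if z': "z' \<in> subs qd z" for z'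
 proof -
  let ?Y = "{x \<in> XX j z. idx (Suc j + qd) (co x) = z'}"
  have "?Y = XX j z \<inter> {x. idx (Suc j + qd) (co x) = z'}" by auto
  then have Y: "?Y \<in> sets borel" using sets_idx1[of "Suc j + qd" z'] by auto
  have "(\<integral>\<^sup>+x\<in>?Y. ennreal ((infdist x L)\<^sup>2) \<partial>M) \<le> (sqdist M y s L)"
   using Wb XX_subset_WW[of j z] by (intro nn_integral_mono) (auto simp: indicator_def)
  also note I
  finally have "\<exists>x\<in>?Y. (infdist x L)\<^sup>2 \<le> c0\<^sup>2 * bb (Suc j) z * t ^ (k + 2) / ((1 / 2 ^ (Suc j + qd)) ^ k / 2)"
   using dense_sub[OF d z z'] t bb_nonneg by (intro exists_le_average[OF Y]) auto
  then obtain x where x: "x \<in> ?Y" "(infdist x L)\<^sup>2 \<le> c0\<^sup>2 * bb (Suc j) z * t ^ (k + 2) / ((1 / 2 ^ (Suc j + qd)) ^ k / 2)"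
   by blast
  note x(2)
  also have "c0\<^sup>2 * bb (Suc j) z * t ^ (k + 2) / ((1 / 2 ^ (Suc j + qd)) ^ k / 2) = 2 * 2 ^ (qd * k) * (c0\<^sup>2 * bb (Suc j) z * t\<^sup>2)"
  proof -
   have "(1 / (2::real) ^ (Suc j + qd)) ^ k = t ^ k * (1 / 2 ^ (qd * k))"
    unfolding t_def power_add power_divide power_mult power_mult_distrib by simp
   moreover have "a * (P * s) / (P * (1 / Q) / 2) = 2 * Q * (a * s)" if "0 < P" "0 < Q" for a s P Q :: real
    using that by (simp add: field_simps)
   ultimately show ?thesis using t by (simp only: power_add) simp
  qed
  also have "\<dots> \<le> (2 * 2 ^ (qd * k))\<^sup>2 * (c0\<^sup>2 * \<phi> * t\<^sup>2)"
  proof (rule mult_mono)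
   have "(1::real) \<le> 2 * 2 ^ (qd * k)" using one_le_power[of "2::real" "qd * k"] by linarith
   then have "(2 * 2 ^ (qd * k)) ^ 1 \<le> (2 * (2::real) ^ (qd * k))\<^sup>2" by (intro power_increasing) auto
   then show "2 * 2 ^ (qd * k) \<le> (2 * (2::real) ^ (qd * k))\<^sup>2" by simp
  qed (use b bb_nonneg in \<open>auto intro!: mult_right_mono mult_left_mono\<close>)
  also have "\<dots> = \<sigma>\<^sup>2" using pos by (simp add: \<sigma>_def power_mult_distrib)
  finally have "infdist x L \<le> \<sigma>" using sig(1) by (rule power2_le_imp_le)
  then show ?thesis using x by blast
 qed
 have "\<exists>A. \<forall>x. c0 * norm (res A x) \<le> infdist x L"
 proof (rule plane_is_graph[OF L, of \<sigma> "2 * KK * t" "t / 2"])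
  fix u assume u: "norm (emb u) = 1"
  \<comment> \<open>\<open>z1\<close> and \<open>z2\<close> are the extreme corner subcells in the
    direction \<open>u\<close>, picked according to the sign of each coordinate.\<close>
  define z1 where "z1 = (\<lambda>i. if i < k then (if 0 \<le> u i then z i * 2 ^ qd + (2 ^ qd - 1) else z i * 2 ^ qd) else 0)"
  define z2 where "z2 = (\<lambda>i. if i < k then (if 0 \<le> u i then z i * 2 ^ qd else z i * 2 ^ qd + (2 ^ qd - 1)) else 0)"
  have q1: "(1::int) \<le> 2 ^ qd" by (rule one_le_power) simp
  have z12: "z1 \<in> subs qd z" "z2 \<in> subs qd z"
   using q1 unfolding subs_alt by (auto simp: z1_def z2_def Z_def)
  obtain x where x: "x \<in> XX j z" "idx (Suc j + qd) (co x) = z1" "infdist x L \<le> \<sigma>" using pt[OF z12(1)] by blast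
  obtain x' where x': "x' \<in> XX j z" "idx (Suc j + qd) (co x') = z2" "infdist x' L \<le> \<sigma>" using pt[OF z12(2)] by blast
  have "norm (x - x') \<le> 2 * KK * t"
  proof -
   have "dist y x < KK * t" "dist y x' < KK * t"
    using WW_dist[OF _ y, of x] WW_dist[OF _ y, of x'] x x' XX_subset_WW[of j z] by (auto simp: t_def)
   then show ?thesis using dist_triangle2[of x x' y] by (simp add: dist_norm dist_commute norm_minus_commute)
  qed
  moreover have "t / 2 \<le> emb u \<bullet> (x - x')"
  proof -
   define h where "h = (1::real) / 2 ^ (Suc j + qd)"
   have h: "2 ^ qd * h = t" "0 < h" by (simp_all add: h_def t_def power_add)
   have th: "t / 2 \<le> (2 ^ qd - 2) * h"
   proof -
    have "t / 2 = (2 ^ qd / 2) * h" using h(1) by simp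
    also have "\<dots> \<le> (2 ^ qd - 2) * h"
    proof (rule mult_right_mono)
     have "(1::real) \<le> 2 ^ k" by simp
     then show "(2::real) ^ qd / 2 \<le> 2 ^ qd - 2" by (simp add: qd_def)
    qed (use h in simp)
    finally show ?thesis .
   qed
   have bnd: "real_of_int (idx (Suc j + qd) v l) * h \<le> v l" "v l < real_of_int (idx (Suc j + qd) v l) * h + h" if "l < k" for v l
    using idx_bounds[OF that, of "Suc j + qd" v] by (simp_all add: h_def add_divide_distrib)
   have trm: "\<bar>u i\<bar> * (t / 2) \<le> u i * (co x i - co x' i)" if i: "i < k" for i
   proof (cases "0 \<le> u i")
    case True
    have "(2 ^ qd - 2) * h \<le> co x i - co x' i"
     using bnd(1)[OF i, of "co x"] bnd(2)[OF i, of "co x'"] True i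
     unfolding x(2) x'(2) by (simp add: z1_def z2_def algebra_simps)
    then have "t / 2 \<le> co x i - co x' i" using th by linarith
    from mult_left_mono[OF this True] show ?thesis using True by simp
   next
    case False
    have "(2 ^ qd - 2) * h \<le> co x' i - co x i"
     using bnd(2)[OF i, of "co x"] bnd(1)[OF i, of "co x'"] False i
     unfolding x(2) x'(2) by (simp add: z1_def z2_def algebra_simps)
    then have "t / 2 \<le> co x' i - co x i" using th by linarith
    then have "\<bar>u i\<bar> * (t / 2) \<le> \<bar>u i\<bar> * (co x' i - co x i)" by (rule mult_left_mono) simp
    then show ?thesis using False by (simp add: algebra_simps)
   qed
   \<comment> \<open>Each coordinate gains \<open>\<bar>u i\<bar> * (t / 2)\<close>, and the sum
     norm of a unit vector is at least 1.\<close>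
   have "1 \<le> (\<Sum>i<k. \<bar>u i\<bar>)" using L2_set_le_sum_abs[of u "{..<k}"] u by (simp add: norm_emb)
   then have "t / 2 \<le> (\<Sum>i<k. \<bar>u i\<bar>) * (t / 2)" using t by simp
   also have "\<dots> = (\<Sum>i<k. \<bar>u i\<bar> * (t / 2))" by (rule sum_distrib_right)
   also have "\<dots> \<le> (\<Sum>i<k. u i * (co x i - co x' i))" using trm by (intro sum_mono) auto
   also have "\<dots> = emb u \<bullet> (x - x')"
    by (simp add: emb_def inner_sum_left co_def inner_diff_right inner_commute[of "e _"] right_diff_distrib sum_subtractf)
   finally show ?thesis .
  qed
  ultimately show "\<exists>x x'. infdist x L \<le> \<sigma> \<and> infdist x' L \<le> \<sigma> \<and> norm (x - x') \<le> 2 * KK * t \<and> t / 2 \<le> emb u \<bullet> (x - x')"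
   using x(3) x'(3) by blast
 next
  have c: "c0 \<le> 1 / 128" using KK_ge by (simp add: c0_def field_simps)
  have "c0 * \<sigma> \<le> 1 * \<sigma>" using c sig by (intro mult_right_mono) auto
  moreover have "c0 * (KK * t) = t / 16" using KK_ge(3) by (simp add: mult.assoc[symmetric])
  moreover have "c0 * t \<le> 1 * t" using c t by (intro mult_right_mono) auto
  moreover have "2 * \<sigma> + 2 * c0 * (2 * KK * t + 2 * \<sigma>) = 2 * \<sigma> + 4 * (c0 * (KK * t)) + 4 * (c0 * \<sigma>)"
   by (simp add: algebra_simps)
  ultimately show "2 * \<sigma> + 2 * c0 * (2 * KK * t + 2 * \<sigma>) < t / 2"
   using sig t by linarith
  show "0 < c0" "c0 \<le> 1 / 2" using c KK_ge by auto
 qed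
 then obtain A where A: "\<And>x. c0 * norm (res A x) \<le> infdist x L" by blast
 have "resint A (WW j z) \<le> (\<integral>\<^sup>+x. ennreal (1 / c0\<^sup>2) * (ennreal ((infdist x L)\<^sup>2) * indicator (ball y s) x) \<partial>M)"
 proof (rule nn_integral_mono)
  fix x
  have "norm (res A x) \<le> infdist x L / c0" using A[of x] KK_ge by (simp add: field_simps)
  then have "(norm (res A x))\<^sup>2 \<le> (infdist x L / c0)\<^sup>2" by (rule power_mono) simp
  then have "ennreal ((norm (res A x))\<^sup>2) \<le> ennreal (1 / c0\<^sup>2) * ennreal ((infdist x L)\<^sup>2)"
   by (simp add: power_divide ennreal_mult[symmetric])
  then show "ennreal ((norm (res A x))\<^sup>2) * indicator (WW j z) x \<le> ennreal (1 / c0\<^sup>2) * (ennreal ((infdist x L)\<^sup>2) * indicator (ball y s) x)"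
   using Wb by (auto simp: indicator_def)
 qed
 also have "\<dots> = ennreal (1 / c0\<^sup>2) * (sqdist M y s L)"
  unfolding measurable_M_eq
  by (intro nn_integral_cmult, unfold measurable_M_eq)
   (intro borel_measurable_times_ennreal measurable_compose[OF _ measurable_ennreal]
    borel_measurable_power measurable_infdist borel_measurable_indicator, simp)
 also have "\<dots> \<le> ennreal (1 / c0\<^sup>2) * ennreal (c0\<^sup>2 * bb (Suc j) z * t ^ (k + 2))"
  by (rule mult_left_mono[OF I]) simp
 also have "\<dots> = ennreal (bb (Suc j) z * t ^ (k + 2))"
  using KK_ge t bb_nonneg by (subst ennreal_mult[symmetric]) auto
 finally show ?thesis by (intro exI[of _ A]) (simp only: fitA_def WW_def bb_def t_def nat.case)
qed

definition DD :: "nat \<Rightarrow> zv set" where "DD j = {z \<in> Z. dense j z}"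

lemma DD_disjoint: "disjoint_family_on (XX j) B"
 by (auto simp: disjoint_family_on_def XX_iff)

lemma finite_DD: "finite (DD j)"
 and DD_mass: "(\<Sum>z\<in>DD j. (1 / 2 ^ Suc j) ^ k) \<le> 2 * measure M UNIV"
proof -
 have *: "(\<Sum>z\<in>F. (1 / 2 ^ Suc j) ^ k) \<le> 2 * measure M UNIV" if F: "finite F" "F \<subseteq> DD j" for F
 proof -
  have "(\<Sum>z\<in>F. (1 / 2 ^ Suc j) ^ k / 2) \<le> (\<Sum>z\<in>F. measure M (XX j z))"
   using F dense_mass by (intro sum_mono) (auto simp: DD_def)
  also have "\<dots> = measure M (\<Union>z\<in>F. XX j z)"
   using F DD_disjoint by (intro finite_measure_finite_Union[symmetric]) (auto simp: sets_M)
  also have "\<dots> \<le> measure M UNIV" by (intro finite_measure_mono) (auto simp: sets_M)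
  finally show ?thesis by (simp add: sum_divide_distrib[symmetric])
 qed
 show f: "finite (DD j)"
 proof (rule ccontr)
  assume inf: "infinite (DD j)"
  define T where "T = (1 / (2::real) ^ Suc j) ^ k"
  have T: "0 < T" by (simp add: T_def)
  obtain n where n: "2 * measure M UNIV < real n * T"
   using reals_Archimedean3[OF T] by blast
  obtain F where F: "F \<subseteq> DD j" "finite F" "card F = n"
   using infinite_arbitrarily_large[OF inf, of n] by blast
  show False using *[OF F(2,1)] n F(3) by (simp add: T_def)
 qed
 show "(\<Sum>z\<in>DD j. (1 / 2 ^ Suc j) ^ k) \<le> 2 * measure M UNIV" by (rule *[OF f]) simp
qed

definition Bt :: real where "Bt = CG * (4 * \<delta> + 2 * \<iota> * measure M UNIV)"

text \<open>Cells of one level carry disjoint mass, so \<open>carleson\<close> applies to all dense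
  cells of all levels at once. The coefficient 4 combines the factor 2 in \<open>bbv\<close> with
  the density of at least one half; the slack terms add up as a geometric series against
  \<open>DD_mass\<close>.\<close>

lemma bb_sum: "(\<Sum>j<J. \<Sum>z\<in>DD j. bb (Suc j) z * (1 / 2 ^ Suc j) ^ k) \<le> Bt"
proof -
 let ?F = "SIGMA j:{..<J}. DD j"
 let ?c = "\<lambda>q. enn2real (cost (Gd (fst q)) (fst q) (snd q))"
 have fF: "finite ?F" by (intro finite_SigmaI finite_DD) auto
 have "(\<Sum>q\<in>?F. ?c q * measure M (XX (fst q) (snd q))) \<le> \<delta>"
 proof (rule car[unfolded carleson_def, rule_format, where lev="\<lambda>q. Suc (fst q)"])
  fix q assume q: "q \<in> ?F"
  then have d: "dense (fst q) (snd q)" by (auto simp: DD_def)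
  have m: "(1 / 2 ^ Suc (fst q)) ^ k / 2 \<le> measure M (ball y (KK / 2 ^ Suc (fst q)))" if y: "y \<in> XX (fst q) (snd q)" for y
  proof -
   have "XX (fst q) (snd q) \<subseteq> ball y (KK / 2 ^ Suc (fst q))"
   proof
    fix x assume "x \<in> XX (fst q) (snd q)"
    then have "x \<in> WW (fst q) (snd q)" using XX_subset_WW by blast
    from WW_dist[OF this y] show "x \<in> ball y (KK / 2 ^ Suc (fst q))" by simp
   qed
   then have "measure M (XX (fst q) (snd q)) \<le> measure M (ball y (KK / 2 ^ Suc (fst q)))"
    by (rule finite_measure_mono) (simp add: sets_M)
   then show ?thesis using dense_mass[OF d] by linarith
  qed
  have c: "ennreal (?c q) \<le> fl y s" if y: "y \<in> XX (fst q) (snd q)" and s: "KK / 2 ^ Suc (fst q) \<le> s" "s < 2 * KK / 2 ^ Suc (fst q)" for y s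
  proof -
   have "cost (Gd (fst q)) (fst q) (snd q) \<le> fl y s"
    unfolding cost_def using y s by (intro INF_lower2[of y] INF_lower) (auto simp: XX_def)
   moreover from this have "cost (Gd (fst q)) (fst q) (snd q) < \<infinity>"
    using fl_finite[of y s] by (rule order_le_less_trans)
   ultimately show ?thesis by (simp add: less_top)
  qed
  show "XX (fst q) (snd q) \<in> sets borel \<and> 0 \<le> ?c q \<and> 1 \<le> Suc (fst q) \<and>
    (\<forall>y\<in>XX (fst q) (snd q). (1 / 2 ^ Suc (fst q)) ^ k / 2 \<le> measure M (ball y (KK / 2 ^ Suc (fst q))) \<and>
      (\<forall>s. KK / 2 ^ Suc (fst q) \<le> s \<longrightarrow> s < 2 * KK / 2 ^ Suc (fst q) \<longrightarrow> ennreal (?c q) \<le> fl y s))"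
   using m c by simp
 next
  fix q q' assume "q \<in> ?F" "q' \<in> ?F" "q \<noteq> q'"
  then show "Suc (fst q) \<noteq> Suc (fst q') \<or> XX (fst q) (snd q) \<inter> XX (fst q') (snd q') = {}"
   by (cases q; cases q') (auto simp: XX_iff)
 qed (rule fF)
 then have S: "(\<Sum>j<J. \<Sum>z\<in>DD j. ?c (j, z) * measure M (XX j z)) \<le> \<delta>"
  by (simp add: sum.Sigma finite_DD split_beta)
 have "(\<Sum>j<J. \<Sum>z\<in>DD j. bb (Suc j) z * (1 / 2 ^ Suc j) ^ k)
   \<le> (\<Sum>j<J. \<Sum>z\<in>DD j. CG * (4 * (?c (j, z) * measure M (XX j z)) + \<iota> / 2 ^ Suc j * (1 / 2 ^ Suc j) ^ k))"
 proof (intro sum_mono)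
  fix j z assume "z \<in> DD j"
  then have d: "dense j z" by (simp add: DD_def)
  have "2 * ?c (j, z) * (1 / 2 ^ Suc j) ^ k \<le> 2 * ?c (j, z) * (2 * measure M (XX j z))"
   using dense_mass[OF d] by (intro mult_left_mono) auto
  then have "(2 * ?c (j, z) + \<iota> / 2 ^ Suc j) * (1 / 2 ^ Suc j) ^ k \<le> 4 * (?c (j, z) * measure M (XX j z)) + \<iota> / 2 ^ Suc j * (1 / 2 ^ Suc j) ^ k"
   by (simp add: distrib_right)
  then have "CG * ((2 * ?c (j, z) + \<iota> / 2 ^ Suc j) * (1 / 2 ^ Suc j) ^ k) \<le> CG * (4 * (?c (j, z) * measure M (XX j z)) + \<iota> / 2 ^ Suc j * (1 / 2 ^ Suc j) ^ k)"
   using KK_ge by (intro mult_left_mono) auto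
  then show "bb (Suc j) z * (1 / 2 ^ Suc j) ^ k \<le> CG * (4 * (?c (j, z) * measure M (XX j z)) + \<iota> / 2 ^ Suc j * (1 / 2 ^ Suc j) ^ k)"
   by (simp add: bb_def bbv_def mult.assoc)
 qed
 also have "\<dots> = CG * (4 * (\<Sum>j<J. \<Sum>z\<in>DD j. ?c (j, z) * measure M (XX j z)) + (\<Sum>j<J. \<iota> / 2 ^ Suc j * (\<Sum>z\<in>DD j. (1 / 2 ^ Suc j) ^ k)))"
  by (simp only: sum_distrib_left sum.distrib distrib_left)
 also have "\<dots> \<le> CG * (4 * \<delta> + (\<Sum>j<J. \<iota> / 2 ^ Suc j * (2 * measure M UNIV)))"
  using S KK_ge pos DD_mass by (intro mult_left_mono add_mono sum_mono) auto
 also have "(\<Sum>j<J. \<iota> / 2 ^ Suc j * (2 * measure M UNIV)) = (2 * \<iota> * measure M UNIV) * (\<Sum>j<J. (1 / 2) ^ Suc j)"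
  by (simp add: sum_distrib_left power_divide mult_ac)
 also have "\<dots> \<le> (2 * \<iota> * measure M UNIV) * 1"
 proof (rule mult_left_mono)
  have "(\<Sum>j<J. (1 / 2::real) ^ Suc j) \<le> (\<Sum>j. (1 / 2) ^ Suc j)"
   using power_half_series by (intro sum_le_suminf) (auto simp: sums_iff)
  then show "(\<Sum>j<J. (1 / 2::real) ^ Suc j) \<le> 1" using power_half_series by (simp add: sums_iff)
 qed (use pos in simp)
 finally show ?thesis using KK_ge by (simp add: Bt_def mult_left_mono)
qed

end

subsection \<open>Lattice Dirichlet energy\<close>

context frame
begin

definition pd :: "nat \<Rightarrow> (zv \<Rightarrow> 'a) \<Rightarrow> zv \<Rightarrow> 'a" where
 "pd l f v = f (v(l := v l + 1)) - f v"

text \<open>For odd \<open>v i\<close> the two roundings are the two coarse neighbours; for even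
  \<open>v i\<close> they coincide.\<close>

definition hs :: "nat set \<Rightarrow> zv \<Rightarrow> nat \<Rightarrow> int" where
 "hs \<sigma> v = (\<lambda>i. (v i + (if i \<in> \<sigma> then 1 else 0)) div 2)"

text \<open>Multilinear interpolation of a function on the coarse lattice to the lattice of half the
 mesh; in each odd coordinate the two coarse neighbours are averaged.\<close>

definition interp :: "(zv \<Rightarrow> 'a) \<Rightarrow> zv \<Rightarrow> 'a" where
 "interp f v = (1 / 2 ^ k) *\<^sub>R (\<Sum>\<sigma>\<in>Pow {..<k}. f (hs \<sigma> v))"

text \<open>Finite support on the lattice keeps all sums over \<open>Z\<close> finite in substance,
  so shifts and summation by parts leave no boundary terms.\<close>

definition fs :: "(zv \<Rightarrow> 'b::zero) \<Rightarrow> bool" where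
 "fs f \<longleftrightarrow> finite {v \<in> Z. f v \<noteq> 0}"

definition En :: "nat \<Rightarrow> (zv \<Rightarrow> 'a) \<Rightarrow> real" where
 "En l f = infsum (\<lambda>v. (norm (pd l f v))\<^sup>2) Z"

lemma fs_summable: "fs (h :: _ \<Rightarrow> real) \<Longrightarrow> h summable_on Z"
 unfolding fs_def by (rule finite_nonzero_values_imp_summable_on)

lemma fs_sub: "fs f \<Longrightarrow> (\<And>v. v \<in> Z \<Longrightarrow> f v = 0 \<Longrightarrow> g v = 0) \<Longrightarrow> fs g"
 unfolding fs_def by (erule rev_finite_subset) auto

lemma fs_infsum:
 fixes h :: "zv \<Rightarrow> real"
 assumes "finite U" "U \<subseteq> Z" "\<And>v. v \<in> Z \<Longrightarrow> v \<notin> U \<Longrightarrow> h v = 0"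
 shows "infsum h Z = sum h U"
proof -
 have "infsum h Z = infsum h U"
  by (rule infsum_cong_neutral) (use assms in auto)
 then show ?thesis using assms by simp
qed

lemma fs_add: "fs f \<Longrightarrow> fs g \<Longrightarrow> fs (\<lambda>v. f v + g v)" for f g :: "_ \<Rightarrow> 'b::monoid_add"
 unfolding fs_def by (rule finite_subset[of _ "{v \<in> Z. f v \<noteq> 0} \<union> {v \<in> Z. g v \<noteq> 0}"]) auto

lemma fs_sum:
 fixes h :: "'b \<Rightarrow> zv \<Rightarrow> real"
 assumes "finite T" "\<And>s. s \<in> T \<Longrightarrow> fs (h s)"
 shows "fs (\<lambda>x. \<Sum>s\<in>T. h s x)" "infsum (\<lambda>x. \<Sum>s\<in>T. h s x) Z = (\<Sum>s\<in>T. infsum (h s) Z)"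
proof -
 have "fs (\<lambda>x. \<Sum>s\<in>T. h s x) \<and> infsum (\<lambda>x. \<Sum>s\<in>T. h s x) Z = (\<Sum>s\<in>T. infsum (h s) Z)"
  using assms
 proof (induction T rule: finite_induct)
  case empty
  then show ?case by (simp add: fs_def)
 next
  case (insert s T)
  then have 1: "fs (h s)" "fs (\<lambda>x. \<Sum>s\<in>T. h s x)" by auto
  then have "fs (\<lambda>x. h s x + (\<Sum>s\<in>T. h s x))" by (rule fs_add)
  moreover have "infsum (\<lambda>x. h s x + (\<Sum>s\<in>T. h s x)) Z = infsum (h s) Z + infsum (\<lambda>x. \<Sum>s\<in>T. h s x) Z"
   using 1 by (intro infsum_add fs_summable)
  ultimately show ?case using insert by simp
 qed
 then show "fs (\<lambda>x. \<Sum>s\<in>T. h s x)" "infsum (\<lambda>x. \<Sum>s\<in>T. h s x) Z = (\<Sum>s\<in>T. infsum (h s) Z)"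
  by auto
qed

lemma bij_shift: "l < k \<Longrightarrow> bij_betw (\<lambda>v. v(l := v l + c)) Z Z" for c :: int
 by (rule bij_betw_byWitness[where f'="\<lambda>v. v(l := v l - c)"]) (auto simp: Z_def)

lemma infsum_shift:
 "l < k \<Longrightarrow> infsum (\<lambda>v. h (v(l := v l + c))) Z = infsum h Z" for c :: int and h :: "_ \<Rightarrow> real"
 using infsum_reindex_bij_betw[OF bij_shift, of l h c] by simp

lemma fs_shift: "l < k \<Longrightarrow> fs f \<Longrightarrow> fs (\<lambda>v. f (v(l := v l + c)))" for c :: int
proof -
 assume l: "l < k" and f: "fs f"
 have "{v \<in> Z. f (v(l := v l + c)) \<noteq> 0} \<subseteq> (\<lambda>v. v(l := v l - c)) ` {v \<in> Z. f v \<noteq> 0}"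
 proof
  fix v assume v: "v \<in> {v \<in> Z. f (v(l := v l + c)) \<noteq> 0}"
  then have "v(l := v l + c) \<in> {v \<in> Z. f v \<noteq> 0}" using l by (simp add: Z_def)
  then show "v \<in> (\<lambda>v. v(l := v l - c)) ` {v \<in> Z. f v \<noteq> 0}"
   by (intro image_eqI[where x="v(l := v l + c)"]) simp_all
 qed
 then show ?thesis using f unfolding fs_def by (meson finite_imageI finite_subset)
qed

lemma fs_pd: "l < k \<Longrightarrow> fs f \<Longrightarrow> fs (pd l f)"
proof -
 assume l: "l < k" and f: "fs f"
 have "fs (\<lambda>v. f (v(l := v l + 1)) + (- f v))"
  using fs_shift[OF l f, of 1] f by (intro fs_add) (auto elim: fs_sub)
 then show ?thesis by (rule fs_sub) (simp add: pd_def)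
qed

lemma fs_norm2: "fs f \<Longrightarrow> fs (\<lambda>v. (norm (f v :: 'a))\<^sup>2)"
 by (erule fs_sub) simp

lemma fs_interp:
 assumes "fs f"
 shows "fs (interp f)"
proof -
 let ?S = "{v \<in> Z. f v \<noteq> 0}"
 have "{v \<in> Z. interp f v \<noteq> 0} \<subseteq> (\<Union>u\<in>?S. {v \<in> Z. \<forall>i<k. v i \<in> {2 * u i - 1..2 * u i + 1}})"
 proof
  fix v assume v: "v \<in> {v \<in> Z. interp f v \<noteq> 0}"
  then have "(\<Sum>\<sigma>\<in>Pow {..<k}. f (hs \<sigma> v)) \<noteq> 0" by (auto simp: interp_def)
  then obtain \<sigma> where s: "\<sigma> \<in> Pow {..<k}" "f (hs \<sigma> v) \<noteq> 0" by (meson sum.neutral)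
  have "hs \<sigma> v \<in> Z" using v s by (auto simp: hs_def Z_def)
  moreover have "v i \<in> {2 * hs \<sigma> v i - 1..2 * hs \<sigma> v i + 1}" for i
   by (auto simp: hs_def)
  ultimately show "v \<in> (\<Union>u\<in>?S. {v \<in> Z. \<forall>i<k. v i \<in> {2 * u i - 1..2 * u i + 1}})"
   using v s by blast
 qed
 moreover have "finite (\<Union>u\<in>?S. {v \<in> Z. \<forall>i<k. v i \<in> {2 * u i - 1..2 * u i + 1}})"
  using assms unfolding fs_def by (intro finite_UN_I card_Z_Pi(1)) (auto simp only: finite_atLeastAtMost_int)
 ultimately show ?thesis unfolding fs_def by (rule finite_subset)
qed

lemma card_Pow_half:
 assumes l: "l < k"
 shows "card {\<sigma> \<in> Pow {..<k}. l \<in> \<sigma>} = 2 ^ (k - 1)" "card {\<sigma> \<in> Pow {..<k}. l \<notin> \<sigma>} = 2 ^ (k - 1)"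
proof -
 have *: "{\<sigma> \<in> Pow {..<k}. l \<notin> \<sigma>} = Pow ({..<k} - {l})" by auto
 show c: "card {\<sigma> \<in> Pow {..<k}. l \<notin> \<sigma>} = 2 ^ (k - 1)"
  unfolding * using l by (simp add: card_Pow)
 have "{\<sigma> \<in> Pow {..<k}. l \<in> \<sigma>} = Pow {..<k} - {\<sigma> \<in> Pow {..<k}. l \<notin> \<sigma>}" by blast
 then have "card {\<sigma> \<in> Pow {..<k}. l \<in> \<sigma>} = card (Pow {..<k}) - card {\<sigma> \<in> Pow {..<k}. l \<notin> \<sigma>}"
  by (simp only:) (rule card_Diff_subset, simp, blast)
 also have "\<dots> = 2 ^ k - 2 ^ (k - 1)" by (simp only: c card_Pow finite_lessThan card_lessThan)
 also have "\<dots> = 2 ^ (k - 1)"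
 proof -
  obtain m where "k = Suc m" using l by (cases k) auto
  then show ?thesis by simp
 qed
 finally show "card {\<sigma> \<in> Pow {..<k}. l \<in> \<sigma>} = 2 ^ (k - 1)" .
qed

lemma norm_sum_squared_le:
 fixes x :: "'b \<Rightarrow> 'c::real_normed_vector"
 shows "(norm (\<Sum>s\<in>A. x s))\<^sup>2 \<le> real (card A) * (\<Sum>s\<in>A. (norm (x s))\<^sup>2)"
proof -
 have "(norm (\<Sum>s\<in>A. x s))\<^sup>2 \<le> (\<Sum>s\<in>A. norm (x s))\<^sup>2"
  by (intro power_mono norm_sum) simp
 also have "\<dots> = (\<Sum>s\<in>A. 1 * norm (x s))\<^sup>2" by simp
 also have "\<dots> \<le> (\<Sum>s\<in>A. 1\<^sup>2) * (\<Sum>s\<in>A. (norm (x s))\<^sup>2)"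
  by (rule Cauchy_Schwarz_ineq_sum)
 finally show ?thesis by simp
qed

lemma hs_shift:
 assumes "l < k"
 shows "hs \<sigma> (v(l := v l + 1)) = (if odd (v l + (if l \<in> \<sigma> then 1 else 0)) then (hs \<sigma> v)(l := hs \<sigma> v l + 1) else hs \<sigma> v)"
proof -
 have "(a + 1) div 2 = (if odd a then a div 2 + 1 else a div 2)" for a :: int by (auto elim!: oddE evenE)
 from this[of "v l + (if l \<in> \<sigma> then 1 else 0)"] show ?thesis
  by (auto simp: hs_def fun_eq_iff add.commute add.left_commute add.assoc)
qed

text \<open>A unit step in direction \<open>l\<close> moves the rounded point only if the number
  being halved is odd, which happens for exactly half of the sets \<open>\<sigma>\<close>.
  Cauchy-Schwarz over these gives \<open>2 ^ (k - 1) / 4 ^ k\<close>.\<close>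

lemma pd_interp_le:
 assumes l: "l < k"
 shows "(norm (pd l (interp f) v))\<^sup>2 \<le> (1 / (2 * 2 ^ k)) *
  (\<Sum>\<sigma>\<in>Pow {..<k}. if odd (v l + (if l \<in> \<sigma> then 1 else 0)) then (norm (pd l f (hs \<sigma> v)))\<^sup>2 else 0)"
proof -
 let ?O = "{\<sigma> \<in> Pow {..<k}. odd (v l + (if l \<in> \<sigma> then 1 else 0))}"
 have "pd l (interp f) v = (1 / 2 ^ k) *\<^sub>R (\<Sum>\<sigma>\<in>Pow {..<k}. f (hs \<sigma> (v(l := v l + 1))) - f (hs \<sigma> v))"
  by (simp add: pd_def interp_def scaleR_diff_right sum_subtractf)
 also have "(\<Sum>\<sigma>\<in>Pow {..<k}. f (hs \<sigma> (v(l := v l + 1))) - f (hs \<sigma> v)) = (\<Sum>\<sigma>\<in>?O. pd l f (hs \<sigma> v))"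
  unfolding hs_shift[OF l]
  by (subst sum.inter_filter) (auto simp: pd_def intro!: sum.cong)
 finally have "(norm (pd l (interp f) v))\<^sup>2 = (1 / 2 ^ k)\<^sup>2 * (norm (\<Sum>\<sigma>\<in>?O. pd l f (hs \<sigma> v)))\<^sup>2"
  by (simp add: power_divide)
 also have "\<dots> \<le> (1 / 2 ^ k)\<^sup>2 * (real (card ?O) * (\<Sum>\<sigma>\<in>?O. (norm (pd l f (hs \<sigma> v)))\<^sup>2))"
  by (intro mult_left_mono norm_sum_squared_le) simp
 also have "card ?O = 2 ^ (k - 1)"
 proof (cases "odd (v l)")
  case True
  then have "?O = {\<sigma> \<in> Pow {..<k}. l \<notin> \<sigma>}" by auto
  then show ?thesis using card_Pow_half[OF l] by simp
 next
  case False
  then have "?O = {\<sigma> \<in> Pow {..<k}. l \<in> \<sigma>}" by auto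
  then show ?thesis using card_Pow_half[OF l] by simp
 qed
 also have "(\<Sum>\<sigma>\<in>?O. (norm (pd l f (hs \<sigma> v)))\<^sup>2) =
  (\<Sum>\<sigma>\<in>Pow {..<k}. if odd (v l + (if l \<in> \<sigma> then 1 else 0)) then (norm (pd l f (hs \<sigma> v)))\<^sup>2 else 0)"
  by (rule sum.inter_filter) simp
 also have "(1 / 2 ^ k)\<^sup>2 * (real (2 ^ (k - 1)) * S) = (1 / (2 * 2 ^ k)) * S" for S :: real
 proof -
  obtain m where "k = Suc m" using l by (cases k) auto
  then show ?thesis by (simp add: power2_eq_square field_simps)
 qed
 finally show ?thesis .
qed

definition ind :: "nat set \<Rightarrow> nat \<Rightarrow> int" where "ind \<sigma> i = (if i \<in> \<sigma> then 1 else 0)"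

lemma infsum_translate:
 fixes h :: "zv \<Rightarrow> real"
 assumes "\<sigma> \<subseteq> {..<k}"
 shows "infsum (\<lambda>v. h (\<lambda>i. v i + ind \<sigma> i)) Z = infsum h Z"
proof (rule infsum_reindex_bij_betw)
 show "bij_betw (\<lambda>v i. v i + ind \<sigma> i) Z Z"
  by (rule bij_betw_byWitness[where f'="\<lambda>v i. v i - ind \<sigma> i"]) (use assms in \<open>auto simp: Z_def ind_def\<close>)
qed

lemma fs_translate:
 assumes s: "\<sigma> \<subseteq> {..<k}" and f: "fs f"
 shows "fs (\<lambda>v. f (\<lambda>i. v i + ind \<sigma> i))"
proof -
 have "{v \<in> Z. f (\<lambda>i. v i + ind \<sigma> i) \<noteq> 0} \<subseteq> (\<lambda>v i. v i - ind \<sigma> i) ` {v \<in> Z. f v \<noteq> 0}"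
 proof
  fix v assume v: "v \<in> {v \<in> Z. f (\<lambda>i. v i + ind \<sigma> i) \<noteq> 0}"
  then have "(\<lambda>i. v i + ind \<sigma> i) \<in> {v \<in> Z. f v \<noteq> 0}" using s by (auto simp: Z_def ind_def)
  then show "v \<in> (\<lambda>v i. v i - ind \<sigma> i) ` {v \<in> Z. f v \<noteq> 0}"
   by (intro image_eqI[where x="\<lambda>i. v i + ind \<sigma> i"]) simp_all
 qed
 then show ?thesis using f unfolding fs_def by (meson finite_imageI finite_subset)
qed

definition par :: "zv \<Rightarrow> nat set" where "par v = {i. i < k \<and> odd (v i)}"

text \<open>The lattice points of a fixed parity pattern form a copy of the coarse lattice under
  \<open>half\<close>.\<close>

lemma infsum_par:
 fixes h :: "zv \<Rightarrow> real"
 assumes "\<sigma> \<subseteq> {..<k}"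
 shows "infsum (\<lambda>v. if par v = \<sigma> then h (half v) else 0) Z = infsum h Z"
proof -
 have "infsum (\<lambda>v. if par v = \<sigma> then h (half v) else 0) Z = infsum (\<lambda>v. h (half v)) {v \<in> Z. par v = \<sigma>}"
  by (rule infsum_cong_neutral) auto
 also have "\<dots> = infsum h Z"
 proof (rule infsum_reindex_bij_betw)
  show "bij_betw half {v \<in> Z. par v = \<sigma>} Z"
  proof (rule bij_betw_byWitness[where f'="\<lambda>u i. 2 * u i + ind \<sigma> i"])
   show "\<forall>v\<in>{v \<in> Z. par v = \<sigma>}. (\<lambda>i. 2 * half v i + ind \<sigma> i) = v"
   proof (intro ballI ext)
    fix v i assume v: "v \<in> {v \<in> Z. par v = \<sigma>}"
    then show "2 * half v i + ind \<sigma> i = v i"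
     by (cases "i < k") (auto simp: half_def ind_def par_def Z_def elim!: oddE evenE)
   qed
   show "\<forall>u\<in>Z. half (\<lambda>i. 2 * u i + ind \<sigma> i) = u"
    by (auto simp: half_def ind_def fun_eq_iff)
   show "half ` {v \<in> Z. par v = \<sigma>} \<subseteq> Z" using half_Z by auto
   show "(\<lambda>u i. 2 * u i + ind \<sigma> i) ` Z \<subseteq> {v \<in> Z. par v = \<sigma>}"
    using assms by (auto simp: Z_def ind_def par_def split: if_splits)
  qed
 qed
 finally show ?thesis .
qed

lemma fs_half:
 assumes "fs f"
 shows "fs (\<lambda>v. f (half v))"
proof -
 let ?S = "{v \<in> Z. f v \<noteq> 0}"
 have "{v \<in> Z. f (half v) \<noteq> 0} \<subseteq> (\<Union>u\<in>?S. {v \<in> Z. \<forall>i<k. v i \<in> {2 * u i..2 * u i + 1}})"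
 proof
  fix v assume v: "v \<in> {v \<in> Z. f (half v) \<noteq> 0}"
  then have "half v \<in> ?S" by (simp add: half_Z)
  moreover have "v i \<in> {2 * half v i..2 * half v i + 1}" for i by (auto simp: half_def)
  ultimately show "v \<in> (\<Union>u\<in>?S. {v \<in> Z. \<forall>i<k. v i \<in> {2 * u i..2 * u i + 1}})" using v by blast
 qed
 moreover have "finite (\<Union>u\<in>?S. {v \<in> Z. \<forall>i<k. v i \<in> {2 * u i..2 * u i + 1}})"
  using assms unfolding fs_def by (intro finite_UN_I card_Z_Pi(1)) (auto simp only: finite_atLeastAtMost_int)
 ultimately show ?thesis unfolding fs_def by (rule finite_subset)
qed

text \<open>After scaling by \<open>4 ^ j / (2 ^ j) ^ k\<close> the factor \<open>2 ^ k / 4\<close>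
  becomes 1, so interpolation does not increase the Dirichlet integral. A shift removes the
  dependence on \<open>\<sigma>\<close>, and each coarse difference is then met
  \<open>2 ^ (k - 1)\<close> times, once for each parity pattern that is odd in direction
  \<open>l\<close>.\<close>

lemma En_interp_le:
 assumes l: "l < k" and f: "fs f"
 shows "En l (interp f) \<le> 2 ^ k / 4 * En l f"
proof -
 let ?g = "\<lambda>v. (norm (pd l f v))\<^sup>2"
 let ?h = "\<lambda>x. if odd (x l) then ?g (half x) else 0"
 have g: "fs ?g" using fs_norm2[OF fs_pd[OF l f]] .
 have h: "fs ?h" using fs_half[OF g] by (rule fs_sub) auto
 have hsum: "infsum ?h Z = 2 ^ (k - 1) * infsum ?g Z"
 proof -
  let ?T = "{\<sigma> \<in> Pow {..<k}. l \<in> \<sigma>}"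
  have "infsum ?h Z = infsum (\<lambda>x. \<Sum>\<sigma>\<in>?T. if par x = \<sigma> then ?g (half x) else 0) Z"
  proof (rule infsum_cong)
   fix x
   have "(\<Sum>\<sigma>\<in>?T. if par x = \<sigma> then ?g (half x) else 0) = (if par x \<in> ?T then ?g (half x) else 0)"
    by (simp add: sum.delta)
   moreover have "par x \<in> ?T \<longleftrightarrow> odd (x l)" using l by (auto simp: par_def)
   ultimately show "?h x = (\<Sum>\<sigma>\<in>?T. if par x = \<sigma> then ?g (half x) else 0)" by simp
  qed
  also have "\<dots> = (\<Sum>\<sigma>\<in>?T. infsum (\<lambda>x. if par x = \<sigma> then ?g (half x) else 0) Z)"
   by (rule fs_sum) (simp, rule fs_sub[OF fs_half[OF g]], simp)
  also have "\<dots> = (\<Sum>\<sigma>\<in>?T. infsum ?g Z)"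
   by (intro sum.cong refl infsum_par) auto
  finally show ?thesis using card_Pow_half[OF l] by simp
 qed
 have hs: "hs \<sigma> v = half (\<lambda>i. v i + ind \<sigma> i)" for \<sigma> v by (simp add: hs_def half_def ind_def)
 have "En l (interp f) \<le> infsum (\<lambda>v. \<Sum>\<sigma>\<in>Pow {..<k}. (1 / (2 * 2 ^ k)) * ?h (\<lambda>i. v i + ind \<sigma> i)) Z"
  unfolding En_def
 proof (rule infsum_mono)
  show "(\<lambda>v. (norm (pd l (interp f) v))\<^sup>2) summable_on Z"
   by (intro fs_summable fs_norm2 fs_pd[OF l] fs_interp f)
  show "(\<lambda>v. \<Sum>\<sigma>\<in>Pow {..<k}. (1 / (2 * 2 ^ k)) * ?h (\<lambda>i. v i + ind \<sigma> i)) summable_on Z"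
   by (rule fs_summable, rule fs_sum) (simp, rule fs_sub[OF fs_translate[OF _ h]], auto)
  fix v
  show "(norm (pd l (interp f) v))\<^sup>2 \<le> (\<Sum>\<sigma>\<in>Pow {..<k}. (1 / (2 * 2 ^ k)) * ?h (\<lambda>i. v i + ind \<sigma> i))"
   using pd_interp_le[OF l, of f v] by (simp only: hs sum_distrib_left[symmetric] ind_def)
 qed
 also have "\<dots> = (\<Sum>\<sigma>\<in>Pow {..<k}. infsum (\<lambda>v. (1 / (2 * 2 ^ k)) * ?h (\<lambda>i. v i + ind \<sigma> i)) Z)"
  by (rule fs_sum) (simp, rule fs_sub[OF fs_translate[OF _ h]], auto)
 also have "\<dots> = (\<Sum>\<sigma>\<in>Pow {..<k}. (1 / (2 * 2 ^ k)) * infsum ?h Z)"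
 proof (rule sum.cong)
  fix \<sigma> assume s: "\<sigma> \<in> Pow {..<k}"
  have "infsum (\<lambda>v. (1 / (2 * 2 ^ k)) * ?h (\<lambda>i. v i + ind \<sigma> i)) Z = (1 / (2 * 2 ^ k)) * infsum (\<lambda>v. ?h (\<lambda>i. v i + ind \<sigma> i)) Z"
   by (rule infsum_cmult_right')
  also have "infsum (\<lambda>v. ?h (\<lambda>i. v i + ind \<sigma> i)) Z = infsum ?h Z"
   using s by (intro infsum_translate[of \<sigma> ?h]) auto
  finally show "infsum (\<lambda>v. (1 / (2 * 2 ^ k)) * ?h (\<lambda>i. v i + ind \<sigma> i)) Z = (1 / (2 * 2 ^ k)) * infsum ?h Z" .
 qed simp
 also have "\<dots> = infsum ?h Z / 2" by (simp add: card_Pow)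
 also have "\<dots> = 2 ^ k / 4 * En l f"
 proof -
  obtain m where "k = Suc m" using l by (cases k) auto
  then show ?thesis unfolding hsum En_def by simp
 qed
 finally show ?thesis .
qed

lemma fs_diff: "fs f \<Longrightarrow> fs g \<Longrightarrow> fs (\<lambda>v. f v - g v)" for f g :: "_ \<Rightarrow> real"
 unfolding fs_def by (rule finite_subset[of _ "{v \<in> Z. f v \<noteq> 0} \<union> {v \<in> Z. g v \<noteq> 0}"]) auto

lemma fs_cmult: "fs f \<Longrightarrow> fs (\<lambda>v. c * f v)" for f :: "_ \<Rightarrow> real"
 by (erule fs_sub) simp

lemma infsum_fs_add: "fs f \<Longrightarrow> fs g \<Longrightarrow> infsum (\<lambda>v. f v + g v) Z = infsum f Z + infsum g Z" for f g :: "_ \<Rightarrow> real"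
 by (intro infsum_add fs_summable)

lemma infsum_fs_diff: "fs f \<Longrightarrow> fs g \<Longrightarrow> infsum (\<lambda>v. f v - g v) Z = infsum f Z - infsum g Z" for f g :: "_ \<Rightarrow> real"
 using infsum_fs_add[of "\<lambda>v. f v - g v" g] fs_diff[of f g] by simp

text \<open>Summation by parts moves the difference in the cross term from \<open>g\<close> to
  \<open>F\<close>. What remains is a second difference of \<open>F\<close>, which is small where
  \<open>F\<close> is nearly affine, whereas first differences are of the size of the slope. The
  square of the difference of \<open>g\<close> is bounded by the parallelogram law.\<close>

lemma En_add_le:
 assumes l: "l < k" and F: "fs F" and U: "finite U" "U \<subseteq> Z" and g: "\<And>v. v \<in> Z \<Longrightarrow> v \<notin> U \<Longrightarrow> g v = 0"
 shows "En l (\<lambda>v. F v + g v) \<le> En l F + (\<Sum>v\<in>U.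
   2 * (norm (F (v(l := v l + 1)) - 2 *\<^sub>R F v + F (v(l := v l - 1))) * norm (g v)) + 4 * (norm (g v))\<^sup>2)"
proof -
 let ?D = "\<lambda>v. F (v(l := v l + 1)) - 2 *\<^sub>R F v + F (v(l := v l - 1))"
 have fg: "fs g" unfolding fs_def by (rule finite_subset[OF _ U(1)]) (use g in auto)
 have pF: "fs (\<lambda>v. (norm (pd l F v))\<^sup>2)" by (intro fs_norm2 fs_pd l F)
 have g2: "fs (\<lambda>v. (norm (g v))\<^sup>2)" by (intro fs_norm2 fg)
 have g2s: "fs (\<lambda>v. (norm (g (v(l := v l + 1))))\<^sup>2)" by (intro fs_norm2 fs_shift l fg)
 have c1: "fs (\<lambda>v. pd l F v \<bullet> g (v(l := v l + 1)))" using fs_shift[OF l fg, of 1] by (rule fs_sub) simp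
 have c2: "fs (\<lambda>v. pd l F v \<bullet> g v)" using fg by (rule fs_sub) simp
 have c3: "fs (\<lambda>v. pd l F (v(l := v l - 1)) \<bullet> g v)" using fg by (rule fs_sub) simp
 have cn: "fs (\<lambda>v. norm (?D v) * norm (g v))" using fg by (rule fs_sub) simp
 have pw: "(norm (pd l (\<lambda>v. F v + g v) v))\<^sup>2 \<le> (norm (pd l F v))\<^sup>2 + 2 * (pd l F v \<bullet> g (v(l := v l + 1)) - pd l F v \<bullet> g v)
   + 2 * ((norm (g (v(l := v l + 1))))\<^sup>2 + (norm (g v))\<^sup>2)" for v
 proof -
  let ?a = "pd l F v" let ?b = "g (v(l := v l + 1))" let ?c = "g v"
  have "pd l (\<lambda>v. F v + g v) v = ?a + (?b - ?c)" by (simp add: pd_def)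
  then have "(norm (pd l (\<lambda>v. F v + g v) v))\<^sup>2 = (norm ?a)\<^sup>2 + 2 * (?a \<bullet> (?b - ?c)) + (norm (?b - ?c))\<^sup>2"
   by (simp add: power2_norm_eq_inner inner_add_left inner_add_right inner_commute)
  moreover have "(norm (?b - ?c))\<^sup>2 \<le> 2 * ((norm ?b)\<^sup>2 + (norm ?c)\<^sup>2)"
  proof -
   have "(norm (?b - ?c))\<^sup>2 + (norm (?b + ?c))\<^sup>2 = 2 * ((norm ?b)\<^sup>2 + (norm ?c)\<^sup>2)"
    by (simp add: power2_norm_eq_inner inner_add_left inner_add_right inner_diff_left inner_diff_right inner_commute)
   moreover have "0 \<le> (norm (?b + ?c))\<^sup>2" by simp
   ultimately show ?thesis by linarith
  qed
  ultimately show ?thesis by (simp add: inner_diff_right)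
 qed
 have "En l (\<lambda>v. F v + g v) \<le> infsum (\<lambda>v. (norm (pd l F v))\<^sup>2 + (2 * (pd l F v \<bullet> g (v(l := v l + 1)) - pd l F v \<bullet> g v)
   + 2 * ((norm (g (v(l := v l + 1))))\<^sup>2 + (norm (g v))\<^sup>2))) Z"
  unfolding En_def
 proof (rule infsum_mono)
  show "(\<lambda>v. (norm (pd l (\<lambda>v. F v + g v) v))\<^sup>2) summable_on Z"
   by (intro fs_summable fs_norm2 fs_pd l fs_add F fg)
  show "(\<lambda>v. (norm (pd l F v))\<^sup>2 + (2 * (pd l F v \<bullet> g (v(l := v l + 1)) - pd l F v \<bullet> g v)
   + 2 * ((norm (g (v(l := v l + 1))))\<^sup>2 + (norm (g v))\<^sup>2))) summable_on Z"
   by (intro fs_summable fs_add fs_cmult fs_diff pF c1 c2 g2 g2s)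
  fix v
  show "(norm (pd l (\<lambda>v. F v + g v) v))\<^sup>2 \<le> (norm (pd l F v))\<^sup>2 + (2 * (pd l F v \<bullet> g (v(l := v l + 1)) - pd l F v \<bullet> g v)
   + 2 * ((norm (g (v(l := v l + 1))))\<^sup>2 + (norm (g v))\<^sup>2))"
   using pw[of v] by (simp only: add.assoc)
 qed
 also have "\<dots> = En l F + (2 * (infsum (\<lambda>v. pd l F v \<bullet> g (v(l := v l + 1))) Z - infsum (\<lambda>v. pd l F v \<bullet> g v) Z)
   + 2 * (infsum (\<lambda>v. (norm (g (v(l := v l + 1))))\<^sup>2) Z + infsum (\<lambda>v. (norm (g v))\<^sup>2) Z))"
  unfolding En_def
  by (simp only: infsum_fs_add infsum_fs_diff infsum_cmult_right' fs_add fs_cmult fs_diff pF c1 c2 g2 g2s)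
 also have "infsum (\<lambda>v. (norm (g (v(l := v l + 1))))\<^sup>2) Z = infsum (\<lambda>v. (norm (g v))\<^sup>2) Z"
  by (rule infsum_shift[OF l, of "\<lambda>v. (norm (g v))\<^sup>2"])
 also have "infsum (\<lambda>v. pd l F v \<bullet> g (v(l := v l + 1))) Z = infsum (\<lambda>v. pd l F (v(l := v l - 1)) \<bullet> g v) Z"
  using infsum_shift[OF l, of "\<lambda>v. pd l F (v(l := v l - 1)) \<bullet> g v" 1] by simp
 also have "infsum (\<lambda>v. pd l F (v(l := v l - 1)) \<bullet> g v) Z - infsum (\<lambda>v. pd l F v \<bullet> g v) Z
   = infsum (\<lambda>v. pd l F (v(l := v l - 1)) \<bullet> g v - pd l F v \<bullet> g v) Z"
  by (rule infsum_fs_diff[symmetric]) (rule c3 c2)+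
 also have "\<dots> \<le> infsum (\<lambda>v. norm (?D v) * norm (g v)) Z"
 proof (rule infsum_mono)
  show "(\<lambda>v. pd l F (v(l := v l - 1)) \<bullet> g v - pd l F v \<bullet> g v) summable_on Z"
   by (intro fs_diff fs_summable c3 c2)
  fix v
  have "pd l F (v(l := v l - 1)) \<bullet> g v - pd l F v \<bullet> g v = (- ?D v) \<bullet> g v"
   by (simp add: pd_def inner_diff_left inner_add_left scaleR_2)
  also have "\<dots> \<le> norm (- ?D v) * norm (g v)" by (rule norm_cauchy_schwarz)
  finally show "pd l F (v(l := v l - 1)) \<bullet> g v - pd l F v \<bullet> g v \<le> norm (?D v) * norm (g v)"
   by (simp only: norm_minus_cancel)
 qed (intro fs_summable cn)
 also have "infsum (\<lambda>v. norm (?D v) * norm (g v)) Z = (\<Sum>v\<in>U. norm (?D v) * norm (g v))"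
  by (rule fs_infsum[OF U]) (use g in auto)
 also have "infsum (\<lambda>v. (norm (g v))\<^sup>2) Z = (\<Sum>v\<in>U. (norm (g v))\<^sup>2)"
  by (rule fs_infsum[OF U]) (use g in auto)
 finally have R: "En l (\<lambda>v. F v + g v) \<le> En l F + (2 * (\<Sum>v\<in>U. norm (?D v) * norm (g v))
   + 2 * ((\<Sum>v\<in>U. (norm (g v))\<^sup>2) + (\<Sum>v\<in>U. (norm (g v))\<^sup>2)))"
  by (simp add: fun_upd_def)
 have "(\<Sum>v\<in>U. 2 * (norm (?D v) * norm (g v)) + 4 * (norm (g v))\<^sup>2)
   = 2 * (\<Sum>v\<in>U. norm (?D v) * norm (g v)) + 4 * (\<Sum>v\<in>U. (norm (g v))\<^sup>2)"
  by (simp only: sum.distrib sum_distrib_left)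
 moreover have "a \<le> e + s" if "a \<le> e + (2 * p + 2 * (q + q))" "s = 2 * p + 4 * q" for a e s p q :: real
  using that by simp
 ultimately show ?thesis using R by blast
qed

text \<open>Summing the differences over the box telescopes, so the deviation from the affine map
  enters only on two opposite faces of \<open>N ^ (k - 1)\<close> points each. By \<open>D\<close>
  it cannot cancel more than half of the slope term; Cauchy-Schwarz then passes to the
  energy.\<close>

lemma box_slope_energy:
 fixes B :: "zv \<Rightarrow> 'a" and N :: nat
 assumes l: "l < k" and N: "0 < N"
  and B: "\<And>v. v \<in> Z \<Longrightarrow> B (v(l := v l + 1)) - B v = b"
  and close: "\<And>v. v \<in> Z \<Longrightarrow> (\<And>i. i < k \<Longrightarrow> a i \<le> v i \<and> v i \<le> a i + int N) \<Longrightarrow> norm (f v - B v) \<le> D"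
  and D: "4 * D \<le> real N * norm b"
 shows "real N ^ k * ((norm b)\<^sup>2 / 4) \<le> (\<Sum>v\<in>{v \<in> Z. \<forall>i<k. v i \<in> {a i..<a i + int N}}. (norm (pd l f v))\<^sup>2)"
proof -
 let ?Q = "{v \<in> Z. \<forall>i<k. v i \<in> {a i..<a i + int N}}"
 let ?T = "{v \<in> Z. \<forall>i<k. v i \<in> (if i = l then {a l + int N} else {a i..<a i + int N})}"
 let ?L = "{v \<in> Z. \<forall>i<k. v i \<in> (if i = l then {a l} else {a i..<a i + int N})}"
 let ?s = "\<lambda>v. v(l := v l + (1::int))"
 define er where "er v = f v - B v" for v
 have cQ: "finite ?Q" "card ?Q = N ^ k"
 proof -
  show "finite ?Q" by (rule card_Z_Pi(1)) simp
  have "card ?Q = (\<Prod>i<k. card {a i..<a i + int N})" by (rule card_Z_Pi(2)) simp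
  then show "card ?Q = N ^ k" by simp
 qed
 have cT: "finite ?T" "card ?T = N ^ (k - 1)"
 proof -
  show "finite ?T" by (rule card_Z_Pi(1)) simp
  have "card ?T = (\<Prod>i<k. card (if i = l then {a l + int N} else {a i..<a i + int N}))" by (rule card_Z_Pi(2)) simp
  also have "\<dots> = card {a l + int N} * (\<Prod>i\<in>{..<k} - {l}. N)"
   using l by (subst prod.remove[of _ l]) (auto intro!: prod.cong)
  finally show "card ?T = N ^ (k - 1)" using l by simp
 qed
 have cL: "finite ?L" "card ?L = N ^ (k - 1)"
 proof -
  show "finite ?L" by (rule card_Z_Pi(1)) simp
  have "card ?L = (\<Prod>i<k. card (if i = l then {a l} else {a i..<a i + int N}))" by (rule card_Z_Pi(2)) simp
  also have "\<dots> = card {a l} * (\<Prod>i\<in>{..<k} - {l}. N)"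
   using l by (subst prod.remove[of _ l]) (auto intro!: prod.cong)
  finally show "card ?L = N ^ (k - 1)" using l by simp
 qed
 have er: "norm (er v) \<le> D" if "v \<in> Z" "\<And>i. i < k \<Longrightarrow> a i \<le> v i \<and> v i \<le> a i + int N" for v
  using close[OF that] by (simp add: er_def)
 have shift: "(\<Sum>v\<in>?Q. er (?s v)) = sum er ?Q - sum er ?L + sum er ?T"
 proof -
  have "(\<Sum>v\<in>?Q. er (?s v)) = sum er ((?Q - ?L) \<union> ?T)"
  \<comment> \<open>Shifting the box by one in direction \<open>l\<close> drops its lowest layer
    \<open>?L\<close> and adds the layer \<open>?T\<close> just above it.\<close>
  proof (rule sum.reindex_bij_witness[where i="\<lambda>v. v(l := v l - 1)" and j="?s"])
   fix v assume v: "v \<in> ?Q"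
   show "?s v \<in> (?Q - ?L) \<union> ?T"
   proof (cases "v l = a l + int N - 1")
    case True
    then have "?s v \<in> ?T" using v l by (auto simp: Z_def)
    then show ?thesis by blast
   next
    case False
    have vl: "a l \<le> v l \<and> v l < a l + int N" using v l by auto
    have "?s v \<in> ?Q" using v vl False l by (auto simp: Z_def)
    moreover have "?s v \<notin> ?L"
    proof
     assume "?s v \<in> ?L"
     then have "?s v l \<in> {a l}" using l by force
     then show False using vl by simp
    qed
    ultimately show ?thesis by blast
   qed
  next
   fix v assume v: "v \<in> (?Q - ?L) \<union> ?T"
   show "v(l := v l - 1) \<in> ?Q"
   proof (cases "v \<in> ?T")
    case True
    then have "v l = a l + int N" "v \<in> Z" "\<And>i. i < k \<Longrightarrow> i \<noteq> l \<Longrightarrow> v i \<in> {a i..<a i + int N}" using l by force+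
    then show ?thesis using N l by (auto simp: Z_def)
   next
    case False
    then have vQ: "v \<in> ?Q" "v \<notin> ?L" using v by auto
    have "v l \<noteq> a l"
    proof
     assume "v l = a l"
     then have "v \<in> ?L" using vQ(1) by auto
     then show False using vQ by blast
    qed
    then show ?thesis using vQ(1) l by (auto simp: Z_def)
   qed
  qed auto
  also have "\<dots> = sum er (?Q - ?L) + sum er ?T"
  proof (rule sum.union_disjoint)
   show "(?Q - ?L) \<inter> ?T = {}"
   proof (rule ccontr)
    assume "(?Q - ?L) \<inter> ?T \<noteq> {}"
    then obtain v where v: "v \<in> ?Q" "v \<in> ?T" by blast
    have "v l < a l + int N" using v(1) l by auto
    moreover have "v l = a l + int N" using v(2) l by force
    ultimately show False by simp
   qed
   show "finite (?Q - ?L)" using cQ(1) by (rule finite_Diff)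
   show "finite ?T" by (rule cT(1))
  qed
  also have "sum er (?Q - ?L) = sum er ?Q - sum er ?L"
  proof (rule sum_diff[OF cQ(1)])
   show "?L \<subseteq> ?Q"
   proof
    fix v assume v: "v \<in> ?L"
    have "v i \<in> {a i..<a i + int N}" if "i < k" for i
    proof -
     have "v i \<in> (if i = l then {a l} else {a i..<a i + int N})" using v that by blast
     then show ?thesis using N by (cases "i = l") simp_all
    qed
    then show "v \<in> ?Q" using v by blast
   qed
  qed
  finally show ?thesis .
 qed
 have "(\<Sum>v\<in>?Q. pd l f v) = (\<Sum>v\<in>?Q. b + (er (?s v) - er v))"
 proof (rule sum.cong)
  fix v assume "v \<in> ?Q"
  then show "pd l f v = b + (er (?s v) - er v)"
   using B[of v] by (simp add: pd_def er_def algebra_simps)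
 qed simp
 also have "\<dots> = real (N ^ k) *\<^sub>R b + ((\<Sum>v\<in>?Q. er (?s v)) - sum er ?Q)"
  by (simp only: sum.distrib sum_subtractf sum_constant_scaleR cQ)
 also have "\<dots> = real (N ^ k) *\<^sub>R b - sum er ?L + sum er ?T" by (simp only: shift) simp
 finally have "real (N ^ k) *\<^sub>R b = (\<Sum>v\<in>?Q. pd l f v) + sum er ?L - sum er ?T" by simp
 then have "norm (real (N ^ k) *\<^sub>R b) \<le> norm (\<Sum>v\<in>?Q. pd l f v) + norm (sum er ?L) + norm (sum er ?T)"
  by (simp only:) (intro order_trans[OF norm_triangle_ineq4] add_right_mono norm_triangle_ineq)
 also have "norm (sum er ?L) \<le> (\<Sum>v\<in>?L. D)"
 proof (rule sum_norm_le)
  fix v assume v: "v \<in> ?L"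
  have "a i \<le> v i \<and> v i \<le> a i + int N" if "i < k" for i
  proof -
   have "v i \<in> (if i = l then {a l} else {a i..<a i + int N})" using v that by blast
   then show ?thesis by (auto split: if_splits)
  qed
  then show "norm (er v) \<le> D" using v by (intro er) auto
 qed
 also have "norm (sum er ?T) \<le> (\<Sum>v\<in>?T. D)"
 proof (rule sum_norm_le)
  fix v assume v: "v \<in> ?T"
  have "a i \<le> v i \<and> v i \<le> a i + int N" if "i < k" for i
  proof -
   have "v i \<in> (if i = l then {a l + int N} else {a i..<a i + int N})" using v that by blast
   then show ?thesis by (auto split: if_splits)
  qed
  then show "norm (er v) \<le> D" using v by (intro er) auto
 qed
 finally have "norm (real (N ^ k) *\<^sub>R b) \<le> norm (\<Sum>v\<in>?Q. pd l f v) + real N ^ (k - 1) * D + real N ^ (k - 1) * D"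
  by (simp only: sum_constant cL cT of_nat_power)
 moreover have "norm (real (N ^ k) *\<^sub>R b) = real N ^ k * norm b" by simp
 ultimately have "real N ^ k * norm b \<le> norm (\<Sum>v\<in>?Q. pd l f v) + 2 * (real N ^ (k - 1) * D)"
  by linarith
 moreover have "2 * (real N ^ (k - 1) * D) \<le> real N ^ k * norm b / 2"
 proof -
  have "real N ^ k = real N ^ (k - 1) * real N" using l by (cases k) auto
  then show ?thesis using mult_left_mono[OF D, of "real N ^ (k - 1)"] by (simp add: mult_ac)
 qed
 ultimately have "real N ^ k * norm b / 2 \<le> norm (\<Sum>v\<in>?Q. pd l f v)" by linarith
 then have "(real N ^ k * norm b / 2)\<^sup>2 \<le> (norm (\<Sum>v\<in>?Q. pd l f v))\<^sup>2" by (intro power_mono) auto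
 also have "\<dots> \<le> real (card ?Q) * (\<Sum>v\<in>?Q. (norm (pd l f v))\<^sup>2)" by (rule norm_sum_squared_le)
 finally have "(real N ^ k * norm b / 2)\<^sup>2 \<le> real N ^ k * (\<Sum>v\<in>?Q. (norm (pd l f v))\<^sup>2)"
  unfolding cQ by simp
 moreover have "(real N ^ k * norm b / 2)\<^sup>2 = real N ^ k * (real N ^ k * ((norm b)\<^sup>2 / 4))"
  by (simp add: power2_eq_square)
 ultimately have "real N ^ k * (real N ^ k * ((norm b)\<^sup>2 / 4)) \<le> real N ^ k * (\<Sum>v\<in>?Q. (norm (pd l f v))\<^sup>2)"
  by simp
 then show ?thesis using N by (simp only: mult_le_cancel_left_pos zero_less_power of_nat_0_less_iff)
qed

end

lemma (in frame) energy_boxes: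
 assumes l: "l < k" and f: "fs f" and I: "finite I" "disjoint_family_on B I" "\<And>i. i \<in> I \<Longrightarrow> B i \<subseteq> Z \<and> finite (B i)"
 shows "(\<Sum>i\<in>I. \<Sum>v\<in>B i. (norm (pd l f v))\<^sup>2) \<le> En l f"
proof -
 have "(\<Sum>i\<in>I. \<Sum>v\<in>B i. (norm (pd l f v))\<^sup>2) = (\<Sum>v\<in>(\<Union>i\<in>I. B i). (norm (pd l f v))\<^sup>2)"
  using I by (intro sum.UNION_disjoint[symmetric]) (auto simp: disjoint_family_on_def)
 also have "\<dots> \<le> En l f"
  unfolding En_def by (intro finite_sum_le_infsum fs_summable fs_norm2 fs_pd l f) (use I in auto)
 finally show ?thesis .
qed

section \<open>Lattice functions following the fits\<close>

context frame
begin

definition pt :: "nat \<Rightarrow> zv \<Rightarrow> nat \<Rightarrow> real" where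
 "pt j v = (\<lambda>i. real_of_int (v i) / 2 ^ j)"

definition cor :: "zv \<Rightarrow> zv \<Rightarrow> bool" where
 "cor z v \<longleftrightarrow> (\<forall>i<k. v i = z i \<or> v i = z i + 1)"

lemma sum_hs:
 assumes i: "i < k"
 shows "(\<Sum>\<sigma>\<in>Pow {..<k}. hs \<sigma> v i) = 2 ^ (k - 1) * v i"
proof -
 have "(\<Sum>\<sigma>\<in>Pow {..<k}. hs \<sigma> v i) = (\<Sum>\<sigma>\<in>Pow {..<k}. if i \<in> \<sigma> then (v i + 1) div 2 else v i div 2)"
  by (intro sum.cong) (auto simp: hs_def)
 also have "\<dots> = (\<Sum>\<sigma>\<in>{\<sigma> \<in> Pow {..<k}. i \<in> \<sigma>}. (v i + 1) div 2) + (\<Sum>\<sigma>\<in>{\<sigma> \<in> Pow {..<k}. i \<notin> \<sigma>}. v i div 2)"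
  by (subst sum.If_cases) (auto simp: Int_def)
 also have "\<dots> = 2 ^ (k - 1) * ((v i + 1) div 2 + v i div 2)"
  by (simp only: sum_constant card_Pow_half[OF i] of_nat_power of_nat_numeral distrib_left)
 also have "(v i + 1) div 2 + v i div 2 = v i" by linarith
 finally show ?thesis .
qed

text \<open>The roundings of \<open>v\<close> average to \<open>v / 2\<close> in each coordinate,
  and affine maps commute with averages.\<close>

lemma interp_af: "interp (\<lambda>u. af A (pt j u)) v = af A (pt (Suc j) v)"
proof -
 have "(\<Sum>\<sigma>\<in>Pow {..<k}. af A (pt j (hs \<sigma> v))) = 2 ^ k *\<^sub>R fst A + (\<Sum>\<sigma>\<in>Pow {..<k}. \<Sum>i<k. pt j (hs \<sigma> v) i *\<^sub>R snd A i)"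
  by (simp add: af_def sum.distrib sum_constant_scaleR card_Pow)
 also have "(\<Sum>\<sigma>\<in>Pow {..<k}. \<Sum>i<k. pt j (hs \<sigma> v) i *\<^sub>R snd A i) = (\<Sum>i<k. (\<Sum>\<sigma>\<in>Pow {..<k}. pt j (hs \<sigma> v) i) *\<^sub>R snd A i)"
  by (subst sum.swap) (simp add: scaleR_sum_left)
 also have "\<dots> = (\<Sum>i<k. (2 ^ k * pt (Suc j) v i) *\<^sub>R snd A i)"
 proof (rule sum.cong)
  fix i assume "i \<in> {..<k}"
  then have i: "i < k" by simp
  have "(\<Sum>\<sigma>\<in>Pow {..<k}. pt j (hs \<sigma> v) i) = real_of_int (\<Sum>\<sigma>\<in>Pow {..<k}. hs \<sigma> v i) / 2 ^ j"
   by (simp add: pt_def sum_divide_distrib)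
  also have "\<dots> = 2 ^ (k - 1) * real_of_int (v i) / 2 ^ j" by (simp add: sum_hs[OF i])
  also have "\<dots> = 2 ^ k * pt (Suc j) v i"
  proof -
   obtain m where "k = Suc m" using i by (cases k) auto
   then show ?thesis by (simp add: pt_def)
  qed
  finally show "(\<Sum>\<sigma>\<in>Pow {..<k}. pt j (hs \<sigma> v) i) *\<^sub>R snd A i = (2 ^ k * pt (Suc j) v i) *\<^sub>R snd A i" by simp
 qed simp
 also have "\<dots> = 2 ^ k *\<^sub>R (\<Sum>i<k. pt (Suc j) v i *\<^sub>R snd A i)" by (simp add: scaleR_sum_right)
 finally show ?thesis by (simp add: interp_def af_def scaleR_add_right)
qed

lemma interp_close:
 assumes "\<And>\<sigma>. \<sigma> \<subseteq> {..<k} \<Longrightarrow> norm (f (hs \<sigma> v) - g (hs \<sigma> v)) \<le> d"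
 shows "norm (interp f v - interp g v) \<le> d"
proof -
 have "interp f v - interp g v = (1 / 2 ^ k) *\<^sub>R (\<Sum>\<sigma>\<in>Pow {..<k}. f (hs \<sigma> v) - g (hs \<sigma> v))"
  by (simp add: interp_def scaleR_diff_right sum_subtractf)
 then have "norm (interp f v - interp g v) = (1 / 2 ^ k) * norm (\<Sum>\<sigma>\<in>Pow {..<k}. f (hs \<sigma> v) - g (hs \<sigma> v))"
  by simp
 also have "\<dots> \<le> (1 / 2 ^ k) * (\<Sum>\<sigma>\<in>Pow {..<k}. d)"
  by (intro mult_left_mono sum_norm_le) (use assms in auto)
 finally show ?thesis by (simp add: card_Pow)
qed

lemma finite_near: "finite {w \<in> Z. \<forall>i<k. w i \<in> {z i - n..z i + n}}" for n :: int
 by (rule card_Z_Pi(1)) (rule finite_atLeastAtMost_int)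

end

context key
begin

text \<open>Near active cells \<open>ff j\<close> follows the affine fits; elsewhere it interpolates the previous level, so that
its energy grows only at active cells.\<close>

definition UU :: "nat \<Rightarrow> zv set" where
 "UU j = {v \<in> Z. \<exists>z\<in>Act j. cor z v}"

definition zc :: "nat \<Rightarrow> zv \<Rightarrow> nat \<Rightarrow> int" where
 "zc j v = (SOME z. z \<in> Act j \<and> cor z v)"

primrec ff :: "nat \<Rightarrow> zv \<Rightarrow> 'a" where
 "ff 0 = (\<lambda>_. 0)"
| "ff (Suc j) = (\<lambda>v. if v \<in> UU (Suc j) then af (Af (Suc j) (zc (Suc j) v)) (pt (Suc j) v) else interp (ff j) v)"

text \<open>Two steps are enough: the cell selected by \<open>zc\<close> at a lattice point is
  adjacent to some neighbour of \<open>z\<close>.\<close>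

definition near :: "nat \<Rightarrow> zv \<Rightarrow> zv set" where
 "near j z = {w \<in> Act j. \<forall>i<k. w i \<in> {z i - 2..z i + 2}}"

definition nb :: "nat \<Rightarrow> zv \<Rightarrow> real" where "nb j z = (\<Sum>w\<in>near j z. bb j w)"

text \<open>Collects the flatness of a cell and of all cells near its parent; the factor
  \<open>2 ^ (k + 2)\<close> is the change of scale in \<open>compare_parent\<close>.\<close>

definition QQ :: "nat \<Rightarrow> zv \<Rightarrow> real" where
 "QQ j z = 2 ^ (k + 2) * (bb (Suc j) z + nb j (half z))"

lemma finite_near': "finite (near j z)"
 by (rule finite_subset[OF _ finite_near[of z 2]]) (use Act_Z in \<open>auto simp: near_def\<close>)

lemma nb_nonneg: "0 \<le> nb j z" unfolding nb_def by (intro sum_nonneg bb_nonneg)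

lemma bb_le_nb: "w \<in> near j z \<Longrightarrow> bb j w \<le> nb j z"
 unfolding nb_def by (intro member_le_sum finite_near' bb_nonneg)

lemma nb_le: "c \<ge> 0 \<Longrightarrow> (\<And>w. w \<in> Act j \<Longrightarrow> bb j w \<le> c) \<Longrightarrow> nb j z \<le> 5 ^ k * c"
proof -
 assume c: "c \<ge> 0" and b: "\<And>w. w \<in> Act j \<Longrightarrow> bb j w \<le> c"
 have "nb j z \<le> (\<Sum>w\<in>near j z. c)" unfolding nb_def using b by (intro sum_mono) (auto simp: near_def)
 also have "\<dots> = real (card (near j z)) * c" by simp
 also have "\<dots> \<le> 5 ^ k * c"
 proof (rule mult_right_mono[OF _ c])
  have "card (near j z) \<le> card {w \<in> Z. \<forall>i<k. w i \<in> {z i - 2..z i + 2}}"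
   by (rule card_mono[OF finite_near]) (use Act_Z in \<open>auto simp: near_def\<close>)
  also have "\<dots> = (\<Prod>i<k. card {z i - 2..z i + 2})" by (rule card_Z_Pi(2)) simp
  also have "\<dots> = 5 ^ k" by simp
  finally have "real (card (near j z)) \<le> real (5 ^ k)" by (simp only: of_nat_le_iff)
  then show "real (card (near j z)) \<le> 5 ^ k" by simp
 qed
 finally show ?thesis .
qed

lemma zc: "v \<in> UU j \<Longrightarrow> zc j v \<in> Act j \<and> cor (zc j v) v"
 unfolding zc_def by (rule someI_ex[of "\<lambda>z. z \<in> Act j \<and> cor z v"]) (simp add: UU_def Bex_def)

lemma ff_UU: "v \<in> UU j \<Longrightarrow> ff j v = af (Af j (zc j v)) (pt j v)"
 by (cases j) (auto simp: Af_def af_def)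

lemma QQ_nonneg: "0 \<le> QQ j z" using bb_nonneg nb_nonneg by (simp add: QQ_def)

text \<open>The fit selected at \<open>u\<close> may belong to a cell two steps from
  \<open>w\<close>. The comparison passes through an intermediate active cell, which is adjacent to
  both and has \<open>u\<close> as a corner.\<close>

lemma ff_near_parent:
 assumes w: "w \<in> Act j" "\<And>w'. w' \<in> Z \<Longrightarrow> adj w' w \<Longrightarrow> w' \<in> Act j"
  and u: "u \<in> Z" "\<And>i. i < k \<Longrightarrow> w i - 1 \<le> u i \<and> u i \<le> w i + 2"
 shows "norm (ff j u - af (Af j w) (pt j u)) \<le> 2 * CS * sqrt (2 * nb j w) / 2 ^ j"
proof -
 \<comment> \<open>Clamping \<open>u i - 1\<close> to within one of \<open>w i\<close> produces a
   neighbour of \<open>w\<close> that has \<open>u\<close> as a corner.\<close>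
 define w' where "w' = (\<lambda>i. if i < k then max (w i - 1) (min (w i + 1) (u i - 1)) else 0)"
 have w'Z: "w' \<in> Z" by (simp add: w'_def Z_def)
 have aw': "adj w' w" by (auto simp: adj_def w'_def)
 have w'A: "w' \<in> Act j" using w(2) w'Z aw' by blast
 have cw': "cor w' u" unfolding cor_def
 proof (intro allI impI)
  fix i assume i: "i < k"
  then show "u i = w' i \<or> u i = w' i + 1" using u(2)[OF i] by (simp add: w'_def) linarith
 qed
 have uU: "u \<in> UU j" using u(1) w'A cw' by (auto simp: UU_def)
 define z0 where "z0 = zc j u"
 have z0: "z0 \<in> Act j" "cor z0 u" using zc[OF uU] by (auto simp: z0_def)
 have az0: "adj z0 w'" unfolding adj_def
 proof (intro allI impI)
  fix i assume i: "i < k"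
  have "u i = z0 i \<or> u i = z0 i + 1" "u i = w' i \<or> u i = w' i + 1"
   using z0(2) cw' i by (simp_all add: cor_def)
  then show "\<bar>z0 i - w' i\<bar> \<le> 1" by auto
 qed
 have near: "z0 \<in> near j w" "w' \<in> near j w" "w \<in> near j w"
 proof -
  have "\<bar>z0 i - w' i\<bar> \<le> 1 \<and> \<bar>w' i - w i\<bar> \<le> 1" if "i < k" for i
   using az0 aw' that by (auto simp: adj_def)
  then show "z0 \<in> near j w" "w' \<in> near j w" using z0 w'A by (force simp: near_def)+
  show "w \<in> near j w" using w by (simp add: near_def)
 qed
 have p: "\<bar>pt j u i - real_of_int (z i) / 2 ^ j\<bar> \<le> 10 / 2 ^ j" if "cor z u" "i < k" for z i
 proof -
  have "\<bar>real_of_int (u i) - real_of_int (z i)\<bar> \<le> 10" using that by (auto simp: cor_def)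
  then have "\<bar>real_of_int (u i) - real_of_int (z i)\<bar> / 2 ^ j \<le> 10 / 2 ^ j" by (rule divide_right_mono) simp
  then show ?thesis by (simp add: pt_def diff_divide_distrib[symmetric])
 qed
 have 1: "norm (af (Af j z0) (pt j u) - af (Af j w') (pt j u)) \<le> CS * sqrt (bb j z0 + bb j w') / 2 ^ j"
  by (rule compare_adj(2)[OF z0(1) w'A az0 p[OF z0(2)]])
 have 2: "norm (af (Af j w') (pt j u) - af (Af j w) (pt j u)) \<le> CS * sqrt (bb j w' + bb j w) / 2 ^ j"
  by (rule compare_adj(2)[OF w'A w(1) aw' p[OF cw']])
 have s: "CS * sqrt (bb j a + bb j b) / 2 ^ j \<le> CS * sqrt (2 * nb j w) / 2 ^ j" if "a \<in> near j w" "b \<in> near j w" for a b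
  using CS_pos bb_le_nb[OF that(1)] bb_le_nb[OF that(2)] by (intro divide_right_mono mult_left_mono) auto
 have "ff j u - af (Af j w) (pt j u) = (af (Af j z0) (pt j u) - af (Af j w') (pt j u)) + (af (Af j w') (pt j u) - af (Af j w) (pt j u))"
  using ff_UU[OF uU] by (simp add: z0_def)
 then have "norm (ff j u - af (Af j w) (pt j u)) \<le> norm (af (Af j z0) (pt j u) - af (Af j w') (pt j u)) + norm (af (Af j w') (pt j u) - af (Af j w) (pt j u))"
  by (simp only: norm_triangle_ineq)
 also have "\<dots> \<le> CS * sqrt (2 * nb j w) / 2 ^ j + CS * sqrt (2 * nb j w) / 2 ^ j"
  using 1 2 s[OF near(1,2)] s[OF near(2,3)] by linarith
 finally show ?thesis by simp
qed

text \<open>Interpolation reproduces the affine map, so only the error at the coarse points remains.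
  The range of \<open>v\<close> exceeds the corners of the children of \<open>w\<close> by one on
  each side, as second differences there require.\<close>

lemma interp_ff_close:
 assumes w: "w \<in> Act j" "\<And>w'. w' \<in> Z \<Longrightarrow> adj w' w \<Longrightarrow> w' \<in> Act j"
  and v: "v \<in> Z" "\<And>i. i < k \<Longrightarrow> 2 * w i - 1 \<le> v i \<and> v i \<le> 2 * w i + 3"
 shows "norm (interp (ff j) v - af (Af j w) (pt (Suc j) v)) \<le> 2 * CS * sqrt (2 * nb j w) / 2 ^ j"
proof -
 have "norm (interp (ff j) v - interp (\<lambda>u. af (Af j w) (pt j u)) v) \<le> 2 * CS * sqrt (2 * nb j w) / 2 ^ j"
 proof (rule interp_close)
  fix \<sigma> assume s: "\<sigma> \<subseteq> {..<k}"
  show "norm (ff j (hs \<sigma> v) - af (Af j w) (pt j (hs \<sigma> v))) \<le> 2 * CS * sqrt (2 * nb j w) / 2 ^ j"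
  proof (rule ff_near_parent[OF w])
   show "hs \<sigma> v \<in> Z" using v s by (auto simp: hs_def Z_def)
   show "w i - 1 \<le> hs \<sigma> v i \<and> hs \<sigma> v i \<le> w i + 2" if i: "i < k" for i
    using v(2)[OF i] by (simp add: hs_def) linarith
  qed
 qed
 then show ?thesis by (simp only: interp_af)
qed

lemma Act_nbhd: "z \<in> Act (Suc j) \<Longrightarrow> w' \<in> Z \<Longrightarrow> adj w' (half z) \<Longrightarrow> w' \<in> Act j"
 by (rule Act_half)

lemma half_range: "2 * half z i \<le> z i" "z i \<le> 2 * half z i + 1"
 by (auto simp: half_def)

lemma nb_le_QQ: "2 * nb j (half z) \<le> QQ j z"
proof -
 have "2 * nb j (half z) \<le> 2 ^ (k + 2) * nb j (half z)"
 proof (rule mult_right_mono[OF _ nb_nonneg])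
  have "(2::real) ^ 1 \<le> 2 ^ (k + 2)" by (rule power_increasing) auto
  then show "(2::real) \<le> 2 ^ (k + 2)" by (simp only: power_one_right)
 qed
 also have "\<dots> \<le> QQ j z" using bb_nonneg by (simp add: QQ_def)
 finally show ?thesis .
qed

text \<open>The update is the comparison with the parent plus the interpolation error,
  \<open>1 + 2\<close>. In the second difference the affine map of the parent drops out, leaving
  four interpolation errors of size 2. Both are of the order of the root of the flatness, so the
  energy cost is linear in \<open>QQ\<close>.\<close>

lemma update_le:
 assumes v: "v \<in> UU (Suc j)"
 shows "norm (ff (Suc j) v - interp (ff j) v) \<le> 3 * CS * sqrt (QQ j (zc (Suc j) v)) / 2 ^ j"
  and "l < k \<Longrightarrow> norm (interp (ff j) (v(l := v l + 1)) - 2 *\<^sub>R interp (ff j) v + interp (ff j) (v(l := v l - 1)))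
   \<le> 8 * CS * sqrt (QQ j (zc (Suc j) v)) / 2 ^ j"
proof -
 define z where "z = zc (Suc j) v"
 have z: "z \<in> Act (Suc j)" "cor z v" using zc[OF v] by (auto simp: z_def)
 let ?w = "half z"
 have w: "?w \<in> Act j" using Act_half_self[OF z(1)] .
 have vZ: "v \<in> Z" using v by (simp add: UU_def)
 have rng: "2 * ?w i \<le> v i \<and> v i \<le> 2 * ?w i + 2" if "i < k" for i
  using z(2) that half_range[of z i] by (auto simp: cor_def)
 let ?s = "sqrt (QQ j z)"
 have le: "2 * CS * sqrt (2 * nb j ?w) / 2 ^ j \<le> 2 * CS * ?s / 2 ^ j"
  using CS_pos nb_le_QQ[of j z] by (intro divide_right_mono mult_left_mono) auto
 have cl: "norm (interp (ff j) v' - af (Af j ?w) (pt (Suc j) v')) \<le> 2 * CS * ?s / 2 ^ j"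
  if "v' \<in> Z" "\<And>i. i < k \<Longrightarrow> v i - 1 \<le> v' i \<and> v' i \<le> v i + 1" for v'
 proof -
  have "norm (interp (ff j) v' - af (Af j ?w) (pt (Suc j) v')) \<le> 2 * CS * sqrt (2 * nb j ?w) / 2 ^ j"
  proof (rule interp_ff_close[OF w Act_nbhd[OF z(1)] that(1)])
   show "2 * ?w i - 1 \<le> v' i \<and> v' i \<le> 2 * ?w i + 3" if "i < k" for i
    using rng[OF that] \<open>\<And>i. i < k \<Longrightarrow> v i - 1 \<le> v' i \<and> v' i \<le> v i + 1\<close>[OF that] by linarith
  qed
  then show ?thesis using le by linarith
 qed
 have d: "dense j z" "z \<in> Z" using z Act_Z[OF z(1)] by (auto simp: Act_Suc)
 have "norm (af (Af (Suc j) z) (pt (Suc j) v) - af (Af j ?w) (pt (Suc j) v)) \<le> CS * sqrt (bb (Suc j) z + 2 ^ (k + 2) * bb j ?w) / 2 ^ Suc j"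
 proof (rule compare_parent(2)[OF d w bb_nonneg])
  show "resint (Af (Suc j) z) (XX j z) \<le> ennreal (bb (Suc j) z * (1 / 2 ^ Suc j) ^ (k + 2))"
   by (rule fit[OF z(1)]) (use XX_subset_WW in auto)
  fix i assume i: "i < k"
  have "\<bar>real_of_int (v i) - real_of_int (z i)\<bar> \<le> 10" using z(2) i by (auto simp: cor_def)
  then have "\<bar>real_of_int (v i) - real_of_int (z i)\<bar> / 2 ^ Suc j \<le> 10 / 2 ^ Suc j" by (rule divide_right_mono) simp
  then show "\<bar>pt (Suc j) v i - real_of_int (z i) / 2 ^ Suc j\<bar> \<le> 10 / 2 ^ Suc j"
   by (simp add: pt_def diff_divide_distrib[symmetric] del: power_Suc)
 qed
 also have "\<dots> \<le> CS * ?s / 2 ^ j"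
 proof (rule frac_le)
  have "bb j ?w \<le> nb j ?w" using w by (intro bb_le_nb) (simp add: near_def)
  then have "2 ^ (k + 2) * bb j ?w \<le> 2 ^ (k + 2) * nb j ?w" by simp
  moreover have "1 * bb (Suc j) z \<le> 2 ^ (k + 2) * bb (Suc j) z"
   using bb_nonneg by (intro mult_right_mono one_le_power) auto
  ultimately have "bb (Suc j) z + 2 ^ (k + 2) * bb j ?w \<le> QQ j z" unfolding QQ_def distrib_left by linarith
  then show "CS * sqrt (bb (Suc j) z + 2 ^ (k + 2) * bb j ?w) \<le> CS * ?s" using CS_pos by simp
 qed (use CS_pos QQ_nonneg in auto)
 finally have 1: "norm (af (Af (Suc j) z) (pt (Suc j) v) - af (Af j ?w) (pt (Suc j) v)) \<le> CS * ?s / 2 ^ j" .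
 have "ff (Suc j) v - interp (ff j) v = (af (Af (Suc j) z) (pt (Suc j) v) - af (Af j ?w) (pt (Suc j) v)) - (interp (ff j) v - af (Af j ?w) (pt (Suc j) v))"
  using v by (simp add: z_def)
 then have "norm (ff (Suc j) v - interp (ff j) v) \<le> norm (af (Af (Suc j) z) (pt (Suc j) v) - af (Af j ?w) (pt (Suc j) v)) + norm (interp (ff j) v - af (Af j ?w) (pt (Suc j) v))"
  by (simp only: norm_triangle_ineq4)
 also have "\<dots> \<le> CS * ?s / 2 ^ j + 2 * CS * ?s / 2 ^ j" by (intro add_mono 1 cl vZ) auto
 finally show "norm (ff (Suc j) v - interp (ff j) v) \<le> 3 * CS * sqrt (QQ j (zc (Suc j) v)) / 2 ^ j"
  by (simp add: z_def add_divide_distrib[symmetric])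
 show "norm (interp (ff j) (v(l := v l + 1)) - 2 *\<^sub>R interp (ff j) v + interp (ff j) (v(l := v l - 1)))
   \<le> 8 * CS * sqrt (QQ j (zc (Suc j) v)) / 2 ^ j" if l: "l < k"
 proof -
  let ?a = "\<lambda>v. af (Af j ?w) (pt (Suc j) v)"
  let ?p = "v(l := v l + 1)" let ?m = "v(l := v l - 1)"
  have "?a ?p - ?a v = (1 / 2 ^ Suc j) *\<^sub>R snd (Af j ?w) l"
  proof -
   have "?a ?p - ?a v = (\<Sum>i<k. (if i = l then 1 / 2 ^ Suc j else 0) *\<^sub>R snd (Af j ?w) i)"
    unfolding af_diff by (intro sum.cong) (auto simp: pt_def add_divide_distrib)
   also have "\<dots> = (\<Sum>i<k. if i = l then (1 / 2 ^ Suc j) *\<^sub>R snd (Af j ?w) i else 0)"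
    by (intro sum.cong) auto
   finally show ?thesis using l by simp
  qed
  moreover have "?a v - ?a ?m = (1 / 2 ^ Suc j) *\<^sub>R snd (Af j ?w) l"
  proof -
   have "?a v - ?a ?m = (\<Sum>i<k. (if i = l then 1 / 2 ^ Suc j else 0) *\<^sub>R snd (Af j ?w) i)"
    unfolding af_diff by (intro sum.cong) (auto simp: pt_def diff_divide_distrib)
   also have "\<dots> = (\<Sum>i<k. if i = l then (1 / 2 ^ Suc j) *\<^sub>R snd (Af j ?w) i else 0)"
    by (intro sum.cong) auto
   finally show ?thesis using l by simp
  qed
  ultimately have a0: "?a ?p - ?a v = ?a v - ?a ?m" by simp
  let ?I = "interp (ff j)"
  have "?I ?p - 2 *\<^sub>R ?I v + ?I ?m = ((?I ?p - ?a ?p) + (?I ?m - ?a ?m)) - ((?I v - ?a v) + (?I v - ?a v)) + ((?a ?p - ?a v) - (?a v - ?a ?m))"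
   by (simp add: scaleR_2)
  also have "\<dots> = ((?I ?p - ?a ?p) + (?I ?m - ?a ?m)) - ((?I v - ?a v) + (?I v - ?a v))" by (simp only: a0 diff_self add_0_right)
  finally have "norm (?I ?p - 2 *\<^sub>R ?I v + ?I ?m) \<le> (norm (?I ?p - ?a ?p) + norm (?I ?m - ?a ?m)) + (norm (?I v - ?a v) + norm (?I v - ?a v))"
   by (simp only:) (intro order_trans[OF norm_triangle_ineq4] add_mono norm_triangle_ineq)
  also have "\<dots> \<le> (2 * CS * ?s / 2 ^ j + 2 * CS * ?s / 2 ^ j) + (2 * CS * ?s / 2 ^ j + 2 * CS * ?s / 2 ^ j)"
   by (intro add_mono cl) (use vZ l in \<open>auto simp: Z_def\<close>)
  finally show ?thesis by (simp add: z_def add_divide_distrib[symmetric])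
 qed
qed

lemma finite_Act: "finite (Act (Suc j))"
 by (rule finite_subset[OF _ finite_DD[of j]]) (use Act_Z in \<open>auto simp: DD_def Act_Suc\<close>)

lemma Act_DD: "Act (Suc j) \<subseteq> DD j"
 using Act_Z by (auto simp: DD_def Act_Suc)

lemma corners: "finite {v \<in> Z. cor z v}" "card {v \<in> Z. cor z v} = 2 ^ k"
proof -
 have *: "{v \<in> Z. cor z v} = {v \<in> Z. \<forall>i<k. v i \<in> {z i, z i + 1}}" by (auto simp: cor_def)
 show "finite {v \<in> Z. cor z v}" unfolding * by (rule card_Z_Pi(1)) simp
 have "card {v \<in> Z. cor z v} = (\<Prod>i<k. card {z i, z i + 1})" unfolding * by (rule card_Z_Pi(2)) simp
 then show "card {v \<in> Z. cor z v} = 2 ^ k" by (simp add: numeral_2_eq_2)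
qed

lemma finite_UU: "finite (UU (Suc j))"
proof -
 have "UU (Suc j) = (\<Union>z\<in>Act (Suc j). {v \<in> Z. cor z v})" by (auto simp: UU_def)
 then show ?thesis using finite_Act corners by auto
qed

lemma sum_UU_le:
 fixes h :: "zv \<Rightarrow> real"
 assumes h: "\<And>z. 0 \<le> h z"
 shows "(\<Sum>v\<in>UU (Suc j). h (zc (Suc j) v)) \<le> 2 ^ k * (\<Sum>z\<in>Act (Suc j). h z)"
proof -
 let ?S = "SIGMA z:Act (Suc j). {v \<in> Z. cor z v}"
 have "(\<Sum>v\<in>UU (Suc j). h (zc (Suc j) v)) = (\<Sum>q\<in>(\<lambda>v. (zc (Suc j) v, v)) ` UU (Suc j). h (fst q))"
  by (subst sum.reindex) (auto simp: inj_on_def)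
 also have "\<dots> \<le> (\<Sum>q\<in>?S. h (fst q))"
 proof (rule sum_mono2)
  show "finite ?S" using finite_Act corners by auto
  show "(\<lambda>v. (zc (Suc j) v, v)) ` UU (Suc j) \<subseteq> ?S" using zc by (auto simp: UU_def)
 qed (rule h)
 also have "\<dots> = (\<Sum>z\<in>Act (Suc j). \<Sum>v\<in>{v \<in> Z. cor z v}. h z)"
  using finite_Act corners by (subst sum.Sigma) (auto simp: split_beta)
 also have "\<dots> = 2 ^ k * (\<Sum>z\<in>Act (Suc j). h z)"
  by (simp add: corners sum_distrib_left)
 finally show ?thesis .
qed

lemma fs_ff: "fs (ff j)"
proof (induction j)
 case 0
 then show ?case by (simp add: fs_def)
next
 case (Suc j)
 have "finite ({v \<in> Z. interp (ff j) v \<noteq> 0} \<union> UU (Suc j))"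
  using fs_interp[OF Suc] finite_UU by (simp add: fs_def)
 then show ?case unfolding fs_def by (rule rev_finite_subset) auto
qed

text \<open>The Dirichlet integral in direction \<open>l\<close> at mesh \<open>1 / 2 ^ j\<close>:
  squared difference quotients times the volume of a cell.\<close>

definition TT :: "nat \<Rightarrow> nat \<Rightarrow> real" where "TT l j = 4 ^ j / (2 ^ j) ^ k * En l (ff j)"

text \<open>The constant is \<open>4 * 84\<close>, where \<open>84 = 2 * 8 * 3 + 4 * 9\<close> comes
  from \<open>update_le\<close> inserted in \<open>En_add_le\<close> and 4 from the change of
  normalisation. Each active cell is charged for its \<open>2 ^ k\<close> corners.\<close>

lemma TT_step:
 assumes l: "l < k"
 shows "TT l (Suc j) \<le> TT l j + 336 * CS\<^sup>2 * 2 ^ k * (\<Sum>z\<in>Act (Suc j). (1 / 2 ^ Suc j) ^ k * QQ j z)"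
proof -
 let ?g = "\<lambda>v. ff (Suc j) v - interp (ff j) v"
 let ?F = "interp (ff j)"
 let ?D = "\<lambda>v. ?F (v(l := v l + 1)) - 2 *\<^sub>R ?F v + ?F (v(l := v l - 1))"
 have "En l (ff (Suc j)) = En l (\<lambda>v. ?F v + ?g v)" by simp
 also have "\<dots> \<le> En l ?F + (\<Sum>v\<in>UU (Suc j). 2 * (norm (?D v) * norm (?g v)) + 4 * (norm (?g v))\<^sup>2)"
  by (rule En_add_le[OF l fs_interp[OF fs_ff] finite_UU]) (auto simp: UU_def)
 also have "En l ?F \<le> 2 ^ k / 4 * En l (ff j)" by (rule En_interp_le[OF l fs_ff])
 also have "(\<Sum>v\<in>UU (Suc j). 2 * (norm (?D v) * norm (?g v)) + 4 * (norm (?g v))\<^sup>2)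
   \<le> (\<Sum>v\<in>UU (Suc j). 84 * CS\<^sup>2 / 4 ^ j * QQ j (zc (Suc j) v))"
 proof (rule sum_mono)
  fix v assume v: "v \<in> UU (Suc j)"
  define s where "s = CS * sqrt (QQ j (zc (Suc j) v)) / 2 ^ j"
  have s: "0 \<le> s" using CS_pos QQ_nonneg by (simp add: s_def)
  have g: "norm (?g v) \<le> 3 * s" using update_le(1)[OF v] by (simp add: s_def)
  have D: "norm (?D v) \<le> 8 * s" using update_le(2)[OF v l] by (simp add: s_def)
  have "2 * (norm (?D v) * norm (?g v)) + 4 * (norm (?g v))\<^sup>2 \<le> 2 * ((8 * s) * (3 * s)) + 4 * (3 * s)\<^sup>2"
   using g D s by (intro add_mono mult_left_mono mult_mono power_mono) auto
  also have "\<dots> = 84 * s\<^sup>2" by (simp add: power2_eq_square)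
  also have "s\<^sup>2 = CS\<^sup>2 / 4 ^ j * QQ j (zc (Suc j) v)"
  proof -
   have "((2::real) ^ j)\<^sup>2 = 4 ^ j" by (simp add: power2_eq_square power_mult_distrib[symmetric])
   then show ?thesis using QQ_nonneg by (simp add: s_def power_mult_distrib power_divide)
  qed
  also have "84 * (CS\<^sup>2 / 4 ^ j * QQ j (zc (Suc j) v)) = 84 * CS\<^sup>2 / 4 ^ j * QQ j (zc (Suc j) v)" by simp
  finally show "2 * (norm (?D v) * norm (?g v)) + 4 * (norm (?g v))\<^sup>2 \<le> 84 * CS\<^sup>2 / 4 ^ j * QQ j (zc (Suc j) v)" .
 qed
 also have "\<dots> = 84 * CS\<^sup>2 / 4 ^ j * (\<Sum>v\<in>UU (Suc j). QQ j (zc (Suc j) v))" by (rule sum_distrib_left[symmetric])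
 also have "\<dots> \<le> 84 * CS\<^sup>2 / 4 ^ j * (2 ^ k * (\<Sum>z\<in>Act (Suc j). QQ j z))"
  by (intro mult_left_mono sum_UU_le QQ_nonneg) auto
 finally have "En l (ff (Suc j)) \<le> 2 ^ k / 4 * En l (ff j) + 84 * CS\<^sup>2 / 4 ^ j * (2 ^ k * (\<Sum>z\<in>Act (Suc j). QQ j z))" by simp
 then have "TT l (Suc j) \<le> 4 ^ Suc j / (2 ^ Suc j) ^ k * (2 ^ k / 4 * En l (ff j) + 84 * CS\<^sup>2 / 4 ^ j * (2 ^ k * (\<Sum>z\<in>Act (Suc j). QQ j z)))"
  unfolding TT_def by (intro mult_left_mono) auto
 also have "\<dots> = TT l j + 336 * CS\<^sup>2 * 2 ^ k * ((1 / 2 ^ Suc j) ^ k * (\<Sum>z\<in>Act (Suc j). QQ j z))"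
 proof -
  have "4 ^ Suc j / (2 ^ Suc j) ^ k * (2 ^ k / 4 * x + 84 * c / 4 ^ j * (2 ^ k * y)) = 4 ^ j / (2 ^ j) ^ k * x + 336 * c * 2 ^ k * ((1 / 2 ^ Suc j) ^ k * y)"
   for x c y :: real
  proof -
   have "((2::real) ^ Suc j) ^ k = 2 ^ k * (2 ^ j) ^ k" by (simp add: power_mult_distrib)
   then show ?thesis by (simp add: power_divide distrib_left)
  qed
  then show ?thesis unfolding TT_def .
 qed
 finally show ?thesis by (simp only: sum_distrib_left)
qed

definition ET :: real where
 "ET = 336 * CS\<^sup>2 * 2 ^ k * (2 ^ (k + 2) * ((1 + 10 ^ k) * Bt + 2 * 5 ^ k * \<tau> * measure M UNIV))"

text \<open>Exchange of sums: \<open>half z i\<close> is within 2 of \<open>w i\<close> for at most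
  ten values of \<open>z i\<close>.\<close>

lemma sum_nb_le:
 "(\<Sum>z\<in>Act (Suc (Suc j)). nb (Suc j) (half z)) \<le> 10 ^ k * (\<Sum>w\<in>Act (Suc j). bb (Suc j) w)"
proof -
 let ?R = "\<lambda>w z. \<forall>i<k. w i \<in> {half z i - 2..half z i + 2}"
 have "(\<Sum>z\<in>Act (Suc (Suc j)). nb (Suc j) (half z)) = (\<Sum>z\<in>Act (Suc (Suc j)). \<Sum>w\<in>Act (Suc j). if ?R w z then bb (Suc j) w else 0)"
  unfolding nb_def near_def by (intro sum.cong refl sum.inter_filter finite_Act)
 also have "\<dots> = (\<Sum>w\<in>Act (Suc j). \<Sum>z\<in>Act (Suc (Suc j)). if ?R w z then bb (Suc j) w else 0)"
  by (rule sum.swap)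
 also have "\<dots> \<le> (\<Sum>w\<in>Act (Suc j). 10 ^ k * bb (Suc j) w)"
 proof (rule sum_mono)
  fix w
  have "(\<Sum>z\<in>Act (Suc (Suc j)). if ?R w z then bb (Suc j) w else 0) = real (card {z \<in> Act (Suc (Suc j)). ?R w z}) * bb (Suc j) w"
   by (subst sum.inter_filter[symmetric]) (simp_all add: finite_Act)
  also have "\<dots> \<le> 10 ^ k * bb (Suc j) w"
  proof (rule mult_right_mono[OF _ bb_nonneg])
   let ?T = "{z \<in> Z. \<forall>i<k. z i \<in> {2 * w i - 4..2 * w i + 5}}"
   have sub: "{z \<in> Act (Suc (Suc j)). ?R w z} \<subseteq> ?T"
   proof
    fix z assume z: "z \<in> {z \<in> Act (Suc (Suc j)). ?R w z}"
    have "z i \<in> {2 * w i - 4..2 * w i + 5}" if "i < k" for i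
    proof -
     have "w i \<in> {half z i - 2..half z i + 2}" using z that by blast
     then show ?thesis using half_range[of z i] by simp
    qed
    then show "z \<in> ?T" using z Act_Z by blast
   qed
   have "finite ?T" by (rule card_Z_Pi(1)) (rule finite_atLeastAtMost_int)
   then have "card {z \<in> Act (Suc (Suc j)). ?R w z} \<le> card ?T" using sub by (rule card_mono)
   also have "card ?T = (\<Prod>i<k. card {2 * w i - 4..2 * w i + 5})" by (rule card_Z_Pi(2)) simp
   also have "\<dots> = 10 ^ k" by simp
   finally have "real (card {z \<in> Act (Suc (Suc j)). ?R w z}) \<le> real (10 ^ k)" by (simp only: of_nat_le_iff)
   then show "real (card {z \<in> Act (Suc (Suc j)). ?R w z}) \<le> 10 ^ k" by simp
  qed
  finally show "(\<Sum>z\<in>Act (Suc (Suc j)). if ?R w z then bb (Suc j) w else 0) \<le> 10 ^ k * bb (Suc j) w" .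
 qed
 finally show ?thesis by (simp only: sum_distrib_left)
qed

text \<open>Parents at level \<open>0\<close> are separated, since their flatness is
  \<open>\<tau>\<close> for each of infinitely many cells; only the \<open>5 ^ k\<close> cells near
  the parent of an active cell are charged. At later levels \<open>sum_nb_le\<close> reduces the
  neighbours to \<open>bb_sum\<close>.\<close>

lemma QQ_sum: "(\<Sum>j<J. \<Sum>z\<in>Act (Suc j). (1 / 2 ^ Suc j) ^ k * QQ j z)
  \<le> 2 ^ (k + 2) * ((1 + 10 ^ k) * Bt + 2 * 5 ^ k * \<tau> * measure M UNIV)"
proof -
 let ?t = "\<lambda>j. (1 / (2::real) ^ j) ^ k"
 have S1: "(\<Sum>j<J. \<Sum>z\<in>Act (Suc j). bb (Suc j) z * ?t (Suc j)) \<le> Bt" for J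
 proof -
  have "(\<Sum>j<J. \<Sum>z\<in>Act (Suc j). bb (Suc j) z * ?t (Suc j)) \<le> (\<Sum>j<J. \<Sum>z\<in>DD j. bb (Suc j) z * ?t (Suc j))"
   by (intro sum_mono sum_mono2 finite_DD Act_DD) (simp add: bb_nonneg)
  then show ?thesis using bb_sum[of J] by linarith
 qed
 have S2: "(\<Sum>j<J. \<Sum>z\<in>Act (Suc j). ?t (Suc j) * nb j (half z)) \<le> 10 ^ k * Bt + 2 * 5 ^ k * \<tau> * measure M UNIV"
 proof (cases J)
  case 0
  have "0 \<le> Bt" using S1[of 0] by simp
  then show ?thesis using 0 pos by simp
 next
  case (Suc J')
  have "(\<Sum>j<J. \<Sum>z\<in>Act (Suc j). ?t (Suc j) * nb j (half z))
    = (\<Sum>z\<in>Act (Suc 0). ?t (Suc 0) * nb 0 (half z)) + (\<Sum>j<J'. \<Sum>z\<in>Act (Suc (Suc j)). ?t (Suc (Suc j)) * nb (Suc j) (half z))"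
   unfolding Suc by (rule sum.lessThan_Suc_shift)
  also have "(\<Sum>z\<in>Act (Suc 0). ?t (Suc 0) * nb 0 (half z)) \<le> (\<Sum>z\<in>Act (Suc 0). ?t (Suc 0) * (5 ^ k * \<tau>))"
   using pos by (intro sum_mono mult_left_mono nb_le) (auto simp: bb_def)
  also have "\<dots> \<le> (\<Sum>z\<in>DD 0. ?t (Suc 0) * (5 ^ k * \<tau>))"
   using pos by (intro sum_mono2 finite_DD Act_DD) auto
  also have "\<dots> = (\<Sum>z\<in>DD 0. ?t (Suc 0)) * (5 ^ k * \<tau>)" by (rule sum_distrib_right[symmetric])
  also have "\<dots> \<le> (2 * measure M UNIV) * (5 ^ k * \<tau>)"
   using pos by (intro mult_right_mono DD_mass) auto
  also have "(\<Sum>j<J'. \<Sum>z\<in>Act (Suc (Suc j)). ?t (Suc (Suc j)) * nb (Suc j) (half z)) \<le> (\<Sum>j<J'. 10 ^ k * (\<Sum>w\<in>Act (Suc j). bb (Suc j) w * ?t (Suc j)))"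
  proof (rule sum_mono)
   fix j
   have "(\<Sum>z\<in>Act (Suc (Suc j)). ?t (Suc (Suc j)) * nb (Suc j) (half z)) = ?t (Suc (Suc j)) * (\<Sum>z\<in>Act (Suc (Suc j)). nb (Suc j) (half z))"
    by (rule sum_distrib_left[symmetric])
   also have "\<dots> \<le> ?t (Suc j) * (10 ^ k * (\<Sum>w\<in>Act (Suc j). bb (Suc j) w))"
   proof (rule mult_mono[OF _ sum_nb_le])
    show "?t (Suc (Suc j)) \<le> ?t (Suc j)" by (intro power_mono divide_left_mono) auto
    show "0 \<le> (\<Sum>z\<in>Act (Suc (Suc j)). nb (Suc j) (half z))" by (intro sum_nonneg nb_nonneg)
   qed simp
   also have "\<dots> = 10 ^ k * (\<Sum>w\<in>Act (Suc j). bb (Suc j) w * ?t (Suc j))"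
    by (simp add: sum_distrib_left mult_ac)
   finally show "(\<Sum>z\<in>Act (Suc (Suc j)). ?t (Suc (Suc j)) * nb (Suc j) (half z)) \<le> 10 ^ k * (\<Sum>w\<in>Act (Suc j). bb (Suc j) w * ?t (Suc j))" .
  qed
  also have "\<dots> = 10 ^ k * (\<Sum>j<J'. \<Sum>w\<in>Act (Suc j). bb (Suc j) w * ?t (Suc j))" by (rule sum_distrib_left[symmetric])
  also have "\<dots> \<le> 10 ^ k * Bt" using S1 by (intro mult_left_mono) auto
  finally show ?thesis by (simp add: mult_ac)
 qed
 have "(\<Sum>j<J. \<Sum>z\<in>Act (Suc j). ?t (Suc j) * QQ j z)
   = (\<Sum>j<J. \<Sum>z\<in>Act (Suc j). 2 ^ (k + 2) * (bb (Suc j) z * ?t (Suc j)) + 2 ^ (k + 2) * (?t (Suc j) * nb j (half z)))"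
  unfolding QQ_def by (intro sum.cong refl) (simp only: distrib_left mult_ac)
 also have "\<dots> = 2 ^ (k + 2) * ((\<Sum>j<J. \<Sum>z\<in>Act (Suc j). bb (Suc j) z * ?t (Suc j)) + (\<Sum>j<J. \<Sum>z\<in>Act (Suc j). ?t (Suc j) * nb j (half z)))"
  by (simp only: sum.distrib sum_distrib_left distrib_left)
 also have "\<dots> \<le> 2 ^ (k + 2) * (Bt + (10 ^ k * Bt + 2 * 5 ^ k * \<tau> * measure M UNIV))"
  by (intro mult_left_mono add_mono S1 S2) simp
 finally show ?thesis by (simp only: distrib_right mult_1 add.assoc)
qed

lemma TT_le: "l < k \<Longrightarrow> TT l J \<le> ET"
proof -
 assume l: "l < k"
 have "TT l J \<le> 336 * CS\<^sup>2 * 2 ^ k * (\<Sum>j<J. \<Sum>z\<in>Act (Suc j). (1 / 2 ^ Suc j) ^ k * QQ j z)"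
 proof (induction J)
  case 0
  have "En l (ff 0) = 0" by (simp add: En_def pd_def)
  then show ?case by (simp add: TT_def)
 next
  case (Suc J)
  show ?case using TT_step[OF l, of J] Suc by (simp only: sum.lessThan_Suc distrib_left)
 qed
 also have "\<dots> \<le> ET" unfolding ET_def by (intro mult_left_mono QQ_sum) simp
 finally show ?thesis .
qed

end

section \<open>Steep cells\<close>

lemma norm_triangle_via: "norm (a - c) \<le> norm (a - b) + norm (b - c)"
 for a b c :: "'a::real_normed_vector"
 using dist_triangle[of a c b] by (simp add: dist_norm)

lemma half_between:
 fixes p t x c :: int
 assumes "2 * p \<le> x" "x \<le> 2 * p + 2 * t" "c = 0 \<or> c = 1"
 shows "p \<le> (x + c) div 2 \<and> (x + c) div 2 \<le> p + t"
 using assms by presburger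

abbreviation (in frame) area :: "nat \<Rightarrow> (nat \<Rightarrow> zv set) \<Rightarrow> real" where
 "area J F \<equiv> (\<Sum>j<J. \<Sum>z\<in>F j. (1 / 2 ^ Suc j) ^ k)"

text \<open>Keeps the total drift of the lattice functions below a cell small against the slope
  bound: in \<open>TL_box\<close> the drift is 8 units and is tested with a factor 4.\<close>

locale key2 = key +
 assumes phi2: "128 * CS * sqrt (2 ^ (k + 2) * (1 + 5 ^ k) * \<phi>) \<le> \<theta>"
begin

text \<open>Cells that failed only because every fit is too steep.\<close>

definition TL :: "nat \<Rightarrow> zv set" where
 "TL j = {z \<in> Z. consid j z \<and> dense j z \<and> bb (Suc j) z \<le> \<phi> \<and> z \<notin> Act (Suc j)}"

lemma consid_half: "consid j z \<Longrightarrow> half z \<in> Act j"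
 using half_Z by (auto simp: consid_def consid'_def)

lemma consid_nbhd: "consid j z \<Longrightarrow> w' \<in> Z \<Longrightarrow> adj w' (half z) \<Longrightarrow> w' \<in> Act j"
 by (simp add: consid_def consid'_def)

lemma Act_anc: "z \<in> Act (i + n) \<Longrightarrow> (\<lambda>l. z l div 2 ^ n) \<in> Act i"
proof (induction n arbitrary: z)
 case (Suc n)
 then have "half z \<in> Act (i + n)" using Act_half_self[of z "i + n"] by simp
 from Suc.IH[OF this] have "(\<lambda>l. half z l div 2 ^ n) \<in> Act i" .
 also have "(\<lambda>l. half z l div 2 ^ n) = (\<lambda>l. z l div 2 ^ Suc n)"
  by (simp add: half_def zdiv_zmult2_eq)
 finally show ?case .
qed simp

definition Qm :: real where "Qm = 2 ^ (k + 2) * (1 + 5 ^ k) * \<phi>"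

lemma Qm: "2 * nb j w \<le> Qm" "z \<in> Act (Suc j) \<Longrightarrow> QQ j z \<le> Qm" "0 \<le> Qm"
proof -
 have nb: "nb j w \<le> 5 ^ k * \<phi>" for j w by (rule nb_le) (use pos bb_le_phi in auto)
 have "2 * nb j w \<le> 2 ^ (k + 2) * (5 ^ k * \<phi>)"
 proof (rule mult_mono[OF _ nb _ nb_nonneg])
  have "(2::real) ^ 1 \<le> 2 ^ (k + 2)" by (rule power_increasing) auto
  then show "(2::real) \<le> 2 ^ (k + 2)" by (simp only: power_one_right)
 qed simp
 also have "\<dots> \<le> Qm" using pos by (simp add: Qm_def distrib_right distrib_left)
 finally show "2 * nb j w \<le> Qm" .
 show "QQ j z \<le> Qm" if "z \<in> Act (Suc j)"
 proof -
  have "bb (Suc j) z + nb j (half z) \<le> (1 + 5 ^ k) * \<phi>"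
   using bb_le_phi[OF that] nb[of j "half z"] by (simp add: distrib_right)
  then have "2 ^ (k + 2) * (bb (Suc j) z + nb j (half z)) \<le> 2 ^ (k + 2) * ((1 + 5 ^ k) * \<phi>)" by (rule mult_left_mono) simp
  then show ?thesis by (simp only: QQ_def Qm_def mult.assoc)
 qed
 show "0 \<le> Qm" using pos by (simp add: Qm_def)
qed

text \<open>Interpolation preserves the affine map of the parent, and every later level adds at most
  three units at its own scale. The expression \<open>8 / 2 ^ j - 3 / 2 ^ (j + n)\<close> is the
  partial sum of this geometric series, starting from \<open>3 + 2\<close>.\<close>

lemma ff_stays_close:
 assumes c: "consid j z"
 shows "v \<in> Z \<Longrightarrow> (\<And>i. i < k \<Longrightarrow> z i * 2 ^ n \<le> v i \<and> v i \<le> z i * 2 ^ n + 2 ^ n) \<Longrightarrow>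
  norm (ff (Suc j + n) v - af (Af j (half z)) (pt (Suc j + n) v)) \<le> CS * sqrt Qm * (8 / 2 ^ j - 3 / 2 ^ (j + n))"
proof (induction n arbitrary: v)
 case 0
 let ?w = "half z" let ?s = "CS * sqrt Qm"
 have s: "2 * CS * sqrt (2 * nb j ?w) / 2 ^ j \<le> 2 * ?s / 2 ^ j"
  using CS_pos Qm(1)[of j ?w] by (intro divide_right_mono) auto
 have "norm (interp (ff j) v - af (Af j ?w) (pt (Suc j) v)) \<le> 2 * CS * sqrt (2 * nb j ?w) / 2 ^ j"
 proof (rule interp_ff_close[OF consid_half[OF c] consid_nbhd[OF c] 0(1)])
  fix i assume "i < k"
  then show "2 * ?w i - 1 \<le> v i \<and> v i \<le> 2 * ?w i + 3"
   using 0(2)[of i] half_range[of z i] by simp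
 qed
 then have 1: "norm (interp (ff j) v - af (Af j ?w) (pt (Suc j) v)) \<le> 2 * ?s / 2 ^ j" using s by linarith
 have 2: "norm (ff (Suc j) v - interp (ff j) v) \<le> 3 * ?s / 2 ^ j"
 proof (cases "v \<in> UU (Suc j)")
  case True
  have "norm (ff (Suc j) v - interp (ff j) v) \<le> 3 * CS * sqrt (QQ j (zc (Suc j) v)) / 2 ^ j" by (rule update_le(1)[OF True])
  also have "\<dots> \<le> 3 * ?s / 2 ^ j"
   using CS_pos Qm(2)[of "zc (Suc j) v" j] zc[OF True] by (intro divide_right_mono) auto
  finally show ?thesis .
 qed (use CS_pos Qm(3) in simp)
 have "norm (ff (Suc j) v - af (Af j ?w) (pt (Suc j) v)) \<le> norm (ff (Suc j) v - interp (ff j) v) + norm (interp (ff j) v - af (Af j ?w) (pt (Suc j) v))"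
  by (rule norm_triangle_via)
 also have "\<dots> \<le> 3 * ?s / 2 ^ j + 2 * ?s / 2 ^ j" using 1 2 by linarith
 also have "\<dots> = ?s * (8 / 2 ^ j - 3 / 2 ^ (j + 0))" by (simp add: right_diff_distrib)
 finally show ?case by (simp only: add_0_right)
next
 case (Suc n)
 let ?w = "half z" let ?s = "CS * sqrt Qm" let ?j = "Suc j + n"
 have 1: "norm (interp (ff ?j) v - interp (\<lambda>u. af (Af j ?w) (pt ?j u)) v) \<le> ?s * (8 / 2 ^ j - 3 / 2 ^ (j + n))"
 proof (rule interp_close)
  fix \<sigma> assume sg: "\<sigma> \<subseteq> {..<k}"
  show "norm (ff ?j (hs \<sigma> v) - af (Af j ?w) (pt ?j (hs \<sigma> v))) \<le> ?s * (8 / 2 ^ j - 3 / 2 ^ (j + n))"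
  proof (rule Suc.IH)
   show "hs \<sigma> v \<in> Z" using Suc.prems(1) sg by (auto simp: hs_def Z_def)
   fix i assume i: "i < k"
   have "z i * 2 ^ Suc n = 2 * (z i * 2 ^ n)" "(2::int) ^ Suc n = 2 * 2 ^ n" by simp_all
   then show "z i * 2 ^ n \<le> hs \<sigma> v i \<and> hs \<sigma> v i \<le> z i * 2 ^ n + 2 ^ n"
    using Suc.prems(2)[OF i] unfolding hs_def by (intro half_between) auto
  qed
 qed
 have 2: "norm (ff (Suc ?j) v - interp (ff ?j) v) \<le> 3 * ?s / 2 ^ ?j"
 proof (cases "v \<in> UU (Suc ?j)")
  case True
  have "norm (ff (Suc ?j) v - interp (ff ?j) v) \<le> 3 * CS * sqrt (QQ ?j (zc (Suc ?j) v)) / 2 ^ ?j" by (rule update_le(1)[OF True])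
  also have "\<dots> \<le> 3 * ?s / 2 ^ ?j"
   using CS_pos Qm(2)[of "zc (Suc ?j) v" ?j] zc[OF True] by (intro divide_right_mono) auto
  finally show ?thesis .
 qed (use CS_pos Qm(3) in simp)
 have "norm (ff (Suc ?j) v - af (Af j ?w) (pt (Suc ?j) v)) \<le> norm (ff (Suc ?j) v - interp (ff ?j) v) + norm (interp (ff ?j) v - af (Af j ?w) (pt (Suc ?j) v))"
  by (rule norm_triangle_via)
 also have "\<dots> \<le> 3 * ?s / 2 ^ ?j + ?s * (8 / 2 ^ j - 3 / 2 ^ (j + n))" using 1 2 unfolding interp_af by linarith
 also have "\<dots> = ?s * (8 / 2 ^ j - 3 / 2 ^ (j + Suc n))"
  by (simp add: field_simps)
 finally show ?case by (simp only: add_Suc_right)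
qed

text \<open>A rejected fit has a slope above \<open>\<theta>\<close> in some direction, so the fit
  of the parent has slope at least \<open>\<theta> / 2\<close> there. The final function
  \<open>ff J\<close> still follows the parent over the whole cell. Measuring at one common level
  \<open>J\<close> lets all steep cells share one energy.\<close>

lemma TL_box:
 assumes z: "z \<in> TL j" and J: "J = Suc j + n"
 shows "(1 / 2 ^ Suc j) ^ k * (\<theta>\<^sup>2 / 16) \<le> 4 ^ J / (2 ^ J) ^ k * (\<Sum>l<k. \<Sum>v\<in>subs n z. (norm (pd l (ff J) v))\<^sup>2)"
proof -
 have c: "consid j z" and d: "dense j z" and zZ: "z \<in> Z" and b: "bb (Suc j) z \<le> \<phi>" and na: "z \<notin> Act (Suc j)"
  using z by (auto simp: TL_def)
 let ?w = "half z" let ?s = "CS * sqrt Qm"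
 have w: "?w \<in> Act j" by (rule consid_half[OF c])
 obtain A where A: "fitA (Gd j) j z A" using exists_fit[OF d zZ b] by blast
 moreover have "\<not> goodA (Gd j) j z A" using na c d b unfolding Act_Suc by blast
 ultimately have "\<not> (\<forall>i<k. norm (snd A i) \<le> \<theta>)" unfolding goodA_def by blast
 then obtain l where l: "l < k" "\<theta> < norm (snd A l)" by (auto simp: not_le)
 have fitX: "resint A (XX j z) \<le> ennreal (bb (Suc j) z * (1 / 2 ^ Suc j) ^ (k + 2))"
 proof -
  have "resint A (XX j z) \<le> resint A (WW j z)"
   using XX_subset_WW[of j z] by (intro nn_integral_mono) (auto simp: indicator_def)
  also have "\<dots> \<le> ennreal (bb (Suc j) z * (1 / 2 ^ Suc j) ^ (k + 2))"
   using A by (simp only: fitA_def WW_def bb_def nat.case)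
  finally show ?thesis .
 qed
 have "norm (snd A l - snd (Af j ?w) l) \<le> CS * sqrt (bb (Suc j) z + 2 ^ (k + 2) * bb j ?w)"
  by (rule compare_parent(1)[OF d zZ w bb_nonneg fitX l(1)])
 also have "\<dots> \<le> ?s"
 proof -
  have "bb (Suc j) z + 2 ^ (k + 2) * bb j ?w \<le> \<phi> + 2 ^ (k + 2) * \<phi>"
   using b bb_le_phi[OF w] by (intro add_mono mult_left_mono) auto
  also have "\<dots> \<le> 2 ^ (k + 2) * \<phi> + 2 ^ (k + 2) * (5 ^ k * \<phi>)"
  proof -
   have "1 * \<phi> \<le> 2 ^ (k + 2) * \<phi>" using pos by (intro mult_right_mono one_le_power) auto
   moreover have "1 * \<phi> \<le> 5 ^ k * \<phi>" using pos by (intro mult_right_mono one_le_power) auto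
   then have "2 ^ (k + 2) * \<phi> \<le> 2 ^ (k + 2) * (5 ^ k * \<phi>)" by (intro mult_left_mono) auto
   ultimately show ?thesis by linarith
  qed
  also have "\<dots> = Qm" by (simp add: Qm_def distrib_left distrib_right)
  finally show ?thesis using CS_pos by (intro mult_left_mono real_sqrt_le_mono) auto
 qed
 also have s: "?s \<le> \<theta> / 128" using phi2 by (simp add: Qm_def)
 finally have "norm (snd A l) - norm (snd (Af j ?w) l) \<le> \<theta> / 128"
  using norm_triangle_ineq2 order_trans by blast
 then have bl: "\<theta> / 2 \<le> norm (snd (Af j ?w) l)" using l(2) pos by linarith
 let ?b = "(1 / 2 ^ J) *\<^sub>R snd (Af j ?w) l"
 let ?B = "\<lambda>v. af (Af j ?w) (pt J v)"
 have tJ: "real (2 ^ n) * (1 / 2 ^ J) = 1 / 2 ^ Suc j" by (simp add: J power_add)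
 have nb: "norm ?b = (1 / 2 ^ J) * norm (snd (Af j ?w) l)" by simp
 have "real (2 ^ n) ^ k * ((norm ?b)\<^sup>2 / 4) \<le> (\<Sum>v\<in>{v \<in> Z. \<forall>i<k. v i \<in> {z i * 2 ^ n..<z i * 2 ^ n + int (2 ^ n)}}. (norm (pd l (ff J) v))\<^sup>2)"
 proof (rule box_slope_energy[OF l(1), of "2 ^ n" ?B ?b "\<lambda>i. z i * 2 ^ n" "ff J" "?s * (8 / 2 ^ j)"])
  show "?B (v(l := v l + 1)) - ?B v = ?b" for v
  proof -
   have "?B (v(l := v l + 1)) - ?B v = (\<Sum>i<k. (if i = l then 1 / 2 ^ J else 0) *\<^sub>R snd (Af j ?w) i)"
    unfolding af_diff by (intro sum.cong) (auto simp: pt_def add_divide_distrib)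
   also have "\<dots> = (\<Sum>i<k. if i = l then ?b else 0)" by (intro sum.cong) auto
   finally show ?thesis using l by simp
  qed
  fix v assume v: "v \<in> Z" "\<And>i. i < k \<Longrightarrow> z i * 2 ^ n \<le> v i \<and> v i \<le> z i * 2 ^ n + int (2 ^ n)"
  have "norm (ff J v - ?B v) \<le> ?s * (8 / 2 ^ j - 3 / 2 ^ (j + n))"
   unfolding J by (rule ff_stays_close[OF c v(1)]) (use v(2) in simp)
  also have "\<dots> \<le> ?s * (8 / 2 ^ j)" using CS_pos Qm(3) by (intro mult_left_mono) auto
  finally show "norm (ff J v - ?B v) \<le> ?s * (8 / 2 ^ j)" .
 next
  have "4 * (?s * (8 / 2 ^ j)) = 64 * ?s * (1 / 2 ^ Suc j)" by simp
  also have "\<dots> \<le> \<theta> / 2 * (1 / 2 ^ Suc j)" using s by (intro mult_right_mono) auto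
  also have "\<dots> \<le> norm (snd (Af j ?w) l) * (1 / 2 ^ Suc j)" using bl by (intro mult_right_mono) auto
  also have "\<dots> = real (2 ^ n) * norm ?b" unfolding nb tJ[symmetric] by simp
  finally show "4 * (?s * (8 / 2 ^ j)) \<le> real (2 ^ n) * norm ?b" .
 qed simp
 also have "\<dots> = (\<Sum>v\<in>subs n z. (norm (pd l (ff J) v))\<^sup>2)" unfolding subs_alt by simp
 also have "\<dots> \<le> (\<Sum>l<k. \<Sum>v\<in>subs n z. (norm (pd l (ff J) v))\<^sup>2)"
  using l(1) by (intro member_le_sum[of l "{..<k}" "\<lambda>l. \<Sum>v\<in>subs n z. (norm (pd l (ff J) v))\<^sup>2"] sum_nonneg) auto
 finally have E: "real (2 ^ n) ^ k * ((norm ?b)\<^sup>2 / 4) \<le> (\<Sum>l<k. \<Sum>v\<in>subs n z. (norm (pd l (ff J) v))\<^sup>2)" .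
 have J4: "(4::real) ^ J = (2 ^ J)\<^sup>2" by (simp add: power2_eq_square power_mult_distrib[symmetric])
 have "(1 / 2 ^ Suc j) ^ k * (\<theta>\<^sup>2 / 16) \<le> (1 / 2 ^ Suc j) ^ k * ((norm (snd (Af j ?w) l))\<^sup>2 / 4)"
 proof (intro mult_left_mono)
  have "(\<theta> / 2)\<^sup>2 \<le> (norm (snd (Af j ?w) l))\<^sup>2" using bl pos by (intro power_mono) auto
  then show "\<theta>\<^sup>2 / 16 \<le> (norm (snd (Af j ?w) l))\<^sup>2 / 4" by (simp add: power_divide)
 qed simp
 also have "\<dots> = 4 ^ J / (2 ^ J) ^ k * (real (2 ^ n) ^ k * ((norm ?b)\<^sup>2 / 4))"
  unfolding tJ[symmetric] J4 nb power_mult_distrib power_divide by simp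
 also have "\<dots> \<le> 4 ^ J / (2 ^ J) ^ k * (\<Sum>l<k. \<Sum>v\<in>subs n z. (norm (pd l (ff J) v))\<^sup>2)"
  using E by (intro mult_left_mono) auto
 finally show ?thesis .
qed

lemma finite_TL: "finite (TL j)"
 by (rule finite_subset[OF _ finite_DD[of j]]) (auto simp: TL_def DD_def)

text \<open>The boxes below steep cells are disjoint: an examined cell has only active proper
  ancestors, and a steep cell is inactive, so no steep cell lies below another.\<close>

lemma TL_sum: "area J TL \<le> 16 * real k * ET / \<theta>\<^sup>2"
proof -
 let ?I = "SIGMA j:{..<J}. TL j"
 let ?B = "\<lambda>q. subs (J - Suc (fst q)) (snd q)"
 let ?c = "4 ^ J / ((2::real) ^ J) ^ k"
 have fin: "finite ?I" using finite_TL by auto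
 have dis: "disjoint_family_on ?B ?I"
  unfolding disjoint_family_on_def
 proof (intro ballI impI)
  have *: False if q: "j \<le> j'" "j' < J" "z \<in> TL j" "z' \<in> TL j'" "(j, z) \<noteq> (j', z')"
   and v: "v \<in> subs (J - Suc j) z" "v \<in> subs (J - Suc j') z'" for j j' z z' v
  proof -
   have zZ: "z \<in> Z" "z' \<in> Z" using q by (auto simp: TL_def)
   have zv: "z = (\<lambda>l. v l div 2 ^ (J - Suc j))"
    by (rule Z_ext) (use v zZ in \<open>auto simp: subs_def Z_def\<close>)
   have zv': "z' = (\<lambda>l. v l div 2 ^ (J - Suc j'))"
    by (rule Z_ext) (use v zZ in \<open>auto simp: subs_def Z_def\<close>)
   show False
   proof (cases "j = j'")
    case True
    then show False using q zv zv' by simp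
   next
    case False
    define m where "m = j' - Suc j"
    have m: "j' = Suc j + m" using False q(1) by (simp add: m_def)
    have "J - Suc j = (J - Suc j') + Suc m" using m q(2) by simp
    then have p: "(2::int) ^ (J - Suc j) = 2 ^ (J - Suc j') * 2 ^ Suc m" by (simp only: power_add)
    have "z = (\<lambda>l. z' l div 2 ^ Suc m)"
     unfolding zv' by (subst zv, unfold p, subst zdiv_zmult2_eq) (rule zero_le_power, simp, rule refl)
    also have "\<dots> = (\<lambda>l. half z' l div 2 ^ m)" by (simp add: half_def zdiv_zmult2_eq)
    also have "\<dots> \<in> Act (Suc j)"
     using q(4) consid_half[of j' z'] m by (intro Act_anc) (auto simp: TL_def)
    finally show False using q(3) by (simp add: TL_def)
   qed
  qed
  fix q q' assume qq: "q \<in> ?I" "q' \<in> ?I" "q \<noteq> q'"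
  obtain j z j' z' where e: "q = (j, z)" "q' = (j', z')" by (cases q; cases q')
  show "?B q \<inter> ?B q' = {}"
  proof (rule ccontr)
   assume "?B q \<inter> ?B q' \<noteq> {}"
   then obtain v where v: "v \<in> ?B q" "v \<in> ?B q'" by blast
   show False
   proof (cases "j \<le> j'")
    case True
    show False by (rule *[of j j' z z' v]) (use True qq e v in auto)
   next
    case False
    show False by (rule *[of j' j z' z v]) (use False qq e v in auto)
   qed
  qed
 qed
 have "(\<Sum>q\<in>?I. (1 / 2 ^ Suc (fst q)) ^ k * (\<theta>\<^sup>2 / 16)) \<le> (\<Sum>q\<in>?I. ?c * (\<Sum>l<k. \<Sum>v\<in>?B q. (norm (pd l (ff J) v))\<^sup>2))"
 proof (rule sum_mono)
  fix q assume "q \<in> ?I"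
  then have q: "snd q \<in> TL (fst q)" "fst q < J" by auto
  show "(1 / 2 ^ Suc (fst q)) ^ k * (\<theta>\<^sup>2 / 16) \<le> ?c * (\<Sum>l<k. \<Sum>v\<in>?B q. (norm (pd l (ff J) v))\<^sup>2)"
   by (rule TL_box[OF q(1)]) (use q in simp)
 qed
 also have "\<dots> = (\<Sum>l<k. ?c * (\<Sum>q\<in>?I. \<Sum>v\<in>?B q. (norm (pd l (ff J) v))\<^sup>2))"
  unfolding sum_distrib_left by (rule sum.swap)
 also have "\<dots> \<le> (\<Sum>l<k. ET)"
 proof (rule sum_mono)
  fix l assume "l \<in> {..<k}"
  then have l: "l < k" by simp
  have "(\<Sum>q\<in>?I. \<Sum>v\<in>?B q. (norm (pd l (ff J) v))\<^sup>2) \<le> En l (ff J)"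
   by (rule energy_boxes[OF l fs_ff fin dis]) (use finite_subs in \<open>auto simp: subs_def\<close>)
  then have "?c * (\<Sum>q\<in>?I. \<Sum>v\<in>?B q. (norm (pd l (ff J) v))\<^sup>2) \<le> TT l J"
   unfolding TT_def by (rule mult_left_mono) simp
  then show "?c * (\<Sum>q\<in>?I. \<Sum>v\<in>?B q. (norm (pd l (ff J) v))\<^sup>2) \<le> ET" using TT_le[OF l, of J] by linarith
 qed
 finally have "(\<Sum>q\<in>?I. (1 / 2 ^ Suc (fst q)) ^ k) * (\<theta>\<^sup>2 / 16) \<le> real k * ET"
  by (simp only: sum_distrib_right sum_constant card_lessThan)
 moreover have "(\<Sum>q\<in>?I. (1 / 2 ^ Suc (fst q)) ^ k) = area J TL"
  using finite_TL by (subst sum.Sigma) (auto simp: split_beta)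
 ultimately have "area J TL * (\<theta>\<^sup>2 / 16) \<le> real k * ET" by simp
 then show ?thesis using pos by (simp add: field_simps)
qed

end

section \<open>Areas of cells in the parameter space\<close>

context frame
begin

definition cell :: "nat \<Rightarrow> zv \<Rightarrow> (nat \<Rightarrow> real) set" where
 "cell j z = {u \<in> space LK. idx j u = z}"

lemma cell_box: "z \<in> Z \<Longrightarrow> cell j z = {u \<in> space LK. \<forall>i<k. real_of_int (z i) / 2 ^ j \<le> u i \<and> u i < (real_of_int (z i) + 1) / 2 ^ j}"
 by (auto simp: cell_def idx_eq_iff)

lemma cell_sets [measurable]: "z \<in> Z \<Longrightarrow> cell j z \<in> sets LK"
 unfolding cell_box by measurable

lemma emeasure_cell: "z \<in> Z \<Longrightarrow> emeasure LK (cell j z) = ennreal ((1 / 2 ^ j) ^ k)"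
 unfolding cell_box
proof (subst emeasure_box)
 fix i show "real_of_int (z i) / 2 ^ j \<le> (real_of_int (z i) + 1) / 2 ^ j" by (intro divide_right_mono) auto
qed (simp add: diff_divide_distrib[symmetric])

lemma area_le:
 assumes I: "finite I" "\<And>q. q \<in> I \<Longrightarrow> ix q \<in> Z" "disjoint_family_on (\<lambda>q. cell (lev q) (ix q)) I"
  and S: "\<And>q. q \<in> I \<Longrightarrow> cell (lev q) (ix q) \<subseteq> S" "S \<in> sets LK" "emeasure LK S \<le> ennreal a" "0 \<le> a"
 shows "(\<Sum>q\<in>I. (1 / 2 ^ lev q) ^ k) \<le> a"
proof -
 have "ennreal (\<Sum>q\<in>I. (1 / 2 ^ lev q) ^ k) = (\<Sum>q\<in>I. emeasure LK (cell (lev q) (ix q)))"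
  using I(2) by (simp add: emeasure_cell)
 also have "\<dots> = emeasure LK (\<Union>q\<in>I. cell (lev q) (ix q))"
  using I by (intro sum_emeasure) auto
 also have "\<dots> \<le> emeasure LK S" using S by (intro emeasure_mono) auto
 finally have "ennreal (\<Sum>q\<in>I. (1 / 2 ^ lev q) ^ k) \<le> ennreal a" using S(3) by (rule order_trans)
 then show ?thesis using S(4) by simp
qed

lemma idx_close:
 assumes "idx j u = idx j v" "i < k"
 shows "\<bar>u i - v i\<bar> \<le> 1 / 2 ^ j"
 using idx_bounds[OF assms(2), of j u] idx_bounds[OF assms(2), of j v] assms(1)
 by (simp add: add_divide_distrib abs_le_iff)

lemma norm_emb_close:
 assumes "\<And>i. i < k \<Longrightarrow> \<bar>u i - v i\<bar> \<le> d"
 shows "norm (emb u) \<le> norm (emb v) + real k * d"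
proof -
 have "norm (emb u - emb v) \<le> real k * d" unfolding emb_diff by (rule norm_emb_le[OF assms])
 then show ?thesis using norm_triangle_sub[of "emb u" "emb v"] by linarith
qed

definition hits :: "real \<Rightarrow> nat \<Rightarrow> zv \<Rightarrow> bool" where
 "hits r j z \<longleftrightarrow> (\<exists>u. idx j u = z \<and> norm (emb u) < r)"

lemma finite_hits: "finite {z \<in> Z. hits r j z}"
proof (rule finite_subset)
 show "{z \<in> Z. hits r j z} \<subseteq> {z \<in> Z. \<forall>i<k. z i \<in> {\<lfloor>- (2 ^ j * r)\<rfloor>..\<lfloor>2 ^ j * r\<rfloor>}}"
 proof
  fix z assume z: "z \<in> {z \<in> Z. hits r j z}"
  then obtain u where u: "idx j u = z" "norm (emb u) < r" by (auto simp: hits_def)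
  have "z i \<in> {\<lfloor>- (2 ^ j * r)\<rfloor>..\<lfloor>2 ^ j * r\<rfloor>}" if i: "i < k" for i
  proof -
   have "\<bar>u i\<bar> \<le> r" using emb_coord_le[OF i, of u] u(2) by linarith
   then have "u i \<le> r" "- r \<le> u i" by linarith+
   then have "2 ^ j * u i \<le> 2 ^ j * r" "2 ^ j * (- r) \<le> 2 ^ j * u i" by (intro mult_left_mono; simp)+
   then have "\<lfloor>2 ^ j * u i\<rfloor> \<le> \<lfloor>2 ^ j * r\<rfloor>" "\<lfloor>2 ^ j * (- r)\<rfloor> \<le> \<lfloor>2 ^ j * u i\<rfloor>" by (auto intro: floor_mono)
   moreover have "z i = \<lfloor>2 ^ j * u i\<rfloor>" using u(1) i by (auto simp: idx_def)
   ultimately show ?thesis by simp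
  qed
  then show "z \<in> {z \<in> Z. \<forall>i<k. z i \<in> {\<lfloor>- (2 ^ j * r)\<rfloor>..\<lfloor>2 ^ j * r\<rfloor>}}" using z by blast
 qed
qed (rule card_Z_Pi(1), rule finite_atLeastAtMost_int)

lemma hits_norm: "hits r j z \<Longrightarrow> idx j u = z \<Longrightarrow> norm (emb u) < r + real k"
proof -
 assume "hits r j z" "idx j u = z"
 then obtain v where v: "idx j v = z" "norm (emb v) < r" "idx j u = idx j v" by (auto simp: hits_def)
 have "norm (emb u) \<le> norm (emb v) + real k * 1"
 proof (rule norm_emb_close)
  fix i assume i: "i < k"
  have "1 / (2::real) ^ j \<le> 1" by simp
  then show "\<bar>u i - v i\<bar> \<le> 1" using idx_close[OF v(3) i] by linarith
 qed
 then show ?thesis using v by simp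
qed

lemma disc_sets: "{u \<in> space LK. norm (emb u) \<le> r} \<in> sets LK" by measurable

lemma emeasure_disc0: "0 < r \<Longrightarrow> emeasure LK {u \<in> space LK. norm (emb u) \<le> r} = ennreal (\<omega> * r ^ k)"
proof -
 assume "0 < r"
 then have "emeasure LK {u \<in> space LK. norm (emb u - emb (\<lambda>_. 0)) \<le> r} = ennreal (\<omega> * r ^ k)" by (rule emeasure_disc)
 moreover have "emb (\<lambda>_. 0) = 0" by (simp add: emb_def)
 ultimately show ?thesis by simp
qed

lemma emeasure_annulus:
 assumes "0 < r" "r < s" "s \<le> r'"
 shows "emeasure LK {u \<in> space LK. s \<le> norm (emb u) \<and> norm (emb u) \<le> r'} \<le> ennreal (\<omega> * (r' ^ k - r ^ k))"
proof -
 let ?D = "\<lambda>r. {u \<in> space LK. norm (emb u) \<le> r}"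
 have "{u \<in> space LK. s \<le> norm (emb u) \<and> norm (emb u) \<le> r'} \<subseteq> ?D r' - ?D r" using assms by auto
 then have "emeasure LK {u \<in> space LK. s \<le> norm (emb u) \<and> norm (emb u) \<le> r'} \<le> emeasure LK (?D r' - ?D r)"
  by (rule emeasure_mono) (intro sets.Diff disc_sets)
 also have "\<dots> = emeasure LK (?D r') - emeasure LK (?D r)"
  using assms by (intro emeasure_Diff disc_sets) (auto simp: emeasure_disc0)
 also have "\<dots> = ennreal (\<omega> * r' ^ k - \<omega> * r ^ k)"
  using assms by (simp add: emeasure_disc0 ennreal_minus)
 finally show ?thesis by (simp add: right_diff_distrib)
qed

end

subsection \<open>Mass and area accounting\<close>

context key2
begin

text \<open>These are the inactive cells with active parent; each inactive cell lies below exactly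
  one of them or is one.\<close>

definition FN :: "nat \<Rightarrow> zv set" where
 "FN j = {z \<in> Z. z \<notin> Act (Suc j) \<and> half z \<in> Act j}"

definition FH :: "nat \<Rightarrow> zv set" where "FH j = {z \<in> FN j. hits R (Suc j) z}"

definition HA :: "nat \<Rightarrow> zv set" where "HA j = {z \<in> Act j. hits R j z}"

lemma finite_FH: "finite (FH j)"
 by (rule finite_subset[OF _ finite_hits[of R "Suc j"]]) (auto simp: FH_def FN_def)

lemma finite_HA: "finite (HA j)"
 by (rule finite_subset[OF _ finite_hits[of R j]]) (use Act_Z in \<open>auto simp: HA_def\<close>)

lemma Act_idx: "idx (i + n) u \<in> Act (i + n) \<Longrightarrow> idx i u \<in> Act i"
proof (induction n)
 case (Suc n)
 then have "half (idx (Suc (i + n)) u) \<in> Act (i + n)" using Act_half_self by simp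
 then show ?case using Suc.IH by (simp add: half_idx)
qed simp

lemma Act_idx_le: "i \<le> j \<Longrightarrow> idx j u \<in> Act j \<Longrightarrow> idx i u \<in> Act i"
 using Act_idx[of i "j - i" u] by simp

lemma FN_disjoint:
 assumes "z \<in> FN j" "z' \<in> FN j'" "u \<in> cell (Suc j) z" "u \<in> cell (Suc j') z'"
 shows "j = j' \<and> z = z'"
proof -
 have *: False if "j < j'" "z \<in> FN j" "z' \<in> FN j'" "u \<in> cell (Suc j) z" "u \<in> cell (Suc j') z'" for j j' z z'
 proof -
  have z': "idx (Suc j') u = z'" "half z' \<in> Act j'" and z: "idx (Suc j) u = z" "z \<notin> Act (Suc j)"
   using that unfolding FN_def cell_def by blast+
  have "idx j' u \<in> Act j'" using z'(2) unfolding z'(1)[symmetric] half_idx .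
  then have "idx (Suc j) u \<in> Act (Suc j)" by (rule Act_idx_le[OF Suc_leI[OF that(1)]])
  then show False using z by simp
 qed
 have "j = j'" using *[of j j' z z'] *[of j' j z' z] assms by (meson linorder_neqE_nat)
 then show ?thesis using assms by (auto simp: cell_def)
qed

text \<open>Failed cells and the active cells of level \<open>J\<close> are disjoint. Each meets the
  open disc of radius \<open>R\<close> and has diameter at most \<open>k\<close>.\<close>

lemma area_total: "area J FH + (\<Sum>z\<in>HA J. (1 / 2 ^ J) ^ k) \<le> \<omega> * (R + real k) ^ k"
proof -
 let ?I1 = "SIGMA j:{..<J}. FH j"
 let ?I = "?I1 <+> HA J"
 let ?lev = "case_sum (\<lambda>q. Suc (fst q)) (\<lambda>_. J)"
 let ?ix = "case_sum snd (\<lambda>z. z)"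
 let ?S = "{u \<in> space LK. norm (emb u) \<le> R + real k}"
 have f1: "finite ?I1" using finite_FH by auto
 have fin: "finite ?I" using f1 finite_HA by simp
 have R: "0 < R + real k" using pos by simp
 have "(\<Sum>q\<in>?I. (1 / 2 ^ ?lev q) ^ k) \<le> \<omega> * (R + real k) ^ k"
 proof (rule area_le[OF fin])
  show "?ix q \<in> Z" if "q \<in> ?I" for q
   using that Act_Z by (auto simp: FH_def FN_def HA_def)
  show "disjoint_family_on (\<lambda>q. cell (?lev q) (?ix q)) ?I"
   unfolding disjoint_family_on_def
  proof (intro ballI impI)
   have FA: False if "j < J" "z \<in> FH j" "z' \<in> HA J" "u \<in> cell (Suc j) z" "u \<in> cell J z'" for j z z' u
   proof -
    have "idx J u \<in> Act J" using that by (auto simp: HA_def cell_def)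
    then have "idx (Suc j) u \<in> Act (Suc j)" using that by (intro Act_idx_le[of "Suc j" J]) auto
    then show False using that by (auto simp: FH_def FN_def cell_def)
   qed
   fix q q' assume q: "q \<in> ?I" "q' \<in> ?I" "q \<noteq> q'"
   show "cell (?lev q) (?ix q) \<inter> cell (?lev q') (?ix q') = {}"
   proof (rule ccontr)
    assume "cell (?lev q) (?ix q) \<inter> cell (?lev q') (?ix q') \<noteq> {}"
    then obtain u where u: "u \<in> cell (?lev q) (?ix q)" "u \<in> cell (?lev q') (?ix q')" by blast
    show False
    proof (cases q)
     case (Inl p)
     show False
     proof (cases q')
      case (Inl p')
      have "fst p = fst p' \<and> snd p = snd p'"
       by (rule FN_disjoint[of "snd p" "fst p" "snd p'" "fst p'" u])
        (use \<open>q = Inl p\<close> Inl q u in \<open>auto simp: FH_def\<close>)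
      then show False using \<open>q = Inl p\<close> Inl q(3) by (simp add: prod_eq_iff)
     next
      case (Inr z')
      show False by (rule FA[of "fst p" "snd p" z' u]) (use \<open>q = Inl p\<close> Inr q u in auto)
     qed
    next
     case (Inr z)
     show False
     proof (cases q')
      case (Inl p')
      show False by (rule FA[of "fst p'" "snd p'" z u]) (use \<open>q = Inr z\<close> Inl q u in auto)
     next
      case (Inr z')
      then show False using \<open>q = Inr z\<close> q u by (auto simp: cell_def)
     qed
    qed
   qed
  qed
  show "cell (?lev q) (?ix q) \<subseteq> ?S" if q: "q \<in> ?I" for q
  proof
   fix u assume u: "u \<in> cell (?lev q) (?ix q)"
   have "hits R (?lev q) (?ix q)" using q by (auto simp: FH_def HA_def)
   from hits_norm[OF this, of u] u show "u \<in> ?S" by (simp add: cell_def)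
  qed
  show "emeasure LK ?S \<le> ennreal (\<omega> * (R + real k) ^ k)" using emeasure_disc0[OF R] by simp
  show "0 \<le> \<omega> * (R + real k) ^ k" using R by simp
 qed (rule disc_sets)
 moreover have "(\<Sum>q\<in>?I. (1 / (2::real) ^ ?lev q) ^ k) = (\<Sum>q\<in>?I1. (1 / 2 ^ Suc (fst q)) ^ k) + (\<Sum>z\<in>HA J. (1 / 2 ^ J) ^ k)"
  by (subst sum.Plus[OF f1 finite_HA]) simp
 moreover have "(\<Sum>q\<in>?I1. (1 / (2::real) ^ Suc (fst q)) ^ k) = area J FH"
  using finite_FH by (subst sum.Sigma) (auto simp: split_beta)
 ultimately show ?thesis by simp
qed

lemma exceptional_mass:
 assumes z: "z \<in> Act (Suc j)"
 shows "measure M {x \<in> XX j z. \<rho> / 2 ^ Suc j < norm (res (Af (Suc j) z) x)} \<le> bb (Suc j) z * (1 / 2 ^ Suc j) ^ k / \<rho>\<^sup>2"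
proof -
 define t where "t = 1 / (2::real) ^ Suc j"
 let ?Y = "{x \<in> XX j z. \<rho> / 2 ^ Suc j < norm (res (Af (Suc j) z) x)}"
 have t: "0 < t" by (simp add: t_def)
 have "?Y = XX j z \<inter> {x. \<rho> / 2 ^ Suc j < norm (res (Af (Suc j) z) x)}" by auto
 then have Y: "?Y \<in> sets M" by (simp add: sets_M)
 have "ennreal ((\<rho> * t)\<^sup>2 * measure M ?Y) = (\<integral>\<^sup>+x. ennreal ((\<rho> * t)\<^sup>2) * indicator ?Y x \<partial>M)"
  using Y by (subst nn_integral_cmult_indicator) (auto simp: emeasure_eq_measure ennreal_mult)
 also have "\<dots> \<le> resint (Af (Suc j) z) (XX j z)"
 proof (rule nn_integral_mono)
  fix x
  show "ennreal ((\<rho> * t)\<^sup>2) * indicator ?Y x \<le> ennreal ((norm (res (Af (Suc j) z) x))\<^sup>2) * indicator (XX j z) x"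
   using pos t by (auto simp: indicator_def t_def intro!: ennreal_leI power_mono)
 qed
 also have "\<dots> \<le> ennreal (bb (Suc j) z * t ^ (k + 2))"
  unfolding t_def by (rule fit[OF z]) (use XX_subset_WW in auto)
 finally have "(\<rho> * t)\<^sup>2 * measure M ?Y \<le> bb (Suc j) z * t ^ (k + 2)"
  using bb_nonneg t by (subst (asm) ennreal_le_iff) auto
 then have "(\<rho>\<^sup>2 * measure M ?Y) * t\<^sup>2 \<le> (bb (Suc j) z * t ^ k) * t\<^sup>2"
  by (simp only: power_mult_distrib power_add mult_ac)
 then have "\<rho>\<^sup>2 * measure M ?Y \<le> bb (Suc j) z * t ^ k" using t by simp
 then show ?thesis using pos by (simp add: t_def field_simps)
qed

lemma supp_null: "measure M {x. R \<le> norm (hor x)} = 0"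
 using supp by (simp add: measure_def)

text \<open>A point is lost between two levels because its cell failed, because it is far from the
  fit of its cell, which Chebyshev's inequality limits, or because it lies in the null set outside
  radius \<open>R\<close>.\<close>

lemma Gd_step:
 "measure M (Gd j) \<le> measure M (Gd (Suc j)) + (\<Sum>z\<in>FH j. measure M (XX j z)) + (\<Sum>z\<in>Act (Suc j). bb (Suc j) z * (1 / 2 ^ Suc j) ^ k) / \<rho>\<^sup>2"
proof -
 let ?Y = "\<lambda>z. {x \<in> XX j z. \<rho> / 2 ^ Suc j < norm (res (Af (Suc j) z) x)}"
 have Y: "?Y z \<in> sets M" for z
 proof -
  have "?Y z = XX j z \<inter> {x. \<rho> / 2 ^ Suc j < norm (res (Af (Suc j) z) x)}" by auto
  then show ?thesis by (simp add: sets_M)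
 qed
 have hs: "{x. R \<le> norm (hor x)} \<in> sets M" by (simp add: sets_M)
 let ?A = "\<Union>z\<in>FH j. XX j z" let ?B = "\<Union>z\<in>Act (Suc j). ?Y z"
 have A: "?A \<in> sets M" using finite_FH by (auto simp: sets_M)
 have B: "?B \<in> sets M" using finite_Act Y by auto
 have "Gd j \<subseteq> ((Gd (Suc j) \<union> ?A) \<union> ?B) \<union> {x. R \<le> norm (hor x)}"
 proof
  fix x assume x: "x \<in> Gd j"
  define z where "z = idx (Suc j) (co x)"
  have xX: "x \<in> XX j z" using x by (simp add: XX_iff z_def)
  show "x \<in> ((Gd (Suc j) \<union> ?A) \<union> ?B) \<union> {x. R \<le> norm (hor x)}"
  proof (cases "z \<in> Act (Suc j)")
   case True
   show ?thesis
   proof (cases "norm (res (Af (Suc j) z) x) \<le> \<rho> / 2 ^ Suc j")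
    case True
    then have "x \<in> Gd (Suc j)" using x \<open>z \<in> Act (Suc j)\<close> by (simp only: Gd_Suc z_def simp_thms)
    then show ?thesis by blast
   next
    case False
    then have "x \<in> ?Y z" using xX by simp
    then show ?thesis using \<open>z \<in> Act (Suc j)\<close> by blast
   qed
  next
   case False
   have "half z \<in> Act j" using Gd_res[OF x] by (simp add: z_def half_idx)
   then have FN: "z \<in> FN j" using False by (simp add: FN_def z_def)
   show ?thesis
   proof (cases "norm (hor x) < R")
    case True
    then have "hits R (Suc j) z" unfolding hits_def by (intro exI[of _ "co x"]) (simp add: z_def hor_def)
    then have "z \<in> FH j" using FN by (simp add: FH_def)
    then show ?thesis using xX by blast
   next
    case False
    then show ?thesis by auto
   qed
  qed
 qed
 then have "measure M (Gd j) \<le> measure M (((Gd (Suc j) \<union> ?A) \<union> ?B) \<union> {x. R \<le> norm (hor x)})"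
  using A B hs by (intro finite_measure_mono) (auto simp: sets_M)
 also have "\<dots> \<le> measure M ((Gd (Suc j) \<union> ?A) \<union> ?B) + measure M {x. R \<le> norm (hor x)}"
  using A B hs by (intro measure_Un_le) (auto simp: sets_M)
 also have "measure M ((Gd (Suc j) \<union> ?A) \<union> ?B) \<le> measure M (Gd (Suc j) \<union> ?A) + measure M ?B"
  using A B by (intro measure_Un_le) (auto simp: sets_M)
 also have "measure M (Gd (Suc j) \<union> ?A) \<le> measure M (Gd (Suc j)) + measure M ?A"
  using A by (intro measure_Un_le) (auto simp: sets_M)
 also have "measure M ?A \<le> (\<Sum>z\<in>FH j. measure M (XX j z))"
  using finite_FH by (intro measure_UNION_le) (auto simp: sets_M)
 also have "measure M ?B \<le> (\<Sum>z\<in>Act (Suc j). measure M (?Y z))"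
  using finite_Act Y by (intro measure_UNION_le) auto
 also have "\<dots> \<le> (\<Sum>z\<in>Act (Suc j). bb (Suc j) z * (1 / 2 ^ Suc j) ^ k / \<rho>\<^sup>2)"
  by (rule sum_mono) (rule exceptional_mass)
 also have "\<dots> = (\<Sum>z\<in>Act (Suc j). bb (Suc j) z * (1 / 2 ^ Suc j) ^ k) / \<rho>\<^sup>2"
  by (rule sum_divide_distrib[symmetric])
 finally show ?thesis using supp_null by simp
qed

lemma bb_Act_sum: "(\<Sum>j<J. \<Sum>z\<in>Act (Suc j). bb (Suc j) z * (1 / 2 ^ Suc j) ^ k) \<le> Bt"
proof -
 have "(\<Sum>j<J. \<Sum>z\<in>Act (Suc j). bb (Suc j) z * (1 / 2 ^ Suc j) ^ k) \<le> (\<Sum>j<J. \<Sum>z\<in>DD j. bb (Suc j) z * (1 / 2 ^ Suc j) ^ k)"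
  by (intro sum_mono sum_mono2 finite_DD Act_DD) (simp add: bb_nonneg)
 then show ?thesis using bb_sum[of J] by linarith
qed

lemma initial_mass: "measure M UNIV \<le> measure M (Gd 0) + \<tau> / \<rho>\<^sup>2"
proof -
 let ?Y = "{x. \<rho> < norm (ver x)}"
 have Y: "?Y \<in> sets M" by (simp add: sets_M)
 have "ennreal (\<rho>\<^sup>2 * measure M ?Y) = (\<integral>\<^sup>+x. ennreal (\<rho>\<^sup>2) * indicator ?Y x \<partial>M)"
  using Y by (subst nn_integral_cmult_indicator) (auto simp: emeasure_eq_measure ennreal_mult)
 also have "\<dots> \<le> (\<integral>\<^sup>+x. ennreal ((norm (ver x))\<^sup>2) \<partial>M)"
  using pos by (intro nn_integral_mono) (auto simp: indicator_def intro!: ennreal_leI power_mono)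
 also note vertical
 finally have "\<rho>\<^sup>2 * measure M ?Y \<le> \<tau>" using pos by (subst (asm) ennreal_le_iff) auto
 then have "measure M ?Y \<le> \<tau> / \<rho>\<^sup>2" using pos by (simp add: field_simps)
 moreover have "measure M UNIV \<le> measure M (Gd 0) + measure M ?Y"
 proof -
  have "UNIV = Gd 0 \<union> ?Y" by (auto simp: Gd_0)
  then show ?thesis using measure_Un_le[of "Gd 0" M ?Y] Y by (simp add: sets_M)
 qed
 ultimately show ?thesis by linarith
qed

lemma mass_balance:
 "measure M UNIV \<le> (\<tau> + Bt) / \<rho>\<^sup>2 + (\<Sum>j<J. \<Sum>z\<in>FH j. measure M (XX j z)) + measure M (Gd J)"
proof -
 have "measure M (Gd 0) \<le> (\<Sum>j<J. \<Sum>z\<in>Act (Suc j). bb (Suc j) z * (1 / 2 ^ Suc j) ^ k) / \<rho>\<^sup>2 + (\<Sum>j<J. \<Sum>z\<in>FH j. measure M (XX j z)) + measure M (Gd J)"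
 proof (induction J)
  case (Suc J)
  then show ?case using Gd_step[of J] by (simp only: sum.lessThan_Suc add_divide_distrib)
 qed simp
 also have "(\<Sum>j<J. \<Sum>z\<in>Act (Suc j). bb (Suc j) z * (1 / 2 ^ Suc j) ^ k) / \<rho>\<^sup>2 \<le> Bt / \<rho>\<^sup>2"
  by (intro divide_right_mono bb_Act_sum) simp
 finally show ?thesis using initial_mass by (simp add: add_divide_distrib)
qed

lemma bottom_mass:
 assumes c: "0 \<le> c"
  and Uc: "\<And>y r. 0 < r \<Longrightarrow> r \<le> 2 * \<Lambda> * (1 / 2 ^ J) * (1 + \<alpha>) \<Longrightarrow> measure M (ball y r) \<le> c * \<omega> * r ^ k"
 shows "measure M (Gd J) \<le> c * \<Lambda> * (\<Sum>z\<in>HA J. (1 / 2 ^ J) ^ k)"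
proof -
 let ?X = "\<lambda>z. {x \<in> Gd J. idx J (co x) = z}"
 have hs: "{x. R \<le> norm (hor x)} \<in> sets M" by (simp add: sets_M)
 have Xs: "?X z \<in> sets M" for z by (simp add: sets_M)
 have XU: "(\<Union>z\<in>HA J. ?X z) \<in> sets M" using finite_HA Xs by (intro sets.finite_UN) auto
 have "Gd J \<subseteq> (\<Union>z\<in>HA J. ?X z) \<union> {x. R \<le> norm (hor x)}"
 proof
  fix x assume x: "x \<in> Gd J"
  have A: "idx J (co x) \<in> Act J" using Gd_res[OF x] by blast
  show "x \<in> (\<Union>z\<in>HA J. ?X z) \<union> {x. R \<le> norm (hor x)}"
  proof (cases "norm (hor x) < R")
   case True
   then have "hits R J (idx J (co x))" unfolding hits_def by (intro exI[of _ "co x"]) (simp add: hor_def)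
   then show ?thesis using A x by (auto simp: HA_def)
  qed auto
 qed
 then have "measure M (Gd J) \<le> measure M ((\<Union>z\<in>HA J. ?X z) \<union> {x. R \<le> norm (hor x)})"
  by (rule finite_measure_mono) (rule sets.Un[OF XU hs])
 also have "\<dots> \<le> measure M (\<Union>z\<in>HA J. ?X z) + measure M {x. R \<le> norm (hor x)}"
  by (rule measure_Un_le[OF XU hs])
 also have "measure M (\<Union>z\<in>HA J. ?X z) \<le> (\<Sum>z\<in>HA J. measure M (?X z))"
  by (rule measure_UNION_le[OF finite_HA Xs])
 also have "\<dots> \<le> (\<Sum>z\<in>HA J. c * \<Lambda> * (1 / 2 ^ J) ^ k)"
  using cell_mass_le[of 0 c J] c Uc by (intro sum_mono) simp
 also have "\<dots> = c * \<Lambda> * (\<Sum>z\<in>HA J. (1 / 2 ^ J) ^ k)" by (rule sum_distrib_left[symmetric])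
 finally show ?thesis using supp_null by simp
qed

text \<open>Cells that failed because they carry too little mass.\<close>

definition LO :: "nat \<Rightarrow> zv set" where
 "LO j = {z \<in> FH j. consid j z \<and> \<not> dense j z}"

text \<open>The right side is small once the total mass is close to \<open>\<omega> * R ^ k\<close>,
  \<open>\<Lambda>\<close> is close to 1 and \<open>R\<close> is large against \<open>k\<close>: the
  failed and active cells together hold at most \<open>\<Lambda>\<close> times the disc, less the
  deficits of the sparse cells.\<close>

lemma low_sum:
 "\<kappa> * area J LO \<le> (\<tau> + Bt) / \<rho>\<^sup>2 + \<Lambda> * (\<omega> * (R + real k) ^ k) - measure M UNIV"
proof -
 have LF: "LO j \<subseteq> FH j" for j by (auto simp: LO_def)
 have "(\<Sum>z\<in>FH j. measure M (XX j z)) \<le> \<Lambda> * (\<Sum>z\<in>FH j. (1 / 2 ^ Suc j) ^ k) - \<kappa> * (\<Sum>z\<in>LO j. (1 / 2 ^ Suc j) ^ k)" for j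
 proof -
  have "(\<Sum>z\<in>FH j. measure M (XX j z)) \<le> (\<Sum>z\<in>FH j. \<Lambda> * (1 / 2 ^ Suc j) ^ k - (if z \<in> LO j then \<kappa> * (1 / 2 ^ Suc j) ^ k else 0))"
  proof (rule sum_mono)
   fix z assume "z \<in> FH j"
   show "measure M (XX j z) \<le> \<Lambda> * (1 / 2 ^ Suc j) ^ k - (if z \<in> LO j then \<kappa> * (1 / 2 ^ Suc j) ^ k else 0)"
   proof (cases "z \<in> LO j")
    case True
    then have "measure M (XX j z) < (1 - \<kappa>) * (1 / 2 ^ Suc j) ^ k"
     by (simp only: LO_def dense_def dense'_def XX_def mem_Collect_eq not_le)
    \<comment> \<open>As \<open>1 \<le> \<Lambda>\<close>, a deficit relative to the volume is also
      a deficit relative to the general upper bound.\<close>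
    also have "\<dots> \<le> (\<Lambda> - \<kappa>) * (1 / 2 ^ Suc j) ^ k"
     using Lam_bounds by (intro mult_right_mono) auto
    finally show ?thesis using True by (simp only: if_True left_diff_distrib)
   qed (use XX_mass_le in simp)
  qed
  also have "\<dots> = \<Lambda> * (\<Sum>z\<in>FH j. (1 / 2 ^ Suc j) ^ k) - (\<Sum>z\<in>FH j. if z \<in> LO j then \<kappa> * (1 / 2 ^ Suc j) ^ k else 0)"
   by (simp only: sum_subtractf sum_distrib_left)
  also have "(\<Sum>z\<in>FH j. if z \<in> LO j then \<kappa> * (1 / 2 ^ Suc j) ^ k else 0) = (\<Sum>z\<in>LO j. \<kappa> * (1 / 2 ^ Suc j) ^ k)"
   using LF finite_FH by (subst sum.inter_restrict[symmetric]) (auto simp: Int_absorb1)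
  also have "\<dots> = \<kappa> * (\<Sum>z\<in>LO j. (1 / 2 ^ Suc j) ^ k)" by (rule sum_distrib_left[symmetric])
  finally show ?thesis .
 qed
 then have "(\<Sum>j<J. \<Sum>z\<in>FH j. measure M (XX j z)) \<le> (\<Sum>j<J. \<Lambda> * (\<Sum>z\<in>FH j. (1 / 2 ^ Suc j) ^ k) - \<kappa> * (\<Sum>z\<in>LO j. (1 / 2 ^ Suc j) ^ k))"
  by (rule sum_mono)
 also have "\<dots> = \<Lambda> * area J FH - \<kappa> * area J LO"
  by (simp only: sum_subtractf sum_distrib_left)
 finally have 1: "(\<Sum>j<J. \<Sum>z\<in>FH j. measure M (XX j z)) \<le> \<Lambda> * area J FH - \<kappa> * area J LO" .
 have 2: "measure M (Gd J) \<le> \<Lambda> * (\<Sum>z\<in>HA J. (1 / 2 ^ J) ^ k)"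
  using bottom_mass[of 1 J] U by simp
 have 3: "\<Lambda> * (area J FH + (\<Sum>z\<in>HA J. (1 / 2 ^ J) ^ k)) \<le> \<Lambda> * (\<omega> * (R + real k) ^ k)"
  using area_total Lam_bounds by (intro mult_left_mono) auto
 show ?thesis using mass_balance[of J] 1 2 3 unfolding distrib_left by linarith
qed

text \<open>The examined failed cells that can account for an unexamined one meeting the disc: such
  a cell lies within radius \<open>R + k\<close>, and \<open>near_failed\<close> bounds the distance
  by four sides of the larger cell.\<close>

definition RL :: "nat \<Rightarrow> zv set" where
 "RL j = {z \<in> FN j. consid j z \<and> (\<exists>u u'. norm (emb u) < R + real k \<and> idx (Suc j) u' = z \<and> (\<forall>i<k. \<bar>u i - u' i\<bar> \<le> 4 / 2 ^ Suc j))}"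

text \<open>A cell that was not examined lies close to a failed cell of at least its size: follow the
 inactive neighbours upwards; the distances form a geometric series.\<close>

lemma near_failed:
 assumes "idx (Suc j) u \<in> FN j"
 shows "\<exists>i\<le>j. \<exists>u'. idx (Suc i) u' \<in> FN i \<and> consid i (idx (Suc i) u') \<and> (\<forall>l<k. \<bar>u l - u' l\<bar> \<le> 4 / 2 ^ Suc i - 4 / 2 ^ Suc j)"
 using assms
proof (induction j arbitrary: u rule: less_induct)
 case (less j)
 let ?z = "idx (Suc j) u"
 show ?case
 proof (cases "consid j ?z")
  case True
  then show ?thesis using less.prems by (intro exI[of _ j] conjI exI[of _ u]) auto
 next
  case False
  then obtain w where w: "w \<in> Z" "adj w (half ?z)" "w \<notin> Act j"
   using less.prems by (auto simp: consid_def consid'_def FN_def)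
  then obtain j0 where j0: "j = Suc j0" by (cases j) (auto simp: Act_0)
  define p where "p = (\<lambda>l. real_of_int (w l) / 2 ^ j)"
  have p: "idx j p = w"
   unfolding idx_eq_iff using w(1) by (auto simp: p_def divide_strict_right_mono)
  \<comment> \<open>The corner \<open>p\<close> represents the inactive neighbour. Its coarsest
    inactive ancestor is a failed cell of a strictly smaller level, to which the induction
    applies.\<close>
  define i0 where "i0 = (LEAST i. idx (Suc i) p \<notin> Act (Suc i))"
  have na: "idx (Suc j0) p \<notin> Act (Suc j0)" using p w j0 by simp
  have i0: "idx (Suc i0) p \<notin> Act (Suc i0)" "i0 \<le> j0"
   unfolding i0_def
   by (rule LeastI[of "\<lambda>i. idx (Suc i) p \<notin> Act (Suc i)", OF na], rule Least_le[of "\<lambda>i. idx (Suc i) p \<notin> Act (Suc i)", OF na])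
  have "idx i0 p \<in> Act i0"
  proof (cases i0)
   case (Suc n)
   then show ?thesis using not_less_Least[of n "\<lambda>i. idx (Suc i) p \<notin> Act (Suc i)"] by (auto simp: i0_def)
  qed (simp add: Act_0)
  then have FN0: "idx (Suc i0) p \<in> FN i0" using i0 by (simp add: FN_def half_idx)
  have "i0 < j" using i0 j0 by simp
  from less.IH[OF this FN0] obtain i u' where iu: "i \<le> i0" "idx (Suc i) u' \<in> FN i" "consid i (idx (Suc i) u')"
   "\<And>l. l < k \<Longrightarrow> \<bar>p l - u' l\<bar> \<le> 4 / 2 ^ Suc i - 4 / 2 ^ Suc i0" by blast
  have "\<bar>u l - u' l\<bar> \<le> 4 / 2 ^ Suc i - 4 / 2 ^ Suc j" if l: "l < k" for l
  proof -
   have "adj (idx j p) (idx j u)" using w(2) by (simp add: p half_idx)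
   then have "\<bar>p l - u l\<bar> \<le> 2 / 2 ^ j" using l by (rule idx_adj_dist)
   moreover have "4 / 2 ^ j \<le> 4 / (2::real) ^ Suc i0"
    using i0(2) j0 by (intro divide_left_mono power_increasing) auto
   moreover have "2 / 2 ^ j = 4 / 2 ^ j - 4 / (2::real) ^ Suc j" by simp
   ultimately show ?thesis using iu(4)[OF l] by linarith
  qed
  then show ?thesis using iu i0 j0 by (intro exI[of _ i] conjI exI[of _ u']) auto
 qed
qed

lemma RL_hits: "RL j \<subseteq> {z \<in> Z. hits (R + 5 * real k) (Suc j) z}"
proof
 fix z assume "z \<in> RL j"
 then obtain u u' where u: "z \<in> Z" "norm (emb u) < R + real k" "idx (Suc j) u' = z" "\<And>i. i < k \<Longrightarrow> \<bar>u i - u' i\<bar> \<le> 4 / 2 ^ Suc j"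
  by (auto simp: RL_def FN_def)
 have "norm (emb u') \<le> norm (emb u) + real k * 4"
 proof (rule norm_emb_close)
  fix i assume "i < k"
  have "4 / (2::real) ^ Suc j \<le> 4 / 1" by (intro divide_left_mono one_le_power) auto
  then show "\<bar>u' i - u i\<bar> \<le> 4" using u(4)[OF \<open>i < k\<close>] by (simp add: abs_minus_commute)
 qed
 then show "z \<in> {z \<in> Z. hits (R + 5 * real k) (Suc j) z}" using u by (auto simp: hits_def intro!: exI[of _ u'])
qed

lemma finite_RL: "finite (RL j)"
 using finite_hits RL_hits by (rule rev_finite_subset)

lemma FH_consid_RL: "z \<in> FH j \<Longrightarrow> consid j z \<Longrightarrow> z \<in> RL j"
proof -
 assume z: "z \<in> FH j" "consid j z"
 then obtain u where u: "idx (Suc j) u = z" "norm (emb u) < R" by (auto simp: FH_def hits_def)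
 have "\<exists>u u'. norm (emb u) < R + real k \<and> idx (Suc j) u' = z \<and> (\<forall>i<k. \<bar>u i - u' i\<bar> \<le> 4 / 2 ^ Suc j)"
  by (intro exI[of _ u]) (use u in auto)
 then show ?thesis using z by (auto simp: RL_def FH_def)
qed

lemma RL_Sigma_disjoint: "disjoint_family_on (\<lambda>q. cell (Suc (fst q)) (snd q)) I"
 if "\<And>q. q \<in> I \<Longrightarrow> snd q \<in> FN (fst q)"
 unfolding disjoint_family_on_def
proof (intro ballI impI)
 fix q q' assume q: "q \<in> I" "q' \<in> I" "q \<noteq> q'"
 show "cell (Suc (fst q)) (snd q) \<inter> cell (Suc (fst q')) (snd q') = {}"
  using FN_disjoint[OF that[OF q(1)] that[OF q(2)]] q(3) by (metis disjoint_iff prod_eqI)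
qed

text \<open>Unexamined failed cells are disjoint and lie in the examined ones enlarged by four sides
  in each direction, that is to \<open>1 + 2 * 4 = 9\<close> sides.\<close>

lemma FH_sum_le: "area J FH \<le> (1 + 9 ^ k) * area J RL"
proof -
 let ?NC = "\<lambda>j. {z \<in> FH j. \<not> consid j z}"
 let ?I = "SIGMA j:{..<J}. ?NC j" let ?K = "SIGMA j:{..<J}. RL j"
 let ?D = "\<lambda>q. {u \<in> space LK. \<forall>l<k. real_of_int (snd q l) / 2 ^ Suc (fst q) - 4 / 2 ^ Suc (fst q) \<le> u l \<and>
   u l < (real_of_int (snd q l) + 1) / 2 ^ Suc (fst q) + 4 / 2 ^ Suc (fst q)}"
 let ?S = "\<Union>q\<in>?K. ?D q"
 have fI: "finite ?I" using finite_FH by auto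
 have fK: "finite ?K" using finite_RL by auto
 have D: "?D q \<in> sets LK" for q by measurable
 have eD: "emeasure LK (?D q) = ennreal (9 ^ k * (1 / 2 ^ Suc (fst q)) ^ k)" for q
 proof -
  have "emeasure LK (?D q) = ennreal (\<Prod>l<k. 9 * (1 / 2 ^ Suc (fst q)))"
  proof (subst emeasure_box)
   fix l
   have "real_of_int (snd q l) / 2 ^ Suc (fst q) \<le> (real_of_int (snd q l) + 1) / 2 ^ Suc (fst q)"
    by (intro divide_right_mono) auto
   moreover have "0 \<le> 4 / (2::real) ^ Suc (fst q)" by simp
   ultimately show "real_of_int (snd q l) / 2 ^ Suc (fst q) - 4 / 2 ^ Suc (fst q) \<le> (real_of_int (snd q l) + 1) / 2 ^ Suc (fst q) + 4 / 2 ^ Suc (fst q)"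
    by linarith
  qed (simp add: add_divide_distrib)
  then show ?thesis by (simp only: prod_constant card_lessThan power_mult_distrib)
 qed
 have "(\<Sum>q\<in>?I. (1 / (2::real) ^ Suc (fst q)) ^ k) \<le> 9 ^ k * (\<Sum>q\<in>?K. (1 / 2 ^ Suc (fst q)) ^ k)"
 proof (rule area_le[OF fI, of snd "\<lambda>q. Suc (fst q)" ?S])
  show "snd q \<in> Z" if "q \<in> ?I" for q using that by (auto simp: FH_def FN_def)
  show "disjoint_family_on (\<lambda>q. cell (Suc (fst q)) (snd q)) ?I"
   by (rule RL_Sigma_disjoint) (auto simp: FH_def)
  show "?S \<in> sets LK" using fK D by (intro sets.finite_UN) auto
  show "cell (Suc (fst q)) (snd q) \<subseteq> ?S" if q: "q \<in> ?I" for q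
  proof
   fix u assume u: "u \<in> cell (Suc (fst q)) (snd q)"
   have z: "snd q \<in> FN (fst q)" "hits R (Suc (fst q)) (snd q)" "fst q < J" using q by (auto simp: FH_def)
   have iu: "idx (Suc (fst q)) u = snd q" and us: "u \<in> space LK" using u by (auto simp: cell_def)
   have nu: "norm (emb u) < R + real k" using hits_norm[OF z(2) iu] .
   obtain i u' where i: "i \<le> fst q" "idx (Suc i) u' \<in> FN i" "consid i (idx (Suc i) u')"
    "\<And>l. l < k \<Longrightarrow> \<bar>u l - u' l\<bar> \<le> 4 / 2 ^ Suc i - 4 / 2 ^ Suc (fst q)"
    using near_failed[of "fst q" u] z(1) iu by auto
   have d: "\<bar>u l - u' l\<bar> \<le> 4 / 2 ^ Suc i" if "l < k" for l
   proof -
    have "0 \<le> 4 / (2::real) ^ Suc (fst q)" by simp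
    then show ?thesis using i(4)[OF that] by linarith
   qed
   have "idx (Suc i) u' \<in> RL i" using i nu d by (auto simp: RL_def)
   then have K: "(i, idx (Suc i) u') \<in> ?K" using i(1) z(3) by auto
   have "u \<in> ?D (i, idx (Suc i) u')"
   proof -
    have "real_of_int (idx (Suc i) u' l) / 2 ^ Suc i - 4 / 2 ^ Suc i \<le> u l \<and> u l < (real_of_int (idx (Suc i) u' l) + 1) / 2 ^ Suc i + 4 / 2 ^ Suc i"
     if l: "l < k" for l
     using idx_bounds[OF l, of "Suc i" u'] d[OF l] unfolding abs_le_iff by linarith
    then show ?thesis using us by (simp del: power_Suc)
   qed
   then show "u \<in> ?S" using K by blast
  qed
  have "emeasure LK ?S \<le> (\<Sum>q\<in>?K. emeasure LK (?D q))"
   by (rule emeasure_subadditive_finite[OF fK]) (use D in auto)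
  also have "\<dots> = ennreal (\<Sum>q\<in>?K. 9 ^ k * (1 / 2 ^ Suc (fst q)) ^ k)" by (simp only: eD) simp
  finally show "emeasure LK ?S \<le> ennreal (9 ^ k * (\<Sum>q\<in>?K. (1 / 2 ^ Suc (fst q)) ^ k))" by (simp only: sum_distrib_left)
 qed (simp add: sum_nonneg)
 moreover have "(\<Sum>q\<in>?I. (1 / (2::real) ^ Suc (fst q)) ^ k) = area J ?NC"
  using finite_FH by (subst sum.Sigma) (auto simp: split_beta)
 moreover have "(\<Sum>q\<in>?K. (1 / (2::real) ^ Suc (fst q)) ^ k) = area J RL"
  using finite_RL by (subst sum.Sigma) (auto simp: split_beta)
 ultimately have 1: "area J ?NC \<le> 9 ^ k * area J RL" by simp
 have "(\<Sum>z\<in>FH j. (1 / (2::real) ^ Suc j) ^ k) \<le> (\<Sum>z\<in>RL j. (1 / 2 ^ Suc j) ^ k) + (\<Sum>z\<in>?NC j. (1 / 2 ^ Suc j) ^ k)" for j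
 proof -
  have "(\<Sum>z\<in>FH j. (1 / (2::real) ^ Suc j) ^ k) \<le> (\<Sum>z\<in>RL j \<union> ?NC j. (1 / 2 ^ Suc j) ^ k)"
   using finite_FH finite_RL FH_consid_RL by (intro sum_mono2) auto
  also have "\<dots> \<le> (\<Sum>z\<in>RL j. (1 / 2 ^ Suc j) ^ k) + (\<Sum>z\<in>?NC j. (1 / 2 ^ Suc j) ^ k)"
   using finite_FH finite_RL by (subst sum.union_inter[symmetric]) (auto intro!: sum_nonneg)
  finally show ?thesis .
 qed
 then have "area J FH \<le> (\<Sum>j<J. (\<Sum>z\<in>RL j. (1 / 2 ^ Suc j) ^ k) + (\<Sum>z\<in>?NC j. (1 / 2 ^ Suc j) ^ k))"
  by (rule sum_mono)
 also have "\<dots> = area J RL + area J ?NC" by (rule sum.distrib)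
 finally show ?thesis using 1 by (simp only: distrib_right mult_1)
qed

text \<open>One term for each way an examined cell can fail, and one for the boundary: too little
  mass, position beyond radius \<open>R\<close>, lack of flatness, steepness.\<close>

definition \<Phi> :: real where
 "\<Phi> = ((\<tau> + Bt) / \<rho>\<^sup>2 + \<Lambda> * (\<omega> * (R + real k) ^ k) - measure M UNIV) / \<kappa>
   + \<omega> * ((R + 10 * real k) ^ k - (R - 1 / 2) ^ k) + Bt / \<phi> + 16 * real k * ET / \<theta>\<^sup>2"

lemma RL_sum_le: "area J RL \<le> \<Phi>"
proof -
 let ?LN = "\<lambda>j. {z \<in> RL j. \<not> hits R (Suc j) z}"
 let ?NF = "\<lambda>j. {z \<in> DD j. \<phi> < bb (Suc j) z}"
 let ?t = "\<lambda>j. (1 / (2::real) ^ Suc j) ^ k"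
 have fLO: "finite (LO j)" for j by (rule finite_subset[OF _ finite_FH[of j]]) (auto simp: LO_def)
 have sub: "RL j \<subseteq> ((LO j \<union> ?LN j) \<union> ?NF j) \<union> TL j" for j
 proof
  fix z assume z: "z \<in> RL j"
  then have c: "consid j z" "z \<in> FN j" "z \<in> Z" "z \<notin> Act (Suc j)" by (auto simp: RL_def FN_def)
  show "z \<in> ((LO j \<union> ?LN j) \<union> ?NF j) \<union> TL j"
  proof (cases "hits R (Suc j) z")
   case False
   then show ?thesis using z by auto
  next
   case True
   then show ?thesis using c by (cases "dense j z") (auto simp: LO_def FH_def TL_def DD_def)
  qed
 qed
 have fs: "finite (LO j)" "finite (?LN j)" "finite (?NF j)" "finite (TL j)" for j
  using fLO finite_RL finite_DD finite_TL by auto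
 have un: "sum (\<lambda>_. ?t j) (A \<union> B) \<le> sum (\<lambda>_. ?t j) A + sum (\<lambda>_. ?t j) B" if "finite A" "finite B" for A B :: "zv set" and j
  using that by (subst sum.union_inter[symmetric]) (auto intro!: sum_nonneg)
 have "(\<Sum>z\<in>RL j. ?t j) \<le> (\<Sum>z\<in>LO j. ?t j) + (\<Sum>z\<in>?LN j. ?t j) + (\<Sum>z\<in>?NF j. ?t j) + (\<Sum>z\<in>TL j. ?t j)" for j
 proof -
  have "(\<Sum>z\<in>RL j. ?t j) \<le> (\<Sum>z\<in>((LO j \<union> ?LN j) \<union> ?NF j) \<union> TL j. ?t j)"
   using sub fs by (intro sum_mono2) auto
  also have "\<dots> \<le> (\<Sum>z\<in>(LO j \<union> ?LN j) \<union> ?NF j. ?t j) + (\<Sum>z\<in>TL j. ?t j)" using fs by (intro un) auto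
  also have "(\<Sum>z\<in>(LO j \<union> ?LN j) \<union> ?NF j. ?t j) \<le> (\<Sum>z\<in>LO j \<union> ?LN j. ?t j) + (\<Sum>z\<in>?NF j. ?t j)" using fs by (intro un) auto
  also have "(\<Sum>z\<in>LO j \<union> ?LN j. ?t j) \<le> (\<Sum>z\<in>LO j. ?t j) + (\<Sum>z\<in>?LN j. ?t j)" using fs by (intro un) auto
  finally show ?thesis by simp
 qed
 then have "(\<Sum>j<J. \<Sum>z\<in>RL j. ?t j) \<le> (\<Sum>j<J. (\<Sum>z\<in>LO j. ?t j) + (\<Sum>z\<in>?LN j. ?t j) + (\<Sum>z\<in>?NF j. ?t j) + (\<Sum>z\<in>TL j. ?t j))"
  by (rule sum_mono)
 then have S: "(\<Sum>j<J. \<Sum>z\<in>RL j. ?t j) \<le> (\<Sum>j<J. \<Sum>z\<in>LO j. ?t j) + (\<Sum>j<J. \<Sum>z\<in>?LN j. ?t j) + (\<Sum>j<J. \<Sum>z\<in>?NF j. ?t j) + (\<Sum>j<J. \<Sum>z\<in>TL j. ?t j)"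
  by (simp only: sum.distrib)
 have 1: "(\<Sum>j<J. \<Sum>z\<in>LO j. ?t j) \<le> ((\<tau> + Bt) / \<rho>\<^sup>2 + \<Lambda> * (\<omega> * (R + real k) ^ k) - measure M UNIV) / \<kappa>"
  using low_sum[of J] kappa(1) by (simp add: pos_le_divide_eq mult.commute)
 have 2: "(\<Sum>j<J. \<Sum>z\<in>?LN j. ?t j) \<le> \<omega> * ((R + 10 * real k) ^ k - (R - 1 / 2) ^ k)"
 proof -
  let ?I = "SIGMA j:{..<J}. ?LN j"
  let ?S = "{u \<in> space LK. R \<le> norm (emb u) \<and> norm (emb u) \<le> R + 10 * real k}"
  have fI: "finite ?I" using finite_RL by auto
  have "(\<Sum>q\<in>?I. (1 / 2 ^ Suc (fst q)) ^ k) \<le> \<omega> * ((R + 10 * real k) ^ k - (R - 1 / 2) ^ k)"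
  proof (rule area_le[OF fI, of snd "\<lambda>q. Suc (fst q)" ?S])
   show "snd q \<in> Z" if "q \<in> ?I" for q using that by (auto simp: RL_def FN_def)
   show "disjoint_family_on (\<lambda>q. cell (Suc (fst q)) (snd q)) ?I"
    by (rule RL_Sigma_disjoint) (auto simp: RL_def)
   show "?S \<in> sets LK" by measurable
   \<comment> \<open>The comparison disc needs a radius strictly below \<open>R\<close>; hence
     \<open>R - 1 / 2\<close>. The outer radius \<open>R + 6 * k\<close> is rounded up.\<close>
   show "emeasure LK ?S \<le> ennreal (\<omega> * ((R + 10 * real k) ^ k - (R - 1 / 2) ^ k))"
    using pos by (intro emeasure_annulus) auto
   show "0 \<le> \<omega> * ((R + 10 * real k) ^ k - (R - 1 / 2) ^ k)"
    using pos by (intro mult_nonneg_nonneg) (auto intro!: power_mono)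
   show "cell (Suc (fst q)) (snd q) \<subseteq> ?S" if q: "q \<in> ?I" for q
   proof
    fix u assume u: "u \<in> cell (Suc (fst q)) (snd q)"
    have "hits (R + 5 * real k) (Suc (fst q)) (snd q)" using q RL_hits[of "fst q"] by (auto simp del: power_Suc)
    moreover have "idx (Suc (fst q)) u = snd q" using u by (simp add: cell_def)
    ultimately have "norm (emb u) < R + 5 * real k + real k" by (rule hits_norm)
    moreover have "R \<le> norm (emb u)"
    proof (rule ccontr)
     assume "\<not> ?thesis"
     then have "hits R (Suc (fst q)) (snd q)" using u by (auto simp: hits_def cell_def)
     then show False using q by auto
    qed
    ultimately show "u \<in> ?S" using u by (simp add: cell_def)
   qed
  qed
  moreover have "(\<Sum>q\<in>?I. (1 / (2::real) ^ Suc (fst q)) ^ k) = (\<Sum>j<J. \<Sum>z\<in>?LN j. ?t j)"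
   using finite_RL by (subst sum.Sigma) (auto simp: split_beta)
  ultimately show ?thesis by simp
 qed
 have 3: "(\<Sum>j<J. \<Sum>z\<in>?NF j. ?t j) \<le> Bt / \<phi>"
 proof -
  have "\<phi> * (\<Sum>j<J. \<Sum>z\<in>?NF j. ?t j) \<le> (\<Sum>j<J. \<Sum>z\<in>DD j. bb (Suc j) z * ?t j)"
   unfolding sum_distrib_left
  proof (intro sum_mono)
   fix j
   have "(\<Sum>z\<in>?NF j. \<phi> * ?t j) \<le> (\<Sum>z\<in>?NF j. bb (Suc j) z * ?t j)"
    by (intro sum_mono mult_right_mono) auto
   also have "\<dots> \<le> (\<Sum>z\<in>DD j. bb (Suc j) z * ?t j)"
    using finite_DD bb_nonneg by (intro sum_mono2) auto
   finally show "(\<Sum>z\<in>?NF j. \<phi> * ?t j) \<le> (\<Sum>z\<in>DD j. bb (Suc j) z * ?t j)" .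
  qed
  also have "\<dots> \<le> Bt" by (rule bb_sum)
  finally show ?thesis using pos by (simp add: pos_le_divide_eq mult.commute)
 qed
 show ?thesis using S 1 2 3 TL_sum[of J] unfolding \<Phi>_def by linarith
qed

theorem good_mass: "measure M UNIV - (\<tau> + Bt) / \<rho>\<^sup>2 - \<Lambda> * (1 + 9 ^ k) * \<Phi> \<le> measure M (Gd J)"
proof -
 have "(\<Sum>j<J. \<Sum>z\<in>FH j. measure M (XX j z)) \<le> (\<Sum>j<J. \<Sum>z\<in>FH j. \<Lambda> * (1 / 2 ^ Suc j) ^ k)"
  by (intro sum_mono XX_mass_le)
 also have "\<dots> = \<Lambda> * area J FH" by (simp only: sum_distrib_left)
 also have "\<dots> \<le> \<Lambda> * ((1 + 9 ^ k) * area J RL)"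
  using Lam_bounds by (intro mult_left_mono FH_sum_le) auto
 also have "\<dots> \<le> \<Lambda> * ((1 + 9 ^ k) * \<Phi>)"
  using Lam_bounds by (intro mult_left_mono RL_sum_le) auto
 finally show ?thesis using mass_balance[of J] by (simp add: mult.assoc)
qed

theorem bottom_mass_disc:
 assumes "0 \<le> c"
  and "\<And>y r. 0 < r \<Longrightarrow> r \<le> 2 * \<Lambda> * (1 / 2 ^ J) * (1 + \<alpha>) \<Longrightarrow> measure M (ball y r) \<le> c * \<omega> * r ^ k"
 shows "measure M (Gd J) \<le> c * \<Lambda> * (\<omega> * (R + real k) ^ k)"
proof -
 have "0 \<le> area J FH" by (intro sum_nonneg) auto
 then have "(\<Sum>z\<in>HA J. (1 / (2::real) ^ J) ^ k) \<le> \<omega> * (R + real k) ^ k" using area_total[of J] by linarith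
 then have "c * \<Lambda> * (\<Sum>z\<in>HA J. (1 / 2 ^ J) ^ k) \<le> c * \<Lambda> * (\<omega> * (R + real k) ^ k)"
  using assms(1) Lam_bounds by (intro mult_left_mono) auto
 moreover have "measure M (Gd J) \<le> c * \<Lambda> * (\<Sum>z\<in>HA J. (1 / 2 ^ J) ^ k)" using assms by (rule bottom_mass)
 ultimately show ?thesis by linarith
qed

text \<open>At horizontal distance \<open>d\<close> the scale with
  \<open>d \<le> 1 / 2 ^ j < 2 * d\<close> is used in \<open>Gd_dist\<close>. For
  \<open>d = 0\<close> all scales are available, and for \<open>d > 1\<close> the initial bound on
  \<open>ver\<close> suffices.\<close>

theorem good_graph:
 assumes x: "x \<in> (\<Inter>j. Gd j)" and y: "y \<in> (\<Inter>j. Gd j)"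
 shows "norm (ver x - ver y) \<le> (real k + 2) * norm (hor x - hor y)"
proof -
 define d where "d = norm (hor x - hor y)"
 have cd: "\<bar>co x i - co y i\<bar> \<le> d" if "i < k" for i
  using emb_coord_le[OF that, of "\<lambda>i. co x i - co y i"] by (simp add: d_def hor_def emb_diff)
 have step: "norm (ver x - ver y) \<le> 1 / 2 ^ j + real k * d" if dj: "d \<le> 1 / 2 ^ j" for j
 proof -
  have "norm (ver x - ver y) \<le> 1 / 2 ^ j + real k * \<theta> * d"
  proof (rule Gd_dist[of x j y, OF _ _ _ cd])
   show "adj (idx j (co x)) (idx j (co y))"
    by (rule dist_imp_adj) (use cd dj order_trans in blast)
  qed (use x y in auto)
  also have "real k * \<theta> * d \<le> real k * 1 * d"
   using pos by (intro mult_right_mono mult_left_mono) (auto simp: d_def)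
  finally show ?thesis by simp
 qed
 consider "d = 0" | "0 < d" "d \<le> 1" | "1 < d" by (fastforce simp: d_def)
 then show ?thesis
 proof cases
  case 1
  have "norm (ver x - ver y) \<le> E" if "0 < E" for E :: real
  proof -
   obtain j where "(1 / 2) ^ j < E" using real_arch_pow_inv[of E "1 / 2"] \<open>0 < E\<close> by auto
   then show ?thesis using step[of j] 1 by (simp add: power_divide)
  qed
  then have "norm (ver x - ver y) \<le> 0" by (rule field_le_epsilon[of _ 0, simplified])
  then show ?thesis using 1 by (simp add: d_def)
 next
  case 2
  define j where "j = (LEAST j. 1 / (2::real) ^ Suc j < d)"
  obtain j' where "(1 / 2) ^ j' < d" using real_arch_pow_inv[OF 2(1), of "1 / 2"] by auto
  moreover have "1 / (2::real) ^ Suc j' \<le> (1 / 2) ^ j'" unfolding power_one_over[symmetric] by (rule power_decreasing) auto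
  ultimately have "1 / (2::real) ^ Suc j' < d" by linarith
  then have j1: "1 / (2::real) ^ Suc j < d" unfolding j_def by (rule LeastI)
  have j2: "d \<le> 1 / 2 ^ j"
  proof (cases j)
   case (Suc n)
   then have "\<not> 1 / (2::real) ^ Suc n < d" using not_less_Least[of n "\<lambda>j. 1 / (2::real) ^ Suc j < d"] by (simp add: j_def)
   then show ?thesis using Suc by simp
  qed (use 2 in simp)
  have "1 / 2 ^ j = 2 * (1 / (2::real) ^ Suc j)" by simp
  then have "norm (ver x - ver y) \<le> 2 * d + real k * d" using step[OF j2] j1 by linarith
  then show ?thesis by (simp add: d_def distrib_right)
 next
  case 3
  have "norm (ver x) \<le> \<rho>" "norm (ver y) \<le> \<rho>" using x y Gd_0 by auto
  then have "norm (ver x - ver y) \<le> 1 * d" using norm_triangle_ineq4[of "ver x" "ver y"] pos 3 by simp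
  also have "\<dots> \<le> (real k + 2) * d" using 3 by (intro mult_right_mono) auto
  finally show ?thesis by (simp add: d_def)
 qed
qed

end

section \<open>Choice of the constants\<close>

lemma exists_radius:
 fixes K :: real and c :: real
 assumes "0 < c"
 shows "\<exists>R\<ge>K. 1 \<le> R \<and> (R + real k) ^ k \<le> (1 + c) * R ^ k \<and> (R + 10 * real k) ^ k - (R - 1 / 2) ^ k \<le> c * R ^ k"
proof -
 have lim: "((\<lambda>R::real. (1 + a * inverse R) ^ k) \<longlongrightarrow> (1 + a * 0) ^ k) at_top" for a
  by (intro tendsto_intros tendsto_inverse_0_at_top filterlim_ident)
 have "((\<lambda>R::real. (1 + 10 * real k * inverse R) ^ k - (1 + (- 1 / 2) * inverse R) ^ k) \<longlongrightarrow> (1 + 10 * real k * 0) ^ k - (1 + (- 1 / 2) * 0) ^ k) at_top"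
  by (intro tendsto_diff lim)
 then have "eventually (\<lambda>R::real. (1 + 10 * real k * inverse R) ^ k - (1 + (- 1 / 2) * inverse R) ^ k < c) at_top"
  using assms by (intro order_tendstoD(2)) auto
 moreover have "eventually (\<lambda>R::real. (1 + real k * inverse R) ^ k < 1 + c) at_top"
  using lim[of "real k"] assms by (intro order_tendstoD(2)) auto
 ultimately have "eventually (\<lambda>R::real. R \<ge> K \<and> 1 \<le> R \<and> (1 + real k * inverse R) ^ k < 1 + c \<and>
   (1 + 10 * real k * inverse R) ^ k - (1 + (- 1 / 2) * inverse R) ^ k < c) at_top"
  using eventually_ge_at_top[of K] eventually_ge_at_top[of "1::real"] by eventually_elim auto
 then obtain R where R: "R \<ge> K" "1 \<le> R" "(1 + real k * inverse R) ^ k < 1 + c"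
   "(1 + 10 * real k * inverse R) ^ k - (1 + (- 1 / 2) * inverse R) ^ k < c"
  using eventually_happens trivial_limit_at_top_linorder by blast
 have *: "(1 + a * inverse R) ^ k * R ^ k = (R + a) ^ k" for a
 proof -
  have "(1 + a * inverse R) * R = R + a" using R(2) by (simp add: field_simps)
  then show ?thesis by (simp add: power_mult_distrib[symmetric])
 qed
 have "0 \<le> R ^ k" using R(2) by simp
 then have "(1 + real k * inverse R) ^ k * R ^ k \<le> (1 + c) * R ^ k"
  "((1 + 10 * real k * inverse R) ^ k - (1 + (- 1 / 2) * inverse R) ^ k) * R ^ k \<le> c * R ^ k"
  using mult_right_mono[OF less_imp_le[OF R(3)]] mult_right_mono[OF less_imp_le[OF R(4)]] by blast+
 then show ?thesis
  using R(1,2) *[of "real k"] *[of "10 * real k"] *[of "- 1 / 2"] by (intro exI[of _ R]) (simp add: left_diff_distrib)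
qed

text \<open>One parameter serves for slope and averaging radius, with \<open>\<gamma>\<close>
  squared as slab thickness: the slab must be thin even compared with the averaging radius.\<close>

lemma exists_angles:
 fixes c C :: real
 assumes "0 < c"
 shows "\<exists>\<gamma>>0. \<gamma> \<le> 1 / 2 \<and> ((1 + 2 * \<gamma>) * (1 + real k * \<gamma> + C * \<gamma>\<^sup>2 / \<gamma>)) ^ k \<le> 1 + c"
proof -
 have "((\<lambda>\<gamma>. ((1 + 2 * \<gamma>) * (1 + real k * \<gamma> + C * \<gamma>)) ^ k) \<longlongrightarrow> ((1 + 2 * 0) * (1 + real k * 0 + C * 0)) ^ k) (at_right 0)"
  by (intro tendsto_intros)
 then have "eventually (\<lambda>\<gamma>. ((1 + 2 * \<gamma>) * (1 + real k * \<gamma> + C * \<gamma>)) ^ k < 1 + c) (at_right 0)"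
  using assms by (intro order_tendstoD(2)) auto
 moreover have "eventually (\<lambda>\<gamma>::real. 0 < \<gamma> \<and> \<gamma> < 1 / 2) (at_right 0)"
  using eventually_at_right[of 0 "1::real"] by (auto simp: eventually_at_right intro!: exI[of _ "1 / 2"])
 ultimately have "eventually (\<lambda>\<gamma>. 0 < \<gamma> \<and> \<gamma> < 1 / 2 \<and> ((1 + 2 * \<gamma>) * (1 + real k * \<gamma> + C * \<gamma>)) ^ k < 1 + c) (at_right 0)"
  by eventually_elim auto
 then obtain \<gamma> where "0 < \<gamma>" "\<gamma> < 1 / 2" "((1 + 2 * \<gamma>) * (1 + real k * \<gamma> + C * \<gamma>)) ^ k < 1 + c"
  using eventually_happens trivial_limit_at_right_real by blast
 then show ?thesis by (intro exI[of _ \<gamma>]) (simp add: power2_eq_square)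
qed

lemma exists_small:
 fixes f :: "real \<Rightarrow> real"
 assumes "(f \<longlongrightarrow> 0) (at_right 0)" "0 < c" "0 < d"
 shows "\<exists>s>0. s \<le> d \<and> f s \<le> c"
proof -
 have "eventually (\<lambda>s. f s < c) (at_right 0)" using assms by (intro order_tendstoD(2)) auto
 moreover have "eventually (\<lambda>s::real. 0 < s \<and> s < d) (at_right 0)"
  using assms(3) by (auto simp: eventually_at_right intro!: exI[of _ d])
 ultimately have "eventually (\<lambda>s. 0 < s \<and> s < d \<and> f s < c) (at_right 0)" by eventually_elim auto
 then obtain s where "0 < s" "s < d" "f s < c"
  using eventually_happens trivial_limit_at_right_real by blast
 then show ?thesis by (intro exI[of _ s]) simp
qed

text \<open>The part of the mass loss that vanishes with \<open>s\<close>, the common value of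
  \<open>\<tau>\<close>, \<open>\<delta>\<close> and \<open>\<iota>\<close>, while all other
  constants stay fixed. \<open>W\<close> bounds the total mass and the factor 2 bounds
  \<open>\<Lambda>\<close>.\<close>

definition loss :: "nat \<Rightarrow> real \<Rightarrow> real \<Rightarrow> real \<Rightarrow> real \<Rightarrow> real \<Rightarrow> real \<Rightarrow> real \<Rightarrow> real \<Rightarrow> real" where
 "loss k CS CG \<kappa> W \<rho> \<theta> \<phi> s =
  (let B = CG * (4 * s + 2 * s * W); E = 336 * CS\<^sup>2 * 2 ^ k * (2 ^ (k + 2) * ((1 + 10 ^ k) * B + 2 * 5 ^ k * s * W))
   in (s + B) / \<rho>\<^sup>2 + 2 * (1 + 9 ^ k) * ((s + B) / \<rho>\<^sup>2 / \<kappa> + B / \<phi> + 16 * real k * E / \<theta>\<^sup>2))"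

lemma loss_tendsto: "(loss k CS CG \<kappa> W \<rho> \<theta> \<phi> \<longlongrightarrow> 0) (at_right 0)"
proof -
 have "(loss k CS CG \<kappa> W \<rho> \<theta> \<phi> \<longlongrightarrow> loss k CS CG \<kappa> W \<rho> \<theta> \<phi> 0) (at_right 0)"
  unfolding loss_def[abs_def] Let_def by (simp only: divide_inverse) (intro tendsto_intros)
 then show ?thesis by (simp add: loss_def Let_def)
qed

text \<open>The order of choice matters: \<open>\<eta>\<close> from \<open>c\<close> and
  \<open>\<kappa>\<close>, then \<open>R\<close> and \<open>\<gamma>\<close> from
  \<open>\<eta>\<close>, then \<open>\<phi>\<close> from \<open>\<gamma>\<close>, and
  \<open>s\<close> last, since \<open>loss\<close> involves all the others.\<close>

lemma exists_constants:
 fixes CS CG \<kappa> K \<omega> c :: real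
 assumes "0 \<le> CS" "0 < \<kappa>" "0 < \<omega>" "0 < c" "c \<le> 1"
 shows "\<exists>R \<gamma> \<phi> s \<eta>. K \<le> R \<and> 1 \<le> R \<and> 0 < \<gamma> \<and> \<gamma> \<le> 1 / 2 \<and> 0 < \<phi> \<and> 0 < s \<and> s \<le> \<phi> \<and> 0 < \<eta> \<and> \<eta> \<le> 1 / 2 \<and>
  ((1 + 2 * \<gamma>) * (1 + real k * \<gamma> + C * \<gamma>\<^sup>2 / \<gamma>)) ^ k \<le> 1 + \<kappa> \<and>
  ((1 + 2 * \<gamma>) * (1 + real k * \<gamma> + C * \<gamma>\<^sup>2 / \<gamma>)) ^ k \<le> 1 + \<eta> \<and>
  CS * sqrt (2 * \<phi>) \<le> 1 / 2 \<and> 128 * CS * sqrt (2 ^ (k + 2) * (1 + 5 ^ k) * \<phi>) \<le> \<gamma> \<and>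
  (R + real k) ^ k \<le> (1 + \<eta>) * R ^ k \<and> (R + 10 * real k) ^ k - (R - 1 / 2) ^ k \<le> \<eta> * R ^ k \<and>
  (1 + \<eta>)\<^sup>2 \<le> 1 + c \<and>
  \<eta> + 2 * (1 + 9 ^ k) * (4 * \<eta> / \<kappa> + \<eta>) \<le> c / 2 \<and>
  loss k CS CG \<kappa> (\<omega> * R ^ k) (\<gamma>\<^sup>2) \<gamma> \<phi> s \<le> c / 2 * (\<omega> * R ^ k)"
proof -
 have "((\<lambda>\<eta>. \<eta> + 2 * (1 + 9 ^ k) * (4 * \<eta> / \<kappa> + \<eta>) + \<eta>) \<longlongrightarrow> 0 + 2 * (1 + 9 ^ k) * (4 * 0 / \<kappa> + 0) + 0) (at_right 0)"
  using assms by (intro tendsto_intros) auto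
 then obtain \<eta> where \<eta>: "0 < \<eta>" "\<eta> \<le> c / 3" "\<eta> + 2 * (1 + 9 ^ k) * (4 * \<eta> / \<kappa> + \<eta>) + \<eta> \<le> c / 2"
  using exists_small[of "\<lambda>\<eta>. \<eta> + 2 * (1 + 9 ^ k) * (4 * \<eta> / \<kappa> + \<eta>) + \<eta>" "c / 2" "c / 3"] assms by auto
 have sq: "(1 + \<eta>)\<^sup>2 \<le> 1 + c"
 proof -
  have "\<eta> * \<eta> \<le> \<eta>" using mult_left_mono[of \<eta> 1 \<eta>] \<eta> assms by simp
  moreover have "(1 + \<eta>)\<^sup>2 = 1 + 2 * \<eta> + \<eta> * \<eta>" by (simp add: power2_eq_square algebra_simps)
  ultimately show ?thesis using \<eta>(2) by linarith
 qed
 obtain R where R: "K \<le> R" "1 \<le> R" "(R + real k) ^ k \<le> (1 + \<eta>) * R ^ k" "(R + 10 * real k) ^ k - (R - 1 / 2) ^ k \<le> \<eta> * R ^ k"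
  using exists_radius[OF \<eta>(1), of K k] by auto
 have "0 < min \<kappa> \<eta>" using assms \<eta> by simp
 then obtain \<gamma> where \<gamma>: "0 < \<gamma>" "\<gamma> \<le> 1 / 2" "((1 + 2 * \<gamma>) * (1 + real k * \<gamma> + C * \<gamma>\<^sup>2 / \<gamma>)) ^ k \<le> 1 + min \<kappa> \<eta>"
  using exists_angles by blast
 have "((\<lambda>\<phi>. 128 * CS * sqrt (2 ^ (k + 2) * (1 + 5 ^ k) * \<phi>) + CS * sqrt (2 * \<phi>)) \<longlongrightarrow>
   128 * CS * sqrt (2 ^ (k + 2) * (1 + 5 ^ k) * 0) + CS * sqrt (2 * 0)) (at_right 0)"
  by (intro tendsto_intros)
 then obtain \<phi> where \<phi>: "0 < \<phi>" "128 * CS * sqrt (2 ^ (k + 2) * (1 + 5 ^ k) * \<phi>) + CS * sqrt (2 * \<phi>) \<le> \<gamma>"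
  using exists_small[of "\<lambda>\<phi>. 128 * CS * sqrt (2 ^ (k + 2) * (1 + 5 ^ k) * \<phi>) + CS * sqrt (2 * \<phi>)" \<gamma> 1] \<gamma> by auto
 have "0 \<le> CS * sqrt (2 * \<phi>)" "0 \<le> 128 * CS * sqrt (2 ^ (k + 2) * (1 + 5 ^ k) * \<phi>)"
  using assms \<phi> by (auto intro!: mult_nonneg_nonneg real_sqrt_ge_zero)
 then have \<phi>': "CS * sqrt (2 * \<phi>) \<le> 1 / 2" "128 * CS * sqrt (2 ^ (k + 2) * (1 + 5 ^ k) * \<phi>) \<le> \<gamma>"
  using \<phi>(2) \<gamma>(2) by linarith+
 have W: "0 < c / 2 * (\<omega> * R ^ k)" using assms R by (intro mult_pos_pos) auto
 obtain s where s: "0 < s" "s \<le> \<phi>" "loss k CS CG \<kappa> (\<omega> * R ^ k) (\<gamma>\<^sup>2) \<gamma> \<phi> s \<le> c / 2 * (\<omega> * R ^ k)"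
  using exists_small[OF loss_tendsto W \<phi>(1)] by blast
 have "\<eta> \<le> 1 / 2" using \<eta> assms by simp
 moreover have "((1 + 2 * \<gamma>) * (1 + real k * \<gamma> + C * \<gamma>\<^sup>2 / \<gamma>)) ^ k \<le> 1 + \<kappa>"
  "((1 + 2 * \<gamma>) * (1 + real k * \<gamma> + C * \<gamma>\<^sup>2 / \<gamma>)) ^ k \<le> 1 + \<eta>" using \<gamma>(3) by linarith+
 moreover have "\<eta> + 2 * (1 + 9 ^ k) * (4 * \<eta> / \<kappa> + \<eta>) \<le> c / 2" using \<eta> by linarith
 ultimately show ?thesis using R \<gamma>(1,2) \<phi>(1) \<phi>' s \<eta>(1) sq by blast
qed

context key2
begin

text \<open>The loss separates into terms proportional to \<open>\<eta>\<close>, which measure the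
  imperfect normalisation, and the terms collected in \<open>loss\<close>; each group is granted
  half of \<open>c\<close>.\<close>

lemma good_mass_loss:
 assumes s: "0 < s" "\<tau> = s" "\<delta> = s" "\<iota> = s" and m: "(1 - \<eta>) * (\<omega> * R ^ k) \<le> measure M UNIV" "measure M UNIV \<le> \<omega> * R ^ k"
  and \<eta>: "0 < \<eta>" "\<eta> \<le> 1 / 2" and L: "\<Lambda> \<le> 1 + \<eta>"
  and R: "(R + real k) ^ k \<le> (1 + \<eta>) * R ^ k" "(R + 10 * real k) ^ k - (R - 1 / 2) ^ k \<le> \<eta> * R ^ k"
  and c: "\<eta> + 2 * (1 + 9 ^ k) * (4 * \<eta> / \<kappa> + \<eta>) \<le> c / 2" "loss k CS CG \<kappa> (\<omega> * R ^ k) \<rho> \<theta> \<phi> s \<le> c / 2 * (\<omega> * R ^ k)"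
 shows "(1 - c) * (\<omega> * R ^ k) \<le> measure M (Gd J)"
proof -
 define W where "W = \<omega> * R ^ k"
 define B where "B = CG * (4 * s + 2 * s * W)"
 define E where "E = 336 * CS\<^sup>2 * 2 ^ k * (2 ^ (k + 2) * ((1 + 10 ^ k) * B + 2 * 5 ^ k * s * W))"
 have W: "0 < W" using pos by (simp add: W_def)
 have CG: "0 \<le> CG" using KK_ge by (simp add: CG_def)
 have m': "measure M UNIV \<le> W" "(1 - \<eta>) * W \<le> measure M UNIV" using m by (simp_all add: W_def)
 have Bt: "Bt = CG * (4 * s + 2 * s * measure M UNIV)" unfolding Bt_def using s by simp
 have ET: "ET = 336 * CS\<^sup>2 * 2 ^ k * (2 ^ (k + 2) * ((1 + 10 ^ k) * Bt + 2 * 5 ^ k * s * measure M UNIV))"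
  unfolding ET_def using s by simp
 have BB: "Bt \<le> B" unfolding Bt B_def
  using CG s m'(1) by (intro mult_left_mono add_left_mono) auto
 have Bt0: "0 \<le> Bt" unfolding Bt_def using CG s by auto
 have EE: "ET \<le> E" unfolding ET E_def
  using s BB m'(1) by (intro mult_left_mono add_mono) auto
 have P: "\<Phi> \<le> (s + B) / \<rho>\<^sup>2 / \<kappa> + 4 * \<eta> / \<kappa> * W + \<eta> * W + B / \<phi> + 16 * real k * E / \<theta>\<^sup>2"
 proof -
  have "\<omega> * (R + real k) ^ k \<le> \<omega> * ((1 + \<eta>) * R ^ k)" using R(1) by (intro mult_left_mono) auto
  then have A: "\<omega> * (R + real k) ^ k \<le> (1 + \<eta>) * W" by (simp add: W_def mult_ac)
  have "\<Lambda> * (\<omega> * (R + real k) ^ k) \<le> (1 + \<eta>) * ((1 + \<eta>) * W)"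
   using L A by (rule mult_mono) (use \<eta> pos in auto)
  also have "\<dots> = (1 + 2 * \<eta> + \<eta> * \<eta>) * W" by (simp add: algebra_simps)
  also have "\<dots> \<le> (1 + 2 * \<eta> + \<eta> * 1) * W" using \<eta> W by (intro mult_right_mono add_left_mono mult_left_mono) auto
  \<comment> \<open>\<open>(1 + \<eta>)\<^sup>2 - (1 - \<eta>) = 3 * \<eta> + \<eta>\<^sup>2\<close>
    is at most \<open>4 * \<eta>\<close>.\<close>
  finally have "\<Lambda> * (\<omega> * (R + real k) ^ k) - measure M UNIV \<le> 4 * \<eta> * W"
   using m'(2) by (simp add: algebra_simps)
  moreover have "(\<tau> + Bt) / \<rho>\<^sup>2 \<le> (s + B) / \<rho>\<^sup>2" using BB s by (intro divide_right_mono) auto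
  ultimately have "((\<tau> + Bt) / \<rho>\<^sup>2 + \<Lambda> * (\<omega> * (R + real k) ^ k) - measure M UNIV) / \<kappa> \<le> ((s + B) / \<rho>\<^sup>2 + 4 * \<eta> * W) / \<kappa>"
   using kappa(1) by (intro divide_right_mono) auto
  also have "\<dots> = (s + B) / \<rho>\<^sup>2 / \<kappa> + 4 * \<eta> / \<kappa> * W" by (simp add: add_divide_distrib)
  finally have 1: "((\<tau> + Bt) / \<rho>\<^sup>2 + \<Lambda> * (\<omega> * (R + real k) ^ k) - measure M UNIV) / \<kappa> \<le> (s + B) / \<rho>\<^sup>2 / \<kappa> + 4 * \<eta> / \<kappa> * W" .
  have "\<omega> * ((R + 10 * real k) ^ k - (R - 1 / 2) ^ k) \<le> \<omega> * (\<eta> * R ^ k)" using R(2) by (intro mult_left_mono) auto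
  then have 2: "\<omega> * ((R + 10 * real k) ^ k - (R - 1 / 2) ^ k) \<le> \<eta> * W" by (simp add: W_def mult_ac)
  have 3: "Bt / \<phi> \<le> B / \<phi>" using BB pos by (intro divide_right_mono) auto
  have 4: "16 * real k * ET / \<theta>\<^sup>2 \<le> 16 * real k * E / \<theta>\<^sup>2" using EE by (intro divide_right_mono mult_left_mono) auto
  show ?thesis unfolding \<Phi>_def using 1 2 3 4 by linarith
 qed
 let ?P = "(s + B) / \<rho>\<^sup>2 / \<kappa> + 4 * \<eta> / \<kappa> * W + \<eta> * W + B / \<phi> + 16 * real k * E / \<theta>\<^sup>2"
 have B0: "0 \<le> B" using Bt0 BB by linarith
 have E0: "0 \<le> E" unfolding E_def using B0 s W by auto
 have P0: "0 \<le> ?P" using B0 E0 s W \<eta> kappa(1) pos by (intro add_nonneg_nonneg) auto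
 have "\<Lambda> * (1 + 9 ^ k) * \<Phi> \<le> \<Lambda> * (1 + 9 ^ k) * ?P" using P Lam_bounds by (intro mult_left_mono) auto
 also have "\<dots> \<le> 2 * (1 + 9 ^ k) * ?P" using L \<eta> P0 by (intro mult_right_mono) auto
 finally have 1: "\<Lambda> * (1 + 9 ^ k) * \<Phi> \<le> 2 * (1 + 9 ^ k) * ?P" .
 have 2: "(\<tau> + Bt) / \<rho>\<^sup>2 \<le> (s + B) / \<rho>\<^sup>2" using BB s by (intro divide_right_mono) auto
 have 3: "2 * (1 + 9 ^ k) * ?P = 2 * (1 + 9 ^ k) * ((s + B) / \<rho>\<^sup>2 / \<kappa> + B / \<phi> + 16 * real k * E / \<theta>\<^sup>2) + (2 * (1 + 9 ^ k) * (4 * \<eta> / \<kappa> + \<eta>)) * W"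
  by (simp only: distrib_left distrib_right mult.assoc add_ac)
 have 4: "(s + B) / \<rho>\<^sup>2 + 2 * (1 + 9 ^ k) * ((s + B) / \<rho>\<^sup>2 / \<kappa> + B / \<phi> + 16 * real k * E / \<theta>\<^sup>2) \<le> c / 2 * W"
  using c(2) by (simp only: loss_def Let_def B_def E_def W_def)
 have 5: "\<eta> * W + (2 * (1 + 9 ^ k) * (4 * \<eta> / \<kappa> + \<eta>)) * W \<le> c / 2 * W"
  using mult_right_mono[OF c(1), of W] W by (simp only: distrib_right)
 have 6: "(1 - \<eta>) * W = W - \<eta> * W" "(1 - c) * W = W - (c / 2 * W + c / 2 * W)" by (simp_all add: algebra_simps)
 show ?thesis using good_mass[of J] 1 2 3 4 5 m'(2) unfolding W_def[symmetric] 6 by linarith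
qed

end

section \<open>The normalised situation\<close>

context fmeas
begin

text \<open>Lists the assumptions in terms of \<open>R\<close>, \<open>s\<close> and
  \<open>\<eta>\<close> alone, so that these can be fixed before frame and measure, with the inner
  parameters hidden.\<close>

definition normalised :: "real \<Rightarrow> real \<Rightarrow> real \<Rightarrow> bool" where
 "normalised R s \<eta> \<longleftrightarrow> (\<forall>y r. 0 < r \<longrightarrow> measure M (ball y r) \<le> \<omega> * r ^ k) \<and>
   emeasure M {x. R \<le> norm (hor x)} = 0 \<and> (\<integral>\<^sup>+x. ennreal ((norm (ver x))\<^sup>2) \<partial>M) \<le> ennreal s \<and>
   carleson s \<and> (1 - \<eta>) * (\<omega> * R ^ k) \<le> measure M UNIV \<and> measure M UNIV \<le> \<omega> * R ^ k"

text \<open>Says that the density cannot drop as the scale shrinks: any bound \<open>u\<close> valid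
  at small radii is at least \<open>(1 - c) / (1 + c)\<close>.\<close>

definition density_bound :: "real \<Rightarrow> bool" where
 "density_bound c \<longleftrightarrow> (\<forall>u r0. 0 \<le> u \<longrightarrow> 0 < r0 \<longrightarrow>
   (\<forall>y r. 0 < r \<longrightarrow> r \<le> r0 \<longrightarrow> measure M (ball y r) \<le> u * \<omega> * r ^ k) \<longrightarrow> 1 - c \<le> u * (1 + c))"

definition graph_part :: bool where
 "graph_part \<longleftrightarrow> (\<exists>G\<in>sets borel. 0 < measure M G \<and>
   (\<forall>x\<in>G. \<forall>y\<in>G. norm (ver x - ver y) \<le> (real k + 2) * norm (hor x - hor y)))"

end

lemma key_proposition:
 fixes c :: real
 assumes k: "1 \<le> k" and c: "0 < c" "c \<le> 1 / 2"
 shows "\<exists>R s \<eta>. 4 * real k + 4 \<le> R \<and> 0 < s \<and> 0 < \<eta> \<and> \<eta> \<le> 1 / 2 \<and>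
  (\<forall>(e :: nat \<Rightarrow> 'a::euclidean_space) M. fmeas e k M \<longrightarrow> fmeas.normalised e k M R s \<eta> \<longrightarrow>
    fmeas.density_bound k M c \<and> fmeas.graph_part e k M)"
proof -
 \<comment> \<open>Copies of the constants of \<open>fmeas\<close>, which depend on \<open>k\<close>
   only; they are needed before any frame or measure is given.\<close>
 define qd0 where "qd0 = k + 2"
 define KK0 where "KK0 = 4 * real k + 4"
 define CS0 where "CS0 = 200 * real k * 2 ^ (qd0 * k)"
 define CG0 where "CG0 = (2 * KK0) ^ (k + 2) / (1 / (16 * KK0))\<^sup>2"
 define \<kappa>0 where "\<kappa>0 = 1 / (4 * (2::real) ^ (qd0 * k))"
 let ?\<omega> = "unit_ball_vol (real k)"
 obtain R \<gamma> \<phi> s \<eta> where R: "KK0 \<le> R" "1 \<le> R" and \<gamma>: "0 < \<gamma>" "\<gamma> \<le> 1 / 2" and \<phi>: "0 < \<phi>" and s: "0 < s" "s \<le> \<phi>"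
  and \<eta>: "0 < \<eta>" "\<eta> \<le> 1 / 2"
  and L1: "((1 + 2 * \<gamma>) * (1 + real k * \<gamma> + 2 ^ (qd0 + 2) * \<gamma>\<^sup>2 / \<gamma>)) ^ k \<le> 1 + \<kappa>0"
  and L2: "((1 + 2 * \<gamma>) * (1 + real k * \<gamma> + 2 ^ (qd0 + 2) * \<gamma>\<^sup>2 / \<gamma>)) ^ k \<le> 1 + \<eta>"
  and ph: "CS0 * sqrt (2 * \<phi>) \<le> 1 / 2" "128 * CS0 * sqrt (2 ^ (k + 2) * (1 + 5 ^ k) * \<phi>) \<le> \<gamma>"
  and RR: "(R + real k) ^ k \<le> (1 + \<eta>) * R ^ k" "(R + 10 * real k) ^ k - (R - 1 / 2) ^ k \<le> \<eta> * R ^ k"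
  and cc: "(1 + \<eta>)\<^sup>2 \<le> 1 + c" "\<eta> + 2 * (1 + 9 ^ k) * (4 * \<eta> / \<kappa>0 + \<eta>) \<le> c / 2"
   "loss k CS0 CG0 \<kappa>0 (?\<omega> * R ^ k) (\<gamma>\<^sup>2) \<gamma> \<phi> s \<le> c / 2 * (?\<omega> * R ^ k)"
  using exists_constants[of CS0 \<kappa>0 ?\<omega> c KK0 k "2 ^ (qd0 + 2)" CG0] c by (auto simp: CS0_def \<kappa>0_def)
 have gam2: "\<gamma>\<^sup>2 \<le> 1 / 4" using power_mono[OF \<gamma>(2), of 2] \<gamma>(1) by (simp add: power2_eq_square)
 show ?thesis
 proof (intro exI conjI allI impI)
  show "4 * real k + 4 \<le> R" "0 < s" "0 < \<eta>" "\<eta> \<le> 1 / 2" using R s \<eta> by (simp_all add: KK0_def)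
  fix e :: "nat \<Rightarrow> 'a" and M :: "'a measure"
  assume f: "fmeas e k M" and nm: "fmeas.normalised e k M R s \<eta>"
  interpret fmeas e k M by (rule f)
  have U: "\<forall>y r. 0 < r \<longrightarrow> measure M (ball y r) \<le> ?\<omega> * r ^ k" and supp: "emeasure M {x. R \<le> norm (hor x)} = 0"
   and vert: "(\<integral>\<^sup>+x. ennreal ((norm (ver x))\<^sup>2) \<partial>M) \<le> ennreal s" and car: "carleson s"
   and m: "(1 - \<eta>) * (?\<omega> * R ^ k) \<le> measure M UNIV" "measure M UNIV \<le> ?\<omega> * R ^ k"
   using nm unfolding normalised_def by blast+
  have eq: "qd = qd0" "KK = KK0" "CS = CS0" "CG = CG0" "\<kappa> = \<kappa>0"
   by (simp_all add: qd_def qd0_def KK_def KK0_def CS_def CS0_def CG_def CG0_def c0_def \<kappa>_def \<kappa>0_def)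
  \<comment> \<open>\<open>\<tau>\<close>, \<open>\<delta>\<close> and \<open>\<iota>\<close> all
    equal \<open>s\<close>; the thickness is \<open>\<gamma>\<close> squared, and both the slope
    bound and the averaging radius are \<open>\<gamma>\<close>.\<close>
  interpret key2 e k M R s s s "\<gamma>\<^sup>2" \<gamma> \<gamma> \<phi>
  proof (unfold_locales)
   show "measure M (ball y r) \<le> ?\<omega> * r ^ k" if "0 < r" for y r using U that by blast
   show "((1 + 2 * \<gamma>) * (1 + real k * \<gamma> + 2 ^ (qd + 2) * \<gamma>\<^sup>2 / \<gamma>)) ^ k \<le> 1 + \<kappa>"
    using L1 by (simp only: eq)
   show "CS * sqrt (2 * \<phi>) \<le> 1 / 2" using ph(1) by (simp only: eq)
   show "128 * CS * sqrt (2 ^ (k + 2) * (1 + 5 ^ k) * \<phi>) \<le> \<gamma>" using ph(2) by (simp only: eq)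
  qed (use R s \<gamma> \<phi> supp vert car gam2 in auto)
  have LL: "\<Lambda> \<le> 1 + \<eta>" using L2 by (simp only: \<Lambda>_def eq)
  have GM: "(1 - c) * (?\<omega> * R ^ k) \<le> measure M (Gd J)" for J
   by (rule good_mass_loss[OF s(1) refl refl refl m \<eta> LL RR]) (use cc in \<open>simp_all only: eq\<close>)
  have W: "0 < ?\<omega> * R ^ k" using R by simp
  have "1 - c \<le> u * (1 + c)"
   if u: "0 \<le> u" "0 < r0" "\<forall>y r. 0 < r \<longrightarrow> r \<le> r0 \<longrightarrow> measure M (ball y r) \<le> u * ?\<omega> * r ^ k" for u r0
  proof -
   have "0 < 2 * \<Lambda> * (1 + \<gamma>)" using Lam_bounds \<gamma> by simp
   \<comment> \<open>The level is so fine that all balls used to estimate the mass of its cells have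
     radius at most \<open>r0\<close>, so \<open>u\<close> bounds their density.\<close>
   then obtain J where J: "(1 / 2) ^ J < r0 / (2 * \<Lambda> * (1 + \<gamma>))"
    using real_arch_pow_inv[of "r0 / (2 * \<Lambda> * (1 + \<gamma>))" "1 / 2"] u(2) by auto
   then have "(1 / 2) ^ J * (2 * \<Lambda> * (1 + \<gamma>)) < r0" using \<open>0 < 2 * \<Lambda> * (1 + \<gamma>)\<close> by (simp only: pos_less_divide_eq)
   then have J': "2 * \<Lambda> * (1 / 2 ^ J) * (1 + \<gamma>) \<le> r0" by (simp add: power_divide mult_ac)
   have "measure M (Gd J) \<le> u * \<Lambda> * (?\<omega> * (R + real k) ^ k)"
   proof (rule bottom_mass_disc[OF u(1)])
    fix y r assume "0 < r" "r \<le> 2 * \<Lambda> * (1 / 2 ^ J) * (1 + \<gamma>)"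
    then show "measure M (ball y r) \<le> u * ?\<omega> * r ^ k" using u(3) J' by auto
   qed
   also have "\<dots> \<le> u * (1 + \<eta>) * (?\<omega> * ((1 + \<eta>) * R ^ k))"
    using u(1) LL RR(1) \<eta> R Lam_bounds by (intro mult_mono mult_left_mono) auto
   also have "\<dots> = u * (1 + \<eta>)\<^sup>2 * (?\<omega> * R ^ k)" by (simp add: power2_eq_square mult_ac)
   also have "\<dots> \<le> u * (1 + c) * (?\<omega> * R ^ k)" using u(1) cc(1) W by (intro mult_right_mono mult_left_mono) auto
   finally have "(1 - c) * (?\<omega> * R ^ k) \<le> u * (1 + c) * (?\<omega> * R ^ k)" using GM[of J] by linarith
   then show ?thesis using W by (simp only: mult_le_cancel_right_pos)
  qed
  then show "density_bound c" unfolding density_bound_def by blast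
  show graph_part
   unfolding graph_part_def
  proof (intro bexI conjI)
   have dec: "decseq Gd" by (rule decseq_SucI) (auto simp: Gd_Suc)
   have Gs: "Gd j \<in> sets M" for j by (simp add: sets_M)
   have "(\<lambda>J. measure M (Gd J)) \<longlonglongrightarrow> measure M (\<Inter>J. Gd J)"
    using Gs dec by (intro finite_Lim_measure_decseq) auto
   then have "(1 - c) * (?\<omega> * R ^ k) \<le> measure M (\<Inter>J. Gd J)"
    by (rule LIMSEQ_le_const) (use GM in auto)
   moreover have "0 < (1 - c) * (?\<omega> * R ^ k)" using W c by (intro mult_pos_pos[OF _ W]) auto
   ultimately show "0 < measure M (\<Inter>J. Gd J)" by linarith
   show "(\<Inter>J. Gd J) \<in> sets borel" using Gs by (auto simp: sets_M)
   show "\<forall>x\<in>\<Inter>J. Gd J. \<forall>y\<in>\<Inter>J. Gd J. norm (ver x - ver y) \<le> (real k + 2) * norm (hor x - hor y)"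
    using good_graph by blast
  qed
 qed
qed

subsection \<open>Hausdorff measure: densities and Lipschitz graphs\<close>

abbreviation "\<H> \<equiv> hausdorff_measure"

lemma null_sets_hausdorff_outer:
 assumes "hausdorff_outer k A = 0"
 shows "A \<in> null_sets (\<H> k)"
proof -
 have "hausdorff_outer k (A \<inter> X) + hausdorff_outer k ((UNIV - A) \<inter> X) = hausdorff_outer k X" for X
 proof (rule antisym)
  have "hausdorff_outer k (A \<inter> X) = 0"
   using hausdorff_outer_mono[of "A \<inter> X" A k] assms by simp
  then show "hausdorff_outer k (A \<inter> X) + hausdorff_outer k ((UNIV - A) \<inter> X) \<le> hausdorff_outer k X"
   by (simp add: hausdorff_outer_mono)
  have "X = (A \<inter> X) \<union> ((UNIV - A) \<inter> X)" by auto
  then show "hausdorff_outer k X \<le> hausdorff_outer k (A \<inter> X) + hausdorff_outer k ((UNIV - A) \<inter> X)"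
   by (metis hausdorff_outer_subadditive)
 qed
 then have "A \<in> sets (\<H> k)" by (simp add: sets_hausdorff_measure lambda_system_def)
 then show ?thesis using assms by (intro null_setsI) (simp_all add: emeasure_hausdorff_measure)
qed

lemma hausdorff_content_le_weight:
 assumes "bounded A" "diameter A \<le> d"
 shows "hausdorff_content k d A \<le> hausdorff_weight k A"
proof -
 have "0 \<le> d" using diameter_ge_0[OF assms(1)] assms(2) by linarith
 then have C: "(\<lambda>n::nat. if n = 0 then A else {}) \<in> hausdorff_covers d A"
  using assms unfolding hausdorff_covers_def by (auto split: if_splits)
 have "hausdorff_content k d A \<le> (\<Sum>n. hausdorff_weight k (if n = (0::nat) then A else {}))"
  unfolding hausdorff_content_def by (rule INF_lower[OF C])
 also have "\<dots> = (\<Sum>n\<in>{0}. hausdorff_weight k (if n = (0::nat) then A else {}))"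
  by (rule suminf_finite) (auto simp: hausdorff_weight_def)
 finally show ?thesis by simp
qed

lemma hausdorff_content_cball:
 fixes x :: "'a::euclidean_space"
 assumes "0 \<le> r" "2 * r \<le> d"
 shows "hausdorff_content k d (cball x r) \<le> ennreal (unit_ball_vol (real k) * r ^ k)"
proof -
 have "hausdorff_content k d (cball x r) \<le> hausdorff_weight k (cball x r)"
  by (rule hausdorff_content_le_weight) (use assms in \<open>auto simp: diameter_cball\<close>)
 also have "\<dots> = ennreal (unit_ball_vol (real k) * r ^ k)"
  using assms by (simp add: hausdorff_weight_def diameter_cball)
 finally show ?thesis .
qed

text \<open>By Vitali's covering lemma, the set where the uncentred upper density exceeds \<open>1\<close> can be
 covered, up to small remainders, by disjoint balls whose total weight is smaller than their
 total mass by a fixed factor.\<close>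

lemma upper_density_null:
 fixes \<mu> :: "'a::euclidean_space measure"
 assumes fin: "finite_measure \<mu>" and sets: "sets \<mu> = sets borel"
  and le: "\<And>A. A \<in> sets borel \<Longrightarrow> emeasure \<mu> A \<le> hausdorff_outer k A"
  and \<eta>: "0 < \<eta>"
 defines "E \<equiv> \<lambda>j::nat. \<Union>{ball y r |y r. 0 < r \<and> r < 1 / real (Suc j) \<and> (1 + \<eta>) * (unit_ball_vol (real k) * r ^ k) < measure \<mu> (ball y r)}"
 shows "emeasure \<mu> (\<Inter>j. E j) = 0"
proof -
 interpret finite_measure \<mu> by (rule fin)
 let ?\<omega> = "unit_ball_vol (real k)"
 define B where "B = (\<Inter>j. E j)"
 have "open (E j)" for j unfolding E_def by auto
 then have B: "B \<in> sets borel" unfolding B_def by auto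
 have outer: "hausdorff_outer k B \<le> ennreal ((measure \<mu> B + \<epsilon>) / (1 + \<eta>))" if \<epsilon>: "0 < \<epsilon>" for \<epsilon>
 proof -
  have "emeasure \<mu> B = (INF U\<in>{U. B \<subseteq> U \<and> open U}. emeasure \<mu> U)"
   by (rule outer_regular[OF sets _ B]) simp
  moreover have "emeasure \<mu> B < emeasure \<mu> B + ennreal \<epsilon>"
   using \<epsilon> by (simp add: emeasure_eq_measure ennreal_less_iff flip: ennreal_plus)
  ultimately obtain Q where Q: "B \<subseteq> Q" "open Q" "emeasure \<mu> Q < emeasure \<mu> B + ennreal \<epsilon>"
   by (auto simp: INF_less_iff)
  then have mQ: "measure \<mu> Q \<le> measure \<mu> B + \<epsilon>"
   using \<epsilon> by (simp add: emeasure_eq_measure ennreal_less_iff flip: ennreal_plus)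
  define X where "X = measure \<mu> Q / (1 + \<eta>)"
  have content: "hausdorff_content k d B \<le> ennreal X" if d: "0 < d" for d
  proof (rule ennreal_le_epsilon)
   fix \<epsilon>' :: real assume \<epsilon>': "0 < \<epsilon>'"
   \<comment> \<open>Balls of excessive density inside \<open>Q\<close> and so small that five times
     each still has diameter at most \<open>d\<close>.\<close>
   define K where "K = {p :: 'a \<times> real. 0 < snd p \<and> snd p \<le> d / 10 \<and> cball (fst p) (snd p) \<subseteq> Q \<and>
    (1 + \<eta>) * (?\<omega> * snd p ^ k) < measure \<mu> (ball (fst p) (snd p))}"
   obtain C where C: "countable C" "C \<subseteq> K"
    "pairwise (\<lambda>i j. disjnt (cball (fst i) (snd i)) (cball (fst j) (snd j))) C"
    "\<And>i. i \<in> K \<Longrightarrow> \<exists>j. j \<in> C \<and> \<not> disjnt (cball (fst i) (snd i)) (cball (fst j) (snd j)) \<and>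
      cball (fst i) (snd i) \<subseteq> ball (fst j) (5 * snd j)"
    by (rule Vitali_covering_lemma_cballs_balls[of K snd "d / 10" fst]) (auto simp: K_def)
   define c where "c = inv_into C (to_nat_on C)"
   define I where "I = to_nat_on C ` C"
   have cI: "c n \<in> C" if "n \<in> I" for n using that by (auto simp: c_def I_def intro: inv_into_into)
   have cinj: "inj_on c I" unfolding c_def I_def by (rule inj_on_inv_into) simp
   have csurj: "\<exists>n\<in>I. c n = q" if "q \<in> C" for q
    using that C(1) inj_on_to_nat_on[OF C(1)] by (auto simp: c_def I_def)
   have cK: "0 < snd (c n)" "snd (c n) \<le> d / 10" "cball (fst (c n)) (snd (c n)) \<subseteq> Q"
     "(1 + \<eta>) * (?\<omega> * snd (c n) ^ k) < measure \<mu> (ball (fst (c n)) (snd (c n)))" if "n \<in> I" for n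
    using cI[OF that] C(2) by (auto simp: K_def)
   define w where "w n = (if n \<in> I then ?\<omega> * snd (c n) ^ k else 0)" for n
   have w0: "0 \<le> w n" for n using cK(1)[of n] by (auto simp: w_def intro!: mult_nonneg_nonneg)
   have psum: "(\<Sum>n<N. w n) \<le> X" for N
   proof -
    let ?J = "{..<N} \<inter> I" let ?cb = "\<lambda>n. cball (fst (c n)) (snd (c n))"
    have cbs: "?cb n \<in> sets \<mu>" for n by (simp add: sets)
    have "(1 + \<eta>) * (\<Sum>n<N. w n) = (\<Sum>n\<in>?J. (1 + \<eta>) * (?\<omega> * snd (c n) ^ k))"
     unfolding sum_distrib_left w_def by (subst sum.inter_restrict) (auto intro!: sum.cong)
    also have "\<dots> \<le> (\<Sum>n\<in>?J. measure \<mu> (?cb n))"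
    proof (rule sum_mono)
     fix n assume "n \<in> ?J"
     then have "(1 + \<eta>) * (?\<omega> * snd (c n) ^ k) < measure \<mu> (ball (fst (c n)) (snd (c n)))" using cK(4) by auto
     also have "\<dots> \<le> measure \<mu> (?cb n)" by (rule finite_measure_mono[OF ball_subset_cball cbs])
     finally show "(1 + \<eta>) * (?\<omega> * snd (c n) ^ k) \<le> measure \<mu> (?cb n)" by simp
    qed
    also have "\<dots> = measure \<mu> (\<Union>n\<in>?J. ?cb n)"
    proof (rule finite_measure_finite_Union[symmetric])
     show "disjoint_family_on ?cb ?J"
      unfolding disjoint_family_on_def
     proof (intro ballI impI)
      fix m n assume mn: "m \<in> ?J" "n \<in> ?J" "m \<noteq> n"
      then have "c m \<noteq> c n" using cinj by (auto dest: inj_onD)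
      then show "?cb m \<inter> ?cb n = {}"
       using pairwiseD[OF C(3) cI cI, of m n] mn by (simp add: disjnt_def)
     qed
    qed (use cbs in auto)
    also have "\<dots> \<le> measure \<mu> Q"
     using cK(3) Q(2) by (intro finite_measure_mono) (auto simp: sets)
    finally show ?thesis using \<eta> by (simp add: X_def pos_le_divide_eq mult.commute)
   qed
   have summ: "summable w" by (rule summableI_nonneg_bounded[OF w0 psum])
   have "0 < \<epsilon>' / 5 ^ k" using \<epsilon>' by simp
   then obtain N where "norm (\<Sum>n. w (n + N)) < \<epsilon>' / 5 ^ k"
    using suminf_exist_split[OF _ summ] by blast
   then have "(\<Sum>n. w (n + N)) \<le> \<epsilon>' / 5 ^ k" by simp
   then have N: "5 ^ k * (\<Sum>n. w (n + N)) \<le> \<epsilon>'" by (simp add: pos_le_divide_eq mult.commute)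
   \<comment> \<open>Finitely many selected balls keep their size. Only the others, whose total
     weight is at most \<open>\<epsilon>' / 5 ^ k\<close>, are enlarged five times, so the factor of
     Vitali's lemma costs only \<open>\<epsilon>'\<close>.\<close>
   define F where "F n = (if n \<in> I then if n < N then cball (fst (c n)) (snd (c n)) else cball (fst (c n)) (5 * snd (c n)) else {})" for n
   define h where "h n = (if n < N then w n else 5 ^ k * w n)" for n
   have cover: "B \<subseteq> (\<Union>n. F n)"
   proof
    fix x assume x: "x \<in> B"
    show "x \<in> (\<Union>n. F n)"
    proof (rule ccontr)
     assume nx: "x \<notin> (\<Union>n. F n)"
     have "closed (\<Union>n\<in>{..<N}. F n)" by (rule closed_UN) (auto simp: F_def)
     then have "open (Q - (\<Union>n\<in>{..<N}. F n))" using Q(2) by blast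
     moreover have "x \<in> Q - (\<Union>n\<in>{..<N}. F n)" using x Q(1) nx by blast
     \<comment> \<open>A point outside the first balls has a small dense ball around it that avoids
       them. The selected ball which that one meets has a later index, and its enlargement contains
       the point.\<close>
     ultimately obtain \<rho> where \<rho>: "0 < \<rho>" "ball x \<rho> \<subseteq> Q - (\<Union>n\<in>{..<N}. F n)"
      by (meson openE)
     obtain j where j: "1 / real (Suc j) < min (\<rho> / 3) (d / 10)"
      using nat_approx_posE[of "min (\<rho> / 3) (d / 10)"] \<rho>(1) d by auto
     have "x \<in> E j" using x by (auto simp: B_def)
     then obtain y r where yr: "x \<in> ball y r" "0 < r" "r < 1 / real (Suc j)" "(1 + \<eta>) * (?\<omega> * r ^ k) < measure \<mu> (ball y r)"
      unfolding E_def by blast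
     have r: "r < \<rho> / 3" "r < d / 10" using yr(3) j by linarith+
     have sub: "cball y r \<subseteq> ball x \<rho>"
     proof
      fix z assume "z \<in> cball y r"
      then have "dist x z < r + r" using yr(1) dist_triangle[of x z y] by (simp add: dist_commute)
      then show "z \<in> ball x \<rho>" using r(1) \<rho>(1) by simp
     qed
     then have "(y, r) \<in> K" using yr r \<rho>(2) by (auto simp: K_def)
     from C(4)[OF this] obtain q where q: "q \<in> C" "\<not> disjnt (cball y r) (cball (fst q) (snd q))"
      "cball y r \<subseteq> ball (fst q) (5 * snd q)" by auto
     obtain n where n: "n \<in> I" "c n = q" using csurj[OF q(1)] by blast
     have "\<not> n < N"
     proof
      assume "n < N"
      then have "cball (fst q) (snd q) \<subseteq> (\<Union>n\<in>{..<N}. F n)" using n by (auto simp: F_def)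
      then show False using q(2) sub \<rho>(2) by (auto simp: disjnt_def)
     qed
     moreover have "x \<in> cball (fst q) (5 * snd q)" using q(3) yr(1) ball_subset_cball by blast
     ultimately have "x \<in> F n" using n by (simp add: F_def)
     then show False using nx by blast
    qed
   qed
   have Fh: "hausdorff_content k d (F n) \<le> ennreal (h n)" for n
   proof (cases "n \<in> I")
    case True
    have "hausdorff_content k d (cball (fst (c n)) (5 * snd (c n))) \<le> ennreal (?\<omega> * (5 * snd (c n)) ^ k)"
     "hausdorff_content k d (cball (fst (c n)) (snd (c n))) \<le> ennreal (?\<omega> * snd (c n) ^ k)"
     by (rule hausdorff_content_cball; use cK(1,2)[OF True] in simp)+
    then show ?thesis using True by (simp add: F_def h_def w_def power_mult_distrib mult_ac)
   next
    case False
    then show ?thesis using hausdorff_content_le_outer[OF d, of k "{}::'a set"] by (simp add: F_def)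
   qed
   have sh: "summable h"
   proof -
    have "summable (\<lambda>n. h (n + N))" using summable_mult[OF summable_ignore_initial_segment[OF summ, of N], of "5 ^ k"] by (simp add: h_def)
    then show ?thesis by (simp only: summable_iff_shift)
   qed
   have "hausdorff_content k d B \<le> hausdorff_content k d (\<Union>n. F n)" by (rule hausdorff_content_mono[OF cover])
   also have "\<dots> \<le> (\<Sum>n. hausdorff_content k d (F n))" by (rule hausdorff_content_countably_subadditive)
   also have "\<dots> \<le> (\<Sum>n. ennreal (h n))" by (intro suminf_le Fh) auto
   also have "\<dots> = ennreal (\<Sum>n. h n)" by (rule suminf_ennreal2[OF _ sh]) (use w0 in \<open>auto simp: h_def\<close>)
   also have "(\<Sum>n. h n) = (\<Sum>n. h (n + N)) + (\<Sum>n<N. h n)" by (rule suminf_split_initial_segment[OF sh])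
   also have "(\<Sum>n. h (n + N)) = 5 ^ k * (\<Sum>n. w (n + N))"
    using suminf_mult[OF summable_ignore_initial_segment[OF summ, of N]] by (simp add: h_def)
   also have "(\<Sum>n<N. h n) = (\<Sum>n<N. w n)" by (intro sum.cong) (auto simp: h_def)
   also have "ennreal (5 ^ k * (\<Sum>n. w (n + N)) + (\<Sum>n<N. w n)) \<le> ennreal (X + \<epsilon>')"
    using N psum[of N] by (intro ennreal_leI) linarith
   also have "\<dots> = ennreal X + ennreal \<epsilon>'" using \<eta> \<epsilon>' by (intro ennreal_plus) (auto simp: X_def)
   finally show "hausdorff_content k d B \<le> ennreal X + ennreal \<epsilon>'" .
  qed
  have "hausdorff_outer k B \<le> ennreal X"
   unfolding hausdorff_outer_def by (rule SUP_least) (use content in auto)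
  also have "\<dots> \<le> ennreal ((measure \<mu> B + \<epsilon>) / (1 + \<eta>))"
   unfolding X_def using mQ \<eta> by (intro ennreal_leI divide_right_mono) auto
  finally show ?thesis .
 qed
 have "\<eta> * measure \<mu> B \<le> \<epsilon>" if \<epsilon>: "0 < \<epsilon>" for \<epsilon>
 proof -
  have "emeasure \<mu> B \<le> ennreal ((measure \<mu> B + \<epsilon>) / (1 + \<eta>))" using le[OF B] outer[OF \<epsilon>] by (rule order_trans)
  then have "measure \<mu> B \<le> (measure \<mu> B + \<epsilon>) / (1 + \<eta>)"
   using \<epsilon> \<eta> by (simp add: emeasure_eq_measure)
  then show ?thesis using \<eta> by (simp add: pos_le_divide_eq algebra_simps)
 qed
 then have "\<eta> * measure \<mu> B \<le> 0" by (rule field_le_epsilon[of _ 0, simplified])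
 then have "measure \<mu> B = 0" using \<eta> measure_nonneg[of \<mu> B] by (simp add: mult_le_0_iff)
 then show ?thesis by (simp add: B_def emeasure_eq_measure)
qed

text \<open>A covering set of positive diameter lies in a ball of twice its diameter, four times the
  radius that its weight counts. Any cover of \<open>T\<close> thus bounds the measure of
  \<open>T\<close> by \<open>4 ^ k * c\<close> times its weight, and near-optimal covers compare
  this measure with itself.\<close>

lemma lower_density:
 fixes T :: "'a::euclidean_space set"
 assumes k: "1 \<le> k" and c: "0 \<le> c"
  and ub: "\<And>y r. 0 < r \<Longrightarrow> hausdorff_outer k (T \<inter> ball y r) \<le> ennreal (c * (unit_ball_vol (real k) * r ^ k))"
  and T: "0 < hausdorff_outer k T" "hausdorff_outer k T < \<infinity>"
 shows "1 \<le> 4 ^ k * c"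
proof -
 let ?\<omega> = "unit_ball_vol (real k)"
 have piece: "hausdorff_outer k (T \<inter> A) \<le> ennreal (4 ^ k * c) * hausdorff_weight k A" if A: "bounded A" for A
 proof (cases "A = {}")
  case False
  then obtain x where x: "x \<in> A" by blast
  have dA: "dist x y \<le> diameter A" if "y \<in> A" for y using diameter_bounded_bound[OF A x that] .
  have step: "hausdorff_outer k (T \<inter> A) \<le> ennreal (c * (?\<omega> * r ^ k))" if r: "diameter A < r" for r
  proof -
   have "0 < r" using r diameter_ge_0[OF A] by linarith
   have "A \<subseteq> ball x r" using dA r by force
   then have "hausdorff_outer k (T \<inter> A) \<le> hausdorff_outer k (T \<inter> ball x r)" by (intro hausdorff_outer_mono) auto
   then show ?thesis using ub[OF \<open>0 < r\<close>, of x] by (rule order_trans)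
  qed
  show ?thesis
  proof (cases "diameter A = 0")
   case True
   have "hausdorff_outer k (T \<inter> A) \<le> 0"
   proof (rule ennreal_le_epsilon)
    fix \<epsilon> :: real assume \<epsilon>: "0 < \<epsilon>"
    \<comment> \<open>A set of diameter 0 admits no proportional radius; there all radii tend to 0,
      and \<open>1 \<le> k\<close> makes the bound vanish.\<close>
    have "((\<lambda>r. c * (?\<omega> * r ^ k)) \<longlongrightarrow> c * (?\<omega> * 0 ^ k)) (at_right 0)" by (intro tendsto_intros)
    then have "((\<lambda>r. c * (?\<omega> * r ^ k)) \<longlongrightarrow> 0) (at_right 0)" using k by (simp add: power_0_left)
    then obtain r where r: "0 < r" "c * (?\<omega> * r ^ k) \<le> \<epsilon>"
     using exists_small[of "\<lambda>r. c * (?\<omega> * r ^ k)" \<epsilon> 1] \<epsilon> k by auto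
    have "hausdorff_outer k (T \<inter> A) \<le> ennreal (c * (?\<omega> * r ^ k))" using step[of r] True r by simp
    also have "\<dots> \<le> ennreal \<epsilon>" using r by (intro ennreal_leI)
    finally show "hausdorff_outer k (T \<inter> A) \<le> 0 + ennreal \<epsilon>" by simp
   qed
   then show ?thesis by simp
  next
   case False
   then have d: "0 < diameter A" using diameter_ge_0[OF A] by linarith
   then have "hausdorff_outer k (T \<inter> A) \<le> ennreal (c * (?\<omega> * (2 * diameter A) ^ k))" by (intro step) simp
   also have "c * (?\<omega> * (2 * diameter A) ^ k) = 4 ^ k * c * (?\<omega> * (diameter A / 2) ^ k)"
   proof -
    have "(2 * diameter A) ^ k = (4 * (diameter A / 2)) ^ k" by simp
    also have "\<dots> = 4 ^ k * (diameter A / 2) ^ k" by (rule power_mult_distrib)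
    finally show ?thesis by simp
   qed
   also have "ennreal \<dots> = ennreal (4 ^ k * c) * hausdorff_weight k A"
    using \<open>A \<noteq> {}\<close> c d by (simp add: hausdorff_weight_def ennreal_mult)
   finally show ?thesis .
  qed
 qed simp
 have "hausdorff_outer k T \<le> ennreal (4 ^ k * c) * (\<Sum>i. hausdorff_weight k (C i))" if C: "C \<in> hausdorff_covers 1 T" for C
 proof -
  have "T = (\<Union>i. T \<inter> C i)" using C by (auto simp: hausdorff_covers_def)
  then have "hausdorff_outer k T \<le> (\<Sum>i. hausdorff_outer k (T \<inter> C i))"
   using hausdorff_outer_countably_subadditive[of k "\<lambda>i. T \<inter> C i"] by simp
  also have "\<dots> \<le> (\<Sum>i. ennreal (4 ^ k * c) * hausdorff_weight k (C i))"
   using C by (intro suminf_le piece) (auto simp: hausdorff_covers_def)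
  finally show ?thesis by simp
 qed
 note le = this
 obtain t where t: "hausdorff_outer k T = ennreal t" "0 < t"
  using T by (cases "hausdorff_outer k T") auto
 have a: "t \<le> 4 ^ k * c * (t + \<epsilon>)" if \<epsilon>: "0 < \<epsilon>" for \<epsilon>
 proof -
  have "hausdorff_content k 1 T \<le> ennreal t" using hausdorff_content_le_outer[of 1 k T] t by simp
  also have "\<dots> < ennreal (t + \<epsilon>)" using \<epsilon> t by (intro ennreal_lessI) auto
  finally obtain C where C: "C \<in> hausdorff_covers 1 T" "(\<Sum>i. hausdorff_weight k (C i)) < ennreal (t + \<epsilon>)"
   unfolding hausdorff_content_def INF_less_iff by blast
  have "ennreal t \<le> ennreal (4 ^ k * c) * ennreal (t + \<epsilon>)"
   using le[OF C(1)] mult_left_mono[OF less_imp_le[OF C(2)], of "ennreal (4 ^ k * c)"] t(1) by (auto intro: order_trans)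
  also have "\<dots> = ennreal (4 ^ k * c * (t + \<epsilon>))" using c t \<epsilon> by (simp add: ennreal_mult)
  finally show ?thesis using c t \<epsilon> by (subst (asm) ennreal_le_iff) auto
 qed
 show ?thesis
 proof (rule ccontr)
  assume "\<not> ?thesis"
  then have lt: "0 < 1 - 4 ^ k * c" by simp
  \<comment> \<open>The error is taken proportional to the assumed gap \<open>1 - 4 ^ k * c\<close>,
    which makes the inequality contradict itself.\<close>
  have "t \<le> 4 ^ k * c * (t + t * (1 - 4 ^ k * c))" using t lt by (intro a mult_pos_pos)
  then have "t * (1 - 4 ^ k * c) \<le> (4 ^ k * c) * (t * (1 - 4 ^ k * c))" by (simp add: algebra_simps)
  moreover have "0 < t * (1 - 4 ^ k * c)" using t lt by simp
  ultimately have "1 * (t * (1 - 4 ^ k * c)) \<le> (4 ^ k * c) * (t * (1 - 4 ^ k * c))" by simp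
  then have "1 \<le> 4 ^ k * c" using \<open>0 < t * (1 - 4 ^ k * c)\<close> by (simp only: mult_le_cancel_right_pos)
  then show False using lt by simp
 qed
qed

lemma hausdorff_content_finite_Union:
 fixes A :: "'b \<Rightarrow> 'a::metric_space set"
 assumes "finite I" "0 < d"
 shows "hausdorff_content k d (\<Union>i\<in>I. A i) \<le> (\<Sum>i\<in>I. hausdorff_content k d (A i))"
 using assms(1)
proof induction
 case empty
 have "hausdorff_content k d ({}::'a set) \<le> hausdorff_outer k ({}::'a set)" by (rule hausdorff_content_le_outer[OF assms(2)])
 then show ?case by simp
next
 case (insert i I)
 define B where "B = (\<lambda>n::nat. if n = 0 then A i else if n = 1 then (\<Union>i\<in>I. A i) else {})"
 have 0: "hausdorff_content k d ({}::'a set) = 0"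
  using hausdorff_content_le_outer[OF assms(2), of k "{}::'a set"] by simp
 have "(\<Union>i\<in>insert i I. A i) = (\<Union>n. B n)" by (auto simp: B_def split: if_splits)
 then have "hausdorff_content k d (\<Union>i\<in>insert i I. A i) \<le> (\<Sum>n. hausdorff_content k d (B n))"
  using hausdorff_content_countably_subadditive[of k d B] by simp
 also have "\<dots> = (\<Sum>n\<in>{0, 1}. hausdorff_content k d (B n))"
  by (rule suminf_finite) (auto simp: B_def 0)
 also have "\<dots> = hausdorff_content k d (A i) + hausdorff_content k d (\<Union>i\<in>I. A i)" by (simp add: B_def)
 also have "\<dots> \<le> hausdorff_content k d (A i) + (\<Sum>i\<in>I. hausdorff_content k d (A i))"
  by (intro add_left_mono insert.IH)
 finally show ?case using insert.hyps by simp
qed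

section \<open>Lipschitz graphs and pieces of planes\<close>

abbreviation lip_image :: "nat \<Rightarrow> 'a::metric_space set \<Rightarrow> bool" where
 "lip_image k G \<equiv> (\<exists>f :: (nat \<Rightarrow> real) \<Rightarrow> 'a. lipschitz_from_Rk k f \<and> G \<subseteq> f ` topspace (Euclidean_space k))"

context frame
begin

lemma hor_hor: "hor (hor x) = hor x"
 by (rule hor_of_span) (simp add: hor_def emb_in_span)

text \<open>At level \<open>j\<close> at most \<open>((2 * n + 1) * 2 ^ j) ^ k\<close> dyadic cells
  of diameter at most \<open>k / 2 ^ j\<close> cover the cube; the powers of two cancel, so the
  bound does not depend on the scale.\<close>

lemma hausdorff_cube_finite: "hausdorff_outer k {v + emb u |u. \<forall>i<k. \<bar>u i\<bar> \<le> real n} < \<infinity>"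
proof -
 let ?Q = "{v + emb u |u. \<forall>i<k. \<bar>u i\<bar> \<le> real n}"
 define b where "b = \<omega> * (real (2 * n + 1) * (real k / 2)) ^ k"
 have "hausdorff_content k d ?Q \<le> ennreal b" if d: "0 < d" for d
 proof -
  obtain j where "(1 / 2) ^ j < d / real k" using real_arch_pow_inv[of "d / real k" "1 / 2"] d k_pos by auto
  then have j: "real k * (1 / 2) ^ j \<le> d" using k_pos by (simp add: pos_less_divide_eq mult.commute)
  define I where "I = {z \<in> Z. \<forall>i<k. z i \<in> {- int (n * 2 ^ j)..int (n * 2 ^ j)}}"
  have finI: "finite I" unfolding I_def by (rule card_Z_Pi(1)) simp
  have "card I = (\<Prod>i<k. card {- int (n * 2 ^ j)..int (n * 2 ^ j)})" unfolding I_def by (rule card_Z_Pi(2)) simp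
  then have "card I = (2 * (n * 2 ^ j) + 1) ^ k" by (simp add: nat_add_distrib nat_mult_distrib nat_power_eq)
  also have "\<dots> \<le> ((2 * n + 1) * 2 ^ j) ^ k" by (intro power_mono) (auto simp: algebra_simps)
  finally have cI: "card I \<le> ((2 * n + 1) * 2 ^ j) ^ k" .
  let ?A = "\<lambda>z. {v + emb u |u. idx j u = z}"
  have "?Q \<subseteq> (\<Union>z\<in>I. ?A z)"
  proof
   fix x assume "x \<in> ?Q"
   then obtain u where u: "x = v + emb u" "\<And>i. i < k \<Longrightarrow> \<bar>u i\<bar> \<le> real n" by blast
   have "idx j u i \<in> {- int (n * 2 ^ j)..int (n * 2 ^ j)}" if i: "i < k" for i
   proof -
    have "- real n \<le> u i" "u i \<le> real n" using u(2)[OF i] by linarith+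
    then have "2 ^ j * (- real n) \<le> 2 ^ j * u i" "2 ^ j * u i \<le> 2 ^ j * real n" by (intro mult_left_mono; simp)+
    then have "real_of_int (- int (n * 2 ^ j)) \<le> 2 ^ j * u i" "2 ^ j * u i \<le> real_of_int (int (n * 2 ^ j))"
     by (simp_all add: mult.commute)
    then have "- int (n * 2 ^ j) \<le> \<lfloor>2 ^ j * u i\<rfloor>" "\<lfloor>2 ^ j * u i\<rfloor> \<le> int (n * 2 ^ j)" by (linarith+)
    then show ?thesis using i by (simp add: idx_def)
   qed
   then have "idx j u \<in> I" by (simp add: I_def)
   then show "x \<in> (\<Union>z\<in>I. ?A z)" using u(1) by blast
  qed
  then have "hausdorff_content k d ?Q \<le> hausdorff_content k d (\<Union>z\<in>I. ?A z)" by (rule hausdorff_content_mono)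
  also have "\<dots> \<le> (\<Sum>z\<in>I. hausdorff_content k d (?A z))" by (rule hausdorff_content_finite_Union[OF finI d])
  also have "\<dots> \<le> (\<Sum>z\<in>I. ennreal (\<omega> * (real k * (1 / 2) ^ j / 2) ^ k))"
  proof (rule sum_mono)
   fix z
   have dist: "dist x y \<le> real k * (1 / 2) ^ j" if xy: "x \<in> ?A z" "y \<in> ?A z" for x y
   proof -
    obtain u w where uw: "x = v + emb u" "y = v + emb w" "idx j u = idx j w" using xy by auto
    have "norm (emb u - emb w) \<le> real k * (1 / 2 ^ j)"
     unfolding emb_diff by (rule norm_emb_le) (rule idx_close[OF uw(3)])
    then show ?thesis using uw by (simp add: dist_norm power_divide)
   qed
   have bd: "bounded (?A z)"
   proof (cases "?A z = {}")
    case False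
    then obtain x where "x \<in> ?A z" by blast
    then show ?thesis unfolding bounded_def using dist by blast
   qed auto
   have dm: "diameter (?A z) \<le> real k * (1 / 2) ^ j" by (rule diameter_le) (use dist in \<open>auto simp: dist_norm\<close>)
   have "hausdorff_content k d (?A z) \<le> hausdorff_weight k (?A z)"
    using dm j by (intro hausdorff_content_le_weight bd) linarith
   also have "\<dots> \<le> ennreal (\<omega> * (real k * (1 / 2) ^ j / 2) ^ k)"
    unfolding hausdorff_weight_def using dm diameter_ge_0[OF bd]
    by (simp only: split: if_split) (auto intro!: ennreal_leI mult_left_mono power_mono)
   finally show "hausdorff_content k d (?A z) \<le> ennreal (\<omega> * (real k * (1 / 2) ^ j / 2) ^ k)" .
  qed
  also have "\<dots> = ennreal (real (card I) * (\<omega> * (real k * (1 / 2) ^ j / 2) ^ k))"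
   by (simp add: ennreal_mult ennreal_of_nat_eq_real_of_nat)
  also have "\<dots> \<le> ennreal b"
  proof (rule ennreal_leI)
   have "real (card I) \<le> real (((2 * n + 1) * 2 ^ j) ^ k)" using cI of_nat_le_iff by blast
   then have "real (card I) * (\<omega> * (real k * (1 / 2) ^ j / 2) ^ k) \<le> real (((2 * n + 1) * 2 ^ j) ^ k) * (\<omega> * (real k * (1 / 2) ^ j / 2) ^ k)"
    by (rule mult_right_mono) simp
   also have "\<dots> = \<omega> * ((real (2 * n + 1) * 2 ^ j) * (real k * (1 / 2) ^ j / 2)) ^ k"
    by (simp only: power_mult_distrib of_nat_power of_nat_mult of_nat_numeral mult_ac)
   also have "(real (2 * n + 1) * 2 ^ j) * (real k * (1 / 2) ^ j / 2) = real (2 * n + 1) * (real k / 2)"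
    by (simp add: power_divide)
   finally show "real (card I) * (\<omega> * (real k * (1 / 2) ^ j / 2) ^ k) \<le> b" by (simp add: b_def)
  qed
  finally show ?thesis .
 qed
 then have "hausdorff_outer k ?Q \<le> ennreal b" unfolding hausdorff_outer_def by (intro SUP_least) auto
 then show ?thesis using ennreal_less_top[of b] by (simp add: le_less_trans)
qed

text \<open>McShane's extension of the inverse of the projection, coordinate by coordinate.\<close>

lemma graph_subset_lipschitz_image:
 assumes C: "0 \<le> C" and G: "\<And>x y. x \<in> G \<Longrightarrow> y \<in> G \<Longrightarrow> norm (x - y) \<le> C * norm (hor x - hor y)"
 shows "lip_image k G"
proof (cases "G = {}")
 case True
 then show ?thesis by (intro exI[of _ "\<lambda>_. 0"]) (auto simp: lipschitz_from_Rk_def intro!: exI[of _ 0])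
next
 case False
 define g where "g b u x = x \<bullet> b + C * norm (emb u - hor x)" for b u and x :: 'a
 define F where "F b u = (INF x\<in>G. g b u x)" for b u
 define f where "f u = (\<Sum>b\<in>Basis. F b u *\<^sub>R b)" for u
 have bdd: "bdd_below (g b u ` G)" if b: "b \<in> Basis" for b u
 proof -
  obtain y where y: "y \<in> G" using False by blast
  have "y \<bullet> b - C * norm (emb u - hor y) \<le> g b u x" if x: "x \<in> G" for x
  proof -
   have "(y - x) \<bullet> b \<le> norm (y - x)" using Basis_le_norm[OF b, of "y - x"] by linarith
   also have "\<dots> \<le> C * norm (hor y - hor x)" by (rule G[OF y x])
   also have "\<dots> \<le> C * (norm (emb u - hor y) + norm (emb u - hor x))"
    using C norm_triangle_ineq4[of "emb u - hor x" "emb u - hor y"] by (intro mult_left_mono) auto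
   finally show ?thesis by (simp add: g_def inner_diff_left distrib_left)
  qed
  then show ?thesis by (intro bdd_belowI[of _ "y \<bullet> b - C * norm (emb u - hor y)"]) auto
 qed
 have le: "F b u \<le> F b w + C * norm (emb u - emb w)" if b: "b \<in> Basis" for b u w
 proof -
  have "F b u - C * norm (emb u - emb w) \<le> F b w"
   unfolding F_def[of b w]
  proof (rule cINF_greatest[OF False])
   fix x assume x: "x \<in> G"
   have "F b u \<le> g b u x" unfolding F_def by (rule cINF_lower[OF bdd[OF b] x])
   moreover have "C * norm (emb u - hor x) \<le> C * (norm (emb u - emb w) + norm (emb w - hor x))"
    using C norm_triangle_ineq[of "emb u - emb w" "emb w - hor x"] by (intro mult_left_mono) auto
   ultimately show "F b u - C * norm (emb u - emb w) \<le> g b w x" by (simp add: g_def distrib_left)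
  qed
  then show ?thesis by simp
 qed
 have Fx: "F b u = x \<bullet> b" if b: "b \<in> Basis" and x: "x \<in> G" and u: "emb u = hor x" for b u x
 proof (rule antisym)
  have "F b u \<le> g b u x" unfolding F_def by (rule cINF_lower[OF bdd[OF b] x])
  then show "F b u \<le> x \<bullet> b" using u by (simp add: g_def)
  show "x \<bullet> b \<le> F b u"
   unfolding F_def
  proof (rule cINF_greatest[OF False])
   fix y assume y: "y \<in> G"
   have "(x - y) \<bullet> b \<le> norm (x - y)" using Basis_le_norm[OF b, of "x - y"] by linarith
   also have "\<dots> \<le> C * norm (hor x - hor y)" by (rule G[OF x y])
   finally show "x \<bullet> b \<le> g b u y" using u by (simp add: g_def inner_diff_left)
  qed
 qed
 show ?thesis
 proof (intro exI conjI)
  show "lipschitz_from_Rk k f"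
   unfolding lipschitz_from_Rk_def
  proof (intro exI conjI ballI)
   show "0 \<le> real DIM('a) * C" using C by simp
   fix u w
   have "norm (f u - f w) \<le> (\<Sum>b\<in>Basis. norm ((F b u - F b w) *\<^sub>R b))"
    unfolding f_def sum_subtractf[symmetric] scaleR_diff_left[symmetric] by (rule norm_sum)
   also have "\<dots> \<le> (\<Sum>b::'a\<in>Basis. C * norm (emb u - emb w))"
   proof (rule sum_mono)
    fix b :: 'a assume b: "b \<in> Basis"
    have "\<bar>F b u - F b w\<bar> \<le> C * norm (emb u - emb w)"
     using le[OF b, of u w] le[OF b, of w u] by (simp add: norm_minus_commute abs_le_iff)
    then show "norm ((F b u - F b w) *\<^sub>R b) \<le> C * norm (emb u - emb w)" using b by simp
   qed
   finally show "dist (f u) (f w) \<le> real DIM('a) * C * L2_set (\<lambda>i. u i - w i) {..<k}"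
    by (simp add: dist_norm emb_diff norm_emb mult.assoc)
  qed
  show "G \<subseteq> f ` topspace (Euclidean_space k)"
  proof
   fix x assume x: "x \<in> G"
   define u where "u i = (if i < k then co x i else 0)" for i
   have u: "emb u = hor x" unfolding hor_def by (rule emb_cong) (simp add: u_def)
   have "f u = (\<Sum>b\<in>Basis. (x \<bullet> b) *\<^sub>R b)" unfolding f_def using Fx[OF _ x u] by (intro sum.cong) auto
   then have "x = f u" by (simp add: euclidean_representation)
   moreover have "u \<in> topspace (Euclidean_space k)" by (simp add: topspace_Euclidean_space u_def)
   ultimately show "x \<in> f ` topspace (Euclidean_space k)" by blast
  qed
 qed
qed

end

lemma plane_frame:
 fixes L :: "'a::euclidean_space set"
 assumes L: "affine L" "aff_dim L = int k" and k: "1 \<le> k"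
 shows "\<exists>e. frame e k \<and> (\<forall>v\<in>L. \<forall>x. infdist x L = norm (frame.ver e k (x - v)) \<and> v + frame.hor e k x \<in> L)"
proof -
 have "L \<noteq> {}" using L(2) by auto
 then obtain q where q: "q \<in> L" by blast
 define D where "D = (\<lambda>x. x - q) ` L"
 have D: "subspace D" unfolding D_def using L(1) q by (rule affine_diffs_subspace_subtract)
 have dD: "dim D = k"
  using aff_dim_eq_dim_subtract[of q L] L q by (simp add: D_def hull_inc)
 obtain B where B: "B \<subseteq> D" "pairwise orthogonal B" "\<And>x. x \<in> B \<Longrightarrow> norm x = 1" "independent B" "card B = dim D" "span B = D"
  using orthonormal_basis_subspace[OF D] by metis
 obtain e where e: "bij_betw e {0..<card B} B"
  using ex_bij_betw_nat_finite[OF independent_imp_finite[OF B(4)]] by blast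
 then have e': "bij_betw e {..<k} B" using B(5) dD by (simp add: atLeast0LessThan)
 have fr: "frame e k"
 proof
  fix i j assume ij: "i < k" "j < k"
  then have eB: "e i \<in> B" "e j \<in> B" using e' by (auto simp: bij_betw_def)
  show "e i \<bullet> e j = (if i = j then 1 else 0)"
  proof (cases "i = j")
   case True
   then show ?thesis using B(3)[OF eB(1)] by (simp add: norm_eq_1)
  next
   case False
   then have "e i \<noteq> e j" using e' ij by (auto simp: bij_betw_def dest: inj_onD)
   then show ?thesis using B(2) eB False by (auto simp: pairwise_def orthogonal_def)
  qed
 qed (rule k)
 interpret frame e k by (rule fr)
 have sp: "span (e ` {..<k}) = D" using e' B(6) by (simp add: bij_betw_def)
 have LD: "x \<in> L \<longleftrightarrow> x - q \<in> D" for x by (auto simp: D_def image_iff)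
 have hD: "hor x \<in> D" for x unfolding hor_def sp[symmetric] by (rule emb_in_span)
 have vh: "v + hor x \<in> L" if "v \<in> L" for v x
 proof -
  have "(v - q) + hor x \<in> D" using that LD hD D by (intro subspace_add) auto
  then show ?thesis by (simp add: LD algebra_simps)
 qed
 have "infdist x L = norm (ver (x - v))" if v: "v \<in> L" for v x
 proof (rule antisym)
  have "infdist x L \<le> dist x (v + hor (x - v))" by (rule infdist_le[OF vh[OF v]])
  then show "infdist x L \<le> norm (ver (x - v))" by (simp add: dist_norm ver_def algebra_simps)
  show "norm (ver (x - v)) \<le> infdist x L"
   unfolding infdist_notempty[OF \<open>L \<noteq> {}\<close>]
  proof (rule cINF_greatest[OF \<open>L \<noteq> {}\<close>])
   fix l assume l: "l \<in> L"
   have "(l - q) - (v - q) \<in> D" by (rule subspace_diff[OF D]) (use l v LD in blast)+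
   then have "hor (l - v) = l - v" using hor_of_span sp by simp
   then have "ver (l - v) = 0" by (simp add: ver_def)
   then have "ver (x - v) = ver (x - l)" using ver_diff[of "x - v" "l - v"] by simp
   then show "norm (ver (x - v)) \<le> dist x l" using norm_ver_le[of "x - l"] by (simp add: dist_norm)
  qed
 qed
 then show ?thesis using fr vh by (intro exI[of _ e]) blast
qed

lemma hausdorff_plane_finite:
 fixes L :: "'a::euclidean_space set"
 assumes L: "affine L" "aff_dim L = int k" and k: "1 \<le> k"
 shows "hausdorff_outer k (L \<inter> ball x r) < \<infinity>"
proof -
 obtain e where e: "frame e k" "\<And>v x. v \<in> L \<Longrightarrow> infdist x L = norm (frame.ver e k (x - v))"
  using plane_frame[OF assms] by blast
 interpret frame e k by (rule e(1))
 have "L \<noteq> {}" using L(2) by auto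
 then obtain v where v: "v \<in> L" by blast
 obtain n :: nat where n: "norm (x - v) + r \<le> real n" using real_arch_simple by blast
 have "L \<inter> ball x r \<subseteq> {v + emb u |u. \<forall>i<k. \<bar>u i\<bar> \<le> real n}"
 proof
  fix y assume y: "y \<in> L \<inter> ball x r"
  then have "norm (ver (y - v)) = 0" using e(2)[OF v, of y] by simp
  then have "y = v + emb (co (y - v))" using hor_ver[of "y - v"] by (simp add: hor_def)
  moreover have "\<bar>co (y - v) i\<bar> \<le> real n" if i: "i < k" for i
  proof -
   have "\<bar>co (y - v) i\<bar> \<le> norm (y - v)" using co_le_norm[OF i, of "y - v"] norm_hor_le[of "y - v"] by linarith
   also have "\<dots> \<le> norm (x - v) + norm (x - y)" using norm_triangle_ineq4[of "x - v" "x - y"] by simp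
   finally show ?thesis using y n by (simp add: dist_norm)
  qed
  ultimately show "y \<in> {v + emb u |u. \<forall>i<k. \<bar>u i\<bar> \<le> real n}" by blast
 qed
 then have "hausdorff_outer k (L \<inter> ball x r) \<le> hausdorff_outer k {v + emb u |u. \<forall>i<k. \<bar>u i\<bar> \<le> real n}"
  by (rule hausdorff_outer_mono)
 then show ?thesis using hausdorff_cube_finite by (rule le_less_trans)
qed

subsection \<open>Sets satisfying the flatness hypothesis\<close>

abbreviation scale_int :: "nat \<Rightarrow> 'a::euclidean_space set \<Rightarrow> 'a \<Rightarrow> real \<Rightarrow> ennreal" where
 "scale_int k S y r \<equiv> (\<integral>\<^sup>+s\<in>{0<..<r}. mean_flatness k (hausdorff_on k S) y s / ennreal s \<partial>lborel)"

abbreviation flat_int :: "nat \<Rightarrow> 'a::euclidean_space set \<Rightarrow> 'a \<Rightarrow> real \<Rightarrow> ennreal" where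
 "flat_int k S x r \<equiv> (\<integral>\<^sup>+y\<in>S \<inter> ball x r. scale_int k S y r \<partial>\<H> k)"

definition tame :: "nat \<Rightarrow> real \<Rightarrow> 'a::euclidean_space set \<Rightarrow> bool" where
 "tame k \<delta> S \<longleftrightarrow> S \<subseteq> ball 0 2 \<and> S \<in> sets (\<H> k) \<and>
  (\<forall>x r. r > 0 \<longrightarrow> ball x r \<subseteq> ball 0 2 \<longrightarrow>
    emeasure (\<H> k) (S \<inter> ball x r) \<ge> ennreal (eps_const DIM('a) * r ^ k) \<longrightarrow>
    flat_int k S x r < ennreal (\<delta>\<^sup>2 * r ^ k))"

lemma borel_hausdorff: "A \<in> sets borel \<Longrightarrow> A \<in> sets (\<H> k)"
 using borel_hausdorff_measure by blast

lemma measurable_hausdorff_measure: "f \<in> borel_measurable borel \<Longrightarrow> f \<in> borel_measurable (\<H> k)"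
 by (auto simp: measurable_def intro: borel_hausdorff)

lemma nn_integral_hausdorff_on:
 assumes "f \<in> borel_measurable borel" "S \<in> sets (\<H> k)"
 shows "(\<integral>\<^sup>+x. f x \<partial>hausdorff_on k S) = (\<integral>\<^sup>+x. indicator S x * f x \<partial>\<H> k)"
 unfolding hausdorff_on_def
 using assms by (intro nn_integral_density measurable_hausdorff_measure borel_measurable_indicator)

lemma measurable_infdist2: "(\<lambda>x. ennreal ((infdist x L)\<^sup>2)) \<in> borel_measurable borel"
 by (intro measurable_compose[OF _ measurable_ennreal] borel_measurable_power borel_measurable_continuous_onI continuous_intros)

lemma mean_flatness_mono:
 assumes "T \<in> sets (\<H> k)" "S \<in> sets (\<H> k)" "T \<subseteq> S"
 shows "mean_flatness k (hausdorff_on k T) x r \<le> mean_flatness k (hausdorff_on k S) x r"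
proof -
 have b: "ball x r \<in> sets (\<H> k)" by (simp add: borel_hausdorff)
 have "emeasure (hausdorff_on k T) (ball x r) \<le> emeasure (hausdorff_on k S) (ball x r)"
  using assms b by (auto simp: emeasure_hausdorff_on intro!: emeasure_mono)
 moreover have "sqdist (hausdorff_on k T) x r L \<le> (sqdist (hausdorff_on k S) x r L)" for L
 proof -
  have "(\<lambda>y. ennreal ((infdist y L)\<^sup>2) * indicator (ball x r) y) \<in> borel_measurable borel"
   by (intro borel_measurable_times_ennreal measurable_infdist2 borel_measurable_indicator) auto
  then show ?thesis
   using assms by (subst (1 2) nn_integral_hausdorff_on)
    (auto intro!: nn_integral_mono split: split_indicator)
 qed
 ultimately show ?thesis
  unfolding mean_flatness_def by (auto intro!: INF_mono' mult_left_mono simp del: power_Suc)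
qed

text \<open>A smaller set has smaller flatness at every ball, as its mass enters both the threshold
  and the integral monotonically, and it meets the threshold on fewer balls. This permits passing to
  convenient pieces.\<close>

lemma tame_subset:
 assumes S: "tame k \<delta> S" and T: "T \<in> sets (\<H> k)" "T \<subseteq> S"
 shows "tame k \<delta> T"
 unfolding tame_def
proof (intro conjI allI impI)
 fix x r
 assume r: "0 < r" "ball x r \<subseteq> ball 0 2" and m: "ennreal (eps_const DIM('a) * r ^ k) \<le> emeasure (\<H> k) (T \<inter> ball x r)"
 have Ss: "S \<in> sets (\<H> k)" using S by (simp add: tame_def)
 then have "emeasure (\<H> k) (T \<inter> ball x r) \<le> emeasure (\<H> k) (S \<inter> ball x r)"
  using T by (intro emeasure_mono sets.Int[OF _ borel_hausdorff]) auto
 then have "ennreal (eps_const DIM('a) * r ^ k) \<le> emeasure (\<H> k) (S \<inter> ball x r)" using m by (rule order_trans[rotated])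
 then have "flat_int k S x r < ennreal (\<delta>\<^sup>2 * r ^ k)" using S r unfolding tame_def by blast
 moreover have "flat_int k T x r
   \<le> flat_int k S x r"
  using T(2) mean_flatness_mono[OF T(1) Ss T(2)]
  by (intro nn_integral_mono mult_mono divide_right_mono_ennreal) (auto split: split_indicator)
 ultimately show "flat_int k T x r < ennreal (\<delta>\<^sup>2 * r ^ k)"
  by (rule le_less_trans[rotated])
qed (use S T in \<open>auto simp: tame_def\<close>)

text \<open>The measure of the set is not assumed finite, so decomposition into pieces of finite
  measure has to be derived.\<close>

definition sigma_cover :: "nat \<Rightarrow> 'a::metric_space set \<Rightarrow> bool" where
 "sigma_cover k X \<longleftrightarrow> (\<exists>A :: nat \<Rightarrow> 'a set. (\<forall>i. A i \<in> sets (\<H> k) \<and> emeasure (\<H> k) (A i) < \<infinity>) \<and> X \<subseteq> (\<Union>i. A i))"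

lemma sigma_cover_finite: "A \<in> sets (\<H> k) \<Longrightarrow> emeasure (\<H> k) A < \<infinity> \<Longrightarrow> sigma_cover k A"
 unfolding sigma_cover_def by (intro exI[of _ "\<lambda>_. A"]) simp

lemma sigma_cover_subset: "sigma_cover k Y \<Longrightarrow> X \<subseteq> Y \<Longrightarrow> sigma_cover k X"
 unfolding sigma_cover_def by (meson order_trans)

lemma sigma_cover_Union:
 fixes \<X> :: "'a::metric_space set set"
 assumes "countable \<X>" "\<And>X. X \<in> \<X> \<Longrightarrow> sigma_cover k X" "Y \<subseteq> \<Union>\<X>"
 shows "sigma_cover k Y"
proof (cases "\<X> = {}")
 case True
 then show ?thesis using assms(3) unfolding sigma_cover_def by (intro exI[of _ "\<lambda>_. {}"]) simp
next
 case False
 then have r: "range (from_nat_into \<X>) = \<X>" using assms(1) by (rule range_from_nat_into)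
 then have "\<forall>n. sigma_cover k (from_nat_into \<X> n)" using assms(2) by blast
 from choice[OF this[unfolded sigma_cover_def]] obtain A :: "nat \<Rightarrow> nat \<Rightarrow> 'a set" where
  A: "\<forall>n. (\<forall>i. A n i \<in> sets (\<H> k) \<and> emeasure (\<H> k) (A n i) < \<infinity>) \<and> from_nat_into \<X> n \<subseteq> (\<Union>i. A n i)" ..
 have "Y \<subseteq> (\<Union>p. case_prod A (prod_decode p))"
 proof
  fix x assume "x \<in> Y"
  then obtain n where "x \<in> from_nat_into \<X> n" using assms(3) r by blast
  then obtain i where "x \<in> A n i" using A by blast
  then have "x \<in> case_prod A (prod_decode (prod_encode (n, i)))" by simp
  then show "x \<in> (\<Union>p. case_prod A (prod_decode p))" by (rule UN_I[OF UNIV_I])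
 qed
 then show ?thesis
  unfolding sigma_cover_def using A by (intro exI[of _ "\<lambda>p. case_prod A (prod_decode p)"]) (simp add: split_beta)
qed

text \<open>Below the threshold the mass is finite. Above it some plane has a finite second moment:
  by Chebyshev's inequality the points at distance at least \<open>1 / Suc n\<close> from it have
  finite measure, and the rest lies in a bounded piece of the plane.\<close>

lemma sigma_finite_ball:
 fixes S :: "'a::euclidean_space set"
 assumes k: "1 \<le> k" and S: "S \<in> sets (\<H> k)" and s: "0 < s"
  and fin: "mean_flatness k (hausdorff_on k S) y s < \<infinity>"
 shows "sigma_cover k (S \<inter> ball y s)"
proof (cases "ennreal (eps_const DIM('a) * s ^ k) \<le> emeasure (hausdorff_on k S) (ball y s)")
 case False
 have b: "ball y s \<in> sets (\<H> k)" by (simp add: borel_hausdorff)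
 have "emeasure (\<H> k) (S \<inter> ball y s) < \<infinity>"
  using False S b order.strict_trans[OF _ ennreal_less_top[of "eps_const DIM('a) * s ^ k"]]
  by (simp add: emeasure_hausdorff_on not_le)
 moreover have "S \<inter> ball y s \<in> sets (\<H> k)" using S b by (rule sets.Int)
 ultimately show ?thesis by (intro sigma_cover_finite)
next
 case True
 with fin have "(INF L\<in>{L. affine L \<and> aff_dim L = int k}. ennreal (1 / s ^ (k + 2)) *
   (sqdist (hausdorff_on k S) y s L)) < \<infinity>"
  by (simp only: mean_flatness_def if_True)
 then obtain L where L: "affine L" "aff_dim L = int k"
  and I: "ennreal (1 / s ^ (k + 2)) * (sqdist (hausdorff_on k S) y s L) < \<infinity>"
  unfolding INF_less_iff by blast
 define I0 where "I0 = (sqdist (hausdorff_on k S) y s L)"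
 have I0: "I0 < \<infinity>"
  using I s unfolding I0_def[symmetric] by (auto simp: less_top[symmetric] ennreal_mult_eq_top_iff)
 have cL: "closed L" using L(1) by (rule affine_closed)
 have Lne: "L \<noteq> {}" using L(2) by auto
 define D where "D n = {x. 1 / real (Suc n) \<le> infdist x L}" for n
 have Db: "D n \<in> sets borel" for n
  unfolding D_def by (intro borel_closed closed_Collect_le continuous_intros)
 define A where "A n = (S \<inter> ball y s) \<inter> D n" for n
 have As: "A n \<in> sets (\<H> k)" for n
  unfolding A_def by (intro sets.Int[OF sets.Int[OF S]] borel_hausdorff Db) auto
 have Ls: "S \<inter> ball y s \<inter> L \<in> sets (\<H> k)"
  using cL by (intro sets.Int[OF sets.Int[OF S]] borel_hausdorff) auto
 have Afin: "emeasure (\<H> k) (A n) < \<infinity>" for n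
 proof -
  have m: "(\<lambda>x. ennreal ((infdist x L)\<^sup>2) * indicator (ball y s) x) \<in> borel_measurable borel"
   by (intro borel_measurable_times_ennreal measurable_infdist2 borel_measurable_indicator) auto
  have "ennreal ((1 / real (Suc n))\<^sup>2) * emeasure (\<H> k) (A n) = (\<integral>\<^sup>+x. ennreal ((1 / real (Suc n))\<^sup>2) * indicator (A n) x \<partial>\<H> k)"
   using As by (simp add: nn_integral_cmult_indicator)
  also have "\<dots> \<le> (\<integral>\<^sup>+x. indicator S x * (ennreal ((infdist x L)\<^sup>2) * indicator (ball y s) x) \<partial>\<H> k)"
  proof (rule nn_integral_mono)
   fix x
   show "ennreal ((1 / real (Suc n))\<^sup>2) * indicator (A n) x \<le> indicator S x * (ennreal ((infdist x L)\<^sup>2) * indicator (ball y s) x)"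
   proof (cases "x \<in> A n")
    case True
    then have "(1 / real (Suc n))\<^sup>2 \<le> (infdist x L)\<^sup>2" by (intro power_mono) (auto simp: A_def D_def)
    then show ?thesis using True by (auto simp: A_def intro!: ennreal_leI)
   qed simp
  qed
  also have "\<dots> = I0" unfolding I0_def by (rule nn_integral_hausdorff_on[OF m S, symmetric])
  finally have "ennreal ((1 / real (Suc n))\<^sup>2) * emeasure (\<H> k) (A n) < \<infinity>" using I0 by (rule le_less_trans)
  then show ?thesis by (auto simp: less_top[symmetric] ennreal_mult_eq_top_iff)
 qed
 have Lfin: "emeasure (\<H> k) (S \<inter> ball y s \<inter> L) < \<infinity>"
 proof -
  have "emeasure (\<H> k) (S \<inter> ball y s \<inter> L) \<le> hausdorff_outer k (L \<inter> ball y s)"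
   unfolding emeasure_hausdorff_measure[OF Ls] by (rule hausdorff_outer_mono) auto
  then show ?thesis using hausdorff_plane_finite[OF L k] by (rule le_less_trans)
 qed
 show ?thesis
 proof (rule sigma_cover_Union)
  show "countable (insert (S \<inter> ball y s \<inter> L) (range A))" by simp
  show "sigma_cover k X" if "X \<in> insert (S \<inter> ball y s \<inter> L) (range A)" for X
   using that As Afin Ls Lfin by (auto intro: sigma_cover_finite)
  show "S \<inter> ball y s \<subseteq> \<Union>(insert (S \<inter> ball y s \<inter> L) (range A))"
  proof
   fix x assume x: "x \<in> S \<inter> ball y s"
   show "x \<in> \<Union>(insert (S \<inter> ball y s \<inter> L) (range A))"
   proof (cases "x \<in> L")
    case False
    then have "0 < infdist x L" using cL Lne infdist_pos_not_in_closed by blast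
    then obtain n where "1 / real (Suc n) < infdist x L" using nat_approx_posE by blast
    then have "x \<in> A n" using x by (simp add: A_def D_def)
    then show ?thesis by blast
   qed (use x in auto)
  qed
 qed
qed

text \<open>If the measure is infinite, the ball of radius 2 passes the threshold and the flatness
  integral over it is finite. Points with infinite flatness at all radii between 1 and 2 then form a
  null set; near any other point \<open>sigma_finite_ball\<close> applies at a radius covering a
  ball of radius \<open>1 / 2\<close>, and finitely many such balls suffice.\<close>

lemma tame_sigma_finite:
 fixes S :: "'a::euclidean_space set"
 assumes k: "1 \<le> k" and S: "tame k \<delta> S"
 shows "sigma_cover k S"
proof (cases "emeasure (\<H> k) S < \<infinity>")
 case True
 then show ?thesis using S by (intro sigma_cover_finite) (auto simp: tame_def)
next
 case False
 let ?mf = "mean_flatness k (hausdorff_on k S)"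
 let ?in = "\<lambda>y. (\<integral>\<^sup>+s\<in>{0<..<2::real}. ?mf y s / ennreal s \<partial>lborel)"
 have Ss: "S \<in> sets (\<H> k)" and S2: "S \<subseteq> ball 0 2" using S by (auto simp: tame_def)
 have SB: "S \<inter> ball 0 2 = S" using S2 by blast
 have "emeasure (\<H> k) S = \<infinity>" using False by (simp add: less_top[symmetric])
 then have "(\<integral>\<^sup>+y\<in>S \<inter> ball 0 2. ?in y \<partial>\<H> k) < ennreal (\<delta>\<^sup>2 * 2 ^ k)"
  using S[unfolded tame_def, THEN conjunct2, THEN conjunct2, rule_format, of 2 0] by (simp add: SB)
 then have fin: "(\<integral>\<^sup>+y\<in>S. ?in y \<partial>\<H> k) < \<infinity>"
  unfolding SB using order.strict_trans[OF _ ennreal_less_top[of "\<delta>\<^sup>2 * 2 ^ k"]] by simp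
 obtain X where X: "finite X" "cball (0::'a) 2 \<subseteq> (\<Union>a\<in>X. ball a (1 / 2))"
 proof -
  have "cball (0::'a) 2 \<subseteq> (\<Union>a\<in>cball 0 2. ball a (1 / 2))" by force
  then obtain X where "X \<subseteq> cball (0::'a) 2" "finite X" "cball (0::'a) 2 \<subseteq> (\<Union>a\<in>X. ball a (1 / 2))"
   using compactE_image[OF compact_cball, of "cball 0 2" "\<lambda>a::'a. ball a (1 / 2)" 0 2] by auto
  then show thesis using that by blast
 qed
 \<comment> \<open>A radius above 1 makes the ball about \<open>y\<close> contain the whole covering
   ball of radius \<open>1 / 2\<close> in which \<open>y\<close> lies.\<close>
 define P where "P a \<longleftrightarrow> (\<exists>y\<in>S \<inter> ball a (1 / 2). \<exists>s\<in>{1<..<2::real}. ?mf y s < \<infinity>)" for a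
 define Q where "Q = S - (\<Union>a\<in>{a \<in> X. P a}. ball a (1 / 2))"
 have Qs: "Q \<in> sets (\<H> k)"
  unfolding Q_def by (intro sets.Diff[OF Ss] borel_hausdorff borel_open open_UN) auto
 have Qin: "?in y = \<infinity>" if y: "y \<in> Q" for y
 proof -
  have "y \<in> S" using y by (simp add: Q_def)
  then have "y \<in> cball 0 2" using S2 by force
  then obtain a where a: "a \<in> X" "y \<in> ball a (1 / 2)" using X(2) by blast
  then have nP: "\<not> P a" using y by (auto simp: Q_def)
  have top: "?mf y s = \<infinity>" if "s \<in> {1<..<2}" for s
   using nP a(2) \<open>y \<in> S\<close> that unfolding P_def by (force simp: less_top[symmetric])
  have "(\<integral>\<^sup>+s. \<infinity> * indicator {1<..<2::real} s \<partial>lborel) \<le> ?in y"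
   by (rule nn_integral_mono) (auto simp: top ennreal_top_divide split: split_indicator)
  moreover have "(\<integral>\<^sup>+s. \<infinity> * indicator {1<..<2::real} s \<partial>lborel) = \<infinity>"
   by (subst nn_integral_cmult_indicator) (auto simp: ennreal_top_mult)
  ultimately show ?thesis by (simp add: top_unique)
 qed
 have Q0: "emeasure (\<H> k) Q = 0"
 proof (rule ccontr)
  assume "emeasure (\<H> k) Q \<noteq> 0"
  then have "\<infinity> = (\<integral>\<^sup>+y. \<infinity> * indicator Q y \<partial>\<H> k)"
   using Qs by (subst nn_integral_cmult_indicator) (auto simp: ennreal_top_mult)
  also have "\<dots> \<le> (\<integral>\<^sup>+y\<in>S. ?in y \<partial>\<H> k)"
  proof (rule nn_integral_mono)
   fix y
   show "\<infinity> * indicator Q y \<le> ?in y * indicator S y"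
    using Qin[of y] by (cases "y \<in> Q") (auto simp: Q_def)
  qed
  finally show False using fin by simp
 qed
 have ball: "sigma_cover k (S \<inter> ball a (1 / 2))" if "P a" for a
 proof -
  obtain y s where ys: "y \<in> ball a (1 / 2)" "1 < s" "?mf y s < \<infinity>" using \<open>P a\<close> unfolding P_def by auto
  have "ball a (1 / 2) \<subseteq> ball y s"
  proof
   fix z assume "z \<in> ball a (1 / 2)"
   then show "z \<in> ball y s" using ys(1,2) dist_triangle3[of y z a] by simp
  qed
  then have "S \<inter> ball a (1 / 2) \<subseteq> S \<inter> ball y s" by (rule Int_mono[OF order_refl])
  moreover have "sigma_cover k (S \<inter> ball y s)" using ys(2) by (intro sigma_finite_ball[OF k Ss _ ys(3)]) simp
  ultimately show ?thesis by (rule sigma_cover_subset[rotated])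
 qed
 show ?thesis
 proof (rule sigma_cover_Union)
  let ?\<X> = "insert Q ((\<lambda>a. S \<inter> ball a (1 / 2)) ` {a \<in> X. P a})"
  show "countable ?\<X>" using X(1) by (intro countable_finite) simp
  have "sigma_cover k Q" by (rule sigma_cover_finite[OF Qs]) (simp add: Q0)
  then show "sigma_cover k Y" if "Y \<in> ?\<X>" for Y using that ball by blast
  show "S \<subseteq> \<Union>?\<X>" unfolding Q_def by blast
 qed
qed

lemma tame_sequence:
 fixes S :: "'a::euclidean_space set"
 assumes "1 \<le> k" "tame k \<delta> S"
 obtains A :: "nat \<Rightarrow> 'a set" where "\<And>i. A i \<in> sets (\<H> k)" "\<And>i. emeasure (\<H> k) (A i) < \<infinity>" "S = (\<Union>i. A i)"
proof -
 obtain A :: "nat \<Rightarrow> 'a set" where A: "\<And>i. A i \<in> sets (\<H> k) \<and> emeasure (\<H> k) (A i) < \<infinity>" "S \<subseteq> (\<Union>i. A i)"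
  using tame_sigma_finite[OF assms] unfolding sigma_cover_def by blast
 have 1: "S \<inter> A i \<in> sets (\<H> k)" for i using assms(2) A(1) by (intro sets.Int) (auto simp: tame_def)
 have 2: "emeasure (\<H> k) (S \<inter> A i) < \<infinity>" for i
  using emeasure_mono[of "S \<inter> A i" "A i" "\<H> k"] A(1)[of i] by (auto intro: le_less_trans)
 have 3: "S = (\<Union>i. S \<inter> A i)" using A(2) by blast
 show thesis by (rule that[OF 1 2 3])
qed

section \<open>Size of the density threshold\<close>

lemma unit_ball_vol_ge: "1 / fact n \<le> unit_ball_vol (real n)"
proof -
 have pi1: "1 \<le> pi ^ m" for m by (intro one_le_power) (use pi_ge_two in linarith)
 show ?thesis
 proof (cases "even n")
  case True
  then obtain m where m: "n = 2 * m" by blast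
  have "1 / fact n \<le> 1 / (fact m :: real)" unfolding m by (intro divide_left_mono fact_mono) auto
  also have "\<dots> \<le> pi ^ m / fact m" using pi1 by (intro divide_right_mono) auto
  also have "\<dots> = unit_ball_vol (real n)" using unit_ball_vol_even[of m] by (simp add: m)
  finally show ?thesis .
 next
  case False
  then obtain m where m: "n = 2 * m + 1" using oddE by blast
  have "1 \<le> (2::real) ^ (2 * m + 1)" by (rule one_le_power) simp
  then have "1 * 1 \<le> 2 ^ (2 * m + 1) * pi ^ m" using pi1[of m] by (intro mult_mono) auto
  moreover define P where "P = 2 ^ (2 * m + 1) * pi ^ m"
  moreover define F where "F = (fact (Suc m) :: real)"
  ultimately have FP: "F * 1 \<le> F * P" by (intro mult_left_mono) auto
  have mF: "real (Suc m) \<le> F" (is "?m \<le> F")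
   unfolding F_def using fact_ge_self[of "Suc m"] by (metis of_nat_fact of_nat_le_iff)
  have "2 * ?m \<le> 2 * (F * P)" using order_trans[OF mF FP[unfolded mult_1_right]] by (rule mult_left_mono) simp
  also have "2 * (F * P) = 2 ^ (2 * Suc m) * fact (Suc m) * pi ^ m" by (simp add: F_def P_def)
  finally have "real (2 * Suc m) \<le> 2 ^ (2 * Suc m) * fact (Suc m) * pi ^ m" by simp
  then have "real (2 * Suc m) / fact (2 * Suc m) \<le> 2 ^ (2 * Suc m) * fact (Suc m) * pi ^ m / fact (2 * Suc m)"
   by (intro divide_right_mono) auto
  moreover have "(fact (2 * Suc m) :: real) = real (2 * Suc m) * fact n"
   using fact_Suc[of "2 * m + 1", where 'a = real] by (simp add: m)
  then have "1 / fact n = real (2 * Suc m) / (fact (2 * Suc m) :: real)" by simp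
  ultimately have "1 / fact n \<le> 2 ^ (2 * Suc m) * fact (Suc m) * pi ^ m / fact (2 * Suc m)" by linarith
  also have "\<dots> = unit_ball_vol (real n)" using unit_ball_vol_odd[of m] by (simp add: m)
  finally show ?thesis .
 qed
qed

text \<open>The only place where the explicit value of the threshold enters. \<open>4 ^ k\<close> is
  the reciprocal of the guaranteed density, \<open>8 * k + 8\<close> is twice \<open>KK\<close>, and
  the left side, with \<open>fact k\<close> for the reciprocal ball volume, needs only
  \<open>3 * k\<close> factors \<open>1000 * n\<close>.\<close>

lemma eps_const_le:
 assumes "1 \<le> k" "k \<le> n"
 shows "2 * 4 ^ k * (8 * real k + 8) ^ k * eps_const n \<le> min 1 (unit_ball_vol (real k))"
proof -
 define x where "x = 1000 * real n"
 have n: "1 \<le> n" "1 \<le> real n" using assms by auto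
 have x: "1 \<le> x" using n by (simp add: x_def)
 have eps: "eps_const n = 1 / x ^ (7 * n\<^sup>2)"
  by (simp only: eps_const_def x_def power_int_minus power_int_of_nat inverse_eq_divide)
 have "2 * 4 ^ k * (8 * real k + 8) ^ k * fact k \<le> x ^ k * x ^ k * x ^ k"
 proof -
  have "2 * 4 ^ k = (2::real) * 4 ^ k" by simp
  have "(2::real) ^ 1 \<le> 2 ^ k" using assms by (intro power_increasing) auto
  then have "2 * 4 ^ k \<le> (2::real) ^ k * 4 ^ k" by simp
  also have "\<dots> = 8 ^ k" by (simp add: power_mult_distrib[symmetric])
  also have "\<dots> \<le> x ^ k" using n by (intro power_mono) (auto simp: x_def)
  finally have 1: "2 * 4 ^ k \<le> x ^ k" .
  have 2: "(8 * real k + 8) ^ k \<le> x ^ k" using assms by (intro power_mono) (auto simp: x_def)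
  have "fact k \<le> real k ^ k" using fact_le_power[of k, where 'a = real] by simp
  also have "\<dots> \<le> x ^ k" using assms by (intro power_mono) (auto simp: x_def)
  finally show ?thesis using 1 2 x by (intro mult_mono) auto
 qed
 also have "\<dots> = x ^ (3 * k)" using power_add[of x "k + k" k] power_add[of x k k] by (simp add: mult.commute[of 3] numeral_3_eq_3 add.assoc)
 also have "\<dots> \<le> x ^ (7 * n\<^sup>2)"
 proof (rule power_increasing[OF _ x])
  have "k * 1 \<le> n * n" using assms n by (intro mult_mono) auto
  then show "3 * k \<le> 7 * n\<^sup>2" by (simp add: power2_eq_square)
 qed
 finally have "2 * 4 ^ k * (8 * real k + 8) ^ k * fact k \<le> x ^ (7 * n\<^sup>2)" .
 then have "2 * 4 ^ k * (8 * real k + 8) ^ k * eps_const n \<le> 1 / fact k"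
  using x by (simp add: eps field_simps)
 moreover have "1 / fact k \<le> (1::real)" using fact_ge_1[of k, where 'a = real] by (simp add: divide_le_eq)
 ultimately show ?thesis using unit_ball_vol_ge[of k] by linarith
qed

abbreviation hmass :: "nat \<Rightarrow> 'a::metric_space set \<Rightarrow> 'a set \<Rightarrow> real" where
 "hmass k T B \<equiv> measure (\<H> k) (T \<inter> B)"

lemma emeasure_hmass:
 assumes "T \<in> sets (\<H> k)" "emeasure (\<H> k) T < \<infinity>"
 shows "emeasure (\<H> k) (T \<inter> B) = ennreal (hmass k T B)"
proof -
 have "emeasure (\<H> k) (T \<inter> B) \<le> emeasure (\<H> k) T" by (rule emeasure_mono[OF _ assms(1)]) simp
 then have "emeasure (\<H> k) (T \<inter> B) < \<infinity>" using assms(2) by (rule le_less_trans)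
 then show ?thesis by (intro emeasure_eq_ennreal_measure) simp
qed

lemma hmass_mono:
 assumes "T \<in> sets (\<H> k)" "emeasure (\<H> k) T < \<infinity>" "B \<subseteq> C" "C \<in> sets borel"
 shows "hmass k T B \<le> hmass k T C"
proof -
 have "emeasure (\<H> k) (T \<inter> B) \<le> emeasure (\<H> k) (T \<inter> C)"
  using assms(3) by (intro emeasure_mono sets.Int[OF assms(1) borel_hausdorff[OF assms(4)]]) auto
 then show ?thesis using assms(1,2) by (simp add: emeasure_hmass)
qed

lemma hmass_Un_le:
 assumes "T \<in> sets (\<H> k)" "B \<in> sets borel" "C \<in> sets borel"
 shows "hmass k T (B \<union> C) \<le> hmass k T B + hmass k T C"
 unfolding Int_Un_distrib by (intro measure_Un_le sets.Int[OF assms(1)] borel_hausdorff assms)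

subsection \<open>Rescaling\<close>

definition rawfl :: "nat \<Rightarrow> 'a::euclidean_space set \<Rightarrow> 'a \<Rightarrow> real \<Rightarrow> ennreal" where
 "rawfl k T y s = (INF L\<in>{L. affine L \<and> aff_dim L = int k}.
   ennreal (1 / s ^ (k + 2)) * (sqdist (hausdorff_on k T) y s L))"

locale rescaling = frame e k for e :: "nat \<Rightarrow> 'a::euclidean_space" and k +
 fixes T A :: "'a set" and w t :: real and v :: 'a
 assumes T: "T \<in> sets (\<H> k)" and T_fin: "emeasure (\<H> k) T < \<infinity>"
  and A: "A \<in> sets borel" and t: "0 < t" and w: "0 < w"
begin

definition \<Psi> :: "'a \<Rightarrow> 'a" where "\<Psi> x = t *\<^sub>R (x - v)"

text \<open>With the factor \<open>t ^ k\<close> the dilation preserves density ratios, so these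
  change by \<open>w\<close> alone.\<close>

definition M :: "'a measure" where
 "M = distr (density (\<H> k) (\<lambda>x. ennreal (w * t ^ k) * indicator (T \<inter> A) x)) borel \<Psi>"

abbreviation mass :: "'a set \<Rightarrow> real" where "mass \<equiv> hmass k T"

lemma sets_M: "sets M = sets borel" by (simp add: M_def)

lemma continuous_Psi: "continuous_on UNIV \<Psi>"
 unfolding \<Psi>_def by (intro continuous_intros)

lemma measurable_Psi: "\<Psi> \<in> borel_measurable borel"
 using continuous_Psi by (rule borel_measurable_continuous_onI)

lemma vimage_Psi: "B \<in> sets borel \<Longrightarrow> \<Psi> -` B \<in> sets borel"
 using measurable_sets[OF measurable_Psi, of B] by simp

lemma TA: "T \<inter> A \<in> sets (\<H> k)"
 by (rule sets.Int[OF T borel_hausdorff[OF A]])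

lemma TB: "B \<in> sets borel \<Longrightarrow> T \<inter> B \<in> sets (\<H> k)"
 by (rule sets.Int[OF T borel_hausdorff])

lemmas emeasure_TB = emeasure_hmass[OF T T_fin]

lemma nn_integral_M:
 assumes f: "f \<in> borel_measurable borel"
 shows "(\<integral>\<^sup>+x. f x \<partial>M) = (\<integral>\<^sup>+x. ennreal (w * t ^ k) * indicator (T \<inter> A) x * f (\<Psi> x) \<partial>\<H> k)"
proof -
 let ?D = "density (\<H> k) (\<lambda>x. ennreal (w * t ^ k) * indicator (T \<inter> A) x)"
 have P: "\<Psi> \<in> measurable ?D borel" using measurable_hausdorff_measure[OF measurable_Psi] by simp
 have "(\<integral>\<^sup>+x. f x \<partial>M) = (\<integral>\<^sup>+x. f (\<Psi> x) \<partial>?D)"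
  unfolding M_def using f by (intro nn_integral_distr[OF P]) simp
 also have "\<dots> = (\<integral>\<^sup>+x. (ennreal (w * t ^ k) * indicator (T \<inter> A) x) * f (\<Psi> x) \<partial>\<H> k)"
  using TA measurable_compose[OF measurable_Psi f]
  by (intro nn_integral_density borel_measurable_times_ennreal borel_measurable_indicator measurable_hausdorff_measure) auto
 finally show ?thesis .
qed

lemma wt: "0 < w * t ^ k" using w t by simp

lemma emeasure_M:
 assumes B: "B \<in> sets borel"
 shows "emeasure M B = ennreal (w * t ^ k * mass (A \<inter> \<Psi> -` B))"
proof -
 have AB: "A \<inter> \<Psi> -` B \<in> sets borel" using A vimage_Psi[OF B] by (rule sets.Int)
 have "emeasure M B = (\<integral>\<^sup>+x. indicator B x \<partial>M)" using B by (simp add: sets_M)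
 also have "\<dots> = (\<integral>\<^sup>+x. ennreal (w * t ^ k) * indicator (T \<inter> A) x * indicator B (\<Psi> x) \<partial>\<H> k)"
  using B by (intro nn_integral_M borel_measurable_indicator)
 also have "\<dots> = (\<integral>\<^sup>+x. ennreal (w * t ^ k) * indicator (T \<inter> (A \<inter> \<Psi> -` B)) x \<partial>\<H> k)"
  by (intro nn_integral_cong) (auto split: split_indicator)
 also have "\<dots> = ennreal (w * t ^ k) * emeasure (\<H> k) (T \<inter> (A \<inter> \<Psi> -` B))"
  by (rule nn_integral_cmult_indicator[OF TB[OF AB]])
 also have "\<dots> = ennreal (w * t ^ k * mass (A \<inter> \<Psi> -` B))"
  unfolding emeasure_TB using wt by (intro ennreal_mult[symmetric]) auto
 finally show ?thesis .
qed

lemma measure_M: "B \<in> sets borel \<Longrightarrow> measure M B = w * t ^ k * mass (A \<inter> \<Psi> -` B)"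
 using wt by (simp add: measure_def[of M] emeasure_M)

lemma fmeas_M: "fmeas e k M"
proof -
 have "space M = UNIV" using sets_eq_imp_space_eq[OF sets_M] by simp
 then have "emeasure M (space M) \<noteq> \<infinity>" by (simp add: emeasure_M)
 then have "finite_measure M" by (rule finite_measureI)
 then show ?thesis using sets_M frame_axioms by (simp add: fmeas_def fmeas_axioms_def)
qed

sublocale fm: fmeas e k M by (rule fmeas_M)

lemmas mass_mono = hmass_mono[OF T T_fin]

lemma dist_Psi: "dist (\<Psi> x) (\<Psi> y) = t * dist x y"
proof -
 have "\<Psi> x - \<Psi> y = t *\<^sub>R (x - y)" by (simp add: \<Psi>_def algebra_simps)
 then show ?thesis using t by (simp add: dist_norm)
qed

lemma vimage_ball: "\<Psi> -` ball (\<Psi> y) s = ball y (s / t)"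
 using t by (auto simp: dist_Psi pos_less_divide_eq mult.commute)

lemma Psi_surj: "\<Psi> (v + (1 / t) *\<^sub>R z) = z"
 using t by (simp add: \<Psi>_def)

lemma Psi_image_plane:
 assumes "affine L" "aff_dim L = int k"
 shows "affine (\<Psi> ` L)" "aff_dim (\<Psi> ` L) = int k"
proof -
 have l: "linear (\<lambda>x. t *\<^sub>R x)" "inj (\<lambda>x::'a. t *\<^sub>R x)" using t by (auto intro!: linearI injI simp: algebra_simps)
 have eq: "\<Psi> ` L = (\<lambda>x. - (t *\<^sub>R v) + x) ` ((\<lambda>x. t *\<^sub>R x) ` L)"
  by (auto simp: \<Psi>_def image_image algebra_simps)
 have "affine hull ((\<lambda>x. t *\<^sub>R x) ` L) = (\<lambda>x. t *\<^sub>R x) ` L"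
  using affine_hull_linear_image[of "\<lambda>x. t *\<^sub>R x" L] l assms(1) affine_hull_eq[of L] by (simp add: linear_linear del: affine_hull_eq)
 then have "affine ((\<lambda>x. t *\<^sub>R x) ` L)" by (metis affine_affine_hull)
 then show "affine (\<Psi> ` L)" unfolding eq by (simp only: affine_translation[symmetric])
 show "aff_dim (\<Psi> ` L) = int k"
  unfolding eq using aff_dim_injective_linear_image[OF l, of L] assms(2) by (simp only: aff_dim_translation_eq)
qed

lemma infdist_Psi:
 assumes "affine L" "L \<noteq> {}"
 shows "infdist (\<Psi> x) (\<Psi> ` L) \<le> t * infdist x L"
proof -
 obtain l where l: "l \<in> L" "infdist x L = dist x l"
  using infdist_attains_inf[OF affine_closed[OF assms(1)] assms(2)] by metis
 then have "infdist (\<Psi> x) (\<Psi> ` L) \<le> dist (\<Psi> x) (\<Psi> l)" by (intro infdist_le) simp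
 then show ?thesis using l by (simp add: dist_Psi)
qed

text \<open>Flatness is invariant under dilation once planes are dilated too, so only the factor
  \<open>w\<close> remains. It is moved to the other side before the infimum over planes is
  taken.\<close>

lemma fl_le:
 assumes s: "0 < s"
 shows "fm.fl (\<Psi> y) (t * s) \<le> ennreal w * rawfl k T y s"
proof -
 have "fm.fl (\<Psi> y) (t * s) \<le> ennreal w * (ennreal (1 / s ^ (k + 2)) * (sqdist (hausdorff_on k T) y s L))"
  if L: "affine L" "aff_dim L = int k" for L
 proof -
  let ?P = "\<Psi> ` L"
  have Lne: "L \<noteq> {}" using L by auto
  have vb: "\<Psi> -` ball (\<Psi> y) (t * s) = ball y s" using t by (simp add: vimage_ball)
  have "fm.fl (\<Psi> y) (t * s) \<le> ennreal (1 / (t * s) ^ (k + 2)) * (\<integral>\<^sup>+x\<in>ball (\<Psi> y) (t * s). ennreal ((infdist x ?P)\<^sup>2) \<partial>M)"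
   unfolding fm.fl_def using Psi_image_plane[OF L] by (intro INF_lower) simp
  also have "(\<integral>\<^sup>+x\<in>ball (\<Psi> y) (t * s). ennreal ((infdist x ?P)\<^sup>2) \<partial>M)
    = (\<integral>\<^sup>+x. ennreal (w * t ^ k) * indicator (T \<inter> A) x * (ennreal ((infdist (\<Psi> x) ?P)\<^sup>2) * indicator (ball (\<Psi> y) (t * s)) (\<Psi> x)) \<partial>\<H> k)"
   by (rule nn_integral_M) (intro borel_measurable_times_ennreal measurable_infdist2 borel_measurable_indicator, simp)
  also have "\<dots> \<le> (\<integral>\<^sup>+x. ennreal (w * t ^ k * t\<^sup>2) * (indicator T x * (ennreal ((infdist x L)\<^sup>2) * indicator (ball y s) x)) \<partial>\<H> k)"
  proof (rule nn_integral_mono)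
   fix x
   have i: "indicator (ball (\<Psi> y) (t * s)) (\<Psi> x) = (indicator (ball y s) x :: ennreal)"
    using vb by (auto simp: indicator_def vimage_def set_eq_iff)
   have "(infdist (\<Psi> x) ?P)\<^sup>2 \<le> t\<^sup>2 * (infdist x L)\<^sup>2"
    unfolding power_mult_distrib[symmetric] using infdist_Psi[OF L(1) Lne, of x] by (intro power_mono) (auto simp: infdist_nonneg)
   then have "ennreal (w * t ^ k) * ennreal ((infdist (\<Psi> x) ?P)\<^sup>2) \<le> ennreal (w * t ^ k) * ennreal (t\<^sup>2 * (infdist x L)\<^sup>2)"
    by (intro mult_left_mono ennreal_leI) auto
   also have "\<dots> = ennreal (w * t ^ k * t\<^sup>2) * ennreal ((infdist x L)\<^sup>2)" using w t by (simp add: ennreal_mult mult.assoc)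
   finally have *: "ennreal (w * t ^ k) * ennreal ((infdist (\<Psi> x) ?P)\<^sup>2) \<le> ennreal (w * t ^ k * t\<^sup>2) * ennreal ((infdist x L)\<^sup>2)" .
   show "ennreal (w * t ^ k) * indicator (T \<inter> A) x * (ennreal ((infdist (\<Psi> x) ?P)\<^sup>2) * indicator (ball (\<Psi> y) (t * s)) (\<Psi> x))
    \<le> ennreal (w * t ^ k * t\<^sup>2) * (indicator T x * (ennreal ((infdist x L)\<^sup>2) * indicator (ball y s) x))"
    unfolding i using * by (auto split: split_indicator)
  qed
  also have "\<dots> = ennreal (w * t ^ k * t\<^sup>2) * (\<integral>\<^sup>+x. indicator T x * (ennreal ((infdist x L)\<^sup>2) * indicator (ball y s) x) \<partial>\<H> k)"
   by (intro nn_integral_cmult borel_measurable_times_ennreal borel_measurable_indicator T measurable_hausdorff_measure measurable_infdist2) simp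
  also have "(\<integral>\<^sup>+x. indicator T x * (ennreal ((infdist x L)\<^sup>2) * indicator (ball y s) x) \<partial>\<H> k)
    = (sqdist (hausdorff_on k T) y s L)" (is "_ = ?I")
   by (rule nn_integral_hausdorff_on[OF _ T, symmetric]) (intro borel_measurable_times_ennreal measurable_infdist2 borel_measurable_indicator, simp)
  also have "ennreal (1 / (t * s) ^ (k + 2)) * (ennreal (w * t ^ k * t\<^sup>2) * ?I) = ennreal (1 / (t * s) ^ (k + 2) * (w * t ^ k * t\<^sup>2)) * ?I"
   using t s w by (subst ennreal_mult) (auto simp: mult.assoc)
  also have "1 / (t * s) ^ (k + 2) * (w * t ^ k * t\<^sup>2) = w * (1 / s ^ (k + 2))"
   using t s by (simp add: power_mult_distrib power_add power2_eq_square)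
  also have "ennreal (w * (1 / s ^ (k + 2))) * ?I = ennreal w * (ennreal (1 / s ^ (k + 2)) * ?I)"
   using s w by (subst ennreal_mult) (auto simp: mult.assoc)
  finally show ?thesis by (simp add: mult_left_mono)
 qed
 then have le: "fm.fl (\<Psi> y) (t * s) \<le> ennreal w * q" if "q \<in> (\<lambda>L. ennreal (1 / s ^ (k + 2)) * (sqdist (hausdorff_on k T) y s L)) ` {L. affine L \<and> aff_dim L = int k}" for q
  using that by blast
 have inv: "ennreal (1 / w) * ennreal w = 1" using w by (simp flip: ennreal_mult)
 have "ennreal (1 / w) * fm.fl (\<Psi> y) (t * s) \<le> rawfl k T y s"
  unfolding rawfl_def
 proof (rule Inf_greatest)
  fix q assume "q \<in> (\<lambda>L. ennreal (1 / s ^ (k + 2)) * (sqdist (hausdorff_on k T) y s L)) ` {L. affine L \<and> aff_dim L = int k}"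
  from mult_left_mono[OF le[OF this], of "ennreal (1 / w)"] have "ennreal (1 / w) * fm.fl (\<Psi> y) (t * s) \<le> (ennreal (1 / w) * ennreal w) * q"
   by (simp add: mult.assoc)
  then show "ennreal (1 / w) * fm.fl (\<Psi> y) (t * s) \<le> q" by (simp add: inv)
 qed
 from mult_left_mono[OF this, of "ennreal w"] show ?thesis
  by (simp add: mult.assoc[symmetric] inv[unfolded mult.commute[of "ennreal (1 / w)"]])
qed

lemma mean_flatness_lower:
 assumes c: "0 \<le> c" "ennreal c \<le> fm.fl (\<Psi> y) (t * s)" and s: "0 < s"
  and thr: "eps_const DIM('a) * s ^ k \<le> mass (ball y s)"
 shows "ennreal (c / w) \<le> mean_flatness k (hausdorff_on k T) y s"
proof -
 have "emeasure (hausdorff_on k T) (ball y s) = ennreal (mass (ball y s))"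
  using emeasure_TB by (simp add: emeasure_hausdorff_on T borel_hausdorff)
 then have mf: "mean_flatness k (hausdorff_on k T) y s = rawfl k T y s"
  using thr by (simp add: mean_flatness_def rawfl_def ennreal_leI)
 have "ennreal (1 / w) * ennreal c \<le> ennreal (1 / w) * (ennreal w * rawfl k T y s)"
  using c(2) fl_le[OF s, of y] by (intro mult_left_mono) auto
 also have "\<dots> = rawfl k T y s" using w by (simp add: mult.assoc[symmetric] flip: ennreal_mult)
 finally show ?thesis using c(1) w mf by (simp flip: ennreal_mult)
qed

text \<open>A point of \<open>X q\<close> has flatness at least \<open>c q / w\<close> at all radii
  in a range \<open>[a, 2 * a)\<close>, whose integral against \<open>ds / s\<close> is at least
  half of that. For fixed point and radius at most one \<open>q\<close> contributes. The factor 2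
  comes from this half, one \<open>w\<close> from the flatness, and \<open>w * t ^ k\<close> from
  the mass of \<open>X q\<close>.\<close>

lemma carleson:
 assumes I: "flat_int k T x0 \<rho> \<le> ennreal J"
  and J: "0 \<le> J" and A\<rho>: "A \<subseteq> ball x0 \<rho>" and K\<rho>: "fm.KK \<le> t * \<rho>"
  and eps: "2 * w * (2 * fm.KK) ^ k * eps_const DIM('a) \<le> 1"
 shows "fm.carleson (2 * w\<^sup>2 * t ^ k * J)"
 unfolding fm.carleson_def
proof (intro allI impI)
 fix F :: "(nat \<times> zv) set" and X c and lev :: "nat \<times> zv \<Rightarrow> nat"
 assume F: "finite F"
  and q: "\<forall>q\<in>F. X q \<in> sets borel \<and> 0 \<le> c q \<and> 1 \<le> lev q \<and>
    (\<forall>y\<in>X q. (1 / 2 ^ lev q) ^ k / 2 \<le> measure M (ball y (fm.KK / 2 ^ lev q)) \<and>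
      (\<forall>s. fm.KK / 2 ^ lev q \<le> s \<longrightarrow> s < 2 * fm.KK / 2 ^ lev q \<longrightarrow> ennreal (c q) \<le> fm.fl y s))"
  and disj: "\<forall>q\<in>F. \<forall>q'\<in>F. q \<noteq> q' \<longrightarrow> lev q \<noteq> lev q' \<or> X q \<inter> X q' = {}"
 have KK: "0 < fm.KK" by (simp add: fm.KK_def)
 define a where "a q = fm.KK / 2 ^ lev q / t" for q
 have a: "0 < a q" for q using KK t by (simp add: a_def)
 have Xs: "X q \<in> sets borel" and c0: "0 \<le> c q" and l1: "1 \<le> lev q" if "q \<in> F" for q using q that by blast+
 let ?mf = "mean_flatness k (hausdorff_on k T)"
 let ?inn = "\<lambda>y. (\<integral>\<^sup>+s\<in>{0<..<\<rho>}. ?mf y s / ennreal s \<partial>lborel)"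
 have point: "ennreal (c q / (2 * w * a q)) \<le> ?mf x s / ennreal s"
  if qF: "q \<in> F" and x: "x \<in> A" "\<Psi> x \<in> X q" and s: "a q \<le> s" "s < 2 * a q" for q x s
 proof -
  have s0: "0 < s" using a[of q] s by linarith
  have ts: "fm.KK / 2 ^ lev q \<le> t * s" "t * s < 2 * fm.KK / 2 ^ lev q"
   using s t by (simp_all add: a_def pos_divide_le_eq pos_less_divide_eq mult.commute)
  have d: "(1 / 2 ^ lev q) ^ k / 2 \<le> measure M (ball (\<Psi> x) (fm.KK / 2 ^ lev q))" and fl: "ennreal (c q) \<le> fm.fl (\<Psi> x) (t * s)"
   using q qF x(2) ts by blast+
  have "measure M (ball (\<Psi> x) (fm.KK / 2 ^ lev q)) = w * t ^ k * mass (A \<inter> ball x (a q))"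
   by (simp add: measure_M vimage_ball a_def)
  also have "\<dots> \<le> w * t ^ k * mass (ball x s)"
   using wt A s by (intro mult_left_mono mass_mono) auto
  finally have m: "(1 / 2 ^ lev q) ^ k / 2 \<le> w * t ^ k * mass (ball x s)" using d by linarith
  \<comment> \<open>The mass condition in \<open>carleson\<close> and the bound \<open>eps\<close>
    on the threshold ensure that \<open>mean_flatness\<close> does not take its default value
    0.\<close>
  have "eps_const DIM('a) * s ^ k \<le> mass (ball x s)"
  proof -
   have "t * s \<le> 2 * fm.KK * (1 / 2 ^ lev q)" using ts(2) by simp
   then have "(t * s) ^ k \<le> (2 * fm.KK * (1 / 2 ^ lev q)) ^ k" using t s0 by (intro power_mono) auto
   then have "(2 * w * eps_const DIM('a)) * (t * s) ^ k \<le> (2 * w * eps_const DIM('a)) * ((2 * fm.KK) ^ k * (1 / 2 ^ lev q) ^ k)"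
    unfolding power_mult_distrib[symmetric] using w by (intro mult_left_mono) (auto simp: eps_const_def)
   also have "\<dots> = (2 * w * (2 * fm.KK) ^ k * eps_const DIM('a)) * (1 / 2 ^ lev q) ^ k" by (simp only: mult_ac)
   also have "\<dots> \<le> 1 * (1 / 2 ^ lev q) ^ k" by (rule mult_right_mono[OF eps]) simp
   also have "\<dots> \<le> 2 * (w * t ^ k * mass (ball x s))" using m by simp
   finally have "(2 * w * t ^ k) * (eps_const DIM('a) * s ^ k) \<le> (2 * w * t ^ k) * mass (ball x s)"
    by (simp only: power_mult_distrib mult_ac)
   moreover have "0 < 2 * w * t ^ k" using w t by simp
   ultimately show ?thesis by (simp only: mult_le_cancel_left_pos)
  qed
  from mean_flatness_lower[OF c0[OF qF] fl s0 this]
  have "ennreal (c q / w) / ennreal s \<le> ?mf x s / ennreal s" by (rule divide_right_mono_ennreal)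
  moreover have "ennreal (c q / (2 * w * a q)) \<le> ennreal (c q / w / s)"
   unfolding divide_divide_eq_left using c0[OF qF] w s s0 a[of q]
   by (intro ennreal_leI divide_left_mono mult_pos_pos) (auto simp: mult.assoc mult.left_commute)
  moreover have "ennreal (c q / w) / ennreal s = ennreal (c q / w / s)"
   using c0[OF qF] w s0 by (intro divide_ennreal) auto
  ultimately show ?thesis using order_trans by simp
 qed
 have inner: "(\<Sum>q\<in>F. ennreal (c q / (2 * w)) * indicator (X q) (\<Psi> x)) \<le> ?inn x" if x: "x \<in> A" for x
 proof -
  let ?g = "\<lambda>q s. ennreal (c q / (2 * w * a q)) * indicator (X q) (\<Psi> x) * indicator {a q..<2 * a q} s"
  have "(\<Sum>q\<in>F. ennreal (c q / (2 * w)) * indicator (X q) (\<Psi> x)) = (\<Sum>q\<in>F. \<integral>\<^sup>+s. ?g q s \<partial>lborel)"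
  proof (rule sum.cong[OF refl])
   fix q assume "q \<in> F"
   have "(\<integral>\<^sup>+s. ?g q s \<partial>lborel) = ennreal (c q / (2 * w * a q)) * indicator (X q) (\<Psi> x) * ennreal (2 * a q - a q)"
    using a[of q] by (subst nn_integral_cmult_indicator) auto
   also have "\<dots> = ennreal (c q / (2 * w * a q)) * ennreal (a q) * indicator (X q) (\<Psi> x)"
    by (simp add: mult_ac)
   also have "ennreal (c q / (2 * w * a q)) * ennreal (a q) = ennreal (c q / (2 * w))"
    using a[of q] c0[OF \<open>q \<in> F\<close>] w by (simp flip: ennreal_mult)
   finally show "ennreal (c q / (2 * w)) * indicator (X q) (\<Psi> x) = (\<integral>\<^sup>+s. ?g q s \<partial>lborel)" by simp
  qed
  also have "\<dots> = (\<integral>\<^sup>+s. (\<Sum>q\<in>F. ?g q s) \<partial>lborel)"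
   by (rule nn_integral_sum[symmetric]) measurable
  also have "\<dots> \<le> ?inn x"
  proof (rule nn_integral_mono)
   fix s :: real
   show "(\<Sum>q\<in>F. ?g q s) \<le> ?mf x s / ennreal s * indicator {0<..<\<rho>} s"
   proof (cases "\<exists>q0\<in>F. \<Psi> x \<in> X q0 \<and> s \<in> {a q0..<2 * a q0}")
    case False
    then have "?g q s = 0" if "q \<in> F" for q using that by (auto simp: indicator_def)
    then have "(\<Sum>q\<in>F. ?g q s) = 0" by (intro sum.neutral) blast
    then show ?thesis by (simp only: zero_le)
   next
    case True
    then obtain q0 where q0: "q0 \<in> F" "\<Psi> x \<in> X q0" "a q0 \<le> s" "s < 2 * a q0" by auto
    \<comment> \<open>Ranges of radii belonging to different levels do not overlap.\<close>
    have ge: "2 * a q' \<le> a q" if "lev q < lev q'" for q q'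
    proof -
     have "(2::real) ^ Suc (lev q) \<le> 2 ^ lev q'" using that by (intro power_increasing) auto
     then have "fm.KK / 2 ^ lev q' \<le> fm.KK / 2 ^ Suc (lev q)" using KK by (intro divide_left_mono) auto
     then have "fm.KK / 2 ^ lev q' / t \<le> fm.KK / 2 ^ Suc (lev q) / t" using t by (intro divide_right_mono) auto
     then show ?thesis by (simp add: a_def)
    qed
    have z: "?g q s = 0" if "q \<in> F - {q0}" for q
    proof (rule ccontr)
     assume "?g q s \<noteq> 0"
     then have qq: "\<Psi> x \<in> X q" "a q \<le> s" "s < 2 * a q" by (auto simp: indicator_def split: if_splits)
     have "lev q = lev q0"
     proof (rule ccontr)
      assume "lev q \<noteq> lev q0"
      then consider "lev q < lev q0" | "lev q0 < lev q" by linarith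
      then show False using ge[of q q0] ge[of q0 q] qq q0 by cases linarith+
     qed
     then show False using disj that q0(1,2) qq(1) by blast
    qed
    have "(\<Sum>q\<in>F. ?g q s) = ?g q0 s + (\<Sum>q\<in>F - {q0}. ?g q s)" by (rule sum.remove[OF F q0(1)])
    also have "(\<Sum>q\<in>F - {q0}. ?g q s) = 0" by (rule sum.neutral) (use z in blast)
    also have "?g q0 s + 0 = ?g q0 s" by (rule add_0_right)
    also have "\<dots> = ennreal (c q0 / (2 * w * a q0))" using q0 by simp
    also have "\<dots> \<le> ?mf x s / ennreal s" by (rule point[OF q0(1) x q0(2-4)])
    also have "\<dots> = ?mf x s / ennreal s * indicator {0<..<\<rho>} s"
    proof -
     \<comment> \<open>Levels start at 1, so the radii stay below \<open>KK / t\<close>, which is at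
       most \<open>\<rho>\<close>.\<close>
     have "(2::real) ^ 1 \<le> 2 ^ lev q0" using l1[OF q0(1)] by (intro power_increasing) auto
     then have "2 * fm.KK / 2 ^ lev q0 \<le> 2 * fm.KK / 2" using KK by (intro divide_left_mono) auto
     then have "2 * fm.KK / 2 ^ lev q0 / t \<le> fm.KK / t" using t by (intro divide_right_mono) auto
     then have "2 * a q0 \<le> fm.KK / t" by (simp add: a_def)
     also have "\<dots> \<le> \<rho>" using K\<rho> t by (simp add: pos_divide_le_eq mult.commute)
     finally have "s < \<rho>" using q0 by linarith
     moreover have "0 < s" using a[of q0] q0 by linarith
     ultimately show ?thesis by simp
    qed
    finally show ?thesis .
   qed
  qed
  finally show ?thesis .
 qed
 let ?E = "\<lambda>q. A \<inter> \<Psi> -` X q"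
 have Es: "?E q \<in> sets borel" if "q \<in> F" for q using A vimage_Psi[OF Xs[OF that]] by (rule sets.Int)
 have "ennreal (\<Sum>q\<in>F. c q / (2 * w) * mass (?E q)) = (\<Sum>q\<in>F. ennreal (c q / (2 * w)) * emeasure (\<H> k) (T \<inter> ?E q))"
 proof (subst sum_ennreal[symmetric])
  show "0 \<le> c q / (2 * w) * mass (?E q)" if "q \<in> F" for q using c0[OF that] w by simp
  show "(\<Sum>q\<in>F. ennreal (c q / (2 * w) * mass (?E q))) = (\<Sum>q\<in>F. ennreal (c q / (2 * w)) * emeasure (\<H> k) (T \<inter> ?E q))"
  proof (rule sum.cong[OF refl])
   fix q assume qF: "q \<in> F"
   show "ennreal (c q / (2 * w) * mass (?E q)) = ennreal (c q / (2 * w)) * emeasure (\<H> k) (T \<inter> ?E q)"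
    unfolding emeasure_TB using c0[OF qF] w by (intro ennreal_mult) auto
  qed
 qed
 also have "\<dots> = (\<Sum>q\<in>F. \<integral>\<^sup>+x. ennreal (c q / (2 * w)) * indicator (T \<inter> ?E q) x \<partial>\<H> k)"
  by (intro sum.cong refl nn_integral_cmult_indicator[symmetric] TB Es)
 also have "\<dots> = (\<integral>\<^sup>+x. (\<Sum>q\<in>F. ennreal (c q / (2 * w)) * indicator (T \<inter> ?E q) x) \<partial>\<H> k)"
  by (intro nn_integral_sum[symmetric] borel_measurable_times_ennreal borel_measurable_const borel_measurable_indicator TB Es)
 also have "\<dots> \<le> (\<integral>\<^sup>+x\<in>T \<inter> ball x0 \<rho>. ?inn x \<partial>\<H> k)"
 proof (rule nn_integral_mono)
  fix x
  show "(\<Sum>q\<in>F. ennreal (c q / (2 * w)) * indicator (T \<inter> ?E q) x) \<le> ?inn x * indicator (T \<inter> ball x0 \<rho>) x"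
  proof (cases "x \<in> T \<inter> A")
   case True
   then have "(\<Sum>q\<in>F. ennreal (c q / (2 * w)) * indicator (T \<inter> ?E q) x) = (\<Sum>q\<in>F. ennreal (c q / (2 * w)) * indicator (X q) (\<Psi> x))"
    by (intro sum.cong) (auto split: split_indicator)
   also have "\<dots> \<le> ?inn x" using True by (intro inner) blast
   also have "\<dots> = ?inn x * indicator (T \<inter> ball x0 \<rho>) x" using True A\<rho> by (simp add: indicator_def subset_iff)
   finally show ?thesis .
  qed auto
 qed
 also have "\<dots> \<le> ennreal J" by (rule I)
 finally have "(\<Sum>q\<in>F. c q / (2 * w) * mass (?E q)) \<le> J" using J by (simp add: ennreal_le_iff)
 then have "(2 * w\<^sup>2 * t ^ k) * (\<Sum>q\<in>F. c q / (2 * w) * mass (?E q)) \<le> (2 * w\<^sup>2 * t ^ k) * J"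
  using w t by (intro mult_left_mono) auto
 moreover have "(2 * w\<^sup>2 * t ^ k) * (\<Sum>q\<in>F. c q / (2 * w) * mass (?E q)) = (\<Sum>q\<in>F. c q * measure M (X q))"
  unfolding sum_distrib_left
 proof (rule sum.cong[OF refl])
  fix q assume "q \<in> F"
  have "2 * w\<^sup>2 * t ^ k * (c q / (2 * w) * mass (?E q)) = c q * (w * t ^ k * mass (?E q))"
   using w by (simp add: power2_eq_square)
  then show "2 * w\<^sup>2 * t ^ k * (c q / (2 * w) * mass (?E q)) = c q * measure M (X q)"
   using measure_M[OF Xs[OF \<open>q \<in> F\<close>]] by simp
 qed
 ultimately show "(\<Sum>q\<in>F. c q * measure M (X q)) \<le> 2 * w\<^sup>2 * t ^ k * J" by simp
qed

end

subsection \<open>Density bound and rectifiability\<close>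

text \<open>\<open>m\<close> is the supremum of the density ratios. It is finite because
  \<open>u\<close> controls small radii and the total mass controls large ones. If a nearly optimal
  ball is larger than \<open>ball x r\<close>, the latter does better, since it contains all of
  \<open>T\<close>.\<close>

lemma near_maximal_ball:
 fixes T :: "'a::euclidean_space set"
 assumes k: "1 \<le> k" and T: "T \<in> sets (\<H> k)" "emeasure (\<H> k) T < \<infinity>" "0 < emeasure (\<H> k) T"
  and Tr: "T \<subseteq> ball x r" "0 < r" and u: "0 < r0" "\<And>y s. 0 < s \<Longrightarrow> s \<le> r0 \<Longrightarrow> hmass k T (ball y s) \<le> u * (unit_ball_vol (real k) * s ^ k)"
  and \<eta>: "0 < \<eta>" "\<eta> < 1"
 shows "\<exists>m x0 R. 1 \<le> 4 ^ k * m \<and> measure (\<H> k) T \<le> m * (unit_ball_vol (real k) * r ^ k) \<and>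
  (\<forall>y s. 0 < s \<longrightarrow> hmass k T (ball y s) \<le> m * (unit_ball_vol (real k) * s ^ k)) \<and>
  0 < R \<and> R \<le> r \<and> (1 - \<eta>) * m * (unit_ball_vol (real k) * R ^ k) \<le> hmass k T (ball x0 R)"
proof -
 let ?\<omega> = "unit_ball_vol (real k)" let ?N = "measure (\<H> k) T"
 have \<omega>: "0 < ?\<omega>" by simp
 define d where "d p = hmass k T (ball (fst p) (snd p)) / (?\<omega> * snd p ^ k)" for p :: "'a \<times> real"
 define P :: "('a \<times> real) set" where "P = UNIV \<times> {0<..}"
 define m where "m = (SUP p\<in>P. d p)"
 have NU: "hmass k T B \<le> ?N" for B using hmass_mono[OF T(1,2), of B UNIV] by simp
 have bdd: "bdd_above (d ` P)"
 proof (rule bdd_aboveI2)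
  fix p assume "p \<in> P"
  then have p: "0 < snd p" by (auto simp: P_def)
  show "d p \<le> max u (?N / (?\<omega> * r0 ^ k))"
  proof (cases "snd p \<le> r0")
   case True
   then have "d p \<le> u" using u(2)[OF p] p \<omega> by (simp add: d_def pos_divide_le_eq)
   then show ?thesis by simp
  next
   case False
   then have "d p \<le> ?N / (?\<omega> * r0 ^ k)"
    unfolding d_def using NU u(1) \<omega> by (intro frac_le mult_left_mono power_mono) auto
   then show ?thesis by simp
  qed
 qed
 have ub: "hmass k T (ball y s) \<le> m * (?\<omega> * s ^ k)" if s: "0 < s" for y s
 proof -
  have "d (y, s) \<le> m" unfolding m_def using s by (intro cSUP_upper bdd) (simp add: P_def)
  then show ?thesis using s \<omega> by (simp add: d_def pos_divide_le_eq)
 qed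
 have TB: "T \<inter> ball x r = T" using Tr by blast
 then have Nm: "?N \<le> m * (?\<omega> * r ^ k)" using ub[OF Tr(2), of x] by simp
 have m0: "0 \<le> m"
 proof -
  have "0 \<le> m * (?\<omega> * r ^ k)" using Nm measure_nonneg order_trans by blast
  moreover have "0 < ?\<omega> * r ^ k" using Tr(2) \<omega> by (intro mult_pos_pos) auto
  ultimately show ?thesis using mult_neg_pos[of m "?\<omega> * r ^ k"] by linarith
 qed
 have "1 \<le> 4 ^ k * m"
 proof (rule lower_density[OF k m0])
  show "hausdorff_outer k (T \<inter> ball y s) \<le> ennreal (m * (?\<omega> * s ^ k))" if "0 < s" for y s
  proof -
   have "T \<inter> ball y s \<in> sets (\<H> k)" by (intro sets.Int[OF T(1)] borel_hausdorff) auto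
   then have "hausdorff_outer k (T \<inter> ball y s) = ennreal (hmass k T (ball y s))"
    using emeasure_hmass[OF T(1,2), of "ball y s"] emeasure_hausdorff_measure by metis
   then show ?thesis using ub[OF that] by (simp add: ennreal_leI)
  qed
 qed (use T in \<open>simp_all add: emeasure_hausdorff_measure\<close>)
 moreover from this have mp: "0 < m" using m0 by (cases "m = 0") auto
 moreover have "\<exists>x0 R. 0 < R \<and> R \<le> r \<and> (1 - \<eta>) * m * (?\<omega> * R ^ k) \<le> hmass k T (ball x0 R)"
 proof -
  have "(1 - \<eta>) * m < m" using mp \<eta> by simp
  then have "\<exists>p\<in>P. (1 - \<eta>) * m < d p"
   unfolding m_def using less_cSUP_iff[OF _ bdd] by (auto simp: P_def)
  then obtain x0 R where R: "0 < R" "(1 - \<eta>) * m < hmass k T (ball x0 R) / (?\<omega> * R ^ k)" by (auto simp: P_def d_def)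
  then have le: "(1 - \<eta>) * m * (?\<omega> * R ^ k) \<le> hmass k T (ball x0 R)" using \<omega> by (simp add: pos_less_divide_eq)
  show ?thesis
  proof (cases "R \<le> r")
   case False
   have "(1 - \<eta>) * m * (?\<omega> * r ^ k) \<le> (1 - \<eta>) * m * (?\<omega> * R ^ k)"
    using False Tr(2) \<eta> m0 \<omega> by (intro mult_left_mono power_mono) auto
   also have "\<dots> \<le> ?N" using le NU order_trans by blast
   finally show ?thesis using Tr(2) TB by (intro exI[of _ x] exI[of _ r]) simp
  qed (use R le in blast)
 qed
 ultimately show ?thesis using ub Nm by blast
qed

text \<open>For small \<open>R\<close> the doubled ball stays inside the ball of radius 2. Otherwise
  that whole ball is used, and \<open>2 \<le> 6 * R\<close>; hence the factor \<open>6 ^ k\<close>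
  in both cases.\<close>

lemma total_flatness:
 fixes T :: "'a::euclidean_space set"
 assumes T: "tame k \<delta> T" "emeasure (\<H> k) T < \<infinity>" "T \<subseteq> ball 0 1"
  and R: "0 < R" "R \<le> 1" and pos: "0 < hmass k T (ball x0 R)" and eps: "eps_const DIM('a) * (6 ^ k * R ^ k) \<le> hmass k T (ball x0 R)"
 shows "flat_int k T x0 (2 * R)
   \<le> ennreal (6 ^ k * \<delta>\<^sup>2 * R ^ k)"
proof -
 have Ts: "T \<in> sets (\<H> k)" using T(1) by (simp add: tame_def)
 have eps0: "0 \<le> eps_const DIM('a)" by (simp add: eps_const_def)
 have tame: "flat_int k T x r
   \<le> ennreal (6 ^ k * \<delta>\<^sup>2 * R ^ k)"
  if r: "0 < r" "ball x r \<subseteq> ball 0 2" "hmass k T (ball x0 R) \<le> hmass k T (ball x r)" "r \<le> 6 * R" for x r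
 proof -
  have rk: "r ^ k \<le> 6 ^ k * R ^ k" unfolding power_mult_distrib[symmetric] using r(1,4) by (intro power_mono) auto
  then have "eps_const DIM('a) * r ^ k \<le> eps_const DIM('a) * (6 ^ k * R ^ k)" using eps0 by (rule mult_left_mono)
  then have "ennreal (eps_const DIM('a) * r ^ k) \<le> emeasure (\<H> k) (T \<inter> ball x r)"
   unfolding emeasure_hmass[OF Ts T(2)] using eps r by (intro ennreal_leI) linarith
  then have "flat_int k T x r
   < ennreal (\<delta>\<^sup>2 * r ^ k)" by (rule T(1)[unfolded tame_def, THEN conjunct2, THEN conjunct2, rule_format, OF r(1,2)])
  also have "\<dots> \<le> ennreal (6 ^ k * \<delta>\<^sup>2 * R ^ k)"
   using mult_left_mono[OF rk, of "\<delta>\<^sup>2"] by (intro ennreal_leI) (simp add: mult_ac)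
  finally show ?thesis by (rule less_imp_le)
 qed
 show ?thesis
 proof (cases "R \<le> 1 / 3")
  case True
  have "T \<inter> ball x0 R \<noteq> {}" using pos by auto
  then obtain z where z: "z \<in> T" "z \<in> ball x0 R" by blast
  then have "norm z < 1" "norm (x0 - z) < R" using T(3) by (auto simp: dist_norm)
  then have "norm x0 < 1 + R" using norm_triangle_sub[of x0 z] by linarith
  then have "ball x0 (2 * R) \<subseteq> ball 0 2" using True R by (simp add: ball_subset_ball_iff dist_norm)
  then show ?thesis using R by (intro tame hmass_mono[OF Ts T(2)]) auto
 next
  case False
  have "flat_int k T x0 (2 * R)
   \<le> flat_int k T 0 2"
   using R T(3) by (intro nn_integral_mono mult_mono) (auto simp: indicator_def)
  also have "\<dots> \<le> ennreal (6 ^ k * \<delta>\<^sup>2 * R ^ k)"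
  proof (rule tame)
   have "T \<inter> ball x0 R \<subseteq> T \<inter> ball 0 2" using T(3) by auto
   then have "hmass k T (T \<inter> ball x0 R) \<le> hmass k T (ball 0 2)" by (intro hmass_mono[OF Ts T(2)]) auto
   then show "hmass k T (ball x0 R) \<le> hmass k T (ball 0 2)" by (simp add: Int_assoc[symmetric])
  qed (use False in auto)
  finally show ?thesis .
 qed
qed

text \<open>Parallelogram law: points of the ball at distance almost \<open>2 * R\<close> from
  \<open>y\<close> lie close to the reflection of \<open>y\<close> in the centre.\<close>

lemma cap_subset_ball:
 fixes x0 y :: "'a::real_inner"
 assumes R: "0 < R" and \<gamma>: "0 \<le> \<eta>" "\<eta> \<le> 1" and y: "y \<in> ball x0 R" and s: "(2 - \<eta>\<^sup>2 / 4) * R \<le> s"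
 shows "ball x0 R - ball y s \<subseteq> ball (2 *\<^sub>R x0 - y) (\<eta> * R)"
proof
 fix z assume z: "z \<in> ball x0 R - ball y s"
 define a b where "a = z - x0" and "b = y - x0"
 have "norm a < R" "norm b < R" using z y by (auto simp: a_def b_def dist_norm norm_minus_commute)
 then have ab: "(norm a)\<^sup>2 < R\<^sup>2" "(norm b)\<^sup>2 < R\<^sup>2" by (auto intro!: power_strict_mono)
 have g: "0 \<le> \<eta>\<^sup>2 / 4" "\<eta>\<^sup>2 / 4 \<le> 1" using power_mono[OF \<gamma>(2,1), of 2] by auto
 have "s \<le> norm (a - b)" using z by (auto simp: a_def b_def dist_norm norm_minus_commute)
 then have "((2 - \<eta>\<^sup>2 / 4) * R)\<^sup>2 \<le> (norm (a - b))\<^sup>2" using s g R by (intro power_mono) auto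
 moreover have "(4 - \<eta>\<^sup>2) * R\<^sup>2 \<le> ((2 - \<eta>\<^sup>2 / 4) * R)\<^sup>2"
 proof -
  have "(2 - \<eta>\<^sup>2 / 4)\<^sup>2 = 4 - \<eta>\<^sup>2 + (\<eta>\<^sup>2 / 4)\<^sup>2" by (simp add: power2_eq_square algebra_simps)
  then show ?thesis unfolding power_mult_distrib by (intro mult_right_mono) simp_all
 qed
 moreover have "(norm (a + b))\<^sup>2 = 2 * (norm a)\<^sup>2 + 2 * (norm b)\<^sup>2 - (norm (a - b))\<^sup>2"
  by (simp add: power2_norm_eq_inner inner_add_left inner_add_right inner_diff_left inner_diff_right inner_commute)
 moreover have "(4 - \<eta>\<^sup>2) * R\<^sup>2 = 4 * R\<^sup>2 - (\<eta> * R)\<^sup>2" by (simp add: power_mult_distrib algebra_simps)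
 ultimately have "(norm (a + b))\<^sup>2 < (\<eta> * R)\<^sup>2" using ab by linarith
 then have "norm (a + b) < \<eta> * R" by (rule power2_less_imp_less) (use \<gamma> R in simp)
 moreover have "a + b = - ((2 *\<^sub>R x0 - y) - z)" by (simp add: a_def b_def scaleR_2)
 ultimately show "z \<in> ball (2 *\<^sub>R x0 - y) (\<eta> * R)" by (simp only: mem_ball dist_norm norm_minus_cancel)
qed

text \<open>If all points of \<open>T\<close> in the ball were less flat than \<open>\<beta>\<close>
  at all radii just below \<open>2 * R\<close>, the flatness integral would exceed \<open>I\<close>.
  As such radii may miss a cap of the ball, its mass is discounted by the density bound; this is the
  second \<open>\<eta>\<close> in \<open>1 - 2 * \<eta>\<close>.\<close>

lemma exists_flat_plane:
 fixes T :: "'a::euclidean_space set"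
 assumes k: "1 \<le> k" and T: "T \<in> sets (\<H> k)" "emeasure (\<H> k) T < \<infinity>"
  and m: "0 < m" "\<And>y s. 0 < s \<Longrightarrow> hmass k T (ball y s) \<le> m * (unit_ball_vol (real k) * s ^ k)"
  and R: "0 < R" "(1 - \<eta>) * m * (unit_ball_vol (real k) * R ^ k) \<le> hmass k T (ball x0 R)" and \<eta>: "0 < \<eta>" "\<eta> \<le> 1 / 4"
  and I: "flat_int k T x0 (2 * R) \<le> ennreal I"
  and \<beta>: "0 < \<beta>" "0 \<le> I" "I < \<beta> * (\<eta>\<^sup>2 / 8) * hmass k T (ball x0 R)"
  and eps: "eps_const DIM('a) * (2 * R) ^ k \<le> (1 - 2 * \<eta>) * m * (unit_ball_vol (real k) * R ^ k)"
 shows "\<exists>y s L. y \<in> ball x0 R \<and> 0 < s \<and> s < 2 * R \<and> affine L \<and> aff_dim L = int k \<and>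
  (sqdist (hausdorff_on k T) y s L) \<le> ennreal (2 * \<beta> * (2 * R) ^ (k + 2)) \<and>
  (1 - 2 * \<eta>) * m * (unit_ball_vol (real k) * R ^ k) \<le> hmass k T (ball x0 R \<inter> ball y s)"
proof -
 let ?\<omega> = "unit_ball_vol (real k)" let ?mf = "mean_flatness k (hausdorff_on k T)"
 define \<gamma> where "\<gamma> = \<eta>\<^sup>2 / 4"
 have \<gamma>: "0 < \<gamma>" "\<gamma> \<le> 1" using \<eta> power_mono[of \<eta> 1 2] by (auto simp: \<gamma>_def)
 have \<gamma>R: "0 < (2 - \<gamma>) * R" "(2 - \<gamma>) * R < 2 * R" using \<gamma> R by auto
 have "\<exists>y\<in>T \<inter> ball x0 R. \<exists>s\<in>{(2 - \<gamma>) * R..<2 * R}. ?mf y s \<le> ennreal \<beta>"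
 proof (rule ccontr)
  assume "\<not> ?thesis"
  then have big: "ennreal \<beta> \<le> ?mf y s" if "y \<in> T \<inter> ball x0 R" "s \<in> {(2 - \<gamma>) * R..<2 * R}" for y s
   using that by (meson linear)
  have inn: "ennreal (\<beta> * \<gamma> / 2) \<le> (\<integral>\<^sup>+s\<in>{0<..<2 * R}. ?mf y s / ennreal s \<partial>lborel)" if y: "y \<in> T \<inter> ball x0 R" for y
  proof -
   have "ennreal (\<beta> * \<gamma> / 2) = ennreal (\<beta> / (2 * R)) * ennreal (2 * R - (2 - \<gamma>) * R)"
    using \<beta> R \<gamma>R by (subst ennreal_mult[symmetric]) (auto simp: field_simps)
   also have "\<dots> = (\<integral>\<^sup>+s. ennreal (\<beta> / (2 * R)) * indicator {(2 - \<gamma>) * R..<2 * R} s \<partial>lborel)"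
    using \<gamma>R(2) emeasure_lborel_Ico[OF less_imp_le] by (subst nn_integral_cmult_indicator) simp_all
   also have "\<dots> \<le> (\<integral>\<^sup>+s\<in>{0<..<2 * R}. ?mf y s / ennreal s \<partial>lborel)"
   proof (rule nn_integral_mono)
    fix s :: real
    show "ennreal (\<beta> / (2 * R)) * indicator {(2 - \<gamma>) * R..<2 * R} s \<le> ?mf y s / ennreal s * indicator {0<..<2 * R} s"
    proof (cases "s \<in> {(2 - \<gamma>) * R..<2 * R}")
     case True
     then have s: "0 < s" "s < 2 * R" using \<gamma>R by auto
     have "ennreal (\<beta> / (2 * R)) \<le> ennreal (\<beta> / s)" using s \<beta> by (intro ennreal_leI divide_left_mono) auto
     also have "\<dots> = ennreal \<beta> / ennreal s" using s \<beta> by (intro divide_ennreal[symmetric]) auto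
     also have "\<dots> \<le> ?mf y s / ennreal s" by (rule divide_right_mono_ennreal[OF big[OF y True]])
     finally show ?thesis using True s by simp
    qed simp
   qed
   finally show ?thesis .
  qed
  have TB: "T \<inter> ball x0 R \<in> sets (\<H> k)" by (intro sets.Int[OF T(1)] borel_hausdorff) auto
  have "ennreal (\<beta> * \<gamma> / 2 * hmass k T (ball x0 R)) = ennreal (\<beta> * \<gamma> / 2) * emeasure (\<H> k) (T \<inter> ball x0 R)"
   unfolding emeasure_hmass[OF T] using \<beta> \<gamma> by (intro ennreal_mult) auto
  also have "\<dots> = (\<integral>\<^sup>+y. ennreal (\<beta> * \<gamma> / 2) * indicator (T \<inter> ball x0 R) y \<partial>\<H> k)"
   by (rule nn_integral_cmult_indicator[OF TB, symmetric])
  also have "\<dots> \<le> (\<integral>\<^sup>+y\<in>T \<inter> ball x0 (2 * R). (\<integral>\<^sup>+s\<in>{0<..<2 * R}. ?mf y s / ennreal s \<partial>lborel) \<partial>\<H> k)"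
  proof (rule nn_integral_mono)
   fix y
   show "ennreal (\<beta> * \<gamma> / 2) * indicator (T \<inter> ball x0 R) y \<le> (\<integral>\<^sup>+s\<in>{0<..<2 * R}. ?mf y s / ennreal s \<partial>lborel) * indicator (T \<inter> ball x0 (2 * R)) y"
   proof (cases "y \<in> T \<inter> ball x0 R")
    case True
    then have "y \<in> T \<inter> ball x0 (2 * R)" using R by auto
    then show ?thesis using True inn[OF True] by simp
   qed simp
  qed
  also note I
  finally have "\<beta> * \<gamma> / 2 * hmass k T (ball x0 R) \<le> I"
   using \<beta>(2) by (simp only: ennreal_le_iff)
  then show False using \<beta>(3) by (simp add: \<gamma>_def)
 qed
 then obtain y s where ys: "y \<in> ball x0 R" "(2 - \<gamma>) * R \<le> s" "s < 2 * R" "?mf y s \<le> ennreal \<beta>" by auto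
 have s: "0 < s" using ys \<gamma>R by linarith
 let ?B = "ball x0 R \<inter> ball y s" let ?C = "ball (2 *\<^sub>R x0 - y) (\<eta> * R)"
 have cap: "ball x0 R \<subseteq> ?B \<union> ?C"
  using cap_subset_ball[of R \<eta> y x0 s] R \<eta> ys by (auto simp: \<gamma>_def)
 have B: "(1 - 2 * \<eta>) * m * (?\<omega> * R ^ k) \<le> hmass k T ?B"
 proof -
  have "hmass k T (ball x0 R) \<le> hmass k T (?B \<union> ?C)" by (rule hmass_mono[OF T cap]) auto
  also have "\<dots> \<le> hmass k T ?B + hmass k T ?C" by (rule hmass_Un_le[OF T(1)]) auto
  also have "hmass k T ?C \<le> m * (?\<omega> * (\<eta> * R) ^ k)" using \<eta> R by (intro m) auto
  also have "\<dots> \<le> m * (?\<omega> * (\<eta> * R ^ k))"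
  proof -
   have "\<eta> ^ k \<le> \<eta> ^ 1" using k \<eta> by (intro power_decreasing) auto
   then show ?thesis using m(1) R by (auto simp: power_mult_distrib intro!: mult_left_mono mult_right_mono)
  qed
  also have "m * (?\<omega> * (\<eta> * R ^ k)) = \<eta> * m * (?\<omega> * R ^ k)" by (simp add: mult_ac)
  finally show ?thesis using R(2) by (simp add: algebra_simps)
 qed
 have thr: "eps_const DIM('a) * s ^ k \<le> hmass k T (ball y s)"
 proof -
  have "eps_const DIM('a) * s ^ k \<le> eps_const DIM('a) * (2 * R) ^ k"
   using ys s by (intro mult_left_mono power_mono) (auto simp: eps_const_def)
  also note eps
  also note B
  also have "hmass k T ?B \<le> hmass k T (ball y s)" by (rule hmass_mono[OF T]) auto
  finally show ?thesis .
 qed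
 have em: "emeasure (hausdorff_on k T) (ball y s) = ennreal (hmass k T (ball y s))"
  using emeasure_hmass[OF T] by (simp add: emeasure_hausdorff_on T borel_hausdorff)
 have "rawfl k T y s \<le> ennreal \<beta>" using ys(4) thr by (simp add: mean_flatness_def rawfl_def em ennreal_leI)
 also have "\<dots> < ennreal (2 * \<beta>)" using \<beta> by (intro ennreal_lessI) auto
 finally obtain L where L: "affine L" "aff_dim L = int k"
  and Lb: "ennreal (1 / s ^ (k + 2)) * (sqdist (hausdorff_on k T) y s L) < ennreal (2 * \<beta>)"
  unfolding rawfl_def INF_less_iff by blast
 have "sqdist (hausdorff_on k T) y s L \<le> ennreal (2 * \<beta> * (2 * R) ^ (k + 2))" (is "?J \<le> _")
 proof -
  have "?J = ennreal (s ^ (k + 2)) * (ennreal (1 / s ^ (k + 2)) * ?J)"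
  proof -
   have "ennreal S * ennreal (1 / S) = 1" if "0 < S" for S using that by (simp flip: ennreal_mult)
   from this[OF zero_less_power[OF s, of "k + 2"]] show ?thesis by (simp only: mult.assoc[symmetric] mult_1)
  qed
  also have "\<dots> \<le> ennreal (s ^ (k + 2)) * ennreal (2 * \<beta>)" by (rule mult_left_mono[OF less_imp_le[OF Lb]]) simp
  also have "\<dots> = ennreal (2 * \<beta> * s ^ (k + 2))" using s \<beta> by (simp add: ennreal_mult[symmetric] mult.commute del: power_Suc)
  also have "\<dots> \<le> ennreal (2 * \<beta> * (2 * R) ^ (k + 2))"
   using s ys \<beta> by (intro ennreal_leI mult_left_mono power_mono) auto
  finally show ?thesis .
 qed
 then show ?thesis using ys s L B by blast
qed

lemma (in fmeas) carleson_mono: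
 assumes "carleson a" "a \<le> b"
 shows "carleson b"
 unfolding carleson_def
proof (rule allI, rule allI, rule allI, rule allI, rule impI, rule impI, rule impI)
 fix F :: "(nat \<times> zv) set" and X c and lev :: "nat \<times> zv \<Rightarrow> nat"
 assume h: "finite F" "\<forall>q\<in>F. X q \<in> sets borel \<and> 0 \<le> c q \<and> 1 \<le> lev q \<and>
    (\<forall>y\<in>X q. (1 / 2 ^ lev q) ^ k / 2 \<le> measure M (ball y (KK / 2 ^ lev q)) \<and>
      (\<forall>s. KK / 2 ^ lev q \<le> s \<longrightarrow> s < 2 * KK / 2 ^ lev q \<longrightarrow> ennreal (c q) \<le> fl y s))"
  "\<forall>q\<in>F. \<forall>q'\<in>F. q \<noteq> q' \<longrightarrow> lev q \<noteq> lev q' \<or> X q \<inter> X q' = {}"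
 have "(\<Sum>q\<in>F. c q * measure M (X q)) \<le> a"
  by (rule assms(1)[unfolded carleson_def, THEN spec, of F, THEN spec, of X, THEN spec, of c, THEN spec, of lev, THEN mp, OF h(1), THEN mp, OF h(2), THEN mp, OF h(3)])
 then show "(\<Sum>q\<in>F. c q * measure M (X q)) \<le> b" using assms(2) by (rule order_trans)
qed

section \<open>The rescaled measure in the normalised situation\<close>

context rescaling
begin

lemma hor_Psi: "hor (\<Psi> x) - hor (\<Psi> y) = t *\<^sub>R (hor x - hor y)"
proof -
 have "hor (\<Psi> x - \<Psi> y) = hor (t *\<^sub>R (x - y))" by (simp add: \<Psi>_def algebra_simps)
 then show ?thesis by (simp add: hor_diff linear_cmul[OF linear_hor])
qed

lemma ver_Psi: "ver (\<Psi> x) - ver (\<Psi> y) = t *\<^sub>R (ver x - ver y)"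
proof -
 have "ver (\<Psi> x - \<Psi> y) = ver (t *\<^sub>R (x - y))" by (simp add: \<Psi>_def algebra_simps)
 then show ?thesis by (simp add: ver_diff linear_cmul[OF linear_ver])
qed

lemma measure_M_ball_le:
 assumes ub: "\<And>y. hmass k T (ball y (r / t)) \<le> c * (unit_ball_vol (real k) * (r / t) ^ k)"
 shows "measure M (ball z r) \<le> c * w * unit_ball_vol (real k) * r ^ k"
proof -
 have "measure M (ball z r) = w * t ^ k * mass (A \<inter> ball (v + (1 / t) *\<^sub>R z) (r / t))"
  using vimage_ball[of "v + (1 / t) *\<^sub>R z" r] by (simp add: measure_M Psi_surj)
 also have "\<dots> \<le> w * t ^ k * mass (ball (v + (1 / t) *\<^sub>R z) (r / t))"
  using wt A by (intro mult_left_mono mass_mono) auto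
 also have "\<dots> \<le> w * t ^ k * (c * (unit_ball_vol (real k) * (r / t) ^ k))"
  using wt ub by (intro mult_left_mono) auto
 also have "\<dots> = c * w * unit_ball_vol (real k) * r ^ k"
  using t by (simp add: power_divide)
 finally show ?thesis .
qed

lemma graph_pullback:
 assumes G: "G \<in> sets borel" "0 < measure M G"
  and lip: "\<And>x y. x \<in> G \<Longrightarrow> y \<in> G \<Longrightarrow> norm (ver x - ver y) \<le> C * norm (hor x - hor y)" and C: "0 \<le> C"
 shows "\<exists>G'\<in>sets borel. 0 < hmass k T G' \<and> lip_image k G'"
proof (intro bexI conjI)
 let ?G = "A \<inter> \<Psi> -` G"
 show "?G \<in> sets borel" using A vimage_Psi[OF G(1)] by (rule sets.Int)
 show "0 < hmass k T ?G" using G(2) wt unfolding measure_M[OF G(1)] by (simp add: zero_less_mult_iff)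
 have C1: "0 \<le> 1 + C" using C by simp
 show "lip_image k ?G"
 proof (rule graph_subset_lipschitz_image[OF C1])
  fix x y assume "x \<in> ?G" "y \<in> ?G"
  then have "norm (ver (\<Psi> x) - ver (\<Psi> y)) \<le> C * norm (hor (\<Psi> x) - hor (\<Psi> y))" using lip by blast
  then have "t * norm (ver x - ver y) \<le> t * (C * norm (hor x - hor y))"
   unfolding hor_Psi ver_Psi norm_scaleR using t by (simp add: mult_ac)
  then have "norm (ver x - ver y) \<le> C * norm (hor x - hor y)" using t by simp
  moreover have "norm (x - y) \<le> norm (hor x - hor y) + norm (ver x - ver y)"
   using norm_triangle_ineq[of "hor (x - y)" "ver (x - y)"] by (simp only: hor_ver hor_diff[symmetric] ver_diff[symmetric])
  ultimately show "norm (x - y) \<le> (1 + C) * norm (hor x - hor y)" by (simp add: distrib_right)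
 qed
qed

lemma emeasure_M_outside:
 assumes "\<And>x. x \<in> A \<Longrightarrow> norm (x - x0) < r" and v: "hor x0 = hor v"
 shows "emeasure M {x. t * r \<le> norm (hor x)} = 0"
proof -
 have b: "{x. t * r \<le> norm (hor x)} \<in> sets borel" by measurable
 have "A \<inter> \<Psi> -` {x. t * r \<le> norm (hor x)} = {}"
 proof -
  have False if x: "x \<in> A" "t * r \<le> norm (hor (\<Psi> x))" for x
  proof -
   have "hor (\<Psi> x) = t *\<^sub>R hor (x - x0)"
    using v by (simp add: \<Psi>_def linear_cmul[OF linear_hor] hor_diff)
   then have "norm (hor (\<Psi> x)) = t * norm (hor (x - x0))" using t by simp
   also have "\<dots> \<le> t * norm (x - x0)" using t norm_hor_le by (intro mult_left_mono) auto
   also have "\<dots> < t * r" using t assms(1)[OF x(1)] by simp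
   finally show False using x by simp
  qed
  then show ?thesis by blast
 qed
 then show ?thesis by (simp add: emeasure_M[OF b])
qed

lemma vertical_M:
 assumes L: "\<And>x. infdist x L = norm (ver (x - v))" and AB: "A \<subseteq> B" "B \<in> sets borel"
  and I: "(\<integral>\<^sup>+x\<in>B. ennreal ((infdist x L)\<^sup>2) \<partial>hausdorff_on k T) \<le> ennreal a" and a: "0 \<le> a"
 shows "(\<integral>\<^sup>+x. ennreal ((norm (ver x))\<^sup>2) \<partial>M) \<le> ennreal (w * t ^ (k + 2) * a)"
proof -
 have "(\<integral>\<^sup>+x. ennreal ((norm (ver x))\<^sup>2) \<partial>M)
  = (\<integral>\<^sup>+x. ennreal (w * t ^ k) * indicator (T \<inter> A) x * ennreal ((norm (ver (\<Psi> x)))\<^sup>2) \<partial>\<H> k)"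
  by (rule nn_integral_M) measurable
 also have "\<dots> \<le> (\<integral>\<^sup>+x. ennreal (w * t ^ (k + 2)) * (indicator T x * (ennreal ((infdist x L)\<^sup>2) * indicator B x)) \<partial>\<H> k)"
 proof (rule nn_integral_mono)
  fix x
  have "norm (ver (\<Psi> x)) = t * infdist x L"
   using t by (simp add: \<Psi>_def linear_cmul[OF linear_ver] L)
  then have "ennreal (w * t ^ k) * ennreal ((norm (ver (\<Psi> x)))\<^sup>2) = ennreal (w * t ^ (k + 2)) * ennreal ((infdist x L)\<^sup>2)"
   using w t by (simp only: ennreal_mult[symmetric] zero_le_power2 zero_le_mult_iff less_imp_le zero_le_power simp_thms power_mult_distrib power_add mult_ac)
  then show "ennreal (w * t ^ k) * indicator (T \<inter> A) x * ennreal ((norm (ver (\<Psi> x)))\<^sup>2)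
   \<le> ennreal (w * t ^ (k + 2)) * (indicator T x * (ennreal ((infdist x L)\<^sup>2) * indicator B x))"
   using AB(1) by (cases "x \<in> T \<inter> A") (auto simp: indicator_def simp del: power_Suc)
 qed
 also have "\<dots> = ennreal (w * t ^ (k + 2)) * (\<integral>\<^sup>+x. indicator T x * (ennreal ((infdist x L)\<^sup>2) * indicator B x) \<partial>\<H> k)"
  by (intro nn_integral_cmult borel_measurable_times_ennreal borel_measurable_indicator T measurable_hausdorff_measure measurable_infdist2 AB(2))
 also have "(\<integral>\<^sup>+x. indicator T x * (ennreal ((infdist x L)\<^sup>2) * indicator B x) \<partial>\<H> k) = (\<integral>\<^sup>+x\<in>B. ennreal ((infdist x L)\<^sup>2) \<partial>hausdorff_on k T)"
  by (rule nn_integral_hausdorff_on[OF _ T, symmetric]) (intro borel_measurable_times_ennreal measurable_infdist2 borel_measurable_indicator AB(2))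
 also have "ennreal (w * t ^ (k + 2)) * \<dots> \<le> ennreal (w * t ^ (k + 2)) * ennreal a"
  by (intro mult_left_mono I) simp
 also have "\<dots> = ennreal (w * t ^ (k + 2) * a)" using w t a by (intro ennreal_mult[symmetric]) auto
 finally show ?thesis .
qed

end

text \<open>The nearly densest ball, of radius \<open>R'\<close>, is blown up to radius
  \<open>R\<close> and its density divided by \<open>m\<close>. Of the two conclusions of
  \<open>key_proposition\<close>, the graph is pulled back, and the density bound reads
  \<open>(1 - c) * m \<le> u * (1 + c)\<close>.\<close>

lemma density_and_graph:
 fixes c :: real
 assumes k: "1 \<le> k" "k \<le> DIM('a::euclidean_space)" and c: "0 < c" "c \<le> 1 / 2"
 shows "\<exists>\<delta>>0. \<forall>(T :: 'a set) x r u r0. tame k \<delta> T \<longrightarrow> T \<subseteq> ball x r \<longrightarrow> 0 < r \<longrightarrow> ball x r \<subseteq> ball 0 1 \<longrightarrow>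
   0 < emeasure (\<H> k) T \<longrightarrow> emeasure (\<H> k) T < \<infinity> \<longrightarrow> 0 \<le> u \<longrightarrow> 0 < r0 \<longrightarrow>
   (\<forall>y s. 0 < s \<longrightarrow> s \<le> r0 \<longrightarrow> hmass k T (ball y s) \<le> u * (unit_ball_vol (real k) * s ^ k)) \<longrightarrow>
   (1 - c) * measure (\<H> k) T \<le> u * (1 + c) * (unit_ball_vol (real k) * r ^ k) \<and>
   (\<exists>G\<in>sets borel. 0 < hmass k T G \<and> lip_image k G)"
proof -
 let ?\<omega> = "unit_ball_vol (real k)"
 have \<omega>: "0 < ?\<omega>" by simp
 obtain R s0 \<eta> where R: "4 * real k + 4 \<le> R" and s0: "0 < s0" and \<eta>: "0 < \<eta>" "\<eta> \<le> 1 / 2"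
  and KEY: "\<And>(e :: nat \<Rightarrow> 'a) M. fmeas e k M \<Longrightarrow> fmeas.normalised e k M R s0 \<eta> \<Longrightarrow>
    fmeas.density_bound k M c \<and> fmeas.graph_part e k M"
  using key_proposition[OF k(1) c, where 'a = 'a] by metis
 \<comment> \<open>Chosen so that the vertical second moment after rescaling,
   \<open>2 * \<beta> * (2 * R) ^ (k + 2) / m\<close>, is at most \<open>s0\<close> for every
   \<open>m\<close> with \<open>1 \<le> 4 ^ k * m\<close>.\<close>
 define \<beta> where "\<beta> = s0 / (2 * 2 ^ (k + 2) * R ^ (k + 2) * 4 ^ k)"
 define \<eta>1 where "\<eta>1 = \<eta> / 2"
 \<comment> \<open>The first entry makes the averaging in \<open>exists_flat_plane\<close> succeed
   with room to spare. The second brings the rescaled flatness sum below \<open>s0\<close>, where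
   \<open>16 ^ k\<close> bounds the square of \<open>1 / m\<close>. Division by \<open>6 ^ k\<close>
   anticipates \<open>total_flatness\<close>.\<close>
 define D where "D = min (\<beta> * (\<eta>1\<^sup>2 / 8) * ?\<omega> / (4 * 4 ^ k)) (s0 / (2 * 16 ^ k * R ^ k)) / 6 ^ k"
 define \<delta> where "\<delta> = sqrt D"
 have R0: "0 < R" using R by linarith
 have \<beta>: "0 < \<beta>" unfolding \<beta>_def using s0 R0 by (intro divide_pos_pos mult_pos_pos) auto
 have \<eta>1: "0 < \<eta>1" "\<eta>1 \<le> 1 / 4" using \<eta> by (auto simp: \<eta>1_def)
 have D: "0 < D" unfolding D_def using \<beta> \<eta>1 \<omega> s0 R0 by auto
 have \<delta>: "0 < \<delta>" "\<delta>\<^sup>2 = D" using D by (auto simp: \<delta>_def)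
 have D6: "6 ^ k * D = min (\<beta> * (\<eta>1\<^sup>2 / 8) * ?\<omega> / (4 * 4 ^ k)) (s0 / (2 * 16 ^ k * R ^ k))" by (simp add: D_def)
 define \<epsilon>c where "\<epsilon>c = eps_const DIM('a)"
 have eps0: "0 \<le> \<epsilon>c" by (simp add: \<epsilon>c_def eps_const_def)
 have eps: "2 * 4 ^ k * (8 * real k + 8) ^ k * \<epsilon>c \<le> min 1 ?\<omega>" unfolding \<epsilon>c_def by (rule eps_const_le[OF k])
 show ?thesis
 proof (intro exI[of _ \<delta>] conjI \<delta>(1) allI impI)
  fix T :: "'a set" and x r u r0
  assume tm: "tame k \<delta> T" and Tr: "T \<subseteq> ball x r" "0 < r" "ball x r \<subseteq> ball 0 1"
   and Tpos: "0 < emeasure (\<H> k) T" and Tfin: "emeasure (\<H> k) T < \<infinity>"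
   and u: "0 \<le> u" "0 < r0" "\<forall>y s. 0 < s \<longrightarrow> s \<le> r0 \<longrightarrow> hmass k T (ball y s) \<le> u * (?\<omega> * s ^ k)"
  have Ts: "T \<in> sets (\<H> k)" using tm by (simp add: tame_def)
  have "\<exists>m x0 R'. 1 \<le> 4 ^ k * m \<and> measure (\<H> k) T \<le> m * (?\<omega> * r ^ k) \<and>
   (\<forall>y s. 0 < s \<longrightarrow> hmass k T (ball y s) \<le> m * (?\<omega> * s ^ k)) \<and>
   0 < R' \<and> R' \<le> r \<and> (1 - \<eta>1) * m * (?\<omega> * R' ^ k) \<le> hmass k T (ball x0 R')"
   by (rule near_maximal_ball[OF k(1) Ts Tfin Tpos Tr(1,2) u(2)]) (use u(3) \<eta>1 in auto)
  then obtain m x0 R' where m4: "1 \<le> 4 ^ k * m" and Nm: "measure (\<H> k) T \<le> m * (?\<omega> * r ^ k)"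
   and mub: "\<And>y s. 0 < s \<Longrightarrow> hmass k T (ball y s) \<le> m * (?\<omega> * s ^ k)"
   and R': "0 < R'" "R' \<le> r" and near: "(1 - \<eta>1) * m * (?\<omega> * R' ^ k) \<le> hmass k T (ball x0 R')" by blast
  have m: "0 < m"
  proof (rule ccontr)
   assume "\<not> 0 < m"
   then have "4 ^ k * m \<le> 0" by (simp add: mult_nonneg_nonpos)
   then show False using m4 by linarith
  qed
  have r1: "r \<le> 1" using Tr(2,3) by (auto simp: ball_subset_ball_iff intro: order_trans[rotated])
  define V where "V = ?\<omega> * R' ^ k"
  have V: "0 < V" using R' \<omega> by (simp add: V_def)
  have half: "1 / (2 * 4 ^ k) * V \<le> (1 - 2 * \<eta>1) * m * V"
  proof -
   have "1 / (2 * 4 ^ k) \<le> 1 / 2 * m" using m4 by (simp add: field_simps)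
   also have "\<dots> \<le> (1 - 2 * \<eta>1) * m" using m \<eta>1 by (intro mult_right_mono) auto
   finally show ?thesis using V by (intro mult_right_mono) auto
  qed
  have half': "(1 - 2 * \<eta>1) * m * V \<le> hmass k T (ball x0 R')"
  proof -
   have "(1 - 2 * \<eta>1) * m * V \<le> (1 - \<eta>1) * m * V" using m V \<eta>1 by (intro mult_right_mono) auto
   then show ?thesis using near by (simp add: V_def)
  qed
  have e6: "\<epsilon>c * (6 ^ k * R' ^ k) \<le> 1 / (2 * 4 ^ k) * V"
  proof -
   have "(6::real) ^ k \<le> (8 * real k + 8) ^ k" by (intro power_mono) auto
   then have "2 * 4 ^ k * 6 ^ k * \<epsilon>c \<le> 2 * 4 ^ k * (8 * real k + 8) ^ k * \<epsilon>c" using eps0 by (intro mult_right_mono mult_left_mono) auto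
   also have "\<dots> \<le> ?\<omega>" using eps by simp
   finally have "\<epsilon>c * 6 ^ k \<le> 1 / (2 * 4 ^ k) * ?\<omega>" by (simp add: field_simps)
   then have "\<epsilon>c * 6 ^ k * R' ^ k \<le> 1 / (2 * 4 ^ k) * ?\<omega> * R' ^ k" using R' by (intro mult_right_mono) auto
   then show ?thesis by (simp add: V_def mult.assoc)
  qed
  define I where "I = 6 ^ k * \<delta>\<^sup>2 * R' ^ k"
  have I0: "0 \<le> I" using R' by (simp add: I_def)
  have Tint: "flat_int k T x0 (2 * R') \<le> ennreal I"
   unfolding I_def
  proof (rule total_flatness[OF tm Tfin])
   show "T \<subseteq> ball 0 1" using Tr by blast
   have "0 < 1 / (2 * 4 ^ k) * V" using V by simp
   then show "0 < hmass k T (ball x0 R')" using half half' by linarith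
   show "eps_const DIM('a) * (6 ^ k * R' ^ k) \<le> hmass k T (ball x0 R')" using e6 half half' unfolding \<epsilon>c_def by linarith
  qed (use R' r1 in auto)
  have Ismall: "I < \<beta> * (\<eta>1\<^sup>2 / 8) * hmass k T (ball x0 R')"
  proof -
   have b: "0 < \<beta> * (\<eta>1\<^sup>2 / 8)" using \<beta> \<eta>1 by simp
   have "6 ^ k * D \<le> \<beta> * (\<eta>1\<^sup>2 / 8) * ?\<omega> / (4 * 4 ^ k)" unfolding D6 by simp
   then have "6 ^ k * D * R' ^ k \<le> \<beta> * (\<eta>1\<^sup>2 / 8) * ?\<omega> / (4 * 4 ^ k) * R' ^ k" using R' by (intro mult_right_mono) auto
   then have "I \<le> \<beta> * (\<eta>1\<^sup>2 / 8) * (1 / (4 * 4 ^ k) * V)" by (simp add: I_def \<delta> V_def)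
   also have "\<dots> < \<beta> * (\<eta>1\<^sup>2 / 8) * (1 / (2 * 4 ^ k) * V)" using b V by (intro mult_strict_left_mono) (auto simp: field_simps)
   also have "\<dots> \<le> \<beta> * (\<eta>1\<^sup>2 / 8) * hmass k T (ball x0 R')" using b half half' by (intro mult_left_mono) linarith+
   finally show ?thesis .
  qed
  have e2: "eps_const DIM('a) * (2 * R') ^ k \<le> (1 - 2 * \<eta>1) * m * (?\<omega> * R' ^ k)"
  proof -
   have "(2 * R') ^ k \<le> 6 ^ k * R' ^ k" unfolding power_mult_distrib[symmetric] using R' by (intro power_mono) auto
   then have "\<epsilon>c * (2 * R') ^ k \<le> \<epsilon>c * (6 ^ k * R' ^ k)" using eps0 by (rule mult_left_mono)
   then show ?thesis using e6 half unfolding V_def[symmetric] \<epsilon>c_def by linarith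
  qed
  have "\<exists>y s L. y \<in> ball x0 R' \<and> 0 < s \<and> s < 2 * R' \<and> affine L \<and> aff_dim L = int k \<and>
   (sqdist (hausdorff_on k T) y s L) \<le> ennreal (2 * \<beta> * (2 * R') ^ (k + 2)) \<and>
   (1 - 2 * \<eta>1) * m * (?\<omega> * R' ^ k) \<le> hmass k T (ball x0 R' \<inter> ball y s)"
   by (rule exists_flat_plane[OF k(1) Ts Tfin m mub R'(1) near \<eta>1 Tint \<beta> I0 Ismall e2])
  then obtain y s L where L: "affine L" "aff_dim L = int k"
   and vert: "sqdist (hausdorff_on k T) y s L \<le> ennreal (2 * \<beta> * (2 * R') ^ (k + 2))"
   and Amass: "(1 - 2 * \<eta>1) * m * (?\<omega> * R' ^ k) \<le> hmass k T (ball x0 R' \<inter> ball y s)" by blast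
  obtain e where e: "frame e k" "\<And>v x. v \<in> L \<Longrightarrow> infdist x L = norm (frame.ver e k (x - v))" "\<And>v x. v \<in> L \<Longrightarrow> v + frame.hor e k x \<in> L"
   using plane_frame[OF L k(1)] by blast
  obtain p where p: "p \<in> L" using L(2) by fastforce
  define A where "A = ball x0 R' \<inter> ball y s"
  \<comment> \<open>The foot of \<open>x0\<close> on the plane, so that the rescaled set is centred
    horizontally and the plane becomes horizontal.\<close>
  define v where "v = p + frame.hor e k (x0 - p)"
  have vL: "v \<in> L" unfolding v_def by (rule e(3)[OF p])
  have "0 < R / R'" "0 < 1 / m" using R0 R' m by auto
  interpret frame e k by (rule e(1))
  interpret rescaling e k T A "1 / m" "R / R'" v
   by unfold_locales (use Ts Tfin \<open>0 < R / R'\<close> \<open>0 < 1 / m\<close> in \<open>auto simp: A_def\<close>)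
  have hv: "hor x0 = hor v" unfolding v_def using linear_add[OF linear_hor] by (simp add: hor_diff hor_hor)
  have tR: "R / R' * R' = R" using R' by simp
  have wt1: "1 / m * (R / R') ^ k * (m * (?\<omega> * R' ^ k)) = ?\<omega> * R ^ k" using m R' by (simp add: power_divide)
  have U: "measure M (ball z q) \<le> ?\<omega> * q ^ k" if q: "0 < q" for z q
  proof -
   have "measure M (ball z q) \<le> m * (1 / m) * ?\<omega> * q ^ k"
    using q R0 R' by (intro measure_M_ball_le mub) auto
   then show ?thesis using m by simp
  qed
  have "emeasure M {x. R / R' * R' \<le> norm (hor x)} = 0"
   by (rule emeasure_M_outside[OF _ hv]) (simp add: A_def dist_norm norm_minus_commute)
  then have supp: "emeasure M {x. R \<le> norm (hor x)} = 0" unfolding tR .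
  have vrt: "(\<integral>\<^sup>+x. ennreal ((norm (ver x))\<^sup>2) \<partial>M) \<le> ennreal s0"
  proof -
   have "(\<integral>\<^sup>+x. ennreal ((norm (ver x))\<^sup>2) \<partial>M) \<le> ennreal (1 / m * (R / R') ^ (k + 2) * (2 * \<beta> * (2 * R') ^ (k + 2)))"
    by (rule vertical_M[OF e(2)[OF vL] _ _ vert]) (use \<beta> R' in \<open>auto simp: A_def\<close>)
   also have "\<dots> \<le> ennreal s0"
   proof (rule ennreal_leI)
    have "1 / m * (R / R') ^ (k + 2) * (2 * \<beta> * (2 * R') ^ (k + 2)) = 1 / m * (2 * \<beta> * ((R / R') * (2 * R')) ^ (k + 2))"
     by (simp only: power_mult_distrib mult_ac)
    also have "(R / R') * (2 * R') = 2 * R" using R' by simp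
    also have "1 / m * (2 * \<beta> * (2 * R) ^ (k + 2)) = 1 / (4 ^ k * m) * s0"
     using R0 by (simp add: \<beta>_def power_mult_distrib)
    also have "\<dots> \<le> 1 * s0" using m4 s0 by (intro mult_right_mono) (auto simp: divide_le_eq_1)
    finally show "1 / m * (R / R') ^ (k + 2) * (2 * \<beta> * (2 * R') ^ (k + 2)) \<le> s0" by simp
   qed
   finally show ?thesis .
  qed
  have w4: "1 / m \<le> 4 ^ k" using m m4 by (simp add: pos_divide_le_eq)
  have car: "fm.carleson s0"
  proof (rule fm.carleson_mono)
   show "fm.carleson (2 * (1 / m)\<^sup>2 * (R / R') ^ k * I)"
   proof (rule carleson[OF Tint I0])
    show "A \<subseteq> ball x0 (2 * R')" using R' by (auto simp: A_def)
    show "fm.KK \<le> R / R' * (2 * R')" using R R0 R' by (simp add: fm.KK_def)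
    have "2 * (1 / m) * (8 * real k + 8) ^ k * \<epsilon>c \<le> 2 * 4 ^ k * (8 * real k + 8) ^ k * \<epsilon>c"
     using w4 eps0 by (intro mult_right_mono mult_left_mono) auto
    also have "\<dots> \<le> 1" using eps by simp
    finally show "2 * (1 / m) * (2 * fm.KK) ^ k * eps_const DIM('a) \<le> 1"
     by (simp add: fm.KK_def \<epsilon>c_def)
   qed
   have "2 * (1 / m)\<^sup>2 * (R / R') ^ k * I = (1 / m)\<^sup>2 * (2 * R ^ k * (6 ^ k * D))"
    using R' by (simp add: I_def \<delta> power_divide)
   also have "\<dots> \<le> (4 ^ k)\<^sup>2 * (2 * R ^ k * (s0 / (2 * 16 ^ k * R ^ k)))"
   proof (rule mult_mono)
    show "(1 / m)\<^sup>2 \<le> (4 ^ k)\<^sup>2" using w4 m by (intro power_mono) auto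
    have "6 ^ k * D \<le> s0 / (2 * 16 ^ k * R ^ k)" unfolding D6 by simp
    then show "2 * R ^ k * (6 ^ k * D) \<le> 2 * R ^ k * (s0 / (2 * 16 ^ k * R ^ k))" using R0 by (intro mult_left_mono) auto
   qed (use R0 D in auto)
   also have "\<dots> = s0"
   proof -
    have "(4 ^ k)\<^sup>2 = (16::real) ^ k" by (simp add: power2_eq_square power_mult_distrib[symmetric])
    then show ?thesis using R0 by simp
   qed
   finally show "2 * (1 / m)\<^sup>2 * (R / R') ^ k * I \<le> s0" .
  qed
  have MU: "measure M UNIV = 1 / m * (R / R') ^ k * hmass k T A" using measure_M[of UNIV] by simp
  have low: "(1 - \<eta>) * (?\<omega> * R ^ k) \<le> measure M UNIV"
  proof -
   have "1 / m * (R / R') ^ k * ((1 - 2 * \<eta>1) * m * (?\<omega> * R' ^ k)) \<le> 1 / m * (R / R') ^ k * hmass k T A"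
    using Amass wt by (intro mult_left_mono) (auto simp: A_def)
   also have "1 / m * (R / R') ^ k * ((1 - 2 * \<eta>1) * m * (?\<omega> * R' ^ k)) = (1 - 2 * \<eta>1) * (1 / m * (R / R') ^ k * (m * (?\<omega> * R' ^ k)))"
    by (simp only: mult_ac)
   finally show ?thesis unfolding wt1 MU by (simp add: \<eta>1_def)
  qed
  have upp: "measure M UNIV \<le> ?\<omega> * R ^ k"
  proof -
   have "hmass k T A \<le> hmass k T (ball x0 R')" by (rule hmass_mono[OF Ts Tfin]) (auto simp: A_def)
   also have "\<dots> \<le> m * (?\<omega> * R' ^ k)" by (rule mub[OF R'(1)])
   finally have "1 / m * (R / R') ^ k * hmass k T A \<le> 1 / m * (R / R') ^ k * (m * (?\<omega> * R' ^ k))"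
    using wt by (intro mult_left_mono) auto
   then show ?thesis unfolding wt1 MU .
  qed
  have "fm.normalised R s0 \<eta>" unfolding fm.normalised_def using U supp vrt car low upp by blast
  note K = KEY[OF fmeas_M this, unfolded fm.density_bound_def fm.graph_part_def]
  have one: "1 - c \<le> u * (1 / m) * (1 + c)"
  proof (rule K[THEN conjunct1, rule_format])
   show "0 \<le> u * (1 / m)" using u m by simp
   show "0 < r0 * (R / R')" using u R0 R' by simp
   show "measure M (ball z q) \<le> u * (1 / m) * ?\<omega> * q ^ k" if q: "0 < q" "q \<le> r0 * (R / R')" for z q
   proof (rule measure_M_ball_le)
    fix y
    have "0 < q / (R / R')" "q / (R / R') \<le> r0" using q R0 R' by (auto simp: field_simps)
    then show "hmass k T (ball y (q / (R / R'))) \<le> u * (?\<omega> * (q / (R / R')) ^ k)" using u(3) by blast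
   qed
  qed
  show "(1 - c) * measure (\<H> k) T \<le> u * (1 + c) * (?\<omega> * r ^ k)"
  proof -
   have "(1 - c) * m \<le> u * (1 / m) * (1 + c) * m" using one m by (intro mult_right_mono) auto
   then have cm: "(1 - c) * m \<le> u * (1 + c)" using m by simp
   have "(1 - c) * measure (\<H> k) T \<le> (1 - c) * (m * (?\<omega> * r ^ k))" using Nm c by (intro mult_left_mono) auto
   also have "\<dots> = (1 - c) * m * (?\<omega> * r ^ k)" by (simp only: mult.assoc)
   also have "\<dots> \<le> u * (1 + c) * (?\<omega> * r ^ k)" using cm \<omega> Tr(2) by (intro mult_right_mono) auto
   finally show ?thesis .
  qed
  obtain G where G: "G \<in> sets borel" "0 < measure M G"
   "\<And>x y. x \<in> G \<Longrightarrow> y \<in> G \<Longrightarrow> norm (ver x - ver y) \<le> (real k + 2) * norm (hor x - hor y)"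
   using K[THEN conjunct2] by blast
  show "\<exists>G\<in>sets borel. 0 < hmass k T G \<and> lip_image k G"
   by (rule graph_pullback[OF G]) auto
 qed
qed

text \<open>Removing the open union of all overly dense balls below a fixed radius leaves a set that
  misses every such ball entirely. By \<open>upper_density_null\<close> these sets increase to
  \<open>T\<close> up to a null set, so one of them keeps mass above \<open>b\<close>.\<close>

lemma uniform_density:
 fixes T :: "'a::euclidean_space set"
 assumes T: "T \<in> sets (\<H> k)" "emeasure (\<H> k) T < \<infinity>" and \<eta>: "0 < \<eta>"
  and b: "b < emeasure (\<H> k) T"
 shows "\<exists>T' r0. T' \<subseteq> T \<and> T' \<in> sets (\<H> k) \<and> b < emeasure (\<H> k) T' \<and> 0 < r0 \<and>
  (\<forall>y s. 0 < s \<longrightarrow> s \<le> r0 \<longrightarrow> hmass k T' (ball y s) \<le> (1 + \<eta>) * (unit_ball_vol (real k) * s ^ k))"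
proof -
 let ?\<omega> = "unit_ball_vol (real k)" let ?H = "\<H> k :: 'a measure"
 define \<mu> where "\<mu> = distr (hausdorff_on k T) borel (\<lambda>x. x)"
 have id: "(\<lambda>x. x) \<in> measurable (hausdorff_on k T) borel"
  unfolding hausdorff_on_def by (simp add: measurable_hausdorff_measure)
 have \<mu>: "emeasure \<mu> B = emeasure ?H (T \<inter> B)" if "B \<in> sets borel" for B
 proof -
  have "space (hausdorff_on k T) = UNIV" by (simp add: hausdorff_on_def)
  then show ?thesis
   unfolding \<mu>_def emeasure_distr[OF id that] by (simp add: emeasure_hausdorff_on[OF T(1) borel_hausdorff[OF that]])
 qed
 have s\<mu>: "sets \<mu> = sets borel" by (simp add: \<mu>_def)
 have sp: "space \<mu> = UNIV" using sets_eq_imp_space_eq[OF s\<mu>] by simp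
 have fin: "finite_measure \<mu>"
  by (rule finite_measureI) (use T(2) \<mu>[of UNIV] sp in simp)
 have m\<mu>: "measure \<mu> B = hmass k T B" if "B \<in> sets borel" for B using \<mu>[OF that] by (simp add: measure_def)
 define E where "E j = (\<Union>{ball y r |y r. 0 < r \<and> r < 1 / real (Suc j) \<and> (1 + \<eta>) * (?\<omega> * r ^ k) < measure \<mu> (ball y r)})" for j
 have Eo: "open (E j)" for j unfolding E_def by auto
 have "emeasure \<mu> (\<Inter>j. E j) = 0"
  unfolding E_def
 proof (rule upper_density_null[OF fin s\<mu> _ \<eta>])
  fix B :: "'a set" assume B: "B \<in> sets borel"
  have "T \<inter> B \<in> sets ?H" by (rule sets.Int[OF T(1) borel_hausdorff[OF B]])
  then show "emeasure \<mu> B \<le> hausdorff_outer k B"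
   unfolding \<mu>[OF B] by (simp add: emeasure_hausdorff_measure hausdorff_outer_mono)
 qed
 moreover have EI: "(\<Inter>j. E j) \<in> sets borel" using Eo by auto
 ultimately have null: "T \<inter> (\<Inter>j. E j) \<in> null_sets ?H"
  using \<mu>[OF EI] sets.Int[OF T(1) borel_hausdorff[OF EI]] by auto
 define Q where "Q j = T - E j" for j
 have Qs: "Q j \<in> sets ?H" for j unfolding Q_def using Eo by (intro sets.Diff[OF T(1)] borel_hausdorff) auto
 have Edec: "E (Suc j) \<subseteq> E j" for j
 proof -
  have "1 / real (Suc (Suc j)) \<le> 1 / real (Suc j)" by (intro divide_left_mono) auto
  then have "r < 1 / real (Suc j)" if "r < 1 / real (Suc (Suc j))" for r using that by (rule less_le_trans[rotated])
  then show ?thesis unfolding E_def by (intro Union_mono) blast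
 qed
 have inc: "incseq Q" by (rule incseq_SucI) (use Edec in \<open>auto simp: Q_def\<close>)
 have UQ: "(\<Union>j. Q j) = T - T \<inter> (\<Inter>j. E j)" by (auto simp: Q_def)
 have "(SUP j. emeasure ?H (Q j)) = emeasure ?H (\<Union>j. Q j)"
  by (rule SUP_emeasure_incseq[OF _ inc]) (use Qs in blast)
 also have "\<dots> = emeasure ?H T" unfolding UQ by (rule emeasure_Diff_null_set[OF null T(1)])
 finally have "b < (SUP j. emeasure ?H (Q j))" using b by simp
 then obtain j where j: "b < emeasure ?H (Q j)" by (auto simp: less_SUP_iff)
 have QT: "Q j \<subseteq> T" by (auto simp: Q_def)
 have QT': "emeasure ?H (Q j) < \<infinity>" using emeasure_mono[OF QT T(1)] T(2) by (rule le_less_trans)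
 have "hmass k (Q j) (ball y s) \<le> (1 + \<eta>) * (?\<omega> * s ^ k)" if s: "0 < s" "s \<le> 1 / real (Suc (Suc j))" for y s
 proof (cases "(1 + \<eta>) * (?\<omega> * s ^ k) < measure \<mu> (ball y s)")
  case True
  have "1 / real (Suc (Suc j)) < 1 / real (Suc j)" by (intro divide_strict_left_mono) auto
  then have "s < 1 / real (Suc j)" using s(2) by linarith
  then have "ball y s \<subseteq> E j"
   unfolding E_def by (intro Union_upper CollectI exI[of _ y] exI[of _ s] conjI refl True s(1))
  then have "Q j \<inter> ball y s = {}" by (auto simp: Q_def)
  then show ?thesis using s \<eta> by simp
 next
  case False
  have "emeasure ?H (Q j \<inter> ball y s) \<le> emeasure ?H (T \<inter> ball y s)"
   using QT by (intro emeasure_mono sets.Int[OF T(1)] borel_hausdorff) auto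
  then have "hmass k (Q j) (ball y s) \<le> hmass k T (ball y s)"
   using emeasure_hmass[OF T] emeasure_hmass[OF Qs QT'] by simp
  then show ?thesis using False m\<mu>[of "ball y s"] by simp
 qed
 moreover have "0 < 1 / real (Suc (Suc j))" by simp
 ultimately show ?thesis using QT Qs j by blast
qed

lemma finite_piece:
 fixes S :: "'a::euclidean_space set"
 assumes k: "1 \<le> k" and S: "tame k \<delta> S" and b: "b < emeasure (\<H> k) S"
 shows "\<exists>T. T \<subseteq> S \<and> T \<in> sets (\<H> k) \<and> emeasure (\<H> k) T < \<infinity> \<and> b < emeasure (\<H> k) T"
proof -
 let ?H = "\<H> k :: 'a measure"
 obtain A :: "nat \<Rightarrow> 'a set" where A: "\<And>i. A i \<in> sets ?H" "\<And>i. emeasure ?H (A i) < \<infinity>" "S = (\<Union>i. A i)"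
  using tame_sequence[OF k S] by metis
 define B where "B n = (\<Union>i<n. A i)" for n
 have Bs: "B n \<in> sets ?H" for n unfolding B_def using A(1) by (intro sets.finite_UN) auto
 have inc: "incseq B" by (rule incseq_SucI) (auto simp: B_def less_Suc_eq)
 have UB: "(\<Union>n. B n) = S" unfolding B_def A(3) by (rule UN_UN_finite_eq[unfolded atLeast0LessThan])
 have "(SUP n. emeasure ?H (B n)) = emeasure ?H S"
  using SUP_emeasure_incseq[OF _ inc, of ?H] Bs UB by auto
 then have "b < (SUP n. emeasure ?H (B n))" using b by simp
 then obtain n where n: "b < emeasure ?H (B n)" unfolding less_SUP_iff by blast
 have "emeasure ?H (B n) \<le> (\<Sum>i<n. emeasure ?H (A i))"
  unfolding B_def using A(1) by (intro emeasure_subadditive_finite) auto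
 also have "\<dots> < \<infinity>" using A(2) by (simp add: ennreal_sum_less_top)
 finally show ?thesis using n Bs by (intro exI[of _ "B n"]) (auto simp: UB[symmetric])
qed

text \<open>Borel sets are required so that unions and remainders stay measurable during the
  exhaustion.\<close>

definition lip_covered :: "nat \<Rightarrow> 'a::euclidean_space set set" where
 "lip_covered k = {A \<in> sets borel. \<exists>f :: nat \<Rightarrow> (nat \<Rightarrow> real) \<Rightarrow> 'a.
   (\<forall>i. lipschitz_from_Rk k (f i)) \<and> A \<subseteq> (\<Union>i. f i ` topspace (Euclidean_space k))}"

lemma lip_covered_UN:
 assumes "\<And>n::nat. A n \<in> lip_covered k"
 shows "(\<Union>n. A n) \<in> lip_covered k"
proof -
 have "\<forall>n. \<exists>f :: nat \<Rightarrow> (nat \<Rightarrow> real) \<Rightarrow> 'a. (\<forall>i. lipschitz_from_Rk k (f i)) \<and> A n \<subseteq> (\<Union>i. f i ` topspace (Euclidean_space k))"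
  using assms by (simp add: lip_covered_def)
 from choice[OF this] obtain f :: "nat \<Rightarrow> nat \<Rightarrow> (nat \<Rightarrow> real) \<Rightarrow> 'a"
  where f: "\<forall>n. (\<forall>i. lipschitz_from_Rk k (f n i)) \<and> A n \<subseteq> (\<Union>i. f n i ` topspace (Euclidean_space k))" ..
 define g where "g p = f (fst (prod_decode p)) (snd (prod_decode p))" for p
 have "(\<Union>n. A n) \<subseteq> (\<Union>p. g p ` topspace (Euclidean_space k))"
 proof
  fix x assume "x \<in> (\<Union>n. A n)"
  then obtain n i where "x \<in> f n i ` topspace (Euclidean_space k)" using f by blast
  then have "x \<in> g (prod_encode (n, i)) ` topspace (Euclidean_space k)" by (simp add: g_def)
  then show "x \<in> (\<Union>p. g p ` topspace (Euclidean_space k))" by blast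
 qed
 moreover have "\<forall>p. lipschitz_from_Rk k (g p)" using f by (simp add: g_def)
 moreover have "(\<Union>n. A n) \<in> sets borel" using assms by (intro sets.countable_UN) (auto simp: lip_covered_def)
 ultimately show ?thesis unfolding lip_covered_def by blast
qed

lemma lip_covered_single:
 assumes "A \<in> sets borel" "lipschitz_from_Rk k f" "A \<subseteq> f ` topspace (Euclidean_space k)"
 shows "A \<in> lip_covered k"
 unfolding lip_covered_def using assms by (intro CollectI conjI exI[of _ "\<lambda>_. f"]) auto

lemma lip_covered_empty: "{} \<in> lip_covered k"
 by (rule lip_covered_single[of _ _ "\<lambda>_. 0"]) (auto simp: lipschitz_from_Rk_def intro!: exI[of _ 0])

lemma lip_covered_Un:
 assumes "A \<in> lip_covered k" "B \<in> lip_covered k"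
 shows "A \<union> B \<in> lip_covered k"
proof -
 have "(\<Union>n. if n = (0::nat) then A else B) \<in> lip_covered k" using assms by (intro lip_covered_UN) simp
 moreover have "(\<Union>n. if n = (0::nat) then A else B) = A \<union> B" by (auto split: if_splits)
 ultimately show ?thesis by simp
qed

text \<open>The supremum of the covered mass is attained by a countable union; a remainder of
  positive measure would contain a further piece and exceed it.\<close>

lemma exhaust_finite:
 fixes T :: "'a::euclidean_space set"
 assumes T: "T \<in> sets (\<H> k)" "emeasure (\<H> k) T < \<infinity>"
  and piece: "\<And>T'. T' \<subseteq> T \<Longrightarrow> T' \<in> sets (\<H> k) \<Longrightarrow> 0 < emeasure (\<H> k) T' \<Longrightarrow>
   \<exists>G\<in>lip_covered k. 0 < hmass k T' G"
 shows "\<exists>G\<in>lip_covered k. emeasure (\<H> k) (T - G) = 0"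
proof -
 let ?H = "\<H> k :: 'a measure"
 have b: "B \<in> sets borel" if "B \<in> lip_covered k" for B :: "'a set" using that by (simp add: lip_covered_def)
 define s where "s = (SUP B\<in>lip_covered k. hmass k T B)"
 have bdd: "bdd_above (hmass k T ` lip_covered k)"
  by (rule bdd_aboveI2[where M = "hmass k T UNIV"]) (rule hmass_mono[OF T], auto)
 have "\<forall>n. \<exists>B\<in>lip_covered k. s - 1 / real (Suc n) < hmass k T B"
 proof
  fix n
  have ne: "(lip_covered k :: 'a set set) \<noteq> {}" using lip_covered_empty by blast
  have "s - 1 / real (Suc n) < (SUP B\<in>lip_covered k. hmass k T B)" by (simp add: s_def)
  then show "\<exists>B\<in>lip_covered k. s - 1 / real (Suc n) < hmass k T B"
   unfolding less_cSUP_iff[OF ne bdd] .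
 qed
 then obtain B where B: "\<And>n. B n \<in> lip_covered k" "\<And>n. s - 1 / real (Suc n) < hmass k T (B n)" by metis
 define G where "G = (\<Union>n. B n)"
 have G: "G \<in> lip_covered k" unfolding G_def using B(1) by (rule lip_covered_UN)
 have sG: "s \<le> hmass k T G"
 proof (rule field_le_epsilon)
  fix d :: real assume "0 < d"
  then obtain n where n: "1 / real (Suc n) < d" using nat_approx_posE by blast
  have "hmass k T (B n) \<le> hmass k T G" by (rule hmass_mono[OF T _ b[OF G]]) (auto simp: G_def)
  then show "s \<le> hmass k T G + d" using B(2)[of n] n by linarith
 qed
 have Ts: "T - G \<in> sets ?H" using b[OF G] by (intro sets.Diff[OF T(1)] borel_hausdorff)
 have "emeasure ?H (T - G) = 0"
 proof (rule ccontr)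
  assume "emeasure ?H (T - G) \<noteq> 0"
  then have "0 < emeasure ?H (T - G)" by (simp add: zero_less_iff_neq_zero)
  then obtain G' where G': "G' \<in> lip_covered k" "0 < hmass k (T - G) G'" using piece[OF _ Ts] by blast
  have GG: "G \<union> G' \<in> lip_covered k" using G G'(1) by (rule lip_covered_Un)
  have dis: "T \<inter> (G \<union> G') = (T \<inter> G) \<union> ((T - G) \<inter> G')" by blast
  have fm: "T \<inter> X \<in> fmeasurable ?H" if "X \<in> sets borel" for X
   using emeasure_hmass[OF T, of X] sets.Int[OF T(1) borel_hausdorff[OF that]] by (simp add: fmeasurable_def)
  have "(T - G) \<inter> G' = T \<inter> (G' - G)" by blast
  moreover have "measure ?H ((T \<inter> G) \<union> (T \<inter> (G' - G))) = measure ?H (T \<inter> G) + measure ?H (T \<inter> (G' - G))"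
   by (rule measure_Un_AE[OF AE_I2]) (use fm b[OF G] b[OF G'(1)] in auto)
  ultimately have "hmass k T (G \<union> G') = hmass k T G + hmass k (T - G) G'" unfolding dis by simp
  moreover have "hmass k T (G \<union> G') \<le> s" unfolding s_def by (rule cSUP_upper[OF GG bdd])
  ultimately show False using G'(2) sG by linarith
 qed
 then show ?thesis using G by blast
qed

lemma rectifiable_of_pieces:
 fixes S :: "'a::euclidean_space set"
 assumes k: "1 \<le> k" and S: "tame k \<delta> S"
  and piece: "\<And>T'. T' \<subseteq> S \<Longrightarrow> T' \<in> sets (\<H> k) \<Longrightarrow> 0 < emeasure (\<H> k) T' \<Longrightarrow>
   emeasure (\<H> k) T' < \<infinity> \<Longrightarrow> \<exists>G\<in>lip_covered k. 0 < hmass k T' G"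
 shows "rectifiable k S"
proof -
 let ?H = "\<H> k :: 'a measure"
 obtain A :: "nat \<Rightarrow> 'a set" where A: "\<And>i. A i \<in> sets ?H" "\<And>i. emeasure ?H (A i) < \<infinity>" "S = (\<Union>i. A i)"
  using tame_sequence[OF k S] by metis
 have "\<exists>G\<in>lip_covered k. emeasure ?H (A i - G) = 0" for i
 proof (rule exhaust_finite[OF A(1,2)])
  show "\<exists>G\<in>lip_covered k. 0 < hmass k T' G" if "T' \<subseteq> A i" "T' \<in> sets ?H" "0 < emeasure ?H T'" for T'
  proof (rule piece)
   show "T' \<subseteq> S" using that(1) A(3) by auto
   show "emeasure ?H T' < \<infinity>" using emeasure_mono[OF that(1) A(1)] A(2) by (rule le_less_trans)
  qed (use that in auto)
 qed
 then obtain G where G: "\<And>i. G i \<in> lip_covered k" "\<And>i. emeasure ?H (A i - G i) = 0" by metis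
 have "(\<Union>i. G i) \<in> lip_covered k" using G(1) by (rule lip_covered_UN)
 then obtain f :: "nat \<Rightarrow> (nat \<Rightarrow> real) \<Rightarrow> 'a" where f: "\<forall>i. lipschitz_from_Rk k (f i)" "(\<Union>i. G i) \<subseteq> (\<Union>i. f i ` topspace (Euclidean_space k))"
  unfolding lip_covered_def by blast
 have N: "(\<Union>i. A i - G i) \<in> null_sets ?H"
 proof (rule null_sets_UN)
  fix i
  have "G i \<in> sets borel" using G(1)[of i] by (simp add: lip_covered_def)
  then have "A i - G i \<in> sets ?H" by (intro sets.Diff[OF A(1)] borel_hausdorff)
  then show "A i - G i \<in> null_sets ?H" using G(2) by (intro null_setsI)
 qed
 have "S - (\<Union>i. G i) \<subseteq> (\<Union>i. A i - G i)" unfolding A(3) by auto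
 then have sub: "S - (\<Union>i. f i ` topspace (Euclidean_space k)) \<subseteq> (\<Union>i. A i - G i)"
  by (rule order_trans[OF Diff_mono[OF order_refl f(2)]])
 \<comment> \<open>Measurability of Lipschitz images is avoided: the uncovered part has outer
   measure 0 and is therefore measurable.\<close>
 have "hausdorff_outer k (S - (\<Union>i. f i ` topspace (Euclidean_space k))) \<le> hausdorff_outer k (\<Union>i. A i - G i)"
  using sub by (rule hausdorff_outer_mono)
 also have "\<dots> = 0" using N by (simp add: emeasure_hausdorff_measure[symmetric] null_setsD1 null_setsD2)
 finally have "S - (\<Union>i. f i ` topspace (Euclidean_space k)) \<in> null_sets ?H" by (intro null_sets_hausdorff_outer) simp
 then show ?thesis unfolding rectifiable_def using f(1) by (intro exI[of _ f]) blast
qed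

text \<open>Excess measure, possibly infinite, survives on a piece of finite measure and then on a
  subset whose small-scale densities are at most \<open>1 + c\<close>. There
  \<open>density_and_graph\<close> applies with \<open>u = 1 + c\<close>.\<close>

lemma density_and_rectifiable:
 fixes \<epsilon> :: real
 assumes k: "1 \<le> k" "k \<le> DIM('a::euclidean_space)" and \<epsilon>: "0 < \<epsilon>"
 shows "\<exists>\<delta>>0. \<forall>S :: 'a set. tame k \<delta> S \<longrightarrow>
  (\<forall>x r. 0 < r \<longrightarrow> ball x r \<subseteq> ball 0 1 \<longrightarrow>
    emeasure (\<H> k) (S \<inter> ball x r) \<le> ennreal ((1 + \<epsilon>) * unit_ball_vol (real k) * r ^ k)) \<and>
  rectifiable k (S \<inter> ball 0 1)"
proof -
 let ?\<omega> = "unit_ball_vol (real k)" let ?H = "\<H> k :: 'a measure"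
 \<comment> \<open>For \<open>8 * c \<le> \<epsilon>\<close> and \<open>c \<le> 1 / 8\<close> one
   has \<open>(1 + c)\<^sup>2 \<le> (1 - c) * (1 + \<epsilon>)\<close>, which contradicts an excess
   by the factor \<open>1 + \<epsilon>\<close>.\<close>
 define c where "c = min \<epsilon> 1 / 8"
 have c: "0 < c" "c \<le> 1 / 2" "8 * c \<le> \<epsilon>" "c \<le> 1 / 8" using \<epsilon> by (auto simp: c_def)
 obtain \<delta> where \<delta>: "0 < \<delta>" and main: "\<forall>(T :: 'a set) x r u r0. tame k \<delta> T \<longrightarrow> T \<subseteq> ball x r \<longrightarrow> 0 < r \<longrightarrow> ball x r \<subseteq> ball 0 1 \<longrightarrow>
   0 < emeasure (\<H> k) T \<longrightarrow> emeasure (\<H> k) T < \<infinity> \<longrightarrow> 0 \<le> u \<longrightarrow> 0 < r0 \<longrightarrow>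
   (\<forall>y s. 0 < s \<longrightarrow> s \<le> r0 \<longrightarrow> hmass k T (ball y s) \<le> u * (?\<omega> * s ^ k)) \<longrightarrow>
   (1 - c) * measure (\<H> k) T \<le> u * (1 + c) * (?\<omega> * r ^ k) \<and>
   (\<exists>G\<in>sets borel. 0 < hmass k T G \<and> lip_image k G)"
  using density_and_graph[OF k c(1,2)] by (elim exE conjE)
 have sub: "\<exists>T'. T' \<subseteq> T \<and> T' \<in> sets ?H \<and> b < emeasure ?H T' \<and> emeasure ?H T' < \<infinity> \<and>
   (1 - c) * measure ?H T' \<le> (1 + c) * (1 + c) * (?\<omega> * r ^ k) \<and> (\<exists>G\<in>lip_covered k. 0 < hmass k T' G)"
  if T: "tame k \<delta> T" and r: "T \<subseteq> ball x r" "0 < r" "ball x r \<subseteq> ball 0 1" and b: "b < emeasure ?H T" for T :: "'a set" and x r b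
 proof -
  from finite_piece[OF k(1) T b] obtain T1 where T1: "T1 \<subseteq> T" "T1 \<in> sets ?H" "emeasure ?H T1 < \<infinity>" "b < emeasure ?H T1"
   by (elim exE conjE)
  from uniform_density[OF T1(2,3) c(1) T1(4)] obtain T2 r0 where T2: "T2 \<subseteq> T1" "T2 \<in> sets ?H" "b < emeasure ?H T2" "0 < r0"
   "\<forall>y s. 0 < s \<longrightarrow> s \<le> r0 \<longrightarrow> hmass k T2 (ball y s) \<le> (1 + c) * (?\<omega> * s ^ k)" by (elim exE conjE)
  have T2T: "T2 \<subseteq> T" using T1(1) T2(1) by (rule order_trans[rotated])
  have fin: "emeasure ?H T2 < \<infinity>" using emeasure_mono[OF T2(1) T1(2)] T1(3) by (rule le_less_trans)
  have pos: "0 < emeasure ?H T2" using T2(3) by (rule le_less_trans[OF zero_le])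
  have c0: "0 \<le> 1 + c" using c by simp
  from main[rule_format, OF tame_subset[OF T T2(2) T2T] order_trans[OF T2T r(1)] r(2,3) pos fin c0 T2(4) T2(5)[rule_format]]
  have *: "(1 - c) * measure ?H T2 \<le> (1 + c) * (1 + c) * (?\<omega> * r ^ k)"
   "\<exists>G\<in>sets borel. 0 < hmass k T2 G \<and> lip_image k G"
   by simp_all
  from *(2) have "\<exists>G\<in>lip_covered k. 0 < hmass k T2 G" using lip_covered_single by blast
  then show ?thesis using T2T T2 fin *(1) by (intro exI[of _ T2] conjI)
 qed
 show ?thesis
 proof (intro exI[of _ \<delta>] conjI \<delta> allI impI)
  fix S :: "'a set" assume S: "tame k \<delta> S"
  have Ss: "S \<in> sets ?H" using S by (simp add: tame_def)
  have SB: "tame k \<delta> (S \<inter> ball x r)" for x r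
   by (rule tame_subset[OF S sets.Int[OF Ss borel_hausdorff]]) auto
  show "emeasure ?H (S \<inter> ball x r) \<le> ennreal ((1 + \<epsilon>) * ?\<omega> * r ^ k)" if r: "0 < r" "ball x r \<subseteq> ball 0 1" for x r
  proof (rule ccontr)
   assume "\<not> ?thesis"
   then have "ennreal ((1 + \<epsilon>) * ?\<omega> * r ^ k) < emeasure ?H (S \<inter> ball x r)" by simp
   from sub[OF SB _ r this] obtain T where T: "ennreal ((1 + \<epsilon>) * ?\<omega> * r ^ k) < emeasure ?H T" "emeasure ?H T < \<infinity>"
    "(1 - c) * measure ?H T \<le> (1 + c) * (1 + c) * (?\<omega> * r ^ k)" by auto
   have w: "0 < ?\<omega> * r ^ k" using r by simp
   have "emeasure ?H T = ennreal (measure ?H T)" using T(2) by (intro emeasure_eq_ennreal_measure) simp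
   then have "(1 + \<epsilon>) * ?\<omega> * r ^ k < measure ?H T" using T(1) r \<epsilon> by (simp add: ennreal_less_iff)
   then have "(1 - c) * ((1 + \<epsilon>) * (?\<omega> * r ^ k)) < (1 - c) * measure ?H T" using c by (intro mult_strict_left_mono) (auto simp: mult.assoc)
   then have "((1 - c) * (1 + \<epsilon>)) * (?\<omega> * r ^ k) < ((1 + c) * (1 + c)) * (?\<omega> * r ^ k)" using T(3) by (simp only: mult.assoc)
   then have lt: "(1 - c) * (1 + \<epsilon>) < (1 + c) * (1 + c)" using w by (simp only: mult_less_cancel_right_pos)
   have "(1 - c) * (1 + 8 * c) \<le> (1 - c) * (1 + \<epsilon>)" using c by (intro mult_left_mono) auto
   then have "(1 - c) * (1 + 8 * c) < (1 + c) * (1 + c)" using lt by (rule le_less_trans)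
   moreover have "(1 + c) * (1 + c) = (1 - c) * (1 + 8 * c) + c * (9 * c - 5)" by (simp add: algebra_simps)
   moreover have "c * (9 * c - 5) \<le> 0" using c by (intro mult_nonneg_nonpos) auto
   ultimately show False by linarith
  qed
  show "rectifiable k (S \<inter> ball 0 1)"
  proof (rule rectifiable_of_pieces[OF k(1) SB])
   fix T' assume T': "T' \<subseteq> S \<inter> ball 0 1" "T' \<in> sets ?H" "0 < emeasure ?H T'" "emeasure ?H T' < \<infinity>"
   have "T' \<subseteq> ball 0 1" using T'(1) by blast
   from sub[OF tame_subset[OF SB T'(2,1)] this zero_less_one order_refl T'(3)] obtain T2
    where T2: "T2 \<subseteq> T'" "T2 \<in> sets ?H" "emeasure ?H T2 < \<infinity>" and ex: "\<exists>G\<in>lip_covered k. 0 < hmass k T2 G"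
    by (elim exE conjE)
   from ex obtain G where G: "G \<in> lip_covered k" "0 < hmass k T2 G" ..
   have "G \<in> sets borel" using G(1) by (simp add: lip_covered_def)
   then have "emeasure ?H (T2 \<inter> G) \<le> emeasure ?H (T' \<inter> G)"
    using T2(1) by (intro emeasure_mono sets.Int[OF T'(2)] borel_hausdorff) auto
   then have "hmass k T2 G \<le> hmass k T' G"
    using emeasure_hmass[OF T2(2,3)] emeasure_hmass[OF T'(2,4)] by simp
   then show "\<exists>G\<in>lip_covered k. 0 < hmass k T' G" using G by (intro bexI[of _ G]) linarith+
  qed
 qed
qed

theorem theorem3p3:
 fixes \<epsilon> :: real
 assumes "\<epsilon> > 0"
 shows "\<exists>\<delta>>0. \<forall>k\<in>{1..CARD('n)}. \<forall>S :: (real ^ 'n) set.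
  S \<subseteq> ball 0 2 \<longrightarrow>
  S \<in> sets (hausdorff_measure k) \<longrightarrow>
  (\<forall>x r. r > 0 \<longrightarrow> ball x r \<subseteq> ball 0 2 \<longrightarrow>
    emeasure (hausdorff_measure k) (S \<inter> ball x r) \<ge> ennreal (eps_const CARD('n) * r ^ k) \<longrightarrow>
    (\<integral>\<^sup>+y\<in>S \<inter> ball x r.
     (\<integral>\<^sup>+s\<in>{0<..<r}. mean_flatness k (hausdorff_on k S) y s / ennreal s \<partial>lborel)
    \<partial>hausdorff_measure k) < ennreal (\<delta>\<^sup>2 * r ^ k)) \<longrightarrow>
  (\<forall>x\<in>S. \<forall>r>0. ball x r \<subseteq> ball 0 1 \<longrightarrow>
    emeasure (hausdorff_measure k) (S \<inter> ball x r)
     \<le> ennreal ((1 + \<epsilon>) * unit_ball_vol (real k) * r ^ k)) \<and>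
  rectifiable k (S \<inter> ball 0 1)"
proof -
 let ?P = "\<lambda>k \<delta>. \<forall>S :: (real ^ 'n) set. tame k \<delta> S \<longrightarrow>
  (\<forall>x r. 0 < r \<longrightarrow> ball x r \<subseteq> ball 0 1 \<longrightarrow>
    emeasure (\<H> k) (S \<inter> ball x r) \<le> ennreal ((1 + \<epsilon>) * unit_ball_vol (real k) * r ^ k)) \<and>
  rectifiable k (S \<inter> ball 0 1)"
 have "\<forall>k\<in>{1..CARD('n)}. \<exists>\<delta>. 0 < \<delta> \<and> ?P k \<delta>"
 proof
  fix k assume "k \<in> {1..CARD('n)}"
  then have "1 \<le> k" "k \<le> DIM(real ^ 'n)" by auto
  from density_and_rectifiable[OF this assms] show "\<exists>\<delta>. 0 < \<delta> \<and> ?P k \<delta>" .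
 qed
 from bchoice[OF this] obtain d where d: "\<forall>k\<in>{1..CARD('n)}. 0 < d k \<and> ?P k (d k)" ..
 \<comment> \<open>\<open>\<delta>\<close> may depend on the ambient dimension but not on
   \<open>k\<close>; there are finitely many \<open>k\<close>, and the flatness hypothesis only
   strengthens as \<open>\<delta>\<close> decreases.\<close>
 define \<delta> where "\<delta> = Min (d ` {1..CARD('n)})"
 have ne: "d ` {1..CARD('n)} \<noteq> {}" by (simp add: Suc_leI)
 have \<delta>: "0 < \<delta>" unfolding \<delta>_def using d ne by (subst Min_gr_iff) auto
 show ?thesis
 proof (rule exI[of _ \<delta>], rule conjI[OF \<delta>], rule ballI, rule allI, rule impI, rule impI, rule impI)
  fix k and S :: "(real ^ 'n) set"
  assume k: "k \<in> {1..CARD('n)}" and S: "S \<subseteq> ball 0 2" "S \<in> sets (\<H> k)"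
   and h: "\<forall>x r. r > 0 \<longrightarrow> ball x r \<subseteq> ball 0 2 \<longrightarrow>
    emeasure (\<H> k) (S \<inter> ball x r) \<ge> ennreal (eps_const CARD('n) * r ^ k) \<longrightarrow>
    flat_int k S x r < ennreal (\<delta>\<^sup>2 * r ^ k)"
  have "\<delta> \<le> d k" unfolding \<delta>_def using k by (intro Min_le) auto
  then have sq: "\<delta>\<^sup>2 \<le> (d k)\<^sup>2" using \<delta> by (intro power_mono) auto
  have D: "DIM(real ^ 'n) = CARD('n)" by simp
  have "tame k (d k) S"
   unfolding tame_def D
  proof (rule conjI[OF S(1) conjI[OF S(2)]], rule allI, rule allI, rule impI, rule impI, rule impI)
   fix x r
   assume r: "(0::real) < r" "ball x r \<subseteq> ball (0 :: real ^ 'n) 2"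
    and m: "ennreal (eps_const CARD('n) * r ^ k) \<le> emeasure (\<H> k) (S \<inter> ball x r)"
   have "flat_int k S x r < ennreal (\<delta>\<^sup>2 * r ^ k)" by (rule h[rule_format, OF r m])
   also have "\<dots> \<le> ennreal ((d k)\<^sup>2 * r ^ k)" using sq r by (intro ennreal_leI mult_right_mono) auto
   finally show "flat_int k S x r < ennreal ((d k)\<^sup>2 * r ^ k)" .
  qed
  from bspec[OF d k, THEN conjunct2, THEN spec, THEN mp, OF this]
  show "(\<forall>x\<in>S. \<forall>r>0. ball x r \<subseteq> ball 0 1 \<longrightarrow>
    emeasure (\<H> k) (S \<inter> ball x r)
     \<le> ennreal ((1 + \<epsilon>) * unit_ball_vol (real k) * r ^ k)) \<and>
   rectifiable k (S \<inter> ball 0 1)" by simp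
 qed
qed

end
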